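(* For each initial datum $\bar u\in H^1_{\rm per}$ there exists a solution $u(\cdot)$ of the Cauchy problem for the Camassa–Holm equation $$u_t+\left(\frac{u^2}{2}\right)_x+P_x=0,\qquad u(0,x)=\bar u(x),$$ with the following properties. The map $t\mapsto u(t)$ is Lipschitz continuous from $\mathbb R$ into $L^2_{\rm per}$, satisfies $u(0,\cdot)=\bar u$, and the identity $$\frac{d}{dt}u=-u\,u_x-P_x \qquad ( * )$$ holds as an equality between elements of $L^2_{\rm per}$ at a.e. time $t\in\mathbb R$. This same map $t\mapsto u(t)$ is continuously differentiable from $\mathbb R$ into $L^p_{\rm per}$ and satisfies $( * )$ at a.e. time $t\in\mathbb R$, for all $p\in[1,2[$. Moreover, this solution $u(\cdot)$ is conservative in the sense that, for a.e. $t\in\mathbb R$, $$\int_0^1\big[u^2(t,x)+u_x^2(t,x)\big]\,dx=\int_0^1\big[\bar u^2(x)+\bar u_x^2(x)\big]\,dx .$$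
   Context: $H^1_{\rm per}$ is the space of absolutely continuous functions $u:\mathbb R\to\mathbb R$ with $u(x+1)=u(x)$ for all $x$ and $u_x\in L^2(0,1)$, with norm $\|u\|_{H^1_{\rm per}}=\big(\int_0^1 u^2\,dx+\int_0^1u_x^2\,dx\big)^{1/2}$. $L^p_{\rm per}$ is the space of 1-periodic functions with $\int_0^1|u|^p\,dx<\infty$. Here $u=u(t,x)$ is 1-periodic in $x$, $u(t)=u(t,\cdot)\in H^1_{\rm per}$, and the nonlocal term $P=P(t,x)$ is $$P=\frac12 e^{-|x|}*\Big(u^2+\frac{u_x^2}{2}\Big)$$ (convolution over $\mathbb R$ in the variable $x$), equivalently $P(x)=\frac12\int_0^1\chi(x-y)\big(u^2(y)+\tfrac12u_x^2(y)\big)\,dy$ with $\chi(x)=\sum_{n\in\mathbb Z}e^{-|x-n|}$. *)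

theory Defs
  imports "HOL-Analysis.Analysis"
begin

definition abs_continuous_on :: "real set \<Rightarrow> (real \<Rightarrow> real) \<Rightarrow> bool" where
  "abs_continuous_on S f \<longleftrightarrow>
    (\<forall>\<epsilon>>0. \<exists>\<delta>>0. \<forall>D. finite D \<longrightarrow>
      (\<forall>(a, b)\<in>D. a \<le> b \<and> {a..b} \<subseteq> S) \<longrightarrow>
      pairwise (\<lambda>(a, b) (c, d). {a<..<b} \<inter> {c<..<d} = {}) D \<longrightarrow>
      (\<Sum>(a, b)\<in>D. b - a) < \<delta> \<longrightarrow>
      (\<Sum>(a, b)\<in>D. \<bar>f b - f a\<bar>) < \<epsilon>)"

text \<open>
  Elements of the spaces below are honest functions. Two of them are identified as elements of
  the Lebesgue space when \<open>Lp_norm\<close> of their difference vanishes, i.e. when they agree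
  almost everywhere.
\<close>

definition periodic1 :: "(real \<Rightarrow> real) \<Rightarrow> bool" where
  "periodic1 f \<longleftrightarrow> (\<forall>x. f (x + 1) = f x)"

definition Lp_per :: "real \<Rightarrow> (real \<Rightarrow> real) set" where
  "Lp_per p = {f. periodic1 f \<and> f \<in> borel_measurable lebesgue \<and>
     set_integrable lebesgue {0..1} (\<lambda>x. \<bar>f x\<bar> powr p)}"

definition Lp_norm :: "real \<Rightarrow> (real \<Rightarrow> real) \<Rightarrow> real" where
  "Lp_norm p f = (LINT x:{0..1}|lebesgue. \<bar>f x\<bar> powr p) powr (1 / p)"

text \<open>
  On the whole line absolute continuity is understood on every compact interval; asking for one
  modulus for all finite families of intervals in \<open>\<real>\<close> would exclude periodic functions with
  unbounded derivative. An absolutely continuous function is differentiable almost everywhere, and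
  \<open>deriv\<close> takes an unspecified value on the exceptional null set.
\<close>

definition H1_per :: "(real \<Rightarrow> real) set" where
  "H1_per = {u. periodic1 u \<and> (\<forall>a b. abs_continuous_on {a..b} u) \<and> deriv u \<in> Lp_per 2}"

definition CH_P :: "(real \<Rightarrow> real) \<Rightarrow> real \<Rightarrow> real" where
  "CH_P u x = 1/2 * (LINT y|lebesgue. exp (- \<bar>x - y\<bar>) * ((u y)\<^sup>2 + (deriv u y)\<^sup>2 / 2))"

definition CH_rhs :: "(real \<Rightarrow> real) \<Rightarrow> real \<Rightarrow> real" where
  "CH_rhs u x = - u x * deriv u x - deriv (CH_P u) x"

definition Lp_lipschitz :: "real \<Rightarrow> (real \<Rightarrow> real \<Rightarrow> real) \<Rightarrow> bool" where
  "Lp_lipschitz p F \<longleftrightarrow> (\<forall>t. F t \<in> Lp_per p) \<and>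
     (\<exists>L. \<forall>s t. Lp_norm p (\<lambda>x. F s x - F t x) \<le> L * \<bar>s - t\<bar>)"

definition Lp_continuous :: "real \<Rightarrow> (real \<Rightarrow> real \<Rightarrow> real) \<Rightarrow> bool" where
  "Lp_continuous p F \<longleftrightarrow> (\<forall>t. F t \<in> Lp_per p) \<and>
     (\<forall>t. ((\<lambda>s. Lp_norm p (\<lambda>x. F s x - F t x)) \<longlongrightarrow> 0) (at t))"

text \<open>
  The membership conditions are essential: \<open>Lp_norm\<close> of a function that is not \<open>p\<close>-integrable
  is 0.
\<close>

definition has_Lp_derivative ::
  "real \<Rightarrow> (real \<Rightarrow> real \<Rightarrow> real) \<Rightarrow> (real \<Rightarrow> real) \<Rightarrow> real \<Rightarrow> bool" where
  "has_Lp_derivative p F v t \<longleftrightarrow> (\<forall>s. F s \<in> Lp_per p) \<and> v \<in> Lp_per p \<and>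
     ((\<lambda>h. Lp_norm p (\<lambda>x. (F (t + h) x - F t x) / h - v x)) \<longlongrightarrow> 0) (at 0)"

definition Lp_C1 :: "real \<Rightarrow> (real \<Rightarrow> real \<Rightarrow> real) \<Rightarrow> bool" where
  "Lp_C1 p F \<longleftrightarrow> (\<exists>v. (\<forall>t. has_Lp_derivative p F (v t) t) \<and> Lp_continuous p v)"

end

theory Submission
  imports Defs "HOL-Analysis.Analysis"
begin

text \<open>\<open>a\<close> and \<open>b\<close> are unknowns in their own right because
  differentiating \<open>y\<close> and \<open>U\<close> in the label would cost a derivative and
  destroy the local Lipschitz property. The price: they are derivatives only for consistent data,
  and the pressure operators match across a period only if \<open>a\<close> has mean 1; both facts
  must be shown to propagate with the flow. Labels that measure position plus accumulated energy
  make the initial \<open>a\<close>, \<open>b\<close>, \<open>h\<close> bounded although the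
  gradient is merely square integrable. Hence the supremum norm suffices, and the evolution laws
  hold at every label and every time. Null sets matter only at the two changes of variable between
  labels and positions. There \<open>y\<close> may collapse a set of labels of positive measure to a
  null set; such labels carry energy but no length. At such times the energy of \<open>u(t)\<close>
  drops below its initial value and the convolution differs from the Lagrangian pressure. The
  derivative \<open>v\<close> is therefore built from the Lagrangian pressure at all times, and is
  identified with the right-hand side of the equation at good times only.\<close>

text \<open>
  The solution is built in Lagrangian variables, along the characteristics \<open>y\<^sub>t = U\<close>. Besides
  \<open>U\<close> the unknowns are \<open>a = y\<^sub>\<xi>\<close>, \<open>b = U\<^sub>\<xi>\<close> and the energy density
  \<open>h = (u\<^sup>2 + u\<^sub>x\<^sup>2) y\<^sub>\<xi>\<close> with respect to the label \<open>\<xi>\<close>. They satisfy a semilinear system with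
  locally Lipschitz right-hand side on bounded periodic functions, because \<open>P\<close> and \<open>P\<^sub>x\<close> become
  integrals of \<open>exp (-\<bar>y \<xi> - y \<eta>\<bar>)\<close> against \<open>U\<^sup>2 a + h\<close>. The identity
  \<open>a h = (U a)\<^sup>2 + b\<^sup>2\<close> and the total energy \<open>\<integral>h\<close> are preserved; this bounds \<open>U\<close> and \<open>P\<close> and
  excludes blow-up. Wave breaking is the vanishing of \<open>a\<close>. Where \<open>a = 0\<close> one has \<open>b = 0\<close> and
  \<open>h > 0\<close>, so \<open>a\<^sub>t\<^sub>t > 0\<close>: for each label these times are isolated, and by Fubini at almost every
  time \<open>a\<close> is nonzero at almost every label. At such times no energy is concentrated, so the energy
  of \<open>u(t)\<close> is \<open>\<integral>h\<close> and the Lagrangian pressure is the convolution \<open>P\<close>. Finally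
  \<open>v = -(u\<^sup>2/2 + P)\<^sub>x\<close> is continuous in time into \<open>L\<^sup>p\<close> for \<open>p < 2\<close>, because its contribution from
  small \<open>a\<close> is of order \<open>a\<^bsup>1-p/2\<^esup>\<close>, and \<open>u\<close> is the time integral of \<open>v\<close>.
\<close>

section \<open>Primitives of locally integrable functions\<close>

text \<open>Local absolute continuity in integral form; \<open>abs_continuous_primitive\<close> and
  \<open>primitive_abs_continuous\<close> give the equivalence with the epsilon-delta form. The
  density is a concrete Borel function, so it can be composed with other maps;
  \<open>primitive_AE_cong\<close> changes it on a null set.\<close>

definition primitive :: "(real \<Rightarrow> real) \<Rightarrow> (real \<Rightarrow> real) \<Rightarrow> bool" where
  "primitive f g \<longleftrightarrow> g \<in> borel_measurable borel \<and>
    (\<forall>a b. a \<le> b \<longrightarrow> set_integrable lborel {a..b} g \<and> (LINT x:{a..b}|lborel. g x) = f b - f a)"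

lemma primitive_measurable: "primitive f g \<Longrightarrow> g \<in> borel_measurable borel"
  by (simp add: primitive_def)

lemma primitive_set_integrable: "primitive f g \<Longrightarrow> set_integrable lborel {a..b} g"
  unfolding primitive_def by (cases "a \<le> b") (auto simp: set_integrable_def)

lemma primitive_LINT: "primitive f g \<Longrightarrow> a \<le> b \<Longrightarrow> (LINT x:{a..b}|lborel. g x) = f b - f a"
  unfolding primitive_def by auto

lemma primitive_has_integral: "primitive f g \<Longrightarrow> a \<le> b \<Longrightarrow> (g has_integral (f b - f a)) {a..b}"
  using primitive_set_integrable[of f g a b] primitive_LINT[of f g a b]
    set_borel_integral_eq_integral[of "{a..b}" g] by (metis has_integral_iff)

lemma primitive_integral: "primitive f g \<Longrightarrow> a \<le> b \<Longrightarrow> integral {a..b} g = f b - f a"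
  using primitive_has_integral by blast

lemma primitive_integrable_on: "primitive f g \<Longrightarrow> g integrable_on {a..b}"
  using primitive_set_integrable set_borel_integral_eq_integral(1) by blast

lemma negligible_AE_lborel: "negligible N \<Longrightarrow> AE x in lborel. x \<notin> N"
  by (metis AE_completion_iff AE_not_in negligible_iff_null_sets)

text \<open>Lebesgue differentiation. \<open>integrable_ccontinuous_explicit\<close> controls
  averages over intervals to the right of a point; applied to the reflected density it controls
  those to the left.\<close>

theorem primitive_AE_derivative:
  assumes "primitive f g"
  shows "AE x in lborel. (f has_real_derivative g x) (at x)"
proof -
  have gi: "g integrable_on cbox a b" for a b
    using primitive_integrable_on[OF assms] by simp
  have gi': "(\<lambda>x. g (- x)) integrable_on cbox a b" for a b
    using gi[of "-b" "-a"] Henstock_Kurzweil_Integration.integrable_reflect_real[where f = g and a = "-b" and b = "-a"] by simp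
  obtain N where N: "negligible N" "\<And>x e. x \<notin> N \<Longrightarrow> 0 < e \<Longrightarrow>
       \<exists>d>0. \<forall>h. 0 < h \<and> h < d \<longrightarrow> norm (integral (cbox x (x + h *\<^sub>R One)) g /\<^sub>R h ^ DIM(real) - g x) < e"
    using integrable_ccontinuous_explicit[OF gi] by blast
  obtain N' where N': "negligible N'" "\<And>x e. x \<notin> N' \<Longrightarrow> 0 < e \<Longrightarrow>
       \<exists>d>0. \<forall>h. 0 < h \<and> h < d \<longrightarrow> norm (integral (cbox x (x + h *\<^sub>R One)) (\<lambda>x. g (- x)) /\<^sub>R h ^ DIM(real) - g (- x)) < e"
    using integrable_ccontinuous_explicit[OF gi'] by blast
  have "negligible (uminus ` N')"
    by (rule negligible_differentiable_image_negligible) (auto intro!: derivative_intros N'(1))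
  with N(1) have "negligible (N \<union> uminus ` N')" by (rule negligible_Un)
  then have "AE x in lborel. x \<notin> N \<union> uminus ` N'" by (rule negligible_AE_lborel)
  then show ?thesis
  proof (rule AE_mp, intro AE_I2 impI)
    fix x assume x: "x \<notin> N \<union> uminus ` N'"
    then have x': "- x \<notin> N'" by force
    have "((\<lambda>h. (f (x + h) - f x) / h) \<longlongrightarrow> g x) (at 0)"
    proof (rule tendstoI)
      fix e :: real assume "e > 0"
      obtain d1 where d1: "d1 > 0" "\<And>h. 0 < h \<Longrightarrow> h < d1 \<Longrightarrow> \<bar>integral {x..x+h} g / h - g x\<bar> < e"
        using N(2)[of x e] x \<open>e > 0\<close> by (auto simp: divide_inverse_commute)
      obtain d2 where d2: "d2 > 0" "\<And>h. 0 < h \<Longrightarrow> h < d2 \<Longrightarrow> \<bar>integral {-x..-x+h} (\<lambda>x. g (-x)) / h - g x\<bar> < e"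
        using N'(2)[of "-x" e] x' \<open>e > 0\<close> by (auto simp: divide_inverse_commute)
      have "dist ((f (x + h) - f x) / h) (g x) < e" if "h \<noteq> 0" "\<bar>h\<bar> < min d1 d2" for h
      proof (cases "h > 0")
        case True
        then show ?thesis using d1(2)[of h] that primitive_integral[OF assms, of x "x + h"]
          by (simp add: dist_real_def)
      next
        case False
        then have "integral {-x..-x + (-h)} (\<lambda>x. g (-x)) = f x - f (x + h)"
          using primitive_integral[OF assms, of "x + h" x] Henstock_Kurzweil_Integration.integral_reflect_real[where f = g and a = "x + h" and b = x]
          by (simp add: algebra_simps)
        moreover have "(f (x + h) - f x) / h = (f x - f (x + h)) / (- h)" using that by (simp add: field_simps)
        ultimately show ?thesis using d2(2)[of "-h"] that False
          by (simp only: dist_real_def)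
      qed
      then show "\<forall>\<^sub>F h in at 0. dist ((f (x + h) - f x) / h) (g x) < e"
        using d1(1) d2(1) by (auto simp: eventually_at dist_real_def intro!: exI[of _ "min d1 d2"])
    qed
    then show "(f has_real_derivative g x) (at x)" by (simp add: DERIV_def)
  qed
qed

lemma primitive_AE_unique:
  assumes "primitive f g" "primitive f g'"
  shows "AE x in lborel. g x = g' x"
  using primitive_AE_derivative[OF assms(1)] primitive_AE_derivative[OF assms(2)]
  by eventually_elim (rule DERIV_unique)

lemma primitive_AE_cong:
  assumes "primitive f g" "AE x in lborel. g x = g' x" "g' \<in> borel_measurable borel"
  shows "primitive f g'"
  unfolding primitive_def
proof (intro conjI allI impI assms(3))
  fix a b :: real assume ab: "a \<le> b"
  note [measurable] = primitive_measurable[OF assms(1)] assms(3)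
  have ae: "AE x in lborel. indicator {a..b} x *\<^sub>R g x = indicator {a..b} x *\<^sub>R g' x"
    using assms(2) by eventually_elim simp
  show "set_integrable lborel {a..b} g'"
    using primitive_set_integrable[OF assms(1), of a b] integrable_cong_AE[OF _ _ ae]
    by (simp add: set_integrable_def)
  show "(LINT x:{a..b}|lborel. g' x) = f b - f a"
    using primitive_LINT[OF assms(1) ab] integral_cong_AE[OF _ _ ae]
    by (simp add: set_lebesgue_integral_def)
qed

lemma primitive_add:
  "primitive f g \<Longrightarrow> primitive f' g' \<Longrightarrow> primitive (\<lambda>x. f x + f' x) (\<lambda>x. g x + g' x)"
  unfolding primitive_def by (auto simp: set_integral_add)

lemma primitive_cmult:
  "primitive f g \<Longrightarrow> primitive (\<lambda>x. c * f x) (\<lambda>x. c * g x)"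
  unfolding primitive_def by (auto simp: set_integral_mult_right right_diff_distrib)

lemma primitive_diff:
  "primitive f g \<Longrightarrow> primitive f' g' \<Longrightarrow> primitive (\<lambda>x. f x - f' x) (\<lambda>x. g x - g' x)"
  unfolding primitive_def by (auto simp: set_integral_diff)

lemma primitive_const: "primitive (\<lambda>x. c) (\<lambda>x. 0)"
  unfolding primitive_def by (auto simp: set_integrable_def set_lebesgue_integral_def)

lemma primitive_continuous:
  assumes "primitive f g" shows "continuous_on UNIV f"
proof -
  have "isCont f x" for x
  proof -
    have "continuous_on {x-1..x+1} (\<lambda>t. f (x-1) + integral {x-1..t} g)"
      by (intro continuous_intros indefinite_integral_continuous_1 primitive_integrable_on[OF assms])
    then have "continuous_on {x-1..x+1} f"
      by (rule continuous_on_eq) (use primitive_integral[OF assms] in auto)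
    then show ?thesis by (rule continuous_on_interior) auto
  qed
  then show ?thesis by (simp add: continuous_at_imp_continuous_on)
qed

lemma primitive_lipschitz:
  assumes "primitive f g" "\<And>x. \<bar>g x\<bar> \<le> C"
  shows "\<bar>f x - f y\<bar> \<le> C * \<bar>x - y\<bar>"
proof -
  have *: "\<bar>f b - f a\<bar> \<le> C * (b - a)" if "a \<le> b" for a b
  proof -
    have "norm (f b - f a) \<le> C * measure lborel (cbox a b)"
      by (rule has_integral_bound[OF _ primitive_has_integral[OF assms(1) that, unfolded box_real[symmetric]]])
        (use assms(2) in \<open>auto intro: order_trans[OF abs_ge_zero]\<close>)
    then show ?thesis using that by simp
  qed
  show ?thesis
  proof (cases "x \<le> y")
    case True
    then have "\<bar>x - y\<bar> = y - x" by simp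
    with *[OF True] show ?thesis by (simp add: abs_minus_commute)
  next
    case False
    then show ?thesis using *[of y x] by simp
  qed
qed

lemma bounded_measurable_set_integrable:
  assumes "g \<in> borel_measurable borel" "\<And>x. \<bar>g x\<bar> \<le> C"
  shows "set_integrable lborel {a..b::real} (g :: real \<Rightarrow> real)"
proof -
  have "emeasure lborel {a..b} < \<infinity>" by (cases "a \<le> b") auto
  then show ?thesis
    unfolding set_integrable_def
    by (intro integrableI_bounded_set_indicator[where B = C]) (use assms in auto)
qed

lemma primitive_nn_integral:
  assumes "primitive f g" "\<And>x. 0 \<le> g x" "a \<le> b"
  shows "(\<integral>\<^sup>+x\<in>{a..b}. ennreal (g x) \<partial>lborel) = ennreal (f b - f a)"
proof -
  have "(\<integral>\<^sup>+x\<in>{a..b}. ennreal (g x) \<partial>lborel) = (\<integral>\<^sup>+x. ennreal (indicator {a..b} x *\<^sub>R g x) \<partial>lborel)"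
    by (intro nn_integral_cong) (auto split: split_indicator)
  also have "\<dots> = ennreal (LINT x:{a..b}|lborel. g x)"
    unfolding set_lebesgue_integral_def
    using primitive_set_integrable[OF assms(1)] assms(2)
    by (intro nn_integral_eq_integral) (auto simp: set_integrable_def)
  finally show ?thesis using primitive_LINT[OF assms(1,3)] by simp
qed

text \<open>A measure is determined by its values on boxes, and the preimage of a box under \<open>y\<close> is an interval.\<close>
theorem primitive_distr_density:
  assumes y: "primitive y a" and a: "\<And>x. 0 \<le> a x"
    and lim: "filterlim y at_top at_top" "filterlim y at_bot at_bot"
  shows "distr (density lborel (\<lambda>x. ennreal (a x))) borel y = lborel"
proof (rule lborel_eqI[symmetric])
  have [measurable]: "a \<in> borel_measurable borel" using primitive_measurable[OF y] .
  have cy: "continuous_on UNIV y" using primitive_continuous[OF y] .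
  then have [measurable]: "y \<in> borel_measurable borel" by (rule borel_measurable_continuous_onI)
  have mono: "y s \<le> y t" if "s \<le> t" for s t
    using primitive_has_integral[OF y that] has_integral_nonneg[of a "y t - y s" "{s..t}"] a by auto
  show "sets (distr (density lborel (\<lambda>x. ennreal (a x))) borel y) = sets borel" by simp
  fix l u :: real assume "\<And>b. b \<in> Basis \<Longrightarrow> l \<bullet> b \<le> u \<bullet> b"
  then have lu: "l \<le> u" by simp
  have surj: "\<exists>x. y x = c" for c
  proof -
    obtain s where s: "y s \<le> c" using lim(2) unfolding filterlim_at_bot eventually_at_bot_linorder by blast
    obtain t where t: "c \<le> y t" using lim(1) unfolding filterlim_at_top eventually_at_top_linorder by blast
    show ?thesis
    proof (cases "s \<le> t")
      case True
      then show ?thesis using IVT'[of y s c t] s t continuous_on_subset[OF cy] by auto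
    next
      case False
      then have "y s = c" using s t mono[of t s] by auto
      then show ?thesis by blast
    qed
  qed
  obtain s t where st: "y s = l" "y t = u" using surj by metis
  define s' t' where "s' = min s t" and "t' = max s t"
  have st': "y s' = l" "y t' = u" "s' \<le> t'"
    using st lu mono[of t s] by (auto simp: s'_def t'_def min_def max_def)
  \<comment> \<open>The preimage of the open box and the interval \<open>{s'..t'}\<close> differ
    only inside the fibres over \<open>l\<close> and \<open>u\<close>. A fibre has no mass: its part
    in a bounded interval is compact, with extreme points \<open>p\<close> and \<open>q\<close>, and
    the integral of \<open>a\<close> over \<open>{p..q}\<close> is
    \<open>y q - y p = 0\<close>.\<close>
  have null: "AE x in lborel. ennreal (a x) * indicator (y -` {c}) x = 0" for c
  proof -
    have *: "(\<integral>\<^sup>+x\<in>y -` {c} \<inter> {-real n..real n}. ennreal (a x) \<partial>lborel) = 0" for n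
    proof (cases "y -` {c} \<inter> {-real n..real n} = {}")
      case False
      have cpt: "compact (y -` {c} \<inter> {-real n..real n})"
        by (rule closed_Int_compact[OF closed_vimage[OF _ cy] compact_Icc]) simp
      obtain p where p: "p \<in> y -` {c} \<inter> {-real n..real n}" "\<forall>x \<in> y -` {c} \<inter> {-real n..real n}. p \<le> x"
        using compact_attains_inf[OF cpt False] by blast
      obtain q where q: "q \<in> y -` {c} \<inter> {-real n..real n}" "\<forall>x \<in> y -` {c} \<inter> {-real n..real n}. x \<le> q"
        using compact_attains_sup[OF cpt False] by blast
      have "(\<integral>\<^sup>+x\<in>y -` {c} \<inter> {-real n..real n}. ennreal (a x) \<partial>lborel) \<le> (\<integral>\<^sup>+x\<in>{p..q}. ennreal (a x) \<partial>lborel)"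
        by (intro nn_integral_mono mult_left_mono) (use p(2) q(2) in \<open>auto simp: indicator_def\<close>)
      also have "\<dots> = ennreal (y q - y p)"
        using p q by (intro primitive_nn_integral[OF y a]) auto
      also have "\<dots> = 0" using p q by simp
      finally show ?thesis by simp
    qed simp
    have "AE x in lborel. ennreal (a x) * indicator (y -` {c} \<inter> {-real n..real n}) x = 0" for n
      using *[of n] by (subst (asm) nn_integral_0_iff_AE) auto
    then have "AE x in lborel. \<forall>n. ennreal (a x) * indicator (y -` {c} \<inter> {-real n..real n}) x = 0"
      by (subst AE_all_countable) blast
    then show ?thesis
    proof (eventually_elim)
      case (elim x)
      have "x \<in> {- real (nat \<lceil>\<bar>x\<bar>\<rceil>)..real (nat \<lceil>\<bar>x\<bar>\<rceil>)}" by (simp, linarith)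
      with elim[rule_format, of "nat \<lceil>\<bar>x\<bar>\<rceil>"] show ?case by (auto split: split_indicator)
    qed
  qed
  have yl: "y -` {l<..<u} \<in> sets borel"
    using measurable_sets[of y borel borel "{l<..<u}"] by simp
  have "emeasure (distr (density lborel (\<lambda>x. ennreal (a x))) borel y) (box l u)
      = emeasure (density lborel (\<lambda>x. ennreal (a x))) (y -` {l<..<u})"
  proof -
    have "y \<in> density lborel (\<lambda>x. ennreal (a x)) \<rightarrow>\<^sub>M borel"
      using \<open>y \<in> borel_measurable borel\<close> by (simp only: measurable_density_eq1 measurable_lborel2)
    from emeasure_distr[OF this, of "{l<..<u}"] show ?thesis
      by (simp only: space_density space_lborel space_borel Int_UNIV_right box_real simp_thms sets.top borel_open open_greaterThanLessThan)
  qed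
  also have "\<dots> = (\<integral>\<^sup>+x\<in>y -` {l<..<u}. ennreal (a x) \<partial>lborel)"
  proof (rule emeasure_density)
    show "(\<lambda>x. ennreal (a x)) \<in> borel_measurable lborel" by measurable
    show "y -` {l<..<u} \<in> sets lborel" using yl by (simp only: sets_lborel)
  qed
  also have "\<dots> = (\<integral>\<^sup>+x\<in>{s'..t'}. ennreal (a x) \<partial>lborel)"
  proof (rule nn_integral_cong_AE)
    from null[of l] null[of u]
    show "AE x in lborel. ennreal (a x) * indicator (y -` {l<..<u}) x = ennreal (a x) * indicator {s'..t'} x"
    proof eventually_elim
      case (elim x)
      show ?case
      proof (cases "a x = 0")
        case False
        then have "y x \<noteq> l" "y x \<noteq> u" using elim a[of x] by (auto split: split_indicator_asm)
        moreover have "x \<in> {s'..t'}" if "l < y x" "y x < u"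
          using mono[of x s'] mono[of t' x] that st' by force
        moreover have "l \<le> y x \<and> y x \<le> u" if "x \<in> {s'..t'}"
          using mono[of s' x] mono[of x t'] that st' by auto
        ultimately show ?thesis by (auto split: split_indicator)
      qed simp
    qed
  qed
  also have "\<dots> = ennreal (u - l)" using primitive_nn_integral[OF y a st'(3)] st' by simp
  finally show "emeasure (distr (density lborel (\<lambda>x. ennreal (a x))) borel y) (box l u) = (\<Prod>b\<in>Basis. (u - l) \<bullet> b)"
    by simp
qed

section \<open>Absolute continuity\<close>

text \<open>Degenerate intervals are excluded, so that intervals from disjoint places are never
  equal as pairs and sums over unions split (see \<open>adm_join\<close>).\<close>

definition adm :: "(real \<times> real) set \<Rightarrow> real \<Rightarrow> real \<Rightarrow> bool" where
  "adm D a b \<longleftrightarrow> finite D \<and> (\<forall>(p, q)\<in>D. a \<le> p \<and> p < q \<and> q \<le> b) \<and>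
     pairwise (\<lambda>(p, q) (r, s). {p<..<q} \<inter> {r<..<s} = {}) D"

definition varsum :: "(real \<Rightarrow> real) \<Rightarrow> (real \<times> real) set \<Rightarrow> real" where
  "varsum f D = (\<Sum>(p, q)\<in>D. \<bar>f q - f p\<bar>)"

abbreviation len :: "(real \<times> real) set \<Rightarrow> real" where
  "len D \<equiv> (\<Sum>(p, q)\<in>D. q - p)"

lemma abs_continuous_on_adm:
  "abs_continuous_on {a..b} f \<longleftrightarrow>
    (\<forall>\<epsilon>>0. \<exists>\<delta>>0. \<forall>D. adm D a b \<longrightarrow> len D < \<delta> \<longrightarrow> varsum f D < \<epsilon>)"
proof (intro iffI allI impI)
  fix \<epsilon> :: real assume f: "abs_continuous_on {a..b} f" and "\<epsilon> > 0"
  then obtain \<delta> where \<delta>: "\<delta> > 0" "\<And>D. finite D \<Longrightarrow>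
      (\<forall>(a', b')\<in>D. a' \<le> b' \<and> {a'..b'} \<subseteq> {a..b}) \<Longrightarrow>
      pairwise (\<lambda>(a, b) (c, d). {a<..<b} \<inter> {c<..<d} = {}) D \<Longrightarrow>
      (\<Sum>(a, b)\<in>D. b - a) < \<delta> \<Longrightarrow> (\<Sum>(a, b)\<in>D. \<bar>f b - f a\<bar>) < \<epsilon>"
    unfolding abs_continuous_on_def by (elim allE[of _ \<epsilon>] impE exE conjE; blast)
  have "varsum f D < \<epsilon>" if "adm D a b" "len D < \<delta>" for D
    unfolding varsum_def
  proof (rule \<delta>(2))
    show "finite D" "pairwise (\<lambda>(a, b) (c, d). {a<..<b} \<inter> {c<..<d} = {}) D" "len D < \<delta>"
      using that unfolding adm_def by simp_all
    show "\<forall>(a', b')\<in>D. a' \<le> b' \<and> {a'..b'} \<subseteq> {a..b}"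
      using that(1) unfolding adm_def by (fastforce dest: bspec)
  qed
  with \<delta>(1) show "\<exists>\<delta>>0. \<forall>D. adm D a b \<longrightarrow> len D < \<delta> \<longrightarrow> varsum f D < \<epsilon>" by blast
next
  assume f: "\<forall>\<epsilon>>0. \<exists>\<delta>>0. \<forall>D. adm D a b \<longrightarrow> len D < \<delta> \<longrightarrow> varsum f D < \<epsilon>"
  show "abs_continuous_on {a..b} f"
    unfolding abs_continuous_on_def
  proof (intro allI impI)
    fix \<epsilon> :: real assume "\<epsilon> > 0"
    with f obtain \<delta> where \<delta>: "\<delta> > 0" "\<And>D. adm D a b \<Longrightarrow> len D < \<delta> \<Longrightarrow> varsum f D < \<epsilon>" by metis
    have "(\<Sum>(p, q)\<in>D. \<bar>f q - f p\<bar>) < \<epsilon>"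
      if D: "finite D" "\<forall>(p, q)\<in>D. p \<le> q \<and> {p..q} \<subseteq> {a..b}"
        "pairwise (\<lambda>(a, b) (c, d). {a<..<b} \<inter> {c<..<d} = {}) D" "len D < \<delta>" for D
    proof -
      let ?D = "{(p, q)\<in>D. p < q}"
      have "adm ?D a b"
        unfolding adm_def
      proof (intro conjI)
        show "finite ?D" by (rule finite_subset[OF _ D(1)]) auto
        show "pairwise (\<lambda>(a, b) (c, d). {a<..<b} \<inter> {c<..<d} = {}) ?D"
          by (rule pairwise_subset[OF D(3)]) auto
        show "\<forall>(p, q)\<in>?D. a \<le> p \<and> p < q \<and> q \<le> b"
        proof clarify
          fix p q assume "(p, q) \<in> D" "p < q"
          with D(2) have "{p..q} \<subseteq> {a..b}" by blast
          then show "a \<le> p \<and> p < q \<and> q \<le> b" using \<open>p < q\<close> by simp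
        qed
      qed
      have eq: "(\<Sum>(p, q)\<in>?D. g p q) = (\<Sum>(p, q)\<in>D. g p q)" if "\<And>p. g p p = 0" for g :: "real \<Rightarrow> real \<Rightarrow> real"
      proof (rule sum.mono_neutral_left[OF D(1)])
        show "?D \<subseteq> D" by auto
        show "\<forall>d\<in>D - ?D. (case d of (p, q) \<Rightarrow> g p q) = 0"
        proof
          fix d assume d: "d \<in> D - ?D"
          obtain p q where pq: "d = (p, q)" by force
          have "p \<le> q" "\<not> p < q" using d D(2) unfolding pq by auto
          then show "(case d of (p, q) \<Rightarrow> g p q) = 0" using that pq by simp
        qed
      qed
      have "len ?D = len D" "varsum f ?D = (\<Sum>(p, q)\<in>D. \<bar>f q - f p\<bar>)"
        unfolding varsum_def by (rule eq; simp)+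
      with \<open>adm ?D a b\<close> show ?thesis using \<delta>(2)[of ?D] D(4) by simp
    qed
    with \<delta>(1) show "\<exists>\<delta>>0. \<forall>D. finite D \<longrightarrow>
      (\<forall>(aa, ba)\<in>D. aa \<le> ba \<and> {aa..ba} \<subseteq> {a..b}) \<longrightarrow>
      pairwise (\<lambda>(a, b) (c, d). {a<..<b} \<inter> {c<..<d} = {}) D \<longrightarrow>
      (\<Sum>(a, b)\<in>D. b - a) < \<delta> \<longrightarrow> (\<Sum>(a, b)\<in>D. \<bar>f b - f a\<bar>) < \<epsilon>"
      by blast
  qed
qed

text \<open>Two comparison functions at once: this covers products, the difference of a function and
  its variation, and the flux \<open>\<Psi>\<close>.\<close>

lemma abs_continuous_on_dominated:
  assumes F: "abs_continuous_on {a..b} F" and G: "abs_continuous_on {a..b} G" and "M \<ge> 0"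
    and h: "\<And>p q. a \<le> p \<Longrightarrow> p \<le> q \<Longrightarrow> q \<le> b \<Longrightarrow> \<bar>h q - h p\<bar> \<le> M * (\<bar>F q - F p\<bar> + \<bar>G q - G p\<bar>)"
  shows "abs_continuous_on {a..b} h"
  unfolding abs_continuous_on_adm
proof (intro allI impI)
  fix \<epsilon> :: real assume "\<epsilon> > 0"
  define e where "e = \<epsilon> / (2 * (M + 1))"
  have e: "e > 0" "M * (2 * e) < \<epsilon>" using \<open>\<epsilon> > 0\<close> \<open>M \<ge> 0\<close> by (auto simp: e_def field_simps)
  obtain d1 where d1: "d1 > 0" "\<And>D. adm D a b \<Longrightarrow> len D < d1 \<Longrightarrow> varsum F D < e"
    using F e(1) unfolding abs_continuous_on_adm by metis
  obtain d2 where d2: "d2 > 0" "\<And>D. adm D a b \<Longrightarrow> len D < d2 \<Longrightarrow> varsum G D < e"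
    using G e(1) unfolding abs_continuous_on_adm by metis
  have "varsum h D < \<epsilon>" if D: "adm D a b" "len D < min d1 d2" for D
  proof -
    have "varsum h D \<le> (\<Sum>(p, q)\<in>D. M * (\<bar>F q - F p\<bar> + \<bar>G q - G p\<bar>))"
      unfolding varsum_def using D(1) h by (intro sum_mono) (force simp: adm_def)
    also have "\<dots> = M * (varsum F D + varsum G D)"
      by (simp add: varsum_def sum_distrib_left sum.distrib[symmetric] case_prod_unfold)
    also have "\<dots> \<le> M * (2 * e)"
      using d1(2)[of D] d2(2)[of D] D \<open>M \<ge> 0\<close> by (intro mult_left_mono) auto
    finally show ?thesis using e(2) by simp
  qed
  then show "\<exists>\<delta>>0. \<forall>D. adm D a b \<longrightarrow> len D < \<delta> \<longrightarrow> varsum h D < \<epsilon>"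
    using d1(1) d2(1) by (intro exI[of _ "min d1 d2"]) auto
qed

lemma abs_continuous_on_lipschitz:
  assumes "\<And>p q. a \<le> p \<Longrightarrow> p \<le> q \<Longrightarrow> q \<le> b \<Longrightarrow> \<bar>h q - h p\<bar> \<le> C * (q - p)"
  shows "abs_continuous_on {a..b} h"
  unfolding abs_continuous_on_adm
proof (intro allI impI)
  fix \<epsilon> :: real assume "\<epsilon> > 0"
  have "varsum h D < \<epsilon>" if D: "adm D a b" "len D < \<epsilon> / (\<bar>C\<bar> + 1)" for D
  proof -
    have "varsum h D \<le> (\<Sum>(p, q)\<in>D. \<bar>C\<bar> * (q - p))"
      unfolding varsum_def
    proof (rule sum_mono, clarify)
      fix p q assume "(p, q) \<in> D"
      then have pq: "a \<le> p" "p < q" "q \<le> b" using D(1) by (auto simp: adm_def)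
      then have "\<bar>h q - h p\<bar> \<le> C * (q - p)" by (intro assms) auto
      also have "\<dots> \<le> \<bar>C\<bar> * (q - p)" using pq by (intro mult_right_mono) auto
      finally show "\<bar>h q - h p\<bar> \<le> \<bar>C\<bar> * (q - p)" .
    qed
    also have "\<dots> = \<bar>C\<bar> * len D" by (simp add: sum_distrib_left case_prod_unfold)
    also have "\<dots> \<le> \<bar>C\<bar> * (\<epsilon> / (\<bar>C\<bar> + 1))" using D(2) by (intro mult_left_mono) auto
    also have "\<dots> < \<epsilon>" using \<open>\<epsilon> > 0\<close> by (simp add: field_simps)
    finally show ?thesis .
  qed
  moreover have "\<epsilon> / (\<bar>C\<bar> + 1) > 0" using \<open>\<epsilon> > 0\<close> by simp
  ultimately show "\<exists>\<delta>>0. \<forall>D. adm D a b \<longrightarrow> len D < \<delta> \<longrightarrow> varsum h D < \<epsilon>" by blast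
qed

lemma abs_continuous_on_imp_continuous_on:
  assumes "abs_continuous_on {a..b} f"
  shows "continuous_on {a..b} f"
  unfolding continuous_on_iff
proof (intro ballI allI impI)
  fix x \<epsilon> :: real assume x: "x \<in> {a..b}" and "\<epsilon> > 0"
  obtain \<delta> where \<delta>: "\<delta> > 0" "\<And>D. adm D a b \<Longrightarrow> len D < \<delta> \<Longrightarrow> varsum f D < \<epsilon>"
    using assms \<open>\<epsilon> > 0\<close> unfolding abs_continuous_on_adm by metis
  have "dist (f y) (f x) < \<epsilon>" if y: "y \<in> {a..b}" "dist y x < \<delta>" for y
  proof (cases "x = y")
    case False
    have "adm {(min x y, max x y)} a b" using x y False by (auto simp: adm_def)
    from \<delta>(2)[OF this] show ?thesis using y(2)
      by (cases "x \<le> y") (auto simp: varsum_def dist_real_def abs_minus_commute)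
  qed (use \<open>\<epsilon> > 0\<close> in simp)
  with \<delta>(1) show "\<exists>d>0. \<forall>x'\<in>{a..b}. dist x' x < d \<longrightarrow> dist (f x') (f x) < \<epsilon>" by blast
qed

lemma adm_len_le_measure:
  assumes "adm D a b" "\<And>p q. (p, q) \<in> D \<Longrightarrow> {p<..<q} \<subseteq> A" "A \<in> fmeasurable lborel"
  shows "len D \<le> measure lborel A"
proof -
  have fin: "finite D" using assms(1) by (simp add: adm_def)
  have disj: "disjoint_family_on (\<lambda>(p, q). {p<..<q}) D"
    using assms(1) unfolding adm_def disjoint_family_on_def pairwise_def by fastforce
  have "len D = (\<Sum>d\<in>D. measure lborel ((\<lambda>(p, q). {p<..<q}) d))"
    using assms(1) by (intro sum.cong) (auto simp: adm_def)
  also have "\<dots> = measure lborel (\<Union>d\<in>D. (\<lambda>(p, q). {p<..<q}) d)"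
    using assms(1) by (intro measure_finite_Union[symmetric] fin disj) (auto simp: adm_def)
  also have "\<dots> \<le> measure lborel A"
  proof (rule measure_mono_fmeasurable)
    show "(\<Union>d\<in>D. (\<lambda>(p, q). {p<..<q}) d) \<subseteq> A" using assms(2) by auto
    show "(\<Union>d\<in>D. (\<lambda>(p, q). {p<..<q}) d) \<in> sets lborel"
      using fin by (intro sets.finite_UN) auto
  qed (rule assms(3))
  finally show ?thesis .
qed

lemma adm_len_le:
  assumes "adm D a b" "a \<le> b" shows "len D \<le> b - a"
proof -
  have "len D \<le> measure lborel {a..b}"
    by (rule adm_len_le_measure[OF assms(1)]) (use assms in \<open>force simp: adm_def\<close>, use assms(2) in \<open>auto simp: fmeasurable_def\<close>)
  then show ?thesis using assms(2) by simp
qed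

text \<open>Subdividing every member of a family separately. It serves for cutting at a point
  (\<open>adm_split\<close>) and for inserting near-optimal subdivisions
  (\<open>abs_continuous_cumVar\<close>).\<close>

lemma adm_join:
  assumes D: "adm D a b" and E: "\<And>p q. (p, q) \<in> D \<Longrightarrow> adm (E (p, q)) p q"
  shows "adm (\<Union>d\<in>D. E d) a b" "varsum f (\<Union>d\<in>D. E d) = (\<Sum>d\<in>D. varsum f (E d))"
    "len (\<Union>d\<in>D. E d) = (\<Sum>d\<in>D. len (E d))"
proof -
  have fin: "finite D" "\<And>d. d \<in> D \<Longrightarrow> finite (E d)" using D E by (auto simp: adm_def)
  have key: "{p<..<q} \<inter> {r<..<s} = {}" if "d \<in> D" "e \<in> D" "d \<noteq> e" "(p, q) \<in> E d" "(r, s) \<in> E e" for d e p q r s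
  proof -
    obtain d1 d2 e1 e2 where de: "d = (d1, d2)" "e = (e1, e2)" by force
    have "{d1<..<d2} \<inter> {e1<..<e2} = {}"
      using D that(1-3) unfolding adm_def pairwise_def de by fastforce
    moreover have "{p<..<q} \<subseteq> {d1<..<d2}" "{r<..<s} \<subseteq> {e1<..<e2}"
      using E[of d1 d2] E[of e1 e2] that de by (force simp: adm_def)+
    ultimately show ?thesis by blast
  qed
  have nonempty: "p < q" if "d \<in> D" "(p, q) \<in> E d" for d p q
    using E[of "fst d" "snd d"] that by (auto simp: adm_def)
  have disj: "\<forall>d\<in>D. \<forall>e\<in>D. d \<noteq> e \<longrightarrow> E d \<inter> E e = {}"
  proof (intro ballI impI, rule ccontr)
    fix d e assume "d \<in> D" "e \<in> D" "d \<noteq> e" "E d \<inter> E e \<noteq> {}"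
    then obtain p q where "(p, q) \<in> E d" "(p, q) \<in> E e" by auto
    with key[of d e p q p q] nonempty[of d p q] \<open>d \<in> D\<close> \<open>e \<in> D\<close> \<open>d \<noteq> e\<close> show False by simp
  qed
  show "varsum f (\<Union>d\<in>D. E d) = (\<Sum>d\<in>D. varsum f (E d))" "len (\<Union>d\<in>D. E d) = (\<Sum>d\<in>D. len (E d))"
    unfolding varsum_def using fin disj by (subst sum.UNION_disjoint; auto)+
  show "adm (\<Union>d\<in>D. E d) a b"
    unfolding adm_def
  proof (intro conjI)
    show "finite (\<Union>d\<in>D. E d)" using fin by blast
    show "\<forall>(p, q)\<in>\<Union>d\<in>D. E d. a \<le> p \<and> p < q \<and> q \<le> b"
    proof clarify
      fix p q d1 d2 assume *: "(d1, d2) \<in> D" "(p, q) \<in> E (d1, d2)"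
      then have "a \<le> d1" "d2 \<le> b" "d1 \<le> p" "p < q" "q \<le> d2" using D E[of d1 d2] by (auto simp: adm_def)
      then show "a \<le> p \<and> p < q \<and> q \<le> b" by simp
    qed
    show "pairwise (\<lambda>(p, q) (r, s). {p<..<q} \<inter> {r<..<s} = {}) (\<Union>d\<in>D. E d)"
    proof (rule pairwiseI)
      fix x y assume "x \<in> (\<Union>d\<in>D. E d)" "y \<in> (\<Union>d\<in>D. E d)" "x \<noteq> y"
      then obtain p q d r s e where *: "x = (p, q)" "y = (r, s)" "d \<in> D" "(p, q) \<in> E d" "e \<in> D" "(r, s) \<in> E e"
        by (metis UN_E surj_pair)
      have "{p<..<q} \<inter> {r<..<s} = {}"
      proof (cases "d = e")
        case True
        then have "pairwise (\<lambda>(p, q) (r, s). {p<..<q} \<inter> {r<..<s} = {}) (E d)"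
          using E[of "fst d" "snd d"] * by (auto simp: adm_def)
        from pairwiseD[OF this, of "(p, q)" "(r, s)"] show ?thesis using * True \<open>x \<noteq> y\<close> by simp
      next
        case False
        show ?thesis by (rule key[OF *(3,5) False *(4,6)])
      qed
      then show "(case x of (p, q) \<Rightarrow> \<lambda>(r, s). {p<..<q} \<inter> {r<..<s} = {}) y" using * by simp
    qed
  qed
qed

text \<open>Only an interval that straddles \<open>b\<close> is changed, into its two halves; by the
  triangle inequality this cannot decrease the sum.\<close>

lemma adm_split:
  assumes D: "adm D a c" and b: "a \<le> b" "b \<le> c"
  obtains L R where "adm L a b" "adm R b c" "varsum f D \<le> varsum f L + varsum f R"
proof -
  define l where "l d = (if fst d < b then {(fst d, min (snd d) b)} else {})" for d :: "real \<times> real"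
  define r where "r d = (if b < snd d then {(max (fst d) b, snd d)} else {})" for d :: "real \<times> real"
  have el: "adm (l (p, q)) p q" "adm (r (p, q)) p q" if "(p, q) \<in> D" for p q
    using D that by (auto simp: adm_def l_def r_def)
  have "adm (\<Union>d\<in>D. l d) a b" "adm (\<Union>d\<in>D. r d) b c"
    using adm_join(1)[of D a c l, OF D el(1)] adm_join(1)[of D a c r, OF D el(2)] b
    by (auto simp: adm_def l_def r_def split: if_splits)
  moreover have "varsum f D \<le> (\<Sum>d\<in>D. varsum f (l d) + varsum f (r d))"
    unfolding varsum_def[of f D]
  proof (rule sum_mono, clarify)
    fix p q assume "(p, q) \<in> D"
    then have "p < q" using D by (auto simp: adm_def)
    then show "\<bar>f q - f p\<bar> \<le> varsum f (l (p, q)) + varsum f (r (p, q))"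
      by (auto simp: varsum_def l_def r_def min_def max_def)
  qed
  then have "varsum f D \<le> varsum f (\<Union>d\<in>D. l d) + varsum f (\<Union>d\<in>D. r d)"
    by (simp add: adm_join(2)[of D a c l, OF D el(1)] adm_join(2)[of D a c r, OF D el(2)] sum.distrib)
  ultimately show ?thesis using that by blast
qed

lemma adm_empty [simp]: "adm {} a b" and varsum_empty [simp]: "varsum f {} = 0"
  by (auto simp: adm_def varsum_def)

text \<open>Take \<open>\<delta>\<close> for the tolerance 1 and peel off pieces of length
  \<open>\<delta> / 2\<close>: each contributes less than 1, and finitely many exhaust the
  interval.\<close>

lemma varsum_bounded:
  assumes "abs_continuous_on {a..b} f"
  shows "\<exists>M. \<forall>D. adm D a b \<longrightarrow> varsum f D \<le> M"
proof -
  obtain \<delta> where \<delta>: "\<delta> > 0" "\<And>D. adm D a b \<Longrightarrow> len D < \<delta> \<Longrightarrow> varsum f D < 1"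
    using assms unfolding abs_continuous_on_adm by (metis zero_less_one)
  have "varsum f D \<le> real n" if "a \<le> c" "c \<le> b" "c - a \<le> real n * (\<delta> / 2)" "adm D a c" for n c D
    using that
  proof (induction n arbitrary: c D)
    case 0
    then have "D = {}" by (force simp: adm_def)
    then show ?case by simp
  next
    case (Suc n)
    define c' where "c' = max a (c - \<delta> / 2)"
    have c': "a \<le> c'" "c' \<le> c" "c' \<le> b" "c' - a \<le> real n * (\<delta> / 2)" "c - c' < \<delta>"
      using Suc.prems \<delta>(1) by (auto simp: c'_def algebra_simps max_def)
    obtain L R where LR: "adm L a c'" "adm R c' c" "varsum f D \<le> varsum f L + varsum f R"
      using adm_split[OF Suc.prems(4) c'(1,2)] by blast
    have "adm R a b" using LR(2) c' Suc.prems(2) by (force simp: adm_def)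
    moreover have "len R < \<delta>" using adm_len_le[OF LR(2) c'(2)] c'(5) by simp
    ultimately have "varsum f R < 1" by (rule \<delta>(2))
    moreover have "varsum f L \<le> real n" by (rule Suc.IH[OF c'(1,3,4) LR(1)])
    ultimately show ?case using LR(3) by simp
  qed
  note key = this
  obtain n where n: "(b - a) / (\<delta> / 2) \<le> real n" using real_arch_simple by blast
  show ?thesis
  proof (cases "a \<le> b")
    case True
    have "b - a \<le> real n * (\<delta> / 2)" using n \<delta>(1) by (simp add: field_simps)
    then show ?thesis using key[of b n] True by blast
  next
    case False
    then have "D = {}" if "adm D a b" for D using that by (force simp: adm_def)
    then show ?thesis by (metis varsum_empty order_refl)
  qed
qed

section \<open>Total variation, and densities by Radon-Nikodym\<close>

definition Var :: "(real \<Rightarrow> real) \<Rightarrow> real \<Rightarrow> real \<Rightarrow> real" where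
  "Var f a b = Sup (varsum f ` {D. adm D a b})"

context
  fixes f :: "real \<Rightarrow> real"
  assumes ac: "\<And>a b. abs_continuous_on {a..b} f"
begin

lemma bdd_above_varsum: "bdd_above (varsum f ` {D. adm D a b})"
  using varsum_bounded[OF ac, of a b] by (auto simp: bdd_above_def)

lemma varsum_le_Var: "adm D a b \<Longrightarrow> varsum f D \<le> Var f a b"
  unfolding Var_def by (intro cSup_upper bdd_above_varsum) auto

lemma Var_least: "(\<And>D. adm D a b \<Longrightarrow> varsum f D \<le> M) \<Longrightarrow> Var f a b \<le> M"
  unfolding Var_def by (rule cSup_least) (use adm_empty in blast, blast)

lemma Var_approx:
  assumes "e > 0" obtains D where "adm D a b" "Var f a b - e < varsum f D"
proof -
  have "Var f a b - e < Sup (varsum f ` {D. adm D a b})" using assms by (simp add: Var_def)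
  then show ?thesis using less_cSupD[of "varsum f ` {D. adm D a b}" "Var f a b - e"] that adm_empty by blast
qed

lemma diff_le_Var: "a \<le> b \<Longrightarrow> \<bar>f b - f a\<bar> \<le> Var f a b"
proof (cases "a = b")
  case True then show ?thesis using varsum_le_Var[OF adm_empty, of a b] by simp
next
  case False
  assume "a \<le> b"
  with False have "adm {(a, b)} a b" by (auto simp: adm_def)
  from varsum_le_Var[OF this] show ?thesis by (simp add: varsum_def)
qed

lemma Var_add:
  assumes "a \<le> b" "b \<le> c" shows "Var f a c = Var f a b + Var f b c"
proof (rule antisym)
  show "Var f a c \<le> Var f a b + Var f b c"
  proof (rule Var_least)
    fix D assume "adm D a c"
    then obtain L R where "adm L a b" "adm R b c" "varsum f D \<le> varsum f L + varsum f R"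
      using adm_split assms by metis
    then show "varsum f D \<le> Var f a b + Var f b c" using varsum_le_Var by (meson add_mono order_trans)
  qed
  show "Var f a b + Var f b c \<le> Var f a c"
  proof (rule field_le_epsilon)
    fix e :: real assume "e > 0"
    then have e2: "e / 2 > 0" by simp
    obtain L where L: "adm L a b" "Var f a b - e / 2 < varsum f L" using Var_approx[OF e2] by blast
    obtain R where R: "adm R b c" "Var f b c - e / 2 < varsum f R" using Var_approx[OF e2] by blast
    have "varsum f L + varsum f R \<le> Var f a c"
    proof -
      have int: "L \<inter> R = {}" using L(1) R(1) by (force simp: adm_def)
      have "adm (L \<union> R) a c"
        unfolding adm_def
      proof (intro conjI)
        show "finite (L \<union> R)" using L(1) R(1) by (auto simp: adm_def)
        show "\<forall>(p, q)\<in>L \<union> R. a \<le> p \<and> p < q \<and> q \<le> c" using L(1) R(1) assms by (force simp: adm_def)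
        let ?P = "\<lambda>d e. {fst d<..<snd d} \<inter> {fst e<..<snd e} = ({} :: real set)"
        have LR: "?P d e" if "d \<in> L" "e \<in> R" for d e
        proof -
          have "snd d \<le> b" using L(1) that(1) unfolding adm_def by (auto simp: case_prod_unfold)
          moreover have "b \<le> fst e" using R(1) that(2) unfolding adm_def by (auto simp: case_prod_unfold)
          ultimately show ?thesis by auto
        qed
        have LL: "pairwise ?P L" and RR: "pairwise ?P R"
          using L(1) R(1) unfolding adm_def by (simp_all add: case_prod_unfold)
        have "pairwise ?P (L \<union> R)"
        proof (rule pairwiseI)
          fix d e assume "d \<in> L \<union> R" "e \<in> L \<union> R" "d \<noteq> e"
          then consider "d \<in> L" "e \<in> L" | "d \<in> R" "e \<in> R" | "d \<in> L" "e \<in> R" | "d \<in> R" "e \<in> L" by blast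
          then show "?P d e"
          proof cases
            case 1 then show ?thesis using pairwiseD[OF LL _ _ \<open>d \<noteq> e\<close>] by blast
          next
            case 2 then show ?thesis using pairwiseD[OF RR _ _ \<open>d \<noteq> e\<close>] by blast
          next
            case 3 then show ?thesis by (rule LR)
          next
            case 4 then show ?thesis using LR[of e d] by (simp only: Int_commute)
          qed
        qed
        then show "pairwise (\<lambda>(p, q) (r, s). {p<..<q} \<inter> {r<..<s} = {}) (L \<union> R)"
          by (simp add: case_prod_unfold)
      qed
      from varsum_le_Var[OF this] show ?thesis
        using int L(1) R(1) by (simp add: varsum_def adm_def sum.union_disjoint)
    qed
    then show "Var f a b + Var f b c \<le> Var f a c + e" using L(2) R(2) by simp
  qed
qed

definition cumVar :: "real \<Rightarrow> real" where
  "cumVar x = (if 0 \<le> x then Var f 0 x else - Var f x 0)"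

lemma cumVar_diff: "x \<le> y \<Longrightarrow> cumVar y - cumVar x = Var f x y"
  using Var_add[of 0 x y] Var_add[of x y 0] Var_add[of x 0 y] by (auto simp: cumVar_def)

text \<open>Replace each interval by a subdivision almost attaining its variation. The total length
  does not grow, so the \<open>\<delta>\<close> of \<open>f\<close> for half the tolerance still
  applies.\<close>

lemma abs_continuous_cumVar: "abs_continuous_on {a..b} cumVar"
  unfolding abs_continuous_on_adm
proof (intro allI impI)
  fix \<epsilon> :: real assume "\<epsilon> > 0"
  obtain \<delta> where \<delta>: "\<delta> > 0" "\<And>D. adm D a b \<Longrightarrow> len D < \<delta> \<Longrightarrow> varsum f D < \<epsilon> / 2"
    using ac[of a b] \<open>\<epsilon> > 0\<close> unfolding abs_continuous_on_adm by (metis half_gt_zero)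
  have "varsum cumVar D < \<epsilon>" if D: "adm D a b" "len D < \<delta>" for D
  proof -
    \<comment> \<open>The loss \<open>e\<close> per interval is chosen so that all intervals
      together lose less than \<open>\<epsilon> / 2\<close>.\<close>
    define e where "e = \<epsilon> / (4 * (real (card D) + 1))"
    have e: "e > 0" "real (card D) * e < \<epsilon> / 2" using \<open>\<epsilon> > 0\<close> by (auto simp: e_def field_simps intro!: add_pos_nonneg)
    have "\<exists>E. adm E (fst d) (snd d) \<and> Var f (fst d) (snd d) - e < varsum f E" for d
      using Var_approx[OF e(1)] by metis
    then obtain E where E: "\<And>d. adm (E d) (fst d) (snd d)" "\<And>d. Var f (fst d) (snd d) - e < varsum f (E d)"
      by metis
    have E': "adm (E (p, q)) p q" for p q using E(1)[of "(p, q)"] by simp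
    have pq: "fst d \<le> snd d" if "d \<in> D" for d using D(1) that by (force simp: adm_def)
    have "varsum cumVar D = (\<Sum>d\<in>D. \<bar>Var f (fst d) (snd d)\<bar>)"
      unfolding varsum_def case_prod_unfold using pq by (intro sum.cong) (auto simp: cumVar_diff)
    also have "\<dots> = (\<Sum>d\<in>D. Var f (fst d) (snd d))"
      using varsum_le_Var[OF adm_empty] by (intro sum.cong) auto
    also have "\<dots> \<le> (\<Sum>d\<in>D. varsum f (E d) + e)"
    proof (rule sum_mono)
      fix d show "Var f (fst d) (snd d) \<le> varsum f (E d) + e" using E(2)[of d] by linarith
    qed
    also have "\<dots> = varsum f (\<Union>d\<in>D. E d) + real (card D) * e"
      by (simp add: adm_join(2)[OF D(1) E'] sum.distrib)
    also have "varsum f (\<Union>d\<in>D. E d) < \<epsilon> / 2"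
    proof (rule \<delta>(2))
      show "adm (\<Union>d\<in>D. E d) a b" by (rule adm_join(1)[OF D(1) E'])
      have "len (\<Union>d\<in>D. E d) = (\<Sum>d\<in>D. len (E d))" by (rule adm_join(3)[OF D(1) E'])
      also have "\<dots> \<le> (\<Sum>d\<in>D. snd d - fst d)"
        using E(1) pq by (intro sum_mono adm_len_le) auto
      also have "\<dots> < \<delta>" using D(2) by (simp add: case_prod_unfold)
      finally show "len (\<Union>d\<in>D. E d) < \<delta>" .
    qed
    finally show ?thesis using e(2) by simp
  qed
  with \<delta>(1) show "\<exists>\<delta>>0. \<forall>D. adm D a b \<longrightarrow> len D < \<delta> \<longrightarrow> varsum cumVar D < \<epsilon>" by blast
qed

end

text \<open>The density is the Radon-Nikodym derivative of the Stieltjes measure of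
  \<open>V\<close>. What has to be shown is that this measure vanishes on Lebesgue null
  sets.\<close>

lemma mono_abs_continuous_primitive:
  assumes mono: "\<And>x y. x \<le> y \<Longrightarrow> V x \<le> V y" and ac: "\<And>a b. abs_continuous_on {a..b} V"
  shows "\<exists>g. primitive V g"
proof -
  have isc: "isCont V x" for x
  proof -
    have "continuous_on {x-1..x+1} V" by (rule abs_continuous_on_imp_continuous_on[OF ac])
    then show ?thesis by (rule continuous_on_interior) auto
  qed
  then have cont: "continuous_on UNIV V" by (simp add: continuous_at_imp_continuous_on)
  define M where "M = interval_measure V"
  have setsM [simp, measurable_cong]: "sets M = sets borel" by (simp add: M_def)
  have Icc: "emeasure M {a..b} = ennreal (V b - V a)" if "a \<le> b" for a b
    unfolding M_def by (rule emeasure_interval_measure_Icc[OF that mono cont])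
  \<comment> \<open>Cover the null set by an open \<open>U\<close> shorter than
    \<open>\<delta>\<close> and exhaust \<open>U\<close> by finite unions of closed intervals. Such
    a union has a division into nonoverlapping intervals, whose Stieltjes measure is a variation sum
    of \<open>V\<close> over a family of length below \<open>\<delta>\<close>.\<close>
  have small: "emeasure M N \<le> ennreal \<epsilon>"
    if N: "N \<in> null_sets lborel" "N \<subseteq> {-real n<..<real n}" and "\<epsilon> > 0" for N n \<epsilon>
  proof -
    obtain \<delta> where \<delta>: "\<delta> > 0" "\<And>D. adm D (-real n) (real n) \<Longrightarrow> len D < \<delta> \<Longrightarrow> varsum V D < \<epsilon>"
      using ac[of "-real n" "real n"] \<open>\<epsilon> > 0\<close> unfolding abs_continuous_on_adm by metis
    have d2: "\<delta> / 2 > 0" using \<delta>(1) by simp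
    have "N \<in> sets borel" using N(1) by auto
    obtain U0 where U0: "open U0" "N \<subseteq> U0" "emeasure lborel (U0 - N) \<le> ennreal (\<delta> / 2)"
      by (rule outer_regular_lborel_le[OF \<open>N \<in> sets borel\<close> d2])
    define U where "U = U0 \<inter> {-real n<..<real n}"
    have U: "open U" "N \<subseteq> U" "U \<subseteq> {-real n<..<real n}" using U0 N by (auto simp: U_def)
    have "emeasure lborel U \<le> emeasure lborel U0" using U0(1) by (intro emeasure_mono) (auto simp: U_def)
    also have "\<dots> = emeasure lborel (U0 - N)"
      using U0(1) by (intro emeasure_Diff_null_set[symmetric] N(1)) auto
    also have "\<dots> \<le> ennreal (\<delta> / 2)" by (rule U0(3))
    finally have eU: "emeasure lborel U \<le> ennreal (\<delta> / 2)" .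
    then have Uf: "U \<in> fmeasurable lborel" using U(1) by (auto simp: fmeasurable_def top.not_eq_extremum intro: le_less_trans)
    have mU: "measure lborel U < \<delta>"
    proof -
      have "measure lborel U \<le> \<delta> / 2"
        unfolding measure_def using eU d2 by (metis enn2real_leI less_imp_le)
      then show ?thesis using d2 by linarith
    qed
    obtain C where C: "countable C" "C \<subseteq> Pow U" "\<And>X. X \<in> C \<Longrightarrow> \<exists>a b. X = cbox a b" "\<Union>C = U"
      using open_countable_Union_open_cbox[OF U(1)] by blast
    have fin: "emeasure M (\<Union>F) \<le> ennreal \<epsilon>" if F: "finite F" "F \<subseteq> C" for F
    proof -
      obtain p where p: "p division_of (\<Union>F)"
        using elementary_unions_intervals[OF F(1)] C(3) F(2) by blast
      have pI: "\<exists>a b. K = {a..b} \<and> a \<le> b" "K \<subseteq> U" if Kp: "K \<in> p" for K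
      proof -
        show "K \<subseteq> U" using division_ofD(2)[OF p Kp] F(2) C(2) by blast
        have "K \<noteq> {}" by (rule division_ofD(3)[OF p Kp])
        moreover obtain a b where "K = cbox a b" using division_ofD(4)[OF p Kp] by blast
        ultimately show "\<exists>a b. K = {a..b} \<and> a \<le> b" by force
      qed
      have Keq: "K = {Inf K..Sup K}" "Inf K \<le> Sup K" if "K \<in> p" for K
        using pI(1)[OF that] by auto
      define p' where "p' = {K\<in>p. Inf K < Sup K}"
      define D where "D = (\<lambda>K. (Inf K, Sup K)) ` p'"
      have fp: "finite p" using p by (rule division_ofD)
      have inj: "inj_on (\<lambda>K. (Inf K, Sup K)) p'"
        by (rule inj_onI) (metis (mono_tags, lifting) Keq(1) Pair_inject mem_Collect_eq p'_def)
      have intr: "interior K = {Inf K<..<Sup K}" if "K \<in> p" for K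
        by (metis Keq(1)[OF that] interior_atLeastAtMost_real)
      have sub: "{Inf K<..<Sup K} \<subseteq> U" "Inf K \<in> U" "Sup K \<in> U" if "K \<in> p" for K
      proof -
        have "{Inf K..Sup K} \<subseteq> U" using Keq(1)[OF that] pI(2)[OF that] by simp
        then show "{Inf K<..<Sup K} \<subseteq> U" "Inf K \<in> U" "Sup K \<in> U" using Keq(2)[OF that] by auto
      qed
      have adm: "adm D (-real n) (real n)"
        unfolding adm_def
      proof (intro conjI)
        show "finite D" using fp by (simp add: D_def p'_def)
        show "\<forall>(p, q)\<in>D. - real n \<le> p \<and> p < q \<and> q \<le> real n"
          using sub(2,3) U(3) by (force simp: D_def p'_def)
        show "pairwise (\<lambda>(p, q) (r, s). {p<..<q} \<inter> {r<..<s} = {}) D"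
        proof (rule pairwiseI)
          fix x y assume "x \<in> D" "y \<in> D" "x \<noteq> y"
          then obtain K L where KL: "K \<in> p" "L \<in> p" "K \<noteq> L" "x = (Inf K, Sup K)" "y = (Inf L, Sup L)"
            by (auto simp: D_def p'_def)
          have "interior K \<inter> interior L = {}" using division_ofD(5)[OF p KL(1,2,3)] .
          then show "(case x of (p, q) \<Rightarrow> \<lambda>(r, s). {p<..<q} \<inter> {r<..<s} = {}) y"
            by (simp add: KL intr[OF KL(1)] intr[OF KL(2)])
        qed
      qed
      have "len D \<le> measure lborel U"
        by (rule adm_len_le_measure[OF adm _ Uf]) (use sub(1) in \<open>auto simp: D_def p'_def\<close>)
      then have "varsum V D < \<epsilon>" using mU by (intro \<delta>(2)[OF adm]) linarith
      have "emeasure M (\<Union>F) = emeasure M (\<Union>K\<in>p. K)" using division_ofD(6)[OF p] by simp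
      also have "\<dots> \<le> (\<Sum>K\<in>p. emeasure M K)"
      proof (rule emeasure_subadditive_finite[OF fp], clarsimp)
        fix K assume "K \<in> p"
        then obtain a b where "K = {a..b}" using pI(1) by blast
        then show "K \<in> sets borel" by simp
      qed
      also have "\<dots> = (\<Sum>K\<in>p. ennreal (V (Sup K) - V (Inf K)))"
        by (rule sum.cong[OF refl]) (metis Keq Icc)
      also have "\<dots> = ennreal (\<Sum>K\<in>p. V (Sup K) - V (Inf K))"
        using Keq(2) mono by (intro sum_ennreal) auto
      also have "(\<Sum>K\<in>p. V (Sup K) - V (Inf K)) = (\<Sum>K\<in>p'. V (Sup K) - V (Inf K))"
      proof (rule sum.mono_neutral_right[OF fp])
        show "\<forall>K\<in>p - p'. V (Sup K) - V (Inf K) = 0"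
        proof
          fix K assume "K \<in> p - p'"
          then have "Inf K = Sup K" using Keq(2)[of K] by (auto simp: p'_def)
          then show "V (Sup K) - V (Inf K) = 0" by simp
        qed
      qed (auto simp: p'_def)
      also have "\<dots> = (\<Sum>K\<in>p'. \<bar>V (Sup K) - V (Inf K)\<bar>)"
        using Keq(2) mono by (intro sum.cong) (auto simp: p'_def)
      also have "\<dots> = varsum V D"
        unfolding varsum_def D_def by (subst sum.reindex[OF inj]) simp
      finally show ?thesis using \<open>varsum V D < \<epsilon>\<close> by (meson ennreal_leI less_imp_le order_trans)
    qed
    have "emeasure M U \<le> ennreal \<epsilon>"
    proof (cases "C = {}")
      case True
      then show ?thesis using C(4) by simp
    next
      case False
      define A where "A k = (\<Union>i\<le>k. from_nat_into C i)" for k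
      have Ak: "emeasure M (A k) \<le> ennreal \<epsilon>" for k
        using fin[of "from_nat_into C ` {..k}"] from_nat_into[OF False] by (auto simp: A_def)
      have "A k \<in> sets M" for k
        unfolding A_def
      proof (rule sets.finite_UN)
        fix i
        obtain a b where "from_nat_into C i = cbox a b" using C(3)[OF from_nat_into[OF False]] by blast
        then show "from_nat_into C i \<in> sets M" by simp
      qed simp
      then have "(SUP k. emeasure M (A k)) = emeasure M (\<Union>k. A k)"
        by (intro SUP_emeasure_incseq) (auto simp: A_def incseq_def intro: order_trans)
      moreover have "(\<Union>k. A k) = U"
      proof -
        have "(\<Union>k. A k) = \<Union>(range (from_nat_into C))" by (auto simp: A_def)
        then show ?thesis using range_from_nat_into[OF False C(1)] C(4) by simp
      qed
      ultimately show ?thesis using Ak by (metis SUP_least)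
    qed
    moreover have "emeasure M N \<le> emeasure M U" using U by (intro emeasure_mono) auto
    ultimately show ?thesis by (rule order_trans[rotated])
  qed
  have "absolutely_continuous lborel M"
    unfolding absolutely_continuous_def
  proof
    fix N :: "real set" assume N: "N \<in> null_sets lborel"
    have Nn: "N \<inter> {-real n<..<real n} \<in> null_sets lborel" for n
      using null_set_Int2[OF N, of "{-real n<..<real n}"] by (simp add: Int_commute)
    have "emeasure M (N \<inter> {-real n<..<real n}) = 0" for n
    proof -
      have "emeasure M (N \<inter> {-real n<..<real n}) \<le> 0 + ennreal \<epsilon>" if "\<epsilon> > 0" for \<epsilon>
        using small[OF Nn, of n n \<epsilon>] that by simp
      then have "emeasure M (N \<inter> {-real n<..<real n}) \<le> 0"
        by (rule ennreal_le_epsilon)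
      then show ?thesis by simp
    qed
    then have "N \<inter> {-real n<..<real n} \<in> null_sets M" for n
      using Nn by (auto simp: null_sets_def)
    then have "(\<Union>n. N \<inter> {-real n<..<real n}) \<in> null_sets M" by (intro null_sets_UN)
    moreover have "(\<Union>n. N \<inter> {-real n<..<real n}) = N"
    proof -
      have "\<exists>n. x \<in> {-real n<..<real n}" for x
      proof -
        obtain n where "\<bar>x\<bar> < real n" using reals_Archimedean2 by blast
        then have "x \<in> {-real n<..<real n}" by auto
        then show ?thesis ..
      qed
      then show ?thesis by blast
    qed
    ultimately show "N \<in> null_sets M" by simp
  qed
  then obtain f where f: "f \<in> borel_measurable lborel" "density lborel f = M"
    using sigma_finite_measure.Radon_Nikodym[OF sigma_finite_lborel, of M] by auto
  define g where "g x = enn2real (f x)" for x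
  have [measurable]: "f \<in> borel_measurable borel" using f(1) by simp
  have gm [measurable]: "g \<in> borel_measurable borel" unfolding g_def by measurable
  have fi: "(\<integral>\<^sup>+x\<in>{a..b}. f x \<partial>lborel) = ennreal (V b - V a)" if "a \<le> b" for a b
    using Icc[OF that] emeasure_density[OF f(1), of "{a..b}"] f(2) by simp
  \<comment> \<open>Finiteness almost everywhere makes the passage from the extended density
    \<open>f\<close> to the real \<open>g\<close> lossless.\<close>
  have finite: "AE x in lborel. f x * indicator {a..b} x \<noteq> \<infinity>" if "a \<le> b" for a b
    using fi[OF that] by (intro nn_integral_noteq_infinite) auto
  have "primitive V g"
    unfolding primitive_def
  proof (intro conjI allI impI gm)
    fix a b :: real assume ab: "a \<le> b"
    have eq: "AE x in lborel. f x * indicator {a..b} x = ennreal (indicator {a..b} x *\<^sub>R g x)"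
      using finite[OF ab]
      by eventually_elim (auto simp: g_def top.not_eq_extremum ennreal_enn2real split: split_indicator)
    have nn: "(\<integral>\<^sup>+x. ennreal (indicator {a..b} x *\<^sub>R g x) \<partial>lborel) = ennreal (V b - V a)"
      using fi[OF ab] nn_integral_cong_AE[OF eq] by simp
    have "has_bochner_integral lborel (\<lambda>x. indicator {a..b} x *\<^sub>R g x) (V b - V a)"
      by (rule has_bochner_integral_nn_integral[OF _ _ _ nn]) (use mono[OF ab] in \<open>auto simp: g_def\<close>)
    then show "set_integrable lborel {a..b} g" "(LINT x:{a..b}|lborel. g x) = V b - V a"
      by (auto simp: set_integrable_def set_lebesgue_integral_def has_bochner_integral_iff)
  qed
  then show ?thesis by blast
qed

text \<open>Jordan decomposition: with \<open>V\<close> the signed variation,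
  \<open>f = V - (V - f)\<close> is a difference of monotone absolutely continuous
  functions.\<close>

theorem abs_continuous_primitive:
  assumes ac: "\<And>a b. abs_continuous_on {a..b} f"
  shows "\<exists>g. primitive f g"
proof -
  define V where "V = cumVar f"
  have Vd: "\<bar>f y - f x\<bar> \<le> V y - V x" if "x \<le> y" for x y
    unfolding V_def using cumVar_diff[OF ac that] diff_le_Var[OF ac that] by simp
  have acV: "abs_continuous_on {a..b} V" for a b
    unfolding V_def by (rule abs_continuous_cumVar[OF ac])
  obtain g1 where g1: "primitive V g1"
    using mono_abs_continuous_primitive[OF _ acV] Vd by (metis abs_ge_zero diff_ge_0_iff_ge order_trans)
  have "\<exists>g. primitive (\<lambda>x. V x - f x) g"
  proof (rule mono_abs_continuous_primitive)
    show "V x - f x \<le> V y - f y" if "x \<le> y" for x y using Vd[OF that] by linarith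
    show "abs_continuous_on {a..b} (\<lambda>x. V x - f x)" for a b
      by (rule abs_continuous_on_dominated[OF acV ac, of 1]) auto
  qed
  then obtain g2 where "primitive (\<lambda>x. V x - f x) g2" by blast
  from primitive_diff[OF g1 this] show ?thesis by auto
qed

text \<open>The source of the calculus rules below: product, chain and inverse rules only have to
  supply absolute continuity and the derivative almost everywhere.\<close>

theorem abs_continuous_primitive_derivative:
  assumes ac: "\<And>a b. abs_continuous_on {a..b} f" and g: "g \<in> borel_measurable borel"
    and d: "AE x in lborel. (f has_real_derivative g x) (at x)"
  shows "primitive f g"
proof -
  obtain g' where g': "primitive f g'" using abs_continuous_primitive[OF ac] by blast
  have "AE x in lborel. g' x = g x"
    using d primitive_AE_derivative[OF g'] by eventually_elim (rule DERIV_unique)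
  then show ?thesis using primitive_AE_cong[OF g' _ g] by blast
qed

lemma lipschitz_primitive:
  assumes "\<And>x y. \<bar>f x - f y\<bar> \<le> C * \<bar>x - y\<bar>" and "g \<in> borel_measurable borel"
    and "AE x in lborel. (f has_real_derivative g x) (at x)"
  shows "primitive f g"
  by (rule abs_continuous_primitive_derivative[OF abs_continuous_on_lipschitz[of _ _ f C]])
    (use assms in \<open>auto, metis abs_of_nonneg diff_ge_0_iff_ge\<close>)

section \<open>From densities back to absolute continuity; product and chain rules\<close>

lemma primitive_abs_diff_le:
  assumes "primitive f g" "a \<le> b"
  shows "\<bar>f b - f a\<bar> \<le> (LINT x:{a..b}|lborel. \<bar>g x\<bar>)"
proof -
  have "norm (LINT x:{a..b}|lborel. g x) \<le> (LINT x:{a..b}|lborel. norm (g x))"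
    by (rule set_integral_norm_bound[OF primitive_set_integrable[OF assms(1)]])
  then show ?thesis using primitive_LINT[OF assms] by simp
qed

lemma adm_sum_integral_le:
  fixes k :: "real \<Rightarrow> real"
  assumes D: "adm D a b" and k: "set_integrable lborel {a..b} k" "\<And>x. 0 \<le> k x"
  shows "(\<Sum>(p, q)\<in>D. LINT x:{p..q}|lborel. k x) \<le> (LINT x:{a..b}|lborel. k x)"
proof -
  have fin: "finite D" using D by (simp add: adm_def)
  have sub: "{p..q} \<subseteq> {a..b}" if "(p, q) \<in> D" for p q using D that by (auto simp: adm_def)
  have si: "set_integrable lborel {p..q} k" if "(p, q) \<in> D" for p q
    by (rule set_integrable_subset[OF k(1)]) (use sub[OF that] in auto)
  have si': "set_integrable lborel {p<..<q} k" if "(p, q) \<in> D" for p q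
    by (rule set_integrable_subset[OF si[OF that]]) auto
  have "(\<Sum>(p, q)\<in>D. LINT x:{p..q}|lborel. k x) = (\<Sum>d\<in>D. LINT x:{fst d<..<snd d}|lborel. k x)"
  proof (rule sum.cong[OF refl], clarsimp)
    fix p q :: real
    have "AE x in lborel. x \<noteq> p" "AE x in lborel. x \<noteq> q" by (rule AE_lborel_singleton)+
    then have "AE x in lborel. indicator {p..q} x *\<^sub>R k x = indicator {p<..<q} x *\<^sub>R k x"
      by eventually_elim (auto split: split_indicator)
    then show "(LINT x:{p..q}|lborel. k x) = (LINT x:{p<..<q}|lborel. k x)" if "(p, q) \<in> D"
      unfolding set_lebesgue_integral_def using si[OF that] si'[OF that]
      by (intro integral_cong_AE) (auto simp: set_integrable_def)
  qed
  also have "\<dots> = (LINT x:(\<Union>d\<in>D. {fst d<..<snd d})|lborel. k x)"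
  proof (rule set_integral_finite_Union[symmetric, OF fin])
    show "disjoint_family_on (\<lambda>d. {fst d<..<snd d}) D"
      using D unfolding adm_def disjoint_family_on_def pairwise_def by (auto simp: case_prod_unfold)
    show "set_integrable lborel {fst d<..<snd d} k" "{fst d<..<snd d} \<in> sets lborel" if "d \<in> D" for d
      using si'[of "fst d" "snd d"] that by auto
  qed
  also have "\<dots> \<le> (LINT x:{a..b}|lborel. k x)"
    unfolding set_lebesgue_integral_def
  proof (rule integral_mono)
    have sub': "(\<Union>d\<in>D. {fst d<..<snd d}) \<subseteq> {a..b}"
      using sub by (force simp: less_imp_le)
    have "set_integrable lborel (\<Union>d\<in>D. {fst d<..<snd d}) k"
      by (rule set_integrable_subset[OF k(1) _ sub']) (use fin in \<open>intro sets.finite_UN; auto\<close>)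
    then show "integrable lborel (\<lambda>x. indicator (\<Union>d\<in>D. {fst d<..<snd d}) x *\<^sub>R k x)"
      "integrable lborel (\<lambda>x. indicator {a..b} x *\<^sub>R k x)"
      using k(1) by (simp_all add: set_integrable_def)
    show "indicator (\<Union>d\<in>D. {fst d<..<snd d}) x *\<^sub>R k x \<le> indicator {a..b} x *\<^sub>R k x" for x
      using k(2)[of x] subsetD[OF sub', of x] unfolding indicator_def by (cases "x \<in> (\<Union>d\<in>D. {fst d<..<snd d})") simp_all
  qed
  finally show ?thesis .
qed

text \<open>Truncating the density at a large height splits it into a part with small integral and a bounded part.\<close>
lemma primitive_abs_continuous:
  assumes f: "primitive f g"
  shows "abs_continuous_on {a..b} f"
  unfolding abs_continuous_on_adm
proof (intro allI impI)
  fix \<epsilon> :: real assume "\<epsilon> > 0"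
  have [measurable]: "g \<in> borel_measurable borel" using f by (rule primitive_measurable)
  have gi: "set_integrable lborel {a..b} g" for a b by (rule primitive_set_integrable[OF f])
  define k where "k n x = \<bar>g x\<bar> - min \<bar>g x\<bar> (real n)" for n x
  have km [measurable]: "k n \<in> borel_measurable borel" for n unfolding k_def by measurable
  have k0: "0 \<le> k n x" "k n x \<le> \<bar>g x\<bar>" "\<bar>g x\<bar> \<le> k n x + real n" for n x by (auto simp: k_def)
  have ki: "set_integrable lborel {a..b} (k n)" for n a b
    by (rule set_integrable_bound[OF gi]) (use k0 in \<open>auto simp: set_borel_measurable_def\<close>)
  have "(\<lambda>n. LINT x:{a..b}|lborel. k n x) \<longlonglongrightarrow> (LINT x:{a..b}|lborel. 0)"
    unfolding set_lebesgue_integral_def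
  proof (rule integral_dominated_convergence[where w = "\<lambda>x. norm (indicator {a..b} x *\<^sub>R g x)"])
    show "integrable lborel (\<lambda>x. norm (indicator {a..b} x *\<^sub>R g x))"
      using gi unfolding set_integrable_def by (rule integrable_norm)
    show "AE x in lborel. (\<lambda>n. indicator {a..b} x *\<^sub>R k n x) \<longlonglongrightarrow> indicator {a..b} x *\<^sub>R 0"
    proof (intro AE_I2 tendsto_intros)
      fix x
      obtain N where "\<bar>g x\<bar> \<le> real N" using real_arch_simple by blast
      then have "\<forall>n\<ge>N. k n x = 0" by (auto simp: k_def min_def)
      then show "(\<lambda>n. k n x) \<longlonglongrightarrow> 0" by (intro tendsto_eventually) (auto simp: eventually_sequentially)
    qed
  qed (use k0 in \<open>auto split: split_indicator\<close>)
  then obtain n where n: "(LINT x:{a..b}|lborel. k n x) < \<epsilon> / 2"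
    using order_tendstoD(2)[of _ _ sequentially "\<epsilon> / 2"] \<open>\<epsilon> > 0\<close> by (force simp: eventually_sequentially set_lebesgue_integral_def)
  have "varsum f D < \<epsilon>" if D: "adm D a b" "len D < \<epsilon> / (2 * (real n + 1))" for D
  proof -
    have "varsum f D \<le> (\<Sum>(p, q)\<in>D. (LINT x:{p..q}|lborel. k n x) + real n * (q - p))"
      unfolding varsum_def
    proof (rule sum_mono, clarify)
      fix p q assume "(p, q) \<in> D"
      then have pq: "p \<le> q" using D(1) by (auto simp: adm_def)
      have ci: "set_integrable lborel {p..q} (\<lambda>_. real n)"
        by (rule bounded_measurable_set_integrable[where C = "real n"]) auto
      have "\<bar>f q - f p\<bar> \<le> (LINT x:{p..q}|lborel. \<bar>g x\<bar>)" by (rule primitive_abs_diff_le[OF f pq])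
      also have "\<dots> \<le> (LINT x:{p..q}|lborel. k n x + real n)"
        by (rule set_integral_mono) (use k0 gi ki ci in \<open>auto intro: set_integrable_abs\<close>)
      also have "\<dots> = (LINT x:{p..q}|lborel. k n x) + (LINT x:{p..q}|lborel. real n)"
        by (rule set_integral_add(2)[OF ki ci])
      also have "(LINT x:{p..q}|lborel. real n) = real n * (q - p)"
        using pq by (simp add: set_lebesgue_integral_def)
      finally show "\<bar>f q - f p\<bar> \<le> (LINT x:{p..q}|lborel. k n x) + real n * (q - p)" by simp
    qed
    also have "\<dots> = (\<Sum>(p, q)\<in>D. LINT x:{p..q}|lborel. k n x) + real n * len D"
      by (simp add: case_prod_unfold sum.distrib sum_distrib_left)
    also have "\<dots> \<le> (LINT x:{a..b}|lborel. k n x) + real n * (\<epsilon> / (2 * (real n + 1)))"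
      using D(2) by (intro add_mono adm_sum_integral_le[OF D(1) ki k0(1)] mult_left_mono) auto
    also have "\<dots> < \<epsilon> / 2 + real n * (\<epsilon> / (2 * (real n + 1)))" using n by simp
    also have "\<dots> \<le> \<epsilon>" using \<open>\<epsilon> > 0\<close> by (simp add: field_simps)
    finally show ?thesis .
  qed
  moreover have "\<epsilon> / (2 * (real n + 1)) > 0" using \<open>\<epsilon> > 0\<close> by simp
  ultimately show "\<exists>\<delta>>0. \<forall>D. adm D a b \<longrightarrow> len D < \<delta> \<longrightarrow> varsum f D < \<epsilon>" by blast
qed

lemma primitive_mult:
  assumes f: "primitive f f'" and g: "primitive g g'"
  shows "primitive (\<lambda>x. f x * g x) (\<lambda>x. f' x * g x + f x * g' x)"
proof (rule abs_continuous_primitive_derivative)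
  have cf: "continuous_on UNIV f" "continuous_on UNIV g"
    using f g by (auto intro: primitive_continuous)
  note [measurable] = primitive_measurable[OF f] primitive_measurable[OF g]
    borel_measurable_continuous_onI[OF cf(1)] borel_measurable_continuous_onI[OF cf(2)]
  show "(\<lambda>x. f' x * g x + f x * g' x) \<in> borel_measurable borel" by measurable
  show "AE x in lborel. ((\<lambda>x. f x * g x) has_real_derivative f' x * g x + f x * g' x) (at x)"
    using primitive_AE_derivative[OF f] primitive_AE_derivative[OF g]
    by eventually_elim (auto intro!: derivative_eq_intros)
  fix a b :: real
  have acf: "abs_continuous_on {a..b} f"
    by (rule primitive_abs_continuous[OF f])
  have acg: "abs_continuous_on {a..b} g"
    by (rule primitive_abs_continuous[OF g])
  have "bounded (f ` {a..b} \<union> g ` {a..b})"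
    by (intro bounded_Un[THEN iffD2] conjI compact_imp_bounded compact_continuous_image
        continuous_on_subset[OF cf(1)] continuous_on_subset[OF cf(2)] compact_Icc subset_UNIV)
  then obtain M where M: "\<forall>z \<in> f ` {a..b} \<union> g ` {a..b}. norm z \<le> M" unfolding bounded_iff by blast
  have M0: "\<bar>f x\<bar> \<le> \<bar>M\<bar>" "\<bar>g x\<bar> \<le> \<bar>M\<bar>" if "a \<le> x" "x \<le> b" for x
  proof -
    have "norm (f x) \<le> M" "norm (g x) \<le> M" using M that by auto
    then show "\<bar>f x\<bar> \<le> \<bar>M\<bar>" "\<bar>g x\<bar> \<le> \<bar>M\<bar>" by auto
  qed
  show "abs_continuous_on {a..b} (\<lambda>x. f x * g x)"
  proof (rule abs_continuous_on_dominated[OF acf acg, of "\<bar>M\<bar>"])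
    fix p q assume pq: "a \<le> p" "p \<le> q" "q \<le> b"
    have "\<bar>f q * g q - f p * g p\<bar> = \<bar>(f q - f p) * g q + f p * (g q - g p)\<bar>" by (simp add: algebra_simps)
    also have "\<dots> \<le> \<bar>f q - f p\<bar> * \<bar>g q\<bar> + \<bar>f p\<bar> * \<bar>g q - g p\<bar>"
      by (metis abs_mult abs_triangle_ineq)
    also have "\<dots> \<le> \<bar>f q - f p\<bar> * \<bar>M\<bar> + \<bar>M\<bar> * \<bar>g q - g p\<bar>"
      using M0 pq by (intro add_mono mult_mono) auto
    finally show "\<bar>f q * g q - f p * g p\<bar> \<le> \<bar>M\<bar> * (\<bar>f q - f p\<bar> + \<bar>g q - g p\<bar>)" by (simp add: algebra_simps)
  qed simp
qed

lemma primitive_compose: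
  assumes f: "primitive f f'"
    and \<phi>: "\<And>x. (\<phi> has_real_derivative \<phi>' x) (at x)" "continuous_on UNIV \<phi>'"
  shows "primitive (\<lambda>x. \<phi> (f x)) (\<lambda>x. \<phi>' (f x) * f' x)"
proof (rule abs_continuous_primitive_derivative)
  have cf: "continuous_on UNIV f" using f by (rule primitive_continuous)
  have cp: "continuous_on UNIV (\<lambda>x. \<phi>' (f x))"
    by (rule continuous_on_compose2[OF \<phi>(2) cf]) simp
  note [measurable] = primitive_measurable[OF f] borel_measurable_continuous_onI[OF cp]
  show "(\<lambda>x. \<phi>' (f x) * f' x) \<in> borel_measurable borel" by measurable
  show "AE x in lborel. ((\<lambda>x. \<phi> (f x)) has_real_derivative \<phi>' (f x) * f' x) (at x)"
    using primitive_AE_derivative[OF f] by eventually_elim (rule DERIV_chain2[OF \<phi>(1)])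
  fix a b :: real
  have acf: "abs_continuous_on {a..b} f"
    by (rule primitive_abs_continuous[OF f])
  have "bounded (f ` {a..b})"
    by (intro compact_imp_bounded compact_continuous_image continuous_on_subset[OF cf] compact_Icc subset_UNIV)
  then obtain R where R: "\<forall>z \<in> f ` {a..b}. norm z \<le> R" unfolding bounded_iff by blast
  have "bounded (\<phi>' ` {-R..R})"
    by (intro compact_imp_bounded compact_continuous_image continuous_on_subset[OF \<phi>(2)] compact_Icc subset_UNIV)
  then obtain M where M: "\<forall>z \<in> \<phi>' ` {-R..R}. norm z \<le> M" unfolding bounded_iff by blast
  show "abs_continuous_on {a..b} (\<lambda>x. \<phi> (f x))"
  proof (rule abs_continuous_on_dominated[OF acf acf, of "\<bar>M\<bar>"])
    fix p q assume pq: "a \<le> p" "p \<le> q" "q \<le> b"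
    have "norm (f p) \<le> R" "norm (f q) \<le> R" using R pq by auto
    then have fpq: "f p \<in> {-R..R}" "f q \<in> {-R..R}" by auto
    have "norm (\<phi> (f q) - \<phi> (f p)) \<le> \<bar>M\<bar> * norm (f q - f p)"
    proof (rule field_differentiable_bound[of "{-R..R}"])
      show "(\<phi> has_field_derivative \<phi>' z) (at z within {-R..R})" for z
        using \<phi>(1) by (rule has_field_derivative_at_within)
      show "norm (\<phi>' z) \<le> \<bar>M\<bar>" if "z \<in> {-R..R}" for z
      proof -
        have "norm (\<phi>' z) \<le> M" using M that by blast
        then show ?thesis by linarith
      qed
    qed (use fpq in auto)
    also have "\<dots> \<le> \<bar>M\<bar> * (\<bar>f q - f p\<bar> + \<bar>f q - f p\<bar>)" by (intro mult_left_mono) auto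
    finally show "\<bar>\<phi> (f q) - \<phi> (f p)\<bar> \<le> \<bar>M\<bar> * (\<bar>f q - f p\<bar> + \<bar>f q - f p\<bar>)" by simp
  qed simp
qed

section \<open>Locally Lipschitz differential equations\<close>

text \<open>The signed integral from 0, on both half-lines because solutions are sought for all real
  times. It is Banach-valued since it serves the Picard iteration as well as real
  primitives.\<close>

definition antider :: "(real \<Rightarrow> 'a::banach) \<Rightarrow> real \<Rightarrow> 'a" where
  "antider f t = (if 0 \<le> t then integral {0..t} f else - integral {t..0} f)"

lemma antider_0 [simp]: "antider f 0 = 0"
  by (simp add: antider_def)

lemma antider_has_vector_derivative:
  fixes f :: "real \<Rightarrow> 'a::banach"
  assumes f: "continuous_on UNIV f"
  shows "(antider f has_vector_derivative f t) (at t)"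
proof -
  define N where "N = \<bar>t\<bar> + 1"
  have fi: "f integrable_on {a..b}" for a b
    using f by (intro integrable_continuous_interval continuous_on_subset[OF f]) auto
  have eq: "antider f s = integral {-N..s} f - integral {-N..0} f" if s: "s \<in> {-N..N}" for s
  proof (cases "0 \<le> s")
    case True
    have "integral {-N..0} f + integral {0..s} f = integral {-N..s} f"
      using True by (intro Henstock_Kurzweil_Integration.integral_combine fi) (auto simp: N_def)
    then show ?thesis using True by (simp add: antider_def algebra_simps)
  next
    case False
    have "integral {-N..s} f + integral {s..0} f = integral {-N..0} f"
      using s False by (intro Henstock_Kurzweil_Integration.integral_combine fi) (auto simp: N_def)
    then show ?thesis using False by (simp add: antider_def algebra_simps)
  qed
  have "((\<lambda>s. integral {-N..s} f) has_vector_derivative f t) (at t within {-N..N})"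
    by (intro integral_has_vector_derivative continuous_on_subset[OF f]) (auto simp: N_def)
  then have "((\<lambda>s. integral {-N..s} f - integral {-N..0} f) has_vector_derivative f t - 0) (at t within {-N..N})"
    by (intro has_vector_derivative_diff has_vector_derivative_const)
  then have "(antider f has_vector_derivative f t) (at t within {-N..N})"
    using eq by (subst has_vector_derivative_transform[of t]) (auto simp: N_def)
  then have "(antider f has_vector_derivative f t) (at t within {-N<..<N})"
    by (rule has_vector_derivative_within_subset) auto
  moreover have "t \<in> {-N<..<N}"
    by (auto simp: N_def)
  ultimately show ?thesis
    by (metis at_within_open open_greaterThanLessThan)
qed

text \<open>Integration reproduces the weight \<open>exp (c * \<bar>t\<bar>)\<close> with a gain of
  \<open>1 / c\<close>; this is what turns the Picard map into a contraction on the whole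
  line.\<close>

lemma norm_antider_exp_bound:
  fixes f :: "real \<Rightarrow> 'a::banach"
  assumes f: "continuous_on UNIV f" and c: "c > 0" and K: "K \<ge> 0"
    and b: "\<And>s. norm (f s) \<le> K * exp (c * \<bar>s\<bar>)"
  shows "norm (antider f t) \<le> K / c * exp (c * \<bar>t\<bar>)"
proof -
  have ca: "continuous_on S (antider f)" for S
    using antider_has_vector_derivative[OF f]
    by (meson continuous_at_imp_continuous_on has_vector_derivative_continuous)
  have e1: "((\<lambda>s. K / c * exp (c * s)) has_vector_derivative K * exp (c * s)) (at s)" for s
    unfolding has_real_derivative_iff_has_vector_derivative[symmetric]
    by (rule derivative_eq_intros refl | use c in simp)+
  have e2: "((\<lambda>s. - K / c * exp (- c * s)) has_vector_derivative K * exp (- c * s)) (at s)" for s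
    unfolding has_real_derivative_iff_has_vector_derivative[symmetric]
    by (rule derivative_eq_intros refl | use c in simp)+
  consider "t = 0" | "t > 0" | "t < 0" by linarith
  then show ?thesis
  proof cases
    case 1 then show ?thesis using c K by simp
  next
    case 2
    have "norm (antider f t - antider f 0) \<le> K / c * exp (c * t) - K / c * exp (c * 0)"
    proof (rule differentiable_bound_general[OF 2, where f' = f and \<phi>' = "\<lambda>s. K * exp (c * s)"])
      show "norm (f s) \<le> K * exp (c * s)" if "0 < s" for s using b[of s] that by simp
    qed (intro ca continuous_intros antider_has_vector_derivative f e1)+
    moreover have "K / c \<ge> 0" using K c by simp
    ultimately show ?thesis using 2 by simp
  next
    case 3
    have "norm (antider f 0 - antider f t) \<le> - K / c * exp (- c * 0) - - K / c * exp (- c * t)"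
    proof (rule differentiable_bound_general[OF 3, where f' = f and \<phi>' = "\<lambda>s. K * exp (- c * s)"])
      show "norm (f s) \<le> K * exp (- c * s)" if "s < 0" for s using b[of s] that by simp
    qed (intro ca continuous_intros antider_has_vector_derivative f e2)+
    moreover have "K / c \<ge> 0" using K c by simp
    ultimately show ?thesis using 3 by simp
  qed
qed

text \<open>Picard iteration in a weighted supremum norm. The bounded continuous function
  \<open>Z\<close> stands for \<open>exp (- c * \<bar>t\<bar>) *\<^sub>R (X t - x0)\<close>, and the
  choice of \<open>c\<close> makes the contraction constant \<open>\<bar>L\<bar> / c\<close> at most
  1/2.\<close>

lemma global_lipschitz_ode:
  fixes G :: "'a::banach \<Rightarrow> 'a"
  assumes L: "\<And>x y. norm (G x - G y) \<le> L * norm (x - y)"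
  shows "\<exists>X. X 0 = x0 \<and> (\<forall>t. (X has_vector_derivative G (X t)) (at t))"
proof -
  define c where "c = 2 * (\<bar>L\<bar> + 1)"
  have c: "c > 0" "\<bar>L\<bar> / c \<le> 1/2" by (auto simp: c_def)
  have L': "norm (G x - G y) \<le> \<bar>L\<bar> * norm (x - y)" for x y
    using L[of x y] by (meson abs_ge_self mult_right_mono norm_ge_zero order_trans)
  have contG: "continuous_on UNIV G"
  proof -
    have "(\<bar>L\<bar>)-lipschitz_on UNIV G" by (rule lipschitz_onI) (use L' in \<open>auto simp: dist_norm\<close>)
    then show ?thesis by (rule lipschitz_on_continuous_on)
  qed
  define g where "g Z s = G (x0 + exp (c * \<bar>s\<bar>) *\<^sub>R apply_bcontfun Z s)" for Z :: "real \<Rightarrow>\<^sub>C 'a" and s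
  have cg: "continuous_on UNIV (g Z)" for Z
    unfolding g_def
    by (intro continuous_on_compose2[OF contG] continuous_intros continuous_on_apply_bcontfun) auto
  have ca: "continuous_on UNIV (antider (g Z))" for Z
    using antider_has_vector_derivative[OF cg]
    by (meson continuous_at_imp_continuous_on has_vector_derivative_continuous)
  define T where "T Z t = exp (- c * \<bar>t\<bar>) *\<^sub>R antider (g Z) t" for Z t
  have bg: "norm (g Z s) \<le> (norm (G x0) + \<bar>L\<bar> * norm Z) * exp (c * \<bar>s\<bar>)" for Z s
  proof -
    have "norm (g Z s) \<le> norm (G x0) + norm (g Z s - G x0)"
      by (metis add.commute diff_add_cancel norm_triangle_ineq)
    also have "norm (g Z s - G x0) \<le> \<bar>L\<bar> * (exp (c * \<bar>s\<bar>) * norm (apply_bcontfun Z s))"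
      using L'[of "x0 + exp (c * \<bar>s\<bar>) *\<^sub>R apply_bcontfun Z s" x0] by (simp add: g_def)
    also have "\<dots> \<le> \<bar>L\<bar> * (exp (c * \<bar>s\<bar>) * norm Z)"
      by (intro mult_left_mono norm_bounded) auto
    also have "norm (G x0) \<le> norm (G x0) * exp (c * \<bar>s\<bar>)"
      using c by (simp add: mult_le_cancel_left1)
    finally show ?thesis by (simp add: algebra_simps)
  qed
  have Tb: "T Z \<in> bcontfun" for Z
  proof (rule bcontfun_normI)
    show "continuous_on UNIV (T Z)" unfolding T_def by (intro continuous_intros ca)
    show "norm (T Z t) \<le> (norm (G x0) + \<bar>L\<bar> * norm Z) / c" for t
      using norm_antider_exp_bound[OF cg c(1) _ bg, of Z t]
      by (simp add: T_def exp_minus field_simps)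
  qed
  have gd: "norm (T Z t - T Z' t) \<le> \<bar>L\<bar> / c * dist Z Z'" for Z Z' t
  proof -
    have eq: "antider (g Z) t - antider (g Z') t = antider (\<lambda>s. g Z s - g Z' s) t"
    proof -
      have i: "g Z integrable_on {a..b}" for Z a b
        by (intro integrable_continuous_interval continuous_on_subset[OF cg]) auto
      show ?thesis using i
        by (auto simp: antider_def Henstock_Kurzweil_Integration.integral_diff algebra_simps)
    qed
    have "norm (antider (\<lambda>s. g Z s - g Z' s) t) \<le> (\<bar>L\<bar> * dist Z Z') / c * exp (c * \<bar>t\<bar>)"
    proof (rule norm_antider_exp_bound)
      show "continuous_on UNIV (\<lambda>s. g Z s - g Z' s)" by (intro continuous_intros cg)
      fix s
      have "norm (g Z s - g Z' s) \<le> \<bar>L\<bar> * norm (exp (c * \<bar>s\<bar>) *\<^sub>R (apply_bcontfun Z s - apply_bcontfun Z' s))"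
        using L'[of "x0 + exp (c * \<bar>s\<bar>) *\<^sub>R apply_bcontfun Z s" "x0 + exp (c * \<bar>s\<bar>) *\<^sub>R apply_bcontfun Z' s"]
        unfolding g_def by (simp add: scaleR_diff_right)
      also have "\<dots> = \<bar>L\<bar> * (exp (c * \<bar>s\<bar>) * dist (apply_bcontfun Z s) (apply_bcontfun Z' s))"
        by (simp add: dist_norm)
      also have "\<dots> \<le> \<bar>L\<bar> * (exp (c * \<bar>s\<bar>) * dist Z Z')"
        by (intro mult_left_mono dist_bounded) auto
      finally show "norm (g Z s - g Z' s) \<le> \<bar>L\<bar> * dist Z Z' * exp (c * \<bar>s\<bar>)"
        by (simp add: algebra_simps)
    qed (use c in auto)
    then show ?thesis
      by (simp add: T_def eq scaleR_diff_right[symmetric] exp_minus field_simps)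
  qed
  have "\<exists>!Z. Bcontfun (T Z) = Z"
  proof (rule banach_fix_type[of "1/2"], safe)
    fix Z Z'
    show "dist (Bcontfun (T Z)) (Bcontfun (T Z')) \<le> 1/2 * dist Z Z'"
    proof (rule dist_bound)
      fix t
      have "dist (T Z t) (T Z' t) \<le> \<bar>L\<bar> / c * dist Z Z'" using gd by (simp add: dist_norm)
      also have "\<dots> \<le> 1/2 * dist Z Z'" using c by (intro mult_right_mono) auto
      finally show "dist (apply_bcontfun (Bcontfun (T Z)) t) (apply_bcontfun (Bcontfun (T Z')) t) \<le> 1/2 * dist Z Z'"
        by (simp add: Bcontfun_inverse Tb)
    qed
  qed auto
  then obtain Z where Z: "Bcontfun (T Z) = Z" by blast
  define X where "X t = x0 + antider (g Z) t" for t
  have "apply_bcontfun Z t = exp (- c * \<bar>t\<bar>) *\<^sub>R antider (g Z) t" for t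
    using Bcontfun_inverse[OF Tb, of Z] unfolding Z by (simp add: T_def)
  then have "g Z t = G (X t)" for t
    by (simp add: g_def X_def exp_add[symmetric])
  moreover have "(X has_vector_derivative g Z t) (at t)" for t
    unfolding X_def using antider_has_vector_derivative[OF cg, of Z t]
    by (auto intro!: derivative_eq_intros)
  ultimately show ?thesis
    by (intro exI[of _ X]) (auto simp: X_def)
qed

text \<open>Iterating the mean value inequality bounds the difference by the terms of the exponential series.\<close>
lemma linear_growth_zero:
  fixes D :: "real \<Rightarrow> 'a::real_normed_vector"
  assumes D: "\<And>t. t \<in> {0..T} \<Longrightarrow> (D has_vector_derivative D' t) (at t within {0..T})"
    and L: "\<And>t. t \<in> {0..T} \<Longrightarrow> norm (D' t) \<le> L * norm (D t)" and D0: "D 0 = 0" and t: "t \<in> {0..T}"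
  shows "D t = 0"
proof -
  have cD: "continuous_on {0..T} D"
    by (meson D continuous_on_eq_continuous_within has_vector_derivative_continuous)
  have "bounded (D ` {0..T})"
    by (intro compact_imp_bounded compact_continuous_image cD compact_Icc)
  then obtain C where C: "\<And>t. t \<in> {0..T} \<Longrightarrow> norm (D t) \<le> C"
    unfolding bounded_iff by blast
  have L': "norm (D' t) \<le> \<bar>L\<bar> * norm (D t)" if "t \<in> {0..T}" for t
    using L[OF that] by (meson abs_ge_self mult_right_mono norm_ge_zero order_trans)
  have "norm (D t) \<le> C * ((\<bar>L\<bar> * t) ^ n / fact n)" if "t \<in> {0..T}" for t n
    using that
  proof (induction n arbitrary: t)
    case 0 then show ?case using C by simp
  next
    case (Suc n)
    show ?case
    proof (cases "t = 0")
      case False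
      then have t: "0 < t" "t \<le> T" using Suc.prems by auto
      have "norm (D t - D 0) \<le> C * ((\<bar>L\<bar> * t) ^ Suc n / fact (Suc n)) - C * ((\<bar>L\<bar> * 0) ^ Suc n / fact (Suc n))"
      proof (rule differentiable_bound_general[OF t(1), where f' = D' and \<phi>' = "\<lambda>s. \<bar>L\<bar> * (C * ((\<bar>L\<bar> * s) ^ n / fact n))"])
        show "continuous_on {0..t} D" using t by (intro continuous_on_subset[OF cD]) auto
        show "(D has_vector_derivative D' s) (at s)" if "0 < s" "s < t" for s
        proof -
          have "(D has_vector_derivative D' s) (at s within {0<..<T})"
            using that t by (intro has_vector_derivative_within_subset[OF D]) auto
          then show ?thesis using that t
            by (metis at_within_open greaterThanLessThan_iff less_le_trans open_greaterThanLessThan)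
        qed
        show "norm (D' s) \<le> \<bar>L\<bar> * (C * ((\<bar>L\<bar> * s) ^ n / fact n))" if "0 < s" "s < t" for s
        proof -
          have s: "s \<in> {0..T}" using that t by auto
          show ?thesis using L'[OF s] mult_left_mono[OF Suc.IH[OF s], of "\<bar>L\<bar>"] by linarith
        qed
        show "((\<lambda>s. C * ((\<bar>L\<bar> * s) ^ Suc n / fact (Suc n))) has_vector_derivative \<bar>L\<bar> * (C * ((\<bar>L\<bar> * s) ^ n / fact n))) (at s)" for s
        proof -
          have "((\<lambda>s. C * ((\<bar>L\<bar> * s) ^ Suc n / fact (Suc n))) has_real_derivative
             C * (real (Suc n) * (\<bar>L\<bar> * s) ^ n * \<bar>L\<bar> / fact (Suc n))) (at s)"
            by (rule derivative_eq_intros refl | simp)+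
          moreover have "C * (real (Suc n) * (\<bar>L\<bar> * s) ^ n * \<bar>L\<bar> / fact (Suc n)) = \<bar>L\<bar> * (C * ((\<bar>L\<bar> * s) ^ n / fact n))"
            by (simp add: fact_Suc divide_simps del: of_nat_Suc)
          ultimately show ?thesis by (metis has_real_derivative_iff_has_vector_derivative)
        qed
      qed (intro continuous_intros, auto)
      then show ?thesis by (simp add: D0)
    qed (simp add: D0)
  qed
  then have "norm (D t) \<le> C * ((\<bar>L\<bar> * t) ^ n / fact n)" for n using t by blast
  moreover have "(\<lambda>n. C * ((\<bar>L\<bar> * t) ^ n / fact n)) \<longlonglongrightarrow> C * 0"
    using summable_LIMSEQ_zero[OF summable_exp[of "\<bar>L\<bar> * t"]]
    by (intro tendsto_mult tendsto_const) (simp add: field_simps)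
  ultimately have "norm (D t) \<le> 0"
    by (intro LIMSEQ_le_const[of "\<lambda>n. C * ((\<bar>L\<bar> * t) ^ n / fact n)"]) auto
  then show ?thesis by simp
qed

lemma linear_growth_zero_symmetric:
  fixes D :: "real \<Rightarrow> 'a::real_normed_vector"
  assumes D: "\<And>t. t \<in> {-T..T} \<Longrightarrow> (D has_vector_derivative D' t) (at t within {-T..T})"
    and L: "\<And>t. t \<in> {-T..T} \<Longrightarrow> norm (D' t) \<le> L * norm (D t)" and D0: "D 0 = 0" and t: "t \<in> {-T..T}"
  shows "D t = 0"
proof (cases "0 \<le> t")
  case True
  show ?thesis
    by (rule linear_growth_zero[of T D D' L]) (use True t L D0 in \<open>auto intro!: has_vector_derivative_within_subset[OF D]\<close>)
next
  case False
  have "((\<lambda>s. D (- s)) has_vector_derivative - D' (- s)) (at s within {0..T})" if "s \<in> {0..T}" for s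
  proof -
    have "((D \<circ> uminus) has_vector_derivative (-1) *\<^sub>R D' (- s)) (at s within {0..T})"
    proof (rule vector_diff_chain_within)
      show "(uminus has_vector_derivative - 1) (at s within {0..T})"
        by (auto intro!: derivative_eq_intros)
      show "(D has_vector_derivative D' (- s)) (at (- s) within uminus ` {0..T})"
        by (rule has_vector_derivative_within_subset[OF D]) (use that in auto)
    qed
    then show ?thesis by (simp add: o_def)
  qed
  then have "D (- (- t)) = 0"
    by (rule linear_growth_zero[of T "\<lambda>s. D (- s)" "\<lambda>s. - D' (- s)" L]) (use False t L D0 in auto)
  then show ?thesis by simp
qed

text \<open>Lipschitz on every ball around the origin. In infinite dimension this is stronger than
  Lipschitz near each point, and it yields boundedness on balls.\<close>

definition loclip :: "('a::real_normed_vector \<Rightarrow> 'b::real_normed_vector) \<Rightarrow> bool" where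
  "loclip F \<longleftrightarrow> (\<forall>R. \<exists>L. \<forall>x y. norm x \<le> R \<longrightarrow> norm y \<le> R \<longrightarrow> norm (F x - F y) \<le> L * norm (x - y))"

lemma loclipE:
  assumes "loclip F"
  obtains L where "L \<ge> 0" "\<And>x y. norm x \<le> R \<Longrightarrow> norm y \<le> R \<Longrightarrow> norm (F x - F y) \<le> L * norm (x - y)"
proof -
  obtain L where L: "\<And>x y. norm x \<le> R \<Longrightarrow> norm y \<le> R \<Longrightarrow> norm (F x - F y) \<le> L * norm (x - y)"
    using assms unfolding loclip_def by blast
  have "norm (F x - F y) \<le> \<bar>L\<bar> * norm (x - y)" if "norm x \<le> R" "norm y \<le> R" for x y
    using L[OF that] by (meson abs_ge_self mult_right_mono norm_ge_zero order_trans)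
  then show ?thesis using that[of "\<bar>L\<bar>"] by auto
qed

lemma loclip_bounded:
  assumes "loclip F"
  obtains M where "M \<ge> 0" "\<And>x. norm x \<le> R \<Longrightarrow> norm (F x) \<le> M"
proof -
  obtain L where L: "L \<ge> 0" "\<And>x y. norm x \<le> \<bar>R\<bar> \<Longrightarrow> norm y \<le> \<bar>R\<bar> \<Longrightarrow> norm (F x - F y) \<le> L * norm (x - y)"
    using loclipE[OF assms] by blast
  have "norm (F x) \<le> norm (F 0) + L * \<bar>R\<bar>" if "norm x \<le> R" for x
  proof -
    have x: "norm x \<le> \<bar>R\<bar>" using that by linarith
    have "norm (F x) \<le> norm (F 0) + norm (F x - F 0)"
      by (metis add.commute diff_add_cancel norm_triangle_ineq)
    also have "norm (F x - F 0) \<le> L * norm x" using L(2)[OF x, of 0] by simp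
    also have "\<dots> \<le> L * \<bar>R\<bar>" using x L by (intro mult_left_mono) auto
    finally show ?thesis by simp
  qed
  then show ?thesis using that[of "norm (F 0) + L * \<bar>R\<bar>"] L by auto
qed

text \<open>\<open>F\<close> is multiplied by a 1-Lipschitz function equal to 1 on the ball of
  radius \<open>R\<close> and 0 beyond \<open>R + 1\<close>. If one of two points lies outside the
  larger ball, only the cutoff varies and the bound of \<open>F\<close> suffices.\<close>

lemma loclip_cutoff:
  fixes F :: "'a::banach \<Rightarrow> 'b::banach"
  assumes F: "loclip F"
  obtains G L where "\<And>x y. norm (G x - G y) \<le> L * norm (x - y)" "\<And>x. norm x \<le> R \<Longrightarrow> G x = F x"
proof -
  define \<phi> where "\<phi> x = max 0 (min 1 (R + 1 - norm x))" for x :: 'a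
  obtain L where L: "L \<ge> 0" "\<And>x y. norm x \<le> R + 1 \<Longrightarrow> norm y \<le> R + 1 \<Longrightarrow> norm (F x - F y) \<le> L * norm (x - y)"
    using loclipE[OF F] by blast
  obtain M where M: "M \<ge> 0" "\<And>x. norm x \<le> R + 1 \<Longrightarrow> norm (F x) \<le> M"
    using loclip_bounded[OF F] by blast
  have phi: "\<bar>\<phi> x - \<phi> y\<bar> \<le> norm (x - y)" for x y
    using norm_triangle_ineq3[of x y] by (auto simp: \<phi>_def)
  have p01: "0 \<le> \<phi> x" "\<phi> x \<le> 1" for x by (auto simp: \<phi>_def)
  define G where "G x = \<phi> x *\<^sub>R F x" for x
  have G0: "\<phi> x = 0" if "norm x > R + 1" for x using that by (auto simp: \<phi>_def)
  have out: "norm (G x - G y) \<le> (L + M) * norm (x - y)" if y: "norm y > R + 1" for x y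
  proof (cases "norm x \<le> R + 1")
    case True
    have "norm (G x - G y) = \<bar>\<phi> x - \<phi> y\<bar> * norm (F x)" using G0[OF y] by (simp add: G_def)
    also have "\<dots> \<le> norm (x - y) * M" using phi M True by (intro mult_mono) auto
    also have "\<dots> \<le> (L + M) * norm (x - y)" using L by (simp add: algebra_simps)
    finally show ?thesis .
  next
    case False
    then show ?thesis using G0[OF y] G0[of x] L M by (simp add: G_def)
  qed
  have "norm (G x - G y) \<le> (L + M) * norm (x - y)" for x y
  proof (cases "norm x \<le> R + 1 \<and> norm y \<le> R + 1")
    case True
    have "norm (G x - G y) = norm (\<phi> x *\<^sub>R (F x - F y) + (\<phi> x - \<phi> y) *\<^sub>R F y)"
      by (simp add: G_def algebra_simps)
    also have "\<dots> \<le> \<bar>\<phi> x\<bar> * norm (F x - F y) + \<bar>\<phi> x - \<phi> y\<bar> * norm (F y)"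
      by (rule norm_triangle_le) simp
    also have "\<dots> \<le> 1 * (L * norm (x - y)) + norm (x - y) * M"
      using True L M phi p01 by (intro add_mono mult_mono) auto
    finally show ?thesis by (simp add: algebra_simps)
  next
    case False
    then show ?thesis using out[of x y] out[of y x] by (auto simp: norm_minus_commute)
  qed
  moreover have "G x = F x" if "norm x \<le> R" for x using that by (auto simp: G_def \<phi>_def)
  ultimately show ?thesis using that by blast
qed

definition solves_on :: "('a::real_normed_vector \<Rightarrow> 'a) \<Rightarrow> real \<Rightarrow> (real \<Rightarrow> 'a) \<Rightarrow> bool" where
  "solves_on F T X \<longleftrightarrow> (\<forall>t\<in>{-T..T}. (X has_vector_derivative F (X t)) (at t within {-T..T}))"

lemma solves_on_unique:
  assumes F: "loclip F" and X: "solves_on F T X" and Y: "solves_on F T Y" and "X 0 = Y 0"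
    and t: "t \<in> {-T..T}"
  shows "X t = Y t"
proof -
  have c: "continuous_on {-T..T} X" "continuous_on {-T..T} Y"
    using X Y unfolding solves_on_def
    by (meson continuous_on_eq_continuous_within has_vector_derivative_continuous)+
  have "bounded (X ` {-T..T} \<union> Y ` {-T..T})"
    by (intro bounded_Un[THEN iffD2] conjI compact_imp_bounded compact_continuous_image c compact_Icc)
  then obtain R where R: "\<And>t. t \<in> {-T..T} \<Longrightarrow> norm (X t) \<le> R" "\<And>t. t \<in> {-T..T} \<Longrightarrow> norm (Y t) \<le> R"
    unfolding bounded_iff by blast
  obtain L where L: "\<And>x y. norm x \<le> R \<Longrightarrow> norm y \<le> R \<Longrightarrow> norm (F x - F y) \<le> L * norm (x - y)"
    using loclipE[OF F] by blast
  have "X t - Y t = 0"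
    by (rule linear_growth_zero_symmetric[of T "\<lambda>t. X t - Y t" "\<lambda>t. F (X t) - F (Y t)" L])
      (use X Y R L t \<open>X 0 = Y 0\<close> in \<open>auto simp: solves_on_def intro!: has_vector_derivative_diff\<close>)
  then show ?thesis by simp
qed

lemma solves_on_subset: "solves_on F T X \<Longrightarrow> S \<le> T \<Longrightarrow> solves_on F S X"
  unfolding solves_on_def
  by (intro ballI, rule has_vector_derivative_within_subset[where S = "{-T..T}"]) auto

lemma solves_on_cong: "solves_on F T X \<Longrightarrow> (\<And>t. t \<in> {-T..T} \<Longrightarrow> Y t = X t) \<Longrightarrow> solves_on F T Y"
  unfolding solves_on_def by (intro ballI, subst has_vector_derivative_transform[where f = X]) auto

text \<open>A continuity argument. The cutoff equation has a global solution \<open>X\<close>, which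
  solves the original equation as long as its norm stays below the bound plus 1. The a priori
  estimate then restores the bound without the 1, so the set of good times cannot end before
  \<open>T\<close>.\<close>

lemma bounded_solution_exists:
  fixes F :: "'a::banach \<Rightarrow> 'a"
  assumes F: "loclip F" and "T > 0"
    and apriori: "\<And>S X. 0 < S \<Longrightarrow> S \<le> T \<Longrightarrow> solves_on F S X \<Longrightarrow> X 0 = x0 \<Longrightarrow> (\<forall>t\<in>{-S..S}. norm (X t) \<le> M)"
  shows "\<exists>X. X 0 = x0 \<and> solves_on F T X"
proof -
  obtain G L where G: "\<And>x y. norm (G x - G y) \<le> L * norm (x - y)" "\<And>x. norm x \<le> max M (norm x0) + 1 \<Longrightarrow> G x = F x"
    using loclip_cutoff[OF F, of "max M (norm x0) + 1"] by metis
  obtain X where X: "X 0 = x0" "\<And>t. (X has_vector_derivative G (X t)) (at t)"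
    using global_lipschitz_ode[OF G(1)] by blast
  have contX: "continuous_on UNIV X"
    using X(2) by (meson continuous_at_imp_continuous_on has_vector_derivative_continuous)
  have sol: "solves_on F S X" if "\<forall>t\<in>{-S..S}. norm (X t) \<le> max M (norm x0) + 1" for S
    unfolding solves_on_def
  proof
    fix t assume "t \<in> {-S..S}"
    then have "G (X t) = F (X t)" using that G(2) by blast
    then show "(X has_vector_derivative F (X t)) (at t within {-S..S})"
      using X(2)[of t] has_vector_derivative_at_within by simp
  qed
  \<comment> \<open>The maximum with \<open>norm x0\<close> guarantees that 0 belongs to
    \<open>B\<close>.\<close>
  define B where "B = {S. 0 \<le> S \<and> S \<le> T \<and> (\<forall>t\<in>{-S..S}. norm (X t) \<le> max M (norm x0))}"
  have "0 \<in> B" using X(1) \<open>T > 0\<close> by (auto simp: B_def)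
  have bdd: "bdd_above B" by (auto simp: B_def bdd_above_def)
  define s where "s = Sup B"
  have s: "0 \<le> s" "s \<le> T"
  proof -
    show "0 \<le> s" unfolding s_def by (rule cSup_upper[OF \<open>0 \<in> B\<close> bdd])
    show "s \<le> T" unfolding s_def
      by (rule cSup_least) (use \<open>0 \<in> B\<close> in blast, simp add: B_def)
  qed
  have below: "norm (X t) \<le> max M (norm x0)" if "\<bar>t\<bar> < s" for t
  proof -
    have "B \<noteq> {}" using \<open>0 \<in> B\<close> by blast
    from less_cSupD[OF this that[unfolded s_def]] obtain S where "S \<in> B" "\<bar>t\<bar> < S" ..
    then have "t \<in> {-S..S}" by auto
    moreover have "\<forall>t\<in>{-S..S}. norm (X t) \<le> max M (norm x0)" using \<open>S \<in> B\<close> by (simp add: B_def)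
    ultimately show ?thesis by blast
  qed
  have at: "norm (X t) \<le> max M (norm x0)" if "\<bar>t\<bar> \<le> s" for t
  proof (cases "s = 0")
    case True then show ?thesis using that X(1) by simp
  next
    case False
    have "closure {-s<..<s} = {-s..s}" using False s by (intro closure_greaterThanLessThan) auto
    then have "t \<in> closure {-s<..<s}" using that by auto
    moreover have "(\<lambda>t. norm (X t)) ` closure {-s<..<s} \<subseteq> {..max M (norm x0)}"
      by (rule image_closure_subset) (use below in \<open>auto intro!: continuous_intros continuous_on_subset[OF contX]\<close>)
    ultimately show ?thesis by auto
  qed
  \<comment> \<open>The margin 1 is spent here: by compactness the strict bound on
    \<open>{-s..s}\<close> persists on a uniformly larger interval.\<close>
  have "\<exists>d>0. \<forall>t. \<bar>t\<bar> < s + d \<longrightarrow> norm (X t) \<le> max M (norm x0) + 1"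
  proof -
    let ?U = "{t. norm (X t) < max M (norm x0) + 1}"
    have "open ?U" using contX by (intro open_Collect_less continuous_intros) auto
    moreover have "{-s..s} \<subseteq> ?U"
    proof
      fix t assume "t \<in> {-s..s}"
      then have "norm (X t) \<le> max M (norm x0)" by (intro at) auto
      then show "t \<in> ?U" by simp
    qed
    ultimately obtain d where d: "d > 0" "(\<Union>x\<in>{-s..s}. ball x d) \<subseteq> ?U"
      using compact_subset_open_imp_ball_epsilon_subset[OF compact_Icc, of ?U "-s" s] by blast
    have "norm (X t) \<le> max M (norm x0) + 1" if "\<bar>t\<bar> < s + d" for t
    proof -
      have "max (-s) (min s t) \<in> {-s..s}" "t \<in> ball (max (-s) (min s t)) d"
        using that s d(1) by (auto simp: dist_real_def max_def min_def)
      then have "t \<in> ?U" using d(2) by blast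
      then show ?thesis by simp
    qed
    then show ?thesis using d(1) by blast
  qed
  then obtain d where d: "d > 0" "\<And>t. \<bar>t\<bar> < s + d \<Longrightarrow> norm (X t) \<le> max M (norm x0) + 1" by blast
  define S where "S = min T (s + d / 2)"
  have S: "0 < S" "S \<le> T" "S < s + d" using s d \<open>T > 0\<close> by (auto simp: S_def)
  have "solves_on F S X" using S(3) d(2) by (intro sol) auto
  then have "\<forall>t\<in>{-S..S}. norm (X t) \<le> M" using apriori S X(1) by blast
  then have "S \<in> B" using S by (auto simp: B_def le_max_iff_disj)
  then have "S \<le> s" unfolding s_def using bdd by (rule cSup_upper)
  then have "S = T" using d(1) by (auto simp: S_def min_def split: if_splits)
  with \<open>solves_on F S X\<close> X(1) show ?thesis by blast
qed

theorem global_solution_exists: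
  fixes F :: "'a::banach \<Rightarrow> 'a"
  assumes F: "loclip F"
    and apriori: "\<And>T. T > 0 \<Longrightarrow> \<exists>M. \<forall>S X. 0 < S \<longrightarrow> S \<le> T \<longrightarrow> solves_on F S X \<longrightarrow> X 0 = x0 \<longrightarrow> (\<forall>t\<in>{-S..S}. norm (X t) \<le> M)"
  shows "\<exists>X. X 0 = x0 \<and> (\<forall>t. (X has_vector_derivative F (X t)) (at t))"
proof -
  have "\<exists>X. X 0 = x0 \<and> solves_on F (real (Suc n)) X" for n
  proof -
    obtain M where M: "\<And>S X. 0 < S \<Longrightarrow> S \<le> real (Suc n) \<Longrightarrow> solves_on F S X \<Longrightarrow> X 0 = x0 \<Longrightarrow> (\<forall>t\<in>{-S..S}. norm (X t) \<le> M)"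
      using apriori[of "real (Suc n)"] by (metis of_nat_0_less_iff zero_less_Suc)
    show ?thesis by (rule bounded_solution_exists[OF F _ M]) auto
  qed
  then obtain Y where Y: "\<And>n. Y n 0 = x0" "\<And>n. solves_on F (real (Suc n)) (Y n)" by metis
  have eq: "Y m t = Y n t" if "m \<le> n" "\<bar>t\<bar> \<le> real (Suc m)" for m n t
    by (rule solves_on_unique[OF F Y(2) solves_on_subset[OF Y(2)[of n]]]) (use that Y(1) in auto)
  \<comment> \<open>The piece with index \<open>n\<close> lives on the half-length
    \<open>Suc n\<close>, so \<open>t\<close> is interior to the interval of the piece that is
    used.\<close>
  define X where "X t = Y (nat \<lceil>\<bar>t\<bar>\<rceil>) t" for t
  have X: "X t = Y n t" if "\<bar>t\<bar> \<le> real (Suc n)" for t n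
  proof -
    have "\<bar>t\<bar> \<le> real (Suc (nat \<lceil>\<bar>t\<bar>\<rceil>))" by linarith
    then show ?thesis unfolding X_def using that eq by (metis nle_le)
  qed
  have "(X has_vector_derivative F (X t)) (at t)" for t
  proof -
    define n where "n = nat \<lceil>\<bar>t\<bar>\<rceil>"
    have t: "\<bar>t\<bar> < real (Suc n)" unfolding n_def by linarith
    have "solves_on F (real (Suc n)) X"
      by (rule solves_on_cong[OF Y(2)]) (use X in auto)
    then have "(X has_vector_derivative F (X t)) (at t within {- real (Suc n)..real (Suc n)})"
      using t unfolding solves_on_def by (metis abs_le_iff atLeastAtMost_iff less_eq_real_def minus_le_iff)
    then have "(X has_vector_derivative F (X t)) (at t within {- real (Suc n)<..<real (Suc n)})"
      by (rule has_vector_derivative_within_subset) auto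
    then show ?thesis using t
      by (metis abs_less_iff at_within_open greaterThanLessThan_iff minus_less_iff open_greaterThanLessThan)
  qed
  moreover have "X 0 = x0" using X[of 0 0] Y(1) by simp
  ultimately show ?thesis by blast
qed

section \<open>The Lagrangian vector field\<close>

lemma antider_primitive_locally_integrable:
  assumes m: "w \<in> borel_measurable borel" and si: "\<And>a b. set_integrable lborel {a..b} w"
  shows "primitive (antider w) w"
  unfolding primitive_def
proof (intro conjI allI impI m si)
  fix a b :: real assume ab: "a \<le> b"
  have i: "w integrable_on {a..b}" for a b using set_borel_integral_eq_integral(1)[OF si] .
  have c: "integral {x..y} w + integral {y..z} w = integral {x..z} w" if "x \<le> y" "y \<le> z" for x y z
    using that i by (rule Henstock_Kurzweil_Integration.integral_combine)
  have "(LINT x:{a..b}|lborel. w x) = integral {a..b} w"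
    by (rule set_borel_integral_eq_integral(2)[OF si])
  also have "\<dots> = antider w b - antider w a"
    using c[of 0 a b] c[of a 0 b] c[of a b 0] ab by (auto simp: antider_def)
  finally show "(LINT x:{a..b}|lborel. w x) = antider w b - antider w a" .
qed

lemma antider_primitive:
  assumes "w \<in> borel_measurable borel" "\<And>x. \<bar>w x\<bar> \<le> C"
  shows "primitive (antider w) w"
  by (rule antider_primitive_locally_integrable[OF assms(1) bounded_measurable_set_integrable[OF assms]])

text \<open>Honest functions under the genuine supremum instead of classes modulo null sets:
  evaluation at a label is then a bounded linear functional, and the evolution equation can be read
  at every single label.\<close>

typedef pbm = "{f :: real \<Rightarrow> real. f \<in> borel_measurable borel \<and> (\<forall>x. f (x + 1) = f x) \<and> bounded (range f)}"
  morphisms ev Pbm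
  by (rule exI[of _ "\<lambda>_. 0"]) auto

setup_lifting type_definition_pbm

lemma ev_measurable [measurable]: "ev f \<in> borel_measurable borel"
  and ev_periodic: "ev f (x + 1) = ev f x"
  and ev_bounded: "bounded (range (ev f))"
  using ev[of f] by auto

lemma pbm_eqI: "(\<And>x. ev f x = ev g x) \<Longrightarrow> f = g"
  by (metis ev_inject ext)

instantiation pbm :: comm_ring
begin

lift_definition zero_pbm :: pbm is "\<lambda>_. 0" by auto

lift_definition plus_pbm :: "pbm \<Rightarrow> pbm \<Rightarrow> pbm" is "\<lambda>f g x. f x + g x"
  by (auto intro: bounded_plus_comp)

lift_definition minus_pbm :: "pbm \<Rightarrow> pbm \<Rightarrow> pbm" is "\<lambda>f g x. f x - g x"
  by (auto intro: bounded_minus_comp)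

lift_definition uminus_pbm :: "pbm \<Rightarrow> pbm" is "\<lambda>f x. - f x"
  by (auto simp: bounded_iff)

lift_definition times_pbm :: "pbm \<Rightarrow> pbm \<Rightarrow> pbm" is "\<lambda>f g x. f x * g x"
proof (safe, goal_cases)
  case (3 f g)
  then obtain B C where B: "\<And>x. \<bar>f x\<bar> \<le> B" "\<And>x. \<bar>g x\<bar> \<le> C" by (auto simp: bounded_iff)
  have "\<bar>f x * g x\<bar> \<le> B * C" for x
    unfolding abs_mult using B[of x] by (intro mult_mono) (auto intro: order_trans[OF abs_ge_zero])
  then show ?case by (auto simp: bounded_iff)
qed auto

instance
  by standard (transfer, auto simp: algebra_simps fun_eq_iff)+

end

lemma ev_simps [simp]:
  "ev 0 x = 0" "ev (f + g) x = ev f x + ev g x" "ev (f - g) x = ev f x - ev g x"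
  "ev (- f) x = - ev f x" "ev (f * g) x = ev f x * ev g x"
  by (transfer, simp)+

instantiation pbm :: real_normed_vector
begin

lift_definition scaleR_pbm :: "real \<Rightarrow> pbm \<Rightarrow> pbm" is "\<lambda>c f x. c * f x"
proof (safe, goal_cases)
  case (3 c f)
  then show ?case using bounded_scaling[of "range f" c] by (simp add: image_image)
qed auto

definition norm_pbm :: "pbm \<Rightarrow> real" where "norm_pbm f = (SUP x. \<bar>ev f x\<bar>)"
definition dist_pbm :: "pbm \<Rightarrow> pbm \<Rightarrow> real" where "dist_pbm f g = norm (f - g)"
definition sgn_pbm :: "pbm \<Rightarrow> pbm" where "sgn_pbm f = inverse (norm f) *\<^sub>R f"
definition uniformity_pbm :: "(pbm \<times> pbm) filter" where
  "uniformity_pbm = (INF e\<in>{0 <..}. principal {(x, y). dist x y < e})"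
definition open_pbm :: "pbm set \<Rightarrow> bool" where
  "open_pbm U = (\<forall>x\<in>U. eventually (\<lambda>(x', y). x' = x \<longrightarrow> y \<in> U) uniformity)"

lemma ev_le_norm: "\<bar>ev f x\<bar> \<le> norm f"
proof -
  have "bdd_above (range (\<lambda>x. \<bar>ev f x\<bar>))"
    using ev_bounded[of f] by (auto simp: bounded_iff bdd_above_def)
  then show ?thesis unfolding norm_pbm_def by (rule cSUP_upper2[OF _ UNIV_I order_refl])
qed

lemma norm_pbm_le: "(\<And>x. \<bar>ev f x\<bar> \<le> B) \<Longrightarrow> norm f \<le> B"
  unfolding norm_pbm_def by (rule cSUP_least) auto

instance
proof
  fix f g :: pbm and c d :: real
  have sc: "ev (c *\<^sub>R f) x = c * ev f x" for c f x by transfer simp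
  show "c *\<^sub>R (f + g) = c *\<^sub>R f + c *\<^sub>R g" "(c + d) *\<^sub>R f = c *\<^sub>R f + d *\<^sub>R f"
    "c *\<^sub>R d *\<^sub>R f = (c * d) *\<^sub>R f" "1 *\<^sub>R f = f"
    by (rule pbm_eqI; simp add: sc algebra_simps)+
  show "dist f g = norm (f - g)" "sgn f = inverse (norm f) *\<^sub>R f" by (auto simp: dist_pbm_def sgn_pbm_def)
  show "(norm f = 0) = (f = 0)"
  proof
    assume "norm f = 0"
    then have "ev f x = 0" for x using ev_le_norm[of f x] by simp
    then show "f = 0" by (intro pbm_eqI) simp
  next
    assume "f = 0"
    then have "norm f \<le> 0" by (intro norm_pbm_le) simp
    moreover have "0 \<le> norm f" using ev_le_norm[of f 0] by linarith
    ultimately show "norm f = 0" by simp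
  qed
  show "norm (f + g) \<le> norm f + norm g"
  proof (rule norm_pbm_le)
    show "\<bar>ev (f + g) x\<bar> \<le> norm f + norm g" for x
      using ev_le_norm[of f x] ev_le_norm[of g x] by simp
  qed
  have le: "norm (c *\<^sub>R f) \<le> \<bar>c\<bar> * norm f"
    for c :: real and f :: pbm
    by (rule norm_pbm_le) (simp add: sc abs_mult mult_left_mono ev_le_norm)
  show "norm (c *\<^sub>R f) = \<bar>c\<bar> * norm f"
  proof (cases "c = 0")
    case True
    have "0 \<le> norm (c *\<^sub>R f)" using ev_le_norm[of "c *\<^sub>R f" 0] by linarith
    with le[of c f] True show ?thesis by simp
  next
    case False
    have "f = inverse c *\<^sub>R (c *\<^sub>R f)" by (rule pbm_eqI) (use False in \<open>simp add: sc\<close>)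
    then have "norm f \<le> \<bar>inverse c\<bar> * norm (c *\<^sub>R f)" using le[of "inverse c" "c *\<^sub>R f"] by simp
    then have "\<bar>c\<bar> * norm f \<le> norm (c *\<^sub>R f)" using False by (simp add: field_simps)
    with le[of c f] show ?thesis by simp
  qed
qed (simp_all add: uniformity_pbm_def open_pbm_def)

end

lemma ev_scaleR [simp]: "ev (c *\<^sub>R f) x = c * ev f x"
  by (simp add: scaleR_pbm.rep_eq)

instance pbm :: real_normed_algebra
proof
  fix f g :: pbm and c :: real
  show "c *\<^sub>R f * g = c *\<^sub>R (f * g)" "f * c *\<^sub>R g = c *\<^sub>R (f * g)"
    by (rule pbm_eqI; simp add: algebra_simps)+
  show "norm (f * g) \<le> norm f * norm g"
    by (rule norm_pbm_le) (auto simp: abs_mult intro!: mult_mono ev_le_norm)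
qed

lemma Pbm_ev: "f \<in> borel_measurable borel \<Longrightarrow> (\<And>x. f (x + 1) = f x) \<Longrightarrow> (\<And>x. \<bar>f x\<bar> \<le> B) \<Longrightarrow> ev (Pbm f) = f"
  by (rule Pbm_inverse) (auto simp: bounded_iff)

lemma bounded_linear_ev: "bounded_linear (\<lambda>f. ev f x)"
  by (rule bounded_linear_intro[of _ 1]) (auto simp: ev_le_norm)

instance pbm :: banach
proof
  fix X :: "nat \<Rightarrow> pbm" assume X: "Cauchy X"
  have "Cauchy (\<lambda>n. ev (X n) x)" for x
    using bounded_linear.Cauchy[OF bounded_linear_ev X] .
  then have conv: "(\<lambda>n. ev (X n) x) \<longlonglongrightarrow> lim (\<lambda>n. ev (X n) x)" for x
    by (simp add: Cauchy_convergent_iff convergent_LIMSEQ_iff)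
  define L where "L x = lim (\<lambda>n. ev (X n) x)" for x
  have lim: "(\<lambda>n. ev (X n) x) \<longlonglongrightarrow> L x" for x using conv by (simp add: L_def)
  have unif: "\<exists>N. \<forall>n\<ge>N. \<forall>x. \<bar>ev (X n) x - L x\<bar> \<le> e" if "e > 0" for e
  proof -
    obtain N where N: "\<And>m n. m \<ge> N \<Longrightarrow> n \<ge> N \<Longrightarrow> norm (X m - X n) < e"
      using X \<open>e > 0\<close> unfolding Cauchy_iff by blast
    have "\<bar>ev (X n) x - L x\<bar> \<le> e" if "n \<ge> N" for n x
    proof (rule LIMSEQ_le_const2)
      show "(\<lambda>m. \<bar>ev (X n) x - ev (X m) x\<bar>) \<longlonglongrightarrow> \<bar>ev (X n) x - L x\<bar>"
        by (intro tendsto_intros lim)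
      show "\<exists>M. \<forall>m\<ge>M. \<bar>ev (X n) x - ev (X m) x\<bar> \<le> e"
      proof (intro exI[of _ N] allI impI)
        fix m assume "m \<ge> N"
        then show "\<bar>ev (X n) x - ev (X m) x\<bar> \<le> e"
          using ev_le_norm[of "X n - X m" x] N[of n m] that by simp
      qed
    qed
    then show ?thesis by blast
  qed
  have "L \<in> borel_measurable borel"
    by (rule borel_measurable_LIMSEQ_metric[OF _ lim]) simp
  moreover have "L (x + 1) = L x" for x unfolding L_def by (simp add: ev_periodic)
  moreover obtain N where N: "\<forall>n\<ge>N. \<forall>x. \<bar>ev (X n) x - L x\<bar> \<le> 1" using unif[of 1] by auto
  have "\<bar>L x\<bar> \<le> norm (X N) + 1" for x
    using N[rule_format, of N x] ev_le_norm[of "X N" x] by linarith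
  ultimately have L: "ev (Pbm L) = L" by (rule Pbm_ev)
  have "X \<longlonglongrightarrow> Pbm L"
  proof (rule LIMSEQ_I)
    fix r :: real assume "r > 0"
    then obtain N where N: "\<forall>n\<ge>N. \<forall>x. \<bar>ev (X n) x - L x\<bar> \<le> r / 2" using unif[of "r / 2"] by auto
    have "norm (X n - Pbm L) < r" if "n \<ge> N" for n
    proof -
      have "norm (X n - Pbm L) \<le> r / 2" by (rule norm_pbm_le) (use N that L in auto)
      then show ?thesis using \<open>r > 0\<close> by linarith
    qed
    then show "\<exists>no. \<forall>n\<ge>no. norm (X n - Pbm L) < r" by blast
  qed
  then show "convergent X" by (auto simp: convergent_def)
qed

lift_definition cst :: "real \<Rightarrow> pbm" is "\<lambda>c _. c" by auto
lemma ev_cst [simp]: "ev (cst c) x = c" by transfer simp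

lemma frac_measurable [measurable]: "(frac :: real \<Rightarrow> real) \<in> borel_measurable borel"
  unfolding frac_def by measurable

lemma ev_primitive: "primitive (antider (ev w)) (ev w)"
  by (rule antider_primitive[OF _ ev_le_norm]) simp

lemma antider_ev_measurable [measurable]: "antider (ev w) \<in> borel_measurable borel"
  by (intro borel_measurable_continuous_onI primitive_continuous[OF ev_primitive])

lemma antider_ev_le: "\<bar>antider (ev w) x\<bar> \<le> norm w * \<bar>x\<bar>"
  using primitive_lipschitz[OF ev_primitive ev_le_norm, of w x 0] by simp

text \<open>The primitive is restarted in each period, since the primitive itself is periodic only
  for mean zero. Thus the operator maps the space to itself for every argument.\<close>

lift_definition cumul :: "pbm \<Rightarrow> pbm" is "\<lambda>w x. antider w (frac x)"
proof (intro conjI allI)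
  fix f :: "real \<Rightarrow> real" and x
  assume "f \<in> borel_measurable borel \<and> (\<forall>x. f (x + 1) = f x) \<and> bounded (range f)"
  then have f: "ev (Pbm f) = f" by (intro Pbm_inverse) simp
  show "(\<lambda>x. antider f (frac x)) \<in> borel_measurable borel"
  proof -
    have "(\<lambda>x. antider (ev (Pbm f)) (frac x)) \<in> borel_measurable borel" by measurable
    then show ?thesis by (simp only: f)
  qed
  show "antider f (frac (x + 1)) = antider f (frac x)" by (simp add: frac_def)
  have "norm (antider f (frac x)) \<le> norm (Pbm f)" for x
  proof -
    have "norm (antider f (frac x)) \<le> norm (Pbm f) * \<bar>frac x\<bar>"
      using antider_ev_le[of "Pbm f" "frac x"] by (simp add: f)
    also have "\<dots> \<le> norm (Pbm f) * 1" using frac_lt_1[of x] by (intro mult_left_mono) auto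
    finally show ?thesis by simp
  qed
  then show "bounded (range (\<lambda>x. antider f (frac x)))" by (auto simp: bounded_iff)
qed
lemma ev_cumul: "ev (cumul w) x = antider (ev w) (frac x)" by transfer simp

lemma antider_ev_add: "antider (ev (f + g)) x = antider (ev f) x + antider (ev g) x"
  and antider_ev_scaleR: "antider (ev (c *\<^sub>R f)) x = c * antider (ev f) x"
proof -
  have i: "ev f integrable_on {a..b}" for f a b using primitive_integrable_on[OF ev_primitive] .
  have "ev (f + g) = (\<lambda>x. ev f x + ev g x)" "ev (c *\<^sub>R f) = (\<lambda>x. c * ev f x)" by auto
  then show "antider (ev (f + g)) x = antider (ev f) x + antider (ev g) x"
    "antider (ev (c *\<^sub>R f)) x = c * antider (ev f) x"
    using i by (auto simp: antider_def Henstock_Kurzweil_Integration.integral_add)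
qed

lemma bounded_linear_antider_ev: "bounded_linear (\<lambda>f. antider (ev f) x)"
  by (rule bounded_linear_intro[of _ "\<bar>x\<bar>"]) (auto simp: antider_ev_add antider_ev_scaleR antider_ev_le)

lemma bounded_linear_cumul: "bounded_linear cumul"
proof (rule bounded_linear_intro[of _ 1])
  show "cumul (f + g) = cumul f + cumul g" "cumul (c *\<^sub>R f) = c *\<^sub>R cumul f" for f g c
    by (rule pbm_eqI; simp add: ev_cumul antider_ev_add antider_ev_scaleR)+
  show "norm (cumul f) \<le> norm f * 1" for f
  proof (rule norm_pbm_le)
    fix x
    have "\<bar>antider (ev f) (frac x)\<bar> \<le> norm f * \<bar>frac x\<bar>" by (rule antider_ev_le)
    also have "\<dots> \<le> norm f * 1" using frac_lt_1[of x] by (intro mult_left_mono) auto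
    finally show "\<bar>ev (cumul f) x\<bar> \<le> norm f * 1" by (simp add: ev_cumul)
  qed
qed

text \<open>Kept as a constant element of the algebra, so that the operators below are composed
  within \<open>pbm\<close>.\<close>

definition mean :: "pbm \<Rightarrow> pbm" where "mean w = cst (antider (ev w) 1)"

lemma ev_mean [simp]: "ev (mean w) x = antider (ev w) 1" by (simp add: mean_def)

lemma bounded_linear_mean: "bounded_linear mean"
proof (rule bounded_linear_intro[of _ 1])
  show "mean (f + g) = mean f + mean g" "mean (c *\<^sub>R f) = c *\<^sub>R mean f" for f g c
    by (rule pbm_eqI; simp add: antider_ev_add antider_ev_scaleR)+
  show "norm (mean f) \<le> norm f * 1" for f
    by (rule norm_pbm_le) (use antider_ev_le[of f 1] in simp)
qed

lift_definition pexp :: "pbm \<Rightarrow> pbm" is "\<lambda>f x. exp (f x)"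
proof (safe, goal_cases)
  case (3 f)
  then obtain B where "\<And>x. \<bar>f x\<bar> \<le> B" by (auto simp: bounded_iff)
  then have "norm (exp (f x)) \<le> exp B" for x by (simp add: abs_le_iff)
  then show ?case by (auto simp: bounded_iff)
qed auto
lemma ev_pexp [simp]: "ev (pexp f) x = exp (ev f x)" by transfer simp

section \<open>Calculus of maps that are Lipschitz on balls\<close>

lemma loclip_bounded_linear: "bounded_linear f \<Longrightarrow> loclip f"
proof -
  assume f: "bounded_linear f"
  then obtain K where K: "\<And>x. norm (f x) \<le> norm x * K" using bounded_linear.bounded by blast
  have "norm (f x - f y) \<le> K * norm (x - y)" for x y
    using K[of "x - y"] by (simp add: linear_diff[OF bounded_linear.linear[OF f]] mult.commute)
  then show ?thesis unfolding loclip_def by blast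
qed

lemma loclip_compose:
  assumes "loclip f" "loclip g" shows "loclip (\<lambda>x. f (g x))"
  unfolding loclip_def
proof
  fix R
  obtain M where M: "M \<ge> 0" "\<And>x. norm x \<le> R \<Longrightarrow> norm (g x) \<le> M" using loclip_bounded[OF assms(2)] by blast
  obtain L where L: "L \<ge> 0" "\<And>x y. norm x \<le> M \<Longrightarrow> norm y \<le> M \<Longrightarrow> norm (f x - f y) \<le> L * norm (x - y)"
    using loclipE[OF assms(1)] by blast
  obtain K where K: "K \<ge> 0" "\<And>x y. norm x \<le> R \<Longrightarrow> norm y \<le> R \<Longrightarrow> norm (g x - g y) \<le> K * norm (x - y)"
    using loclipE[OF assms(2)] by blast
  have "norm (f (g x) - f (g y)) \<le> (L * K) * norm (x - y)" if "norm x \<le> R" "norm y \<le> R" for x y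
  proof -
    have "norm (f (g x) - f (g y)) \<le> L * norm (g x - g y)" using that M(2) by (intro L(2)) auto
    also have "\<dots> \<le> L * (K * norm (x - y))" by (rule mult_left_mono[OF K(2)[OF that] L(1)])
    finally show ?thesis by (simp add: algebra_simps)
  qed
  then show "\<exists>L. \<forall>x y. norm x \<le> R \<longrightarrow> norm y \<le> R \<longrightarrow> norm (f (g x) - f (g y)) \<le> L * norm (x - y)" by blast
qed

lemma loclip_Pair:
  assumes "loclip f" "loclip g" shows "loclip (\<lambda>x. (f x, g x))"
  unfolding loclip_def
proof
  fix R
  obtain L where L: "L \<ge> 0" "\<And>x y. norm x \<le> R \<Longrightarrow> norm y \<le> R \<Longrightarrow> norm (f x - f y) \<le> L * norm (x - y)"
    using loclipE[OF assms(1)] by blast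
  obtain K where K: "K \<ge> 0" "\<And>x y. norm x \<le> R \<Longrightarrow> norm y \<le> R \<Longrightarrow> norm (g x - g y) \<le> K * norm (x - y)"
    using loclipE[OF assms(2)] by blast
  have "norm ((f x, g x) - (f y, g y)) \<le> (L + K) * norm (x - y)" if "norm x \<le> R" "norm y \<le> R" for x y
  proof -
    have "norm ((f x, g x) - (f y, g y)) \<le> norm (f x - f y) + norm (g x - g y)"
      by (simp add: norm_Pair_le)
    then show ?thesis using L(2)[OF that] K(2)[OF that] by (simp add: algebra_simps)
  qed
  then show "\<exists>L. \<forall>x y. norm x \<le> R \<longrightarrow> norm y \<le> R \<longrightarrow> norm ((f x, g x) - (f y, g y)) \<le> L * norm (x - y)" by blast
qed

lemma loclip_mult:
  fixes f g :: "'a::real_normed_vector \<Rightarrow> 'b::real_normed_algebra"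
  assumes "loclip f" "loclip g" shows "loclip (\<lambda>x. f x * g x)"
  unfolding loclip_def
proof
  fix R
  obtain L where L: "L \<ge> 0" "\<And>x y. norm x \<le> R \<Longrightarrow> norm y \<le> R \<Longrightarrow> norm (f x - f y) \<le> L * norm (x - y)"
    using loclipE[OF assms(1)] by blast
  obtain K where K: "K \<ge> 0" "\<And>x y. norm x \<le> R \<Longrightarrow> norm y \<le> R \<Longrightarrow> norm (g x - g y) \<le> K * norm (x - y)"
    using loclipE[OF assms(2)] by blast
  obtain M where M: "M \<ge> 0" "\<And>x. norm x \<le> R \<Longrightarrow> norm (f x) \<le> M" using loclip_bounded[OF assms(1)] by blast
  obtain N where N: "N \<ge> 0" "\<And>x. norm x \<le> R \<Longrightarrow> norm (g x) \<le> N" using loclip_bounded[OF assms(2)] by blast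
  have "norm (f x * g x - f y * g y) \<le> (L * N + M * K) * norm (x - y)" if "norm x \<le> R" "norm y \<le> R" for x y
  proof -
    have "norm (f x * g x - f y * g y) = norm ((f x - f y) * g x + f y * (g x - g y))" by (simp add: algebra_simps)
    also have "\<dots> \<le> norm (f x - f y) * norm (g x) + norm (f y) * norm (g x - g y)"
      by (intro norm_triangle_le add_mono norm_mult_ineq)
    also have "\<dots> \<le> (L * norm (x - y)) * N + M * (K * norm (x - y))"
      using that L K M N by (intro add_mono mult_mono) auto
    finally show ?thesis by (simp add: algebra_simps)
  qed
  then show "\<exists>L. \<forall>x y. norm x \<le> R \<longrightarrow> norm y \<le> R \<longrightarrow> norm (f x * g x - f y * g y) \<le> L * norm (x - y)" by blast
qed

lemma loclip_add: "loclip f \<Longrightarrow> loclip g \<Longrightarrow> loclip (\<lambda>x. f x + g x)"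
  using loclip_compose[OF loclip_bounded_linear[OF bounded_linear_add[OF bounded_linear_fst bounded_linear_snd]] loclip_Pair]
  by force

lemma loclip_diff: "loclip f \<Longrightarrow> loclip g \<Longrightarrow> loclip (\<lambda>x. f x - g x)"
  using loclip_compose[OF loclip_bounded_linear[OF bounded_linear_sub[OF bounded_linear_fst bounded_linear_snd]] loclip_Pair]
  by force

lemma loclip_minus: "loclip f \<Longrightarrow> loclip (\<lambda>x. - f x)"
  using loclip_compose[OF loclip_bounded_linear[OF bounded_linear_minus[OF bounded_linear_ident]]] .

lemma loclip_scaleR: "loclip f \<Longrightarrow> loclip (\<lambda>x. c *\<^sub>R f x)"
  using loclip_compose[OF loclip_bounded_linear[OF bounded_linear_scaleR_right]] .

lemma loclip_fst: "loclip f \<Longrightarrow> loclip (\<lambda>x. fst (f x))"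
  using loclip_compose[OF loclip_bounded_linear[OF bounded_linear_fst]] .

lemma loclip_snd: "loclip f \<Longrightarrow> loclip (\<lambda>x. snd (f x))"
  using loclip_compose[OF loclip_bounded_linear[OF bounded_linear_snd]] .

lemma loclip_ident: "loclip (\<lambda>x. x)"
  by (rule loclip_bounded_linear[OF bounded_linear_ident])

lemma loclip_pexp: "loclip pexp"
  unfolding loclip_def
proof (intro allI exI impI)
  fix R :: real and f g :: pbm assume fg: "norm f \<le> R" "norm g \<le> R"
  show "norm (pexp f - pexp g) \<le> exp R * norm (f - g)"
  proof (rule norm_pbm_le)
    fix x
    have "norm (exp (ev f x) - exp (ev g x)) \<le> exp R * norm (ev f x - ev g x)"
    proof (rule field_differentiable_bound[of "{-R..R}"])
      show "(exp has_field_derivative exp z) (at z within {- R..R})" for z :: real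
        by (auto intro!: derivative_eq_intros)
      show "ev f x \<in> {-R..R}" "ev g x \<in> {-R..R}"
        using ev_le_norm[of f x] ev_le_norm[of g x] fg by auto
    qed auto
    also have "\<dots> \<le> exp R * norm (f - g)" using ev_le_norm[of "f - g" x] by simp
    finally show "\<bar>ev (pexp f - pexp g) x\<bar> \<le> exp R * norm (f - g)" by simp
  qed
qed

lemmas loclip_intros = loclip_add loclip_diff loclip_minus loclip_scaleR loclip_mult loclip_Pair loclip_fst loclip_snd
  loclip_ident loclip_compose[OF loclip_pexp] loclip_compose[OF loclip_bounded_linear[OF bounded_linear_cumul]]
  loclip_compose[OF loclip_bounded_linear[OF bounded_linear_mean]]

text \<open>
  With \<open>\<integral>a = 1\<close> these are the periodic solutions of \<open>A' = w - a A\<close> and \<open>B' = a B - w\<close>, that is, the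
  integrals of \<open>exp (-\<bar>y \<xi> - y \<eta>\<bar>) w \<eta>\<close> over \<open>\<eta> < \<xi>\<close> and over \<open>\<eta> > \<xi>\<close>.
\<close>

definition srcA :: "pbm \<Rightarrow> pbm \<Rightarrow> pbm" where
  "srcA a w = pexp (- cumul a) * (cumul (pexp (cumul a) * w) + (1 / (exp 1 - 1)) *\<^sub>R mean (pexp (cumul a) * w))"

definition srcB :: "pbm \<Rightarrow> pbm \<Rightarrow> pbm" where
  "srcB a w = pexp (cumul a) * ((exp 1 / (exp 1 - 1)) *\<^sub>R mean (pexp (- cumul a) * w) - cumul (pexp (- cumul a) * w))"

text \<open>The factor 1/4 is the 1/2 of the kernel times another 1/2: with
  \<open>h = (u^2 + u_x^2) a\<close> the source \<open>(u^2 + u_x^2 / 2) a\<close> is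
  \<open>(U^2 a + h) / 2\<close>.\<close>

definition pP :: "pbm \<Rightarrow> pbm \<Rightarrow> pbm \<Rightarrow> pbm" where
  "pP U a h = (1/4) *\<^sub>R (srcA a (U * U * a + h) + srcB a (U * U * a + h))"

text \<open>This is \<open>P_x\<close> at the position of the label: the derivative of the kernel
  \<open>exp (-\<bar>x\<bar>)\<close> has sign minus for sources on the left and plus for sources on
  the right.\<close>

definition pQ :: "pbm \<Rightarrow> pbm \<Rightarrow> pbm \<Rightarrow> pbm" where
  "pQ U a h = (1/4) *\<^sub>R (srcB a (U * U * a + h) - srcA a (U * U * a + h))"

text \<open>The components are \<open>y - \<xi>\<close> (periodic, unlike \<open>y\<close>), \<open>U\<close>, \<open>a\<close>, \<open>b\<close>, \<open>h\<close>.\<close>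

type_synonym lstate = "pbm \<times> pbm \<times> pbm \<times> pbm \<times> pbm"

definition cz :: "lstate \<Rightarrow> pbm" where "cz X = fst X"
definition cU :: "lstate \<Rightarrow> pbm" where "cU X = fst (snd X)"
definition ca :: "lstate \<Rightarrow> pbm" where "ca X = fst (snd (snd X))"
definition cb :: "lstate \<Rightarrow> pbm" where "cb X = fst (snd (snd (snd X)))"
definition ch :: "lstate \<Rightarrow> pbm" where "ch X = snd (snd (snd (snd X)))"
definition cP :: "lstate \<Rightarrow> pbm" where "cP X = pP (cU X) (ca X) (ch X)"
definition cQ :: "lstate \<Rightarrow> pbm" where "cQ X = pQ (cU X) (ca X) (ch X)"

text \<open>The fourth component is the label derivative of \<open>- Q\<close>, the fifth that of
  \<open>U^3 - 2 P U\<close>, the flux in the energy balance along characteristics. Both are written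
  out by means of \<open>U_\<xi> = b\<close>, \<open>P_\<xi> = a Q\<close> and
  \<open>Q_\<xi> = a P - (U^2 a + h) / 2\<close>, so that no label derivative of an unknown
  remains.\<close>

definition lfield :: "lstate \<Rightarrow> lstate" where
  "lfield X = (cU X, - cQ X, cb X,
     (1/2) *\<^sub>R ch X + ((1/2) *\<^sub>R (cU X * cU X) - cP X) * ca X,
     (3 *\<^sub>R (cU X * cU X) - 2 *\<^sub>R cP X) * cb X - 2 *\<^sub>R (cQ X * cU X * ca X))"

lemma loclip_cP: "loclip cP" and loclip_cQ: "loclip cQ"
  unfolding cP_def cQ_def pP_def pQ_def srcA_def srcB_def cU_def ca_def ch_def
  by (intro loclip_intros)+

lemma loclip_lfield: "loclip lfield"
  unfolding lfield_def cU_def ca_def ch_def cb_def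
  by (intro loclip_intros loclip_cP loclip_cQ)

lemma bounded_linear_components:
  "bounded_linear cz" "bounded_linear cU" "bounded_linear ca" "bounded_linear cb" "bounded_linear ch"
  unfolding cz_def cU_def ca_def cb_def ch_def
  by (intro bounded_linear_fst bounded_linear_snd bounded_linear_compose[OF bounded_linear_fst] bounded_linear_compose[OF bounded_linear_snd])+

section \<open>Periodic primitives, and the source operators as solutions of their equations\<close>

lemma primitive_shift:
  assumes "primitive f g" shows "primitive (\<lambda>x. f (x + c)) (\<lambda>x. g (x + c))"
  unfolding primitive_def
proof (intro conjI allI impI)
  have [measurable]: "g \<in> borel_measurable borel" using assms by (rule primitive_measurable)
  show "(\<lambda>x. g (x + c)) \<in> borel_measurable borel" by measurable
  fix a b :: real assume ab: "a \<le> b"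
  have eq: "indicator {a..b} x *\<^sub>R g (x + c) = indicator {a + c..b + c} (c + 1 * x) *\<^sub>R g (c + 1 * x)" for x
    by (auto simp: indicator_def add.commute)
  have "integrable lborel (\<lambda>x. indicator {a + c..b + c} x *\<^sub>R g x)"
    using primitive_set_integrable[OF assms, of "a + c" "b + c"] by (simp add: set_integrable_def)
  from lborel_integrable_real_affine[OF this, of 1 c] show "set_integrable lborel {a..b} (\<lambda>x. g (x + c))"
    unfolding set_integrable_def eq by simp
  have "(LINT x:{a..b}|lborel. g (x + c)) = (LINT x:{a + c..b + c}|lborel. g x)"
    unfolding set_lebesgue_integral_def eq
    by (subst lborel_integral_real_affine[of 1 _ c]) auto
  then show "(LINT x:{a..b}|lborel. g (x + c)) = f (b + c) - f (a + c)"
    using primitive_LINT[OF assms, of "a + c" "b + c"] ab by simp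
qed

lemma primitive_zero_const: "primitive f (\<lambda>_. 0) \<Longrightarrow> f x = f y"
  using primitive_LINT[of f "\<lambda>_. 0" x y] primitive_LINT[of f "\<lambda>_. 0" y x]
  by (cases "x \<le> y") (auto simp: set_lebesgue_integral_def)

lemma primitive_unique_diff: "primitive f g \<Longrightarrow> primitive f' g \<Longrightarrow> f x - f y = f' x - f' y"
  using primitive_zero_const[of "\<lambda>x. f x - f' x" x y] primitive_diff[of f g f' g] by simp

lemma periodic_int:
  assumes "\<And>x::real. f (x + 1) = f x" shows "f (x + of_int k) = f x"
proof (induction k rule: int_induct[of _ 0])
  case (step1 i)
  then show ?case using assms[of "x + of_int i"] by (simp add: algebra_simps)
next
  case (step2 i)
  then show ?case using assms[of "x + of_int (i - 1)"] by (simp add: algebra_simps)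
qed simp

lemma periodic_frac: "(\<And>x::real. f (x + 1) = f x) \<Longrightarrow> f (frac x) = f x"
  using periodic_int[of f x "- \<lfloor>x\<rfloor>"] by (simp add: frac_def)

lemma antider_period: "antider (ev w) (x + 1) = antider (ev w) x + antider (ev w) 1"
proof -
  have "primitive (\<lambda>x. antider (ev w) (x + 1)) (ev w)"
    using primitive_shift[OF ev_primitive, of w 1] by (simp add: ev_periodic)
  from primitive_unique_diff[OF this ev_primitive, of x 0] show ?thesis by simp
qed

text \<open>A formula on \<open>[0,1)\<close> extends to the line when the density has zero mean,
  for then its primitive is periodic as well.\<close>

lemma periodic_primitive:
  assumes f: "\<And>x. f (x + 1) = f x" and g: "\<And>x. 0 \<le> x \<Longrightarrow> x < 1 \<Longrightarrow> f x = f 0 + antider (ev g) x"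
    and g1: "antider (ev g) 1 = 0"
  shows "primitive f (ev g)"
proof -
  have "f x = f 0 + antider (ev g) x" for x
  proof -
    have "antider (ev g) (x + 1) = antider (ev g) x" for x by (simp add: antider_period g1)
    then have "antider (ev g) (frac x) = antider (ev g) x" by (rule periodic_frac)
    moreover have "f (frac x) = f x" using f by (rule periodic_frac)
    ultimately show ?thesis using g[of "frac x"] by (simp add: frac_lt_1)
  qed
  then have "f = (\<lambda>x. f 0 + antider (ev g) x)" by blast
  then show ?thesis
    using primitive_add[OF primitive_const ev_primitive, of "f 0" g] by simp
qed

lemma antider_mono:
  assumes "\<And>x. ev f x \<le> ev g x" "0 \<le> x" shows "antider (ev f) x \<le> antider (ev g) x"
  using assms primitive_integrable_on[OF ev_primitive]
  by (auto simp: antider_def intro!: integral_le)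

lemma antider_add: "antider (ev (f + g)) x = antider (ev f) x + antider (ev g) x"
  and antider_diff: "antider (ev (f - g)) x = antider (ev f) x - antider (ev g) x"
  and antider_minus: "antider (ev (- f)) x = - antider (ev f) x"
  and antider_scaleR: "antider (ev (c *\<^sub>R f)) x = c * antider (ev f) x"
proof -
  interpret bounded_linear "\<lambda>f. antider (ev f) x" by (rule bounded_linear_antider_ev)
  show "antider (ev (f + g)) x = antider (ev f) x + antider (ev g) x"
    "antider (ev (f - g)) x = antider (ev f) x - antider (ev g) x"
    "antider (ev (- f)) x = - antider (ev f) x" "antider (ev (c *\<^sub>R f)) x = c * antider (ev f) x"
    by (simp_all add: add diff neg scaleR)
qed

lemma antider_nonneg: "(\<And>x. 0 \<le> ev f x) \<Longrightarrow> 0 \<le> x \<Longrightarrow> 0 \<le> antider (ev f) x"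
  using antider_mono[of 0 f x] by (simp add: antider_def zero_pbm.rep_eq)

lemma antider_mono_arg: "(\<And>x. 0 \<le> ev f x) \<Longrightarrow> x \<le> y \<Longrightarrow> antider (ev f) x \<le> antider (ev f) y"
  using primitive_has_integral[OF ev_primitive, of x y f] has_integral_nonneg[of "ev f" "antider (ev f) y - antider (ev f) x" "{x..y}"]
  by auto

text \<open>A density formula valid on \<open>[0,1)\<close> transfers to the operators, which only see one period.\<close>
lemma antider_eqI:
  assumes "primitive F d" "\<And>x. 0 \<le> x \<Longrightarrow> x < 1 \<Longrightarrow> d x = ev g x" "0 \<le> x" "x \<le> 1"
  shows "F x - F 0 = antider (ev g) x"
proof -
  have "integral {0..x} d = integral {0..x} (ev g)"
    by (rule integral_spike[of "{1}"]) (use assms in auto)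
  then show ?thesis using primitive_integral[OF assms(1,3)] assms(3) by (simp add: antider_def)
qed

context
  fixes a w :: pbm
begin

private definition "Y = antider (ev a)"
private definition "G = antider (ev (pexp (cumul a) * w))"
private definition "V = antider (ev (pexp (- cumul a) * w))"

private lemma Y_frac: "0 \<le> x \<Longrightarrow> x < 1 \<Longrightarrow> ev (cumul a) x = Y x"
  by (simp add: ev_cumul frac_eq Y_def)

private lemma evA: "0 \<le> x \<Longrightarrow> x < 1 \<Longrightarrow> ev (srcA a w) x = exp (- Y x) * (G x + (1 / (exp 1 - 1)) * G 1)"
  unfolding srcA_def G_def by (simp add: ev_cumul[of "pexp (cumul a) * w"] Y_frac frac_eq)

private lemma evB: "0 \<le> x \<Longrightarrow> x < 1 \<Longrightarrow> ev (srcB a w) x = exp (Y x) * ((exp 1 / (exp 1 - 1)) * V 1 - V x)"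
  unfolding srcB_def V_def by (simp add: ev_cumul[of "pexp (- cumul a) * w"] Y_frac frac_eq)

private lemma primY: "primitive Y (ev a)" and primG: "primitive G (ev (pexp (cumul a) * w))"
  and primV: "primitive V (ev (pexp (- cumul a) * w))"
  unfolding Y_def G_def V_def by (rule ev_primitive)+

private lemma primA:
  "primitive (\<lambda>x. exp (- Y x) * (G x + (1 / (exp 1 - 1)) * G 1))
     (\<lambda>x. (- exp (- Y x) * ev a x) * (G x + (1 / (exp 1 - 1)) * G 1) + exp (- Y x) * (ev (pexp (cumul a) * w) x + 0))"
  by (intro primitive_mult primitive_add primG primitive_const primitive_compose[OF primY, where \<phi> = "\<lambda>x. exp (- x)"])
    (auto intro!: derivative_eq_intros continuous_intros)

private lemma primB:
  "primitive (\<lambda>x. exp (Y x) * ((exp 1 / (exp 1 - 1)) * V 1 - V x))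
     (\<lambda>x. (exp (Y x) * ev a x) * ((exp 1 / (exp 1 - 1)) * V 1 - V x) + exp (Y x) * (0 - ev (pexp (- cumul a) * w) x))"
  by (intro primitive_mult primitive_diff primV primitive_const primitive_compose[OF primY, where \<phi> = exp])
    (auto intro!: derivative_eq_intros continuous_intros)

private lemma densA: "0 \<le> x \<Longrightarrow> x < 1 \<Longrightarrow>
  (- exp (- Y x) * ev a x) * (G x + (1 / (exp 1 - 1)) * G 1) + exp (- Y x) * (ev (pexp (cumul a) * w) x + 0) = ev (w - a * srcA a w) x"
  by (simp add: evA Y_frac algebra_simps exp_minus)

private lemma densB: "0 \<le> x \<Longrightarrow> x < 1 \<Longrightarrow>
  (exp (Y x) * ev a x) * ((exp 1 / (exp 1 - 1)) * V 1 - V x) + exp (Y x) * (0 - ev (pexp (- cumul a) * w) x) = ev (a * srcB a w - w) x"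
  by (simp add: evB Y_frac algebra_simps exp_minus)

lemma srcA_antider: "0 \<le> x \<Longrightarrow> x < 1 \<Longrightarrow> ev (srcA a w) x = ev (srcA a w) 0 + antider (ev (w - a * srcA a w)) x"
  using antider_eqI[OF primA densA, of x] by (simp add: evA)

lemma srcB_antider: "0 \<le> x \<Longrightarrow> x < 1 \<Longrightarrow> ev (srcB a w) x = ev (srcB a w) 0 + antider (ev (a * srcB a w - w)) x"
  using antider_eqI[OF primB densB, of x] by (simp add: evB)

text \<open>The mismatch across one period. The constants \<open>1 / (exp 1 - 1)\<close> here and
  \<open>exp 1 / (exp 1 - 1)\<close> in \<open>srcB\<close> are those for which it vanishes when
  \<open>a\<close> has mean 1. The formula is needed for arbitrary mean, because the mean is not yet
  known to stay 1 along the flow.\<close>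

lemma srcA_total: "antider (ev (w - a * srcA a w)) 1 =
    antider (ev (pexp (cumul a) * w)) 1 / (exp 1 - 1) * (exp (1 - antider (ev a) 1) - 1)"
proof -
  have "(exp 1 - 1 :: real) \<noteq> 0" by simp
  then show ?thesis
    using antider_eqI[OF primA densA, of 1]
    by (simp add: Y_def G_def exp_diff exp_minus divide_simps) (simp add: algebra_simps)
qed

lemma srcB_total: "antider (ev (a * srcB a w - w)) 1 =
    exp 1 * antider (ev (pexp (- cumul a) * w)) 1 / (exp 1 - 1) * (exp (antider (ev a) 1 - 1) - 1)"
proof -
  have "(exp 1 - 1 :: real) \<noteq> 0" by simp
  then show ?thesis
    using antider_eqI[OF primB densB, of 1]
    by (simp add: Y_def V_def exp_diff exp_minus divide_simps) (simp add: algebra_simps)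
qed

text \<open>One factor \<open>exp 1\<close> comes from the weight \<open>exp (cumul a)\<close>,
  which is at most \<open>exp 1\<close>; the rest is
  \<open>1 + 1 / (exp 1 - 1) = exp 1 / (exp 1 - 1)\<close>. For \<open>srcB\<close> the factor
  \<open>exp 1\<close> comes from the outer exponential instead.\<close>

lemma srcA_bound:
  assumes a: "\<And>x. 0 \<le> ev a x" "antider (ev a) 1 = 1" and w: "\<And>x. 0 \<le> ev w x"
  shows "0 \<le> ev (srcA a w) x" "ev (srcA a w) x \<le> exp 1 * exp 1 / (exp 1 - 1) * antider (ev w) 1"
proof -
  define y where "y = frac x"
  have y: "0 \<le> y" "y < 1" by (auto simp: y_def frac_lt_1)
  have eq: "ev (srcA a w) x = ev (srcA a w) y" unfolding y_def by (rule periodic_frac[symmetric]) (rule ev_periodic)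
  have Y: "0 \<le> Y y" "Y y \<le> 1"
    using antider_nonneg[OF a(1), of y] antider_mono_arg[OF a(1), of y 1] y a(2) by (auto simp: Y_def)
  have cu: "ev (cumul a) z \<le> 1" for z
    using antider_mono_arg[OF a(1), of "frac z" 1] a(2) frac_lt_1[of z] by (simp add: ev_cumul)
  have nn: "0 \<le> ev (pexp (cumul a) * w) z" for z using w by simp
  have G: "0 \<le> G y" "G y \<le> G 1" "0 \<le> G 1"
    unfolding G_def using antider_nonneg[OF nn] antider_mono_arg[OF nn] y by auto
  have "G 1 \<le> antider (ev (exp 1 *\<^sub>R w)) 1"
    unfolding G_def by (rule antider_mono) (use cu w in \<open>auto intro!: mult_right_mono\<close>)
  then have G1: "G 1 \<le> exp 1 * antider (ev w) 1" by (simp add: antider_scaleR)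
  have e: "exp 1 - 1 > (0::real)" by simp
  show "0 \<le> ev (srcA a w) x" unfolding eq evA[OF y] using G e by simp
  have "ev (srcA a w) x \<le> 1 * (G 1 + (1 / (exp 1 - 1)) * G 1)"
    unfolding eq evA[OF y] using Y G e by (intro mult_mono add_mono) auto
  also have "\<dots> = exp 1 / (exp 1 - 1) * G 1" by (simp add: field_simps)
  also have "\<dots> \<le> exp 1 / (exp 1 - 1) * (exp 1 * antider (ev w) 1)" using G1 by (intro mult_left_mono) auto
  finally show "ev (srcA a w) x \<le> exp 1 * exp 1 / (exp 1 - 1) * antider (ev w) 1" by simp
qed

lemma srcB_bound:
  assumes a: "\<And>x. 0 \<le> ev a x" "antider (ev a) 1 = 1" and w: "\<And>x. 0 \<le> ev w x"
  shows "0 \<le> ev (srcB a w) x" "ev (srcB a w) x \<le> exp 1 * exp 1 / (exp 1 - 1) * antider (ev w) 1"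
proof -
  define y where "y = frac x"
  have y: "0 \<le> y" "y < 1" by (auto simp: y_def frac_lt_1)
  have eq: "ev (srcB a w) x = ev (srcB a w) y" unfolding y_def by (rule periodic_frac[symmetric]) (rule ev_periodic)
  have Y: "0 \<le> Y y" "Y y \<le> 1"
    using antider_nonneg[OF a(1), of y] antider_mono_arg[OF a(1), of y 1] y a(2) by (auto simp: Y_def)
  have cu: "0 \<le> ev (cumul a) z" for z
    using antider_nonneg[OF a(1), of "frac z"] by (simp add: ev_cumul)
  have nn: "0 \<le> ev (pexp (- cumul a) * w) z" for z using w by simp
  have V: "0 \<le> V y" "V y \<le> V 1" "0 \<le> V 1"
    unfolding V_def using antider_nonneg[OF nn] antider_mono_arg[OF nn] y by auto
  have V1: "V 1 \<le> antider (ev w) 1"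
    unfolding V_def by (rule antider_mono) (use cu w in \<open>auto intro: mult_left_le_one_le\<close>)
  have e: "exp 1 - 1 > (0::real)" by simp
  have k: "1 \<le> exp 1 / (exp 1 - 1 :: real)" by (simp add: field_simps)
  have k': "V 1 \<le> exp 1 / (exp 1 - 1) * V 1" using mult_right_mono[OF k V(3)] by simp
  show "0 \<le> ev (srcB a w) x" unfolding eq evB[OF y] using V(2) k' by simp
  have "ev (srcB a w) x \<le> exp 1 * (exp 1 / (exp 1 - 1) * V 1)"
    unfolding eq evB[OF y] using Y V k' by (intro mult_mono) auto
  also have "\<dots> \<le> exp 1 * (exp 1 / (exp 1 - 1) * antider (ev w) 1)" using V1 by (intro mult_left_mono) auto
  finally show "ev (srcB a w) x \<le> exp 1 * exp 1 / (exp 1 - 1) * antider (ev w) 1" by simp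
qed

lemma src_primitive:
  assumes "antider (ev a) 1 = 1"
  shows "primitive (ev (srcA a w)) (ev (w - a * srcA a w))" "primitive (ev (srcB a w)) (ev (a * srcB a w - w))"
  using srcA_total srcB_total assms
  by (auto intro!: periodic_primitive srcA_antider srcB_antider simp: ev_periodic)

end

section \<open>Conserved quantities\<close>

text \<open>Together with the means of \<open>a\<close> and \<open>b\<close>, the last two conditions say \<open>y\<^sub>\<xi> = a\<close> and \<open>U\<^sub>\<xi> = b\<close>.\<close>

definition linit :: "lstate \<Rightarrow> real \<Rightarrow> bool" where
  "linit Z E \<longleftrightarrow> (\<forall>x. 0 < ev (ca Z) x + ev (ch Z) x) \<and>
    (\<forall>x. ev (ca Z) x * ev (ch Z) x = (ev (cU Z) x * ev (ca Z) x)\<^sup>2 + (ev (cb Z) x)\<^sup>2) \<and>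
    antider (ev (ca Z)) 1 = 1 \<and> antider (ev (cb Z)) 1 = 0 \<and> antider (ev (ch Z)) 1 = E \<and>
    (\<forall>x. ev (cU Z) x = ev (cU Z) 0 + antider (ev (cb Z)) (frac x)) \<and>
    (\<forall>x. ev (cz Z) x = ev (cz Z) 0 + antider (ev (ca Z)) (frac x) - frac x)"

lemma lfield_components:
  "cz (lfield Z) = cU Z" "cU (lfield Z) = - cQ Z" "ca (lfield Z) = cb Z"
  "cb (lfield Z) = (1/2) *\<^sub>R ch Z + ((1/2) *\<^sub>R (cU Z * cU Z) - cP Z) * ca Z"
  "ch (lfield Z) = (3 *\<^sub>R (cU Z * cU Z) - 2 *\<^sub>R cP Z) * cb Z - 2 *\<^sub>R (cQ Z * cU Z * ca Z)"
  by (simp_all add: lfield_def cz_def cU_def ca_def cb_def ch_def)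

text \<open>Twice the source of the pressure in label variables,
  \<open>(2 u^2 + u_x^2) y_\<xi>\<close>.\<close>

definition cw :: "lstate \<Rightarrow> pbm" where "cw Z = cU Z * cU Z * ca Z + ch Z"

lemma loclip_cw: "loclip cw"
  unfolding cw_def cU_def ca_def ch_def by (intro loclip_intros)

lemma cP_eq: "cP Z = (1/4) *\<^sub>R (srcA (ca Z) (cw Z) + srcB (ca Z) (cw Z))"
  and cQ_eq: "cQ Z = (1/4) *\<^sub>R (srcB (ca Z) (cw Z) - srcA (ca Z) (cw Z))"
  by (simp_all add: cP_def cQ_def pP_def pQ_def cw_def)

lemma constant_if_zero_derivative:
  fixes f :: "real \<Rightarrow> real"
  assumes "\<And>t. t \<in> {-S..S} \<Longrightarrow> (f has_real_derivative 0) (at t within {-S..S})" "t \<in> {-S..S}"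
  shows "f t = f 0"
proof -
  obtain c where "\<forall>x\<in>{-S..S}. f x = c"
    using has_field_derivative_zero_constant[of "{-S..S}" f] assms(1) by auto
  moreover have "0 \<in> {-S..S}" using assms(2) by auto
  ultimately show ?thesis using assms(2) by metis
qed

text \<open>\<open>n^2 exp (2 C t)\<close> increases and \<open>n^2 exp (- 2 C t)\<close> decreases;
  squaring avoids any assumption on the sign of \<open>n\<close>. So \<open>n\<close> never
  vanishes, and positivity follows from the intermediate value theorem.\<close>

lemma gronwall_positive:
  fixes n :: "real \<Rightarrow> real"
  assumes n: "\<And>t. t \<in> {-S..S} \<Longrightarrow> (n has_real_derivative n' t) (at t within {-S..S})"
    and b: "\<And>t. t \<in> {-S..S} \<Longrightarrow> \<bar>n' t\<bar> \<le> C * \<bar>n t\<bar>" and n0: "0 < n 0" and t: "t \<in> {-S..S}"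
  shows "0 < n t" "n t \<le> n 0 * exp (C * \<bar>t\<bar>)"
proof -
  have cn: "continuous_on {-S..S} n"
    using n by (meson DERIV_continuous continuous_on_eq_continuous_within)
  have nd: "(n has_real_derivative n' s) (at s)" if "-S < s" "s < S" for s
  proof -
    have "(n has_real_derivative n' s) (at s within {-S<..<S})"
      by (rule DERIV_subset[OF n]) (use that in auto)
    then show ?thesis using that by (metis at_within_open greaterThanLessThan_iff open_greaterThanLessThan)
  qed
  have incr: "(n p)\<^sup>2 * exp (2 * C * p) \<le> (n q)\<^sup>2 * exp (2 * C * q)" if pq: "p \<le> q" "-S \<le> p" "q \<le> S" for p q
  proof (rule DERIV_nonneg_imp_increasing_open[OF pq(1)])
    fix s assume s: "p < s" "s < q"
    then have s': "-S < s" "s < S" using pq by auto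
    have "((\<lambda>s. (n s)\<^sup>2 * exp (2 * C * s)) has_real_derivative (2 * n s * n' s + 2 * C * (n s)\<^sup>2) * exp (2 * C * s)) (at s)"
      by (rule derivative_eq_intros nd s' refl | simp add: algebra_simps)+
    moreover have "0 \<le> (2 * n s * n' s + 2 * C * (n s)\<^sup>2) * exp (2 * C * s)"
    proof -
      have "\<bar>n s * n' s\<bar> \<le> \<bar>n s\<bar> * (C * \<bar>n s\<bar>)" unfolding abs_mult using b[of s] s' by (intro mult_left_mono) auto
      also have "\<dots> = C * (n s)\<^sup>2" by (simp add: power2_eq_square)
      finally have "\<bar>n s * n' s\<bar> \<le> C * (n s)\<^sup>2" .
      then have "0 \<le> 2 * n s * n' s + 2 * C * (n s)\<^sup>2" by (simp add: abs_le_iff)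
      then show ?thesis by simp
    qed
    ultimately show "\<exists>y. ((\<lambda>s. (n s)\<^sup>2 * exp (2 * C * s)) has_real_derivative y) (at s) \<and> 0 \<le> y" by blast
  qed (use pq in \<open>auto intro!: continuous_intros continuous_on_subset[OF cn]\<close>)
  have decr: "(n q)\<^sup>2 * exp (- (2 * C * q)) \<le> (n p)\<^sup>2 * exp (- (2 * C * p))" if pq: "p \<le> q" "-S \<le> p" "q \<le> S" for p q
  proof -
    have "- ((n p)\<^sup>2 * exp (- (2 * C * p))) \<le> - ((n q)\<^sup>2 * exp (- (2 * C * q)))"
    proof (rule DERIV_nonneg_imp_increasing_open[OF pq(1)])
      fix s assume s: "p < s" "s < q"
      then have s': "-S < s" "s < S" using pq by auto
      have "((\<lambda>s. - ((n s)\<^sup>2 * exp (- (2 * C * s)))) has_real_derivative (2 * C * (n s)\<^sup>2 - 2 * n s * n' s) * exp (- (2 * C * s))) (at s)"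
        by (rule derivative_eq_intros nd s' refl | simp add: algebra_simps)+
      moreover have "0 \<le> (2 * C * (n s)\<^sup>2 - 2 * n s * n' s) * exp (- (2 * C * s))"
      proof -
        have "\<bar>n s * n' s\<bar> \<le> \<bar>n s\<bar> * (C * \<bar>n s\<bar>)" unfolding abs_mult using b[of s] s' by (intro mult_left_mono) auto
        also have "\<dots> = C * (n s)\<^sup>2" by (simp add: power2_eq_square)
        finally have "\<bar>n s * n' s\<bar> \<le> C * (n s)\<^sup>2" .
        then have "0 \<le> 2 * C * (n s)\<^sup>2 - 2 * n s * n' s" by (simp add: abs_le_iff)
        then show ?thesis by simp
      qed
      ultimately show "\<exists>y. ((\<lambda>s. - ((n s)\<^sup>2 * exp (- (2 * C * s)))) has_real_derivative y) (at s) \<and> 0 \<le> y" by blast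
    qed (use pq in \<open>auto intro!: continuous_intros continuous_on_subset[OF cn]\<close>)
    then show ?thesis by simp
  qed
  have S0: "0 \<le> S" using t by auto
  have nz: "n s \<noteq> 0" if s: "s \<in> {-S..S}" for s
  proof (cases "0 \<le> s")
    case True
    then show ?thesis using incr[of 0 s] s n0 by auto
  next
    case False
    then show ?thesis using decr[of s 0] s n0 by auto
  qed
  show npos: "0 < n t"
  proof (rule ccontr)
    assume "\<not> 0 < n t"
    then have neg: "n t < 0" using nz[OF t] by auto
    have "\<exists>s\<in>{-S..S}. n s = 0"
    proof (cases "0 \<le> t")
      case True
      then have "\<exists>s\<ge>0. s \<le> t \<and> n s = 0"
        using neg n0 t by (intro IVT2') (auto intro: continuous_on_subset[OF cn])
      then show ?thesis using t by force
    next
      case False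
      then have "\<exists>s\<ge>t. s \<le> 0 \<and> n s = 0"
        using neg n0 t by (intro IVT') (auto intro: continuous_on_subset[OF cn])
      then show ?thesis using t by force
    qed
    then show False using nz by blast
  qed
  have "(n t)\<^sup>2 \<le> (n 0 * exp (C * \<bar>t\<bar>))\<^sup>2"
  proof (cases "0 \<le> t")
    case True
    have "(n t)\<^sup>2 * exp (- (2 * C * t)) \<le> (n 0)\<^sup>2" using decr[of 0 t] t True S0 by simp
    then have "(n t)\<^sup>2 \<le> (n 0)\<^sup>2 * exp (2 * C * t)" by (simp add: exp_minus field_simps)
    also have "\<dots> = (n 0 * exp (C * t))\<^sup>2" by (simp add: power_mult_distrib exp_double[symmetric] mult.assoc)
    finally show ?thesis using True by simp
  next
    case False
    have "(n t)\<^sup>2 * exp (2 * C * t) \<le> (n 0)\<^sup>2" using incr[of t 0] t False S0 by simp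
    then have "(n t)\<^sup>2 \<le> (n 0)\<^sup>2 * exp (- (2 * C * t))" by (simp add: exp_minus field_simps)
    also have "\<dots> = (n 0 * exp (- (C * t)))\<^sup>2" by (simp add: power_mult_distrib exp_double[symmetric] mult.assoc)
    finally show ?thesis using False by simp
  qed
  then show "n t \<le> n 0 * exp (C * \<bar>t\<bar>)" by (rule power2_le_imp_le) (use n0 in simp)
qed

lemma exp_minus_one_le: "\<bar>exp x - 1\<bar> \<le> exp M * \<bar>x\<bar>" if "\<bar>x\<bar> \<le> M" for x M :: real
proof -
  have "norm (exp x - exp 0) \<le> exp M * norm (x - 0)"
    by (rule field_differentiable_bound[of "{-M..M}"]) (use that in \<open>auto intro!: derivative_eq_intros\<close>)
  then show ?thesis by simp
qed

text \<open>A bounded time interval, because these estimates are the input of the global existence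
  theorem and must hold for solutions that exist only on a bounded interval.\<close>

locale lagrangian_solution =
  fixes X :: "real \<Rightarrow> lstate" and S E :: real
  assumes S: "0 < S" and sol: "solves_on lfield S X" and init: "linit (X 0) E"
begin

lemma init_pos: "0 < ev (ca (X 0)) x + ev (ch (X 0)) x"
  and init_inv: "ev (ca (X 0)) x * ev (ch (X 0)) x = (ev (cU (X 0)) x * ev (ca (X 0)) x)\<^sup>2 + (ev (cb (X 0)) x)\<^sup>2"
  and init_mean: "antider (ev (ca (X 0))) 1 = 1" "antider (ev (cb (X 0))) 1 = 0" "antider (ev (ch (X 0))) 1 = E"
  and init_U: "ev (cU (X 0)) x = ev (cU (X 0)) 0 + antider (ev (cb (X 0))) (frac x)"
  and init_z: "ev (cz (X 0)) x = ev (cz (X 0)) 0 + antider (ev (ca (X 0))) (frac x) - frac x"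
  using init unfolding linit_def by blast+

abbreviation "zz t \<equiv> ev (cz (X t))"
abbreviation "U t \<equiv> ev (cU (X t))"
abbreviation "a t \<equiv> ev (ca (X t))"
abbreviation "b t \<equiv> ev (cb (X t))"
abbreviation "h t \<equiv> ev (ch (X t))"
abbreviation "P t \<equiv> ev (cP (X t))"
abbreviation "Q t \<equiv> ev (cQ (X t))"

lemma zero_in: "0 \<in> {-S..S}" using S by auto

lemma dX: "t \<in> {-S..S} \<Longrightarrow> (X has_vector_derivative lfield (X t)) (at t within {-S..S})"
  using sol by (auto simp: solves_on_def)

lemma d_linear:
  assumes "bounded_linear \<phi>" "t \<in> {-S..S}"
  shows "((\<lambda>t. \<phi> (X t)) has_real_derivative \<phi> (lfield (X t))) (at t within {-S..S})"
  using bounded_linear.has_vector_derivative[OF assms(1) dX[OF assms(2)]]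
  by (simp add: has_real_derivative_iff_has_vector_derivative)

lemma d_ev:
  assumes "bounded_linear c" "t \<in> {-S..S}"
  shows "((\<lambda>t. ev (c (X t)) x) has_real_derivative ev (c (lfield (X t))) x) (at t within {-S..S})"
  by (rule d_linear[OF bounded_linear_compose[OF bounded_linear_ev assms(1)] assms(2)])

lemma d_antider:
  assumes "bounded_linear c" "t \<in> {-S..S}"
  shows "((\<lambda>t. antider (ev (c (X t))) x) has_real_derivative antider (ev (c (lfield (X t)))) x) (at t within {-S..S})"
  by (rule d_linear[OF bounded_linear_compose[OF bounded_linear_antider_ev assms(1)] assms(2)])

lemmas bl = bounded_linear_components

lemma dz: "t \<in> {-S..S} \<Longrightarrow> ((\<lambda>t. zz t x) has_real_derivative U t x) (at t within {-S..S})"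
  and dU: "t \<in> {-S..S} \<Longrightarrow> ((\<lambda>t. U t x) has_real_derivative - Q t x) (at t within {-S..S})"
  and da: "t \<in> {-S..S} \<Longrightarrow> ((\<lambda>t. a t x) has_real_derivative b t x) (at t within {-S..S})"
  and db: "t \<in> {-S..S} \<Longrightarrow> ((\<lambda>t. b t x) has_real_derivative h t x / 2 + ((U t x)\<^sup>2 / 2 - P t x) * a t x) (at t within {-S..S})"
  and dh: "t \<in> {-S..S} \<Longrightarrow> ((\<lambda>t. h t x) has_real_derivative (3 * (U t x)\<^sup>2 - 2 * P t x) * b t x - 2 * Q t x * U t x * a t x) (at t within {-S..S})"
  using d_ev[OF bl(1)] d_ev[OF bl(2)] d_ev[OF bl(3)] d_ev[OF bl(4)] d_ev[OF bl(5)]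
  by (simp_all add: lfield_components power2_eq_square mult.assoc)

lemma continuous_X: "continuous_on {-S..S} X"
  by (meson dX continuous_on_eq_continuous_within has_vector_derivative_continuous)

lemma bounded_X: obtains R where "\<And>t. t \<in> {-S..S} \<Longrightarrow> norm (X t) \<le> R"
proof -
  have "bounded (X ` {-S..S})" by (intro compact_imp_bounded compact_continuous_image continuous_X compact_Icc)
  then show ?thesis using that unfolding bounded_iff by blast
qed

lemma loclip_bound:
  assumes "loclip F" obtains M where "M \<ge> 0" "\<And>t. t \<in> {-S..S} \<Longrightarrow> norm (F (X t)) \<le> M"
proof -
  obtain R where R: "\<And>t. t \<in> {-S..S} \<Longrightarrow> norm (X t) \<le> R" by (rule bounded_X) blast
  obtain M where "M \<ge> 0" "\<And>x. norm x \<le> R \<Longrightarrow> norm (F x) \<le> M" by (rule loclip_bounded[OF assms, of R]) blast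
  then show ?thesis using that R by blast
qed

text \<open>In the time derivative all terms with \<open>P\<close> and \<open>Q\<close> cancel label
  by label, so nothing has to be known about the nonlocal terms.\<close>

lemma invariant: "t \<in> {-S..S} \<Longrightarrow> a t x * h t x = (U t x * a t x)\<^sup>2 + (b t x)\<^sup>2"
proof -
  assume t: "t \<in> {-S..S}"
  let ?K = "\<lambda>t. a t x * h t x - (U t x * a t x)\<^sup>2 - (b t x)\<^sup>2"
  have "(?K has_real_derivative 0) (at t within {-S..S})" if "t \<in> {-S..S}" for t
    by (rule derivative_eq_intros dz dU da db dh that refl | simp add: algebra_simps power2_eq_square)+
  from constant_if_zero_derivative[OF this t] have "?K t = ?K 0" .
  then show ?thesis using init_inv[of x] by simp
qed

text \<open>The product of \<open>A\<close> and \<open>H\<close> is nonnegative, so they have the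
  same sign, and \<open>B\<close> is bounded by the arithmetic-geometric mean inequality. This
  controls everything by \<open>\<bar>A + H\<bar>\<close> while the signs are still unknown.\<close>

lemma density_bound:
  fixes A B H u :: real
  assumes "A * H = (u * A)\<^sup>2 + B\<^sup>2"
  shows "\<bar>B\<bar> \<le> (\<bar>A\<bar> + \<bar>H\<bar>) / 2" "\<bar>A\<bar> + \<bar>H\<bar> = \<bar>A + H\<bar>"
proof -
  have nn: "0 \<le> A * H" unfolding assms by simp
  have "B\<^sup>2 \<le> \<bar>A\<bar> * \<bar>H\<bar>" using assms nn by (simp add: abs_mult[symmetric])
  also have "\<dots> \<le> ((\<bar>A\<bar> + \<bar>H\<bar>) / 2)\<^sup>2"
    using sum_squares_ge_zero[of "\<bar>A\<bar> - \<bar>H\<bar>" 0] by (simp add: power2_eq_square field_simps)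
  finally have "\<bar>B\<bar>\<^sup>2 \<le> ((\<bar>A\<bar> + \<bar>H\<bar>) / 2)\<^sup>2" by simp
  then show "\<bar>B\<bar> \<le> (\<bar>A\<bar> + \<bar>H\<bar>) / 2" by (rule power2_le_imp_le) simp
  show "\<bar>A\<bar> + \<bar>H\<bar> = \<bar>A + H\<bar>" using nn by (auto simp: zero_le_mult_iff)
qed

text \<open>Estimating the derivative of \<open>a + h\<close> term by term gives the constant, with
  \<open>K1\<close> for \<open>U\<close> and \<open>K2\<close> for \<open>P\<close> and
  \<open>Q\<close>. It is used twice: with bounds depending on the solution to get positivity, and
  with bounds in \<open>E\<close> alone in \<open>ah_bound\<close>.\<close>

lemma total_growth:
  assumes t: "t \<in> {-S..S}" and K: "\<And>t. t \<in> {-S..S} \<Longrightarrow> \<bar>U t x\<bar> \<le> K1" "\<And>t. t \<in> {-S..S} \<Longrightarrow> \<bar>P t x\<bar> \<le> K2" "\<And>t. t \<in> {-S..S} \<Longrightarrow> \<bar>Q t x\<bar> \<le> K2"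
  shows "0 < a t x + h t x" "a t x + h t x \<le> (a 0 x + h 0 x) * exp ((1 + 3 * K1\<^sup>2 + 2 * K2 + 2 * K2 * K1) * \<bar>t\<bar>)"
proof -
  let ?C = "1 + 3 * K1\<^sup>2 + 2 * K2 + 2 * K2 * K1"
  have d: "((\<lambda>t. a t x + h t x) has_real_derivative b t x + ((3 * (U t x)\<^sup>2 - 2 * P t x) * b t x - 2 * Q t x * U t x * a t x)) (at t within {-S..S})"
    if "t \<in> {-S..S}" for t
    by (intro derivative_intros da dh that)
  have K0: "0 \<le> K1" "0 \<le> K2" using K[OF zero_in] by linarith+
  have bd: "\<bar>b t x + ((3 * (U t x)\<^sup>2 - 2 * P t x) * b t x - 2 * Q t x * U t x * a t x)\<bar> \<le> ?C * \<bar>a t x + h t x\<bar>"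
    if t: "t \<in> {-S..S}" for t
  proof -
    let ?n = "\<bar>a t x + h t x\<bar>"
    note db = density_bound[OF invariant[OF t, of x]]
    have n1: "\<bar>a t x\<bar> \<le> ?n" using db(2) by linarith
    have n: "\<bar>b t x\<bar> \<le> ?n" "\<bar>a t x\<bar> \<le> ?n" using db n1 by auto
    have U2: "(U t x)\<^sup>2 \<le> K1\<^sup>2" using K(1)[OF t] by (metis abs_ge_zero power2_abs power_mono)
    have tri: "\<bar>p + (q - r)\<bar> \<le> \<bar>p\<bar> + q' + r'" if "\<bar>q\<bar> \<le> q'" "\<bar>r\<bar> \<le> r'" for p q r q' r' :: real
      using that by linarith
    have "\<bar>b t x + ((3 * (U t x)\<^sup>2 - 2 * P t x) * b t x - 2 * Q t x * U t x * a t x)\<bar>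
      \<le> \<bar>b t x\<bar> + (\<bar>3 * (U t x)\<^sup>2\<bar> + \<bar>2 * P t x\<bar>) * \<bar>b t x\<bar> + 2 * \<bar>Q t x\<bar> * \<bar>U t x\<bar> * \<bar>a t x\<bar>"
    proof (rule tri)
      show "\<bar>(3 * (U t x)\<^sup>2 - 2 * P t x) * b t x\<bar> \<le> (\<bar>3 * (U t x)\<^sup>2\<bar> + \<bar>2 * P t x\<bar>) * \<bar>b t x\<bar>"
        unfolding abs_mult[of "3 * (U t x)\<^sup>2 - 2 * P t x"] by (intro mult_right_mono abs_triangle_ineq4 abs_ge_zero)
      show "\<bar>2 * Q t x * U t x * a t x\<bar> \<le> 2 * \<bar>Q t x\<bar> * \<bar>U t x\<bar> * \<bar>a t x\<bar>" by (simp add: abs_mult)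
    qed
    also have "\<dots> \<le> ?n + (3 * K1\<^sup>2 + 2 * K2) * ?n + 2 * K2 * K1 * ?n"
    proof (intro add_mono n mult_mono)
      show "\<bar>3 * (U t x)\<^sup>2\<bar> \<le> 3 * K1\<^sup>2" using U2 by simp
      show "\<bar>2 * P t x\<bar> \<le> 2 * K2" using K(2)[OF t] by simp
    qed (use K(1,3)[OF t] K0 in simp_all)
    finally show ?thesis by (simp add: algebra_simps)
  qed
  have n0: "0 < a 0 x + h 0 x" by (rule init_pos)
  show "0 < a t x + h t x" by (rule gronwall_positive(1)[OF d bd n0 t])
  show "a t x + h t x \<le> (a 0 x + h 0 x) * exp (?C * \<bar>t\<bar>)" by (rule gronwall_positive(2)[OF d bd n0 t])
qed

lemma total_pos: "t \<in> {-S..S} \<Longrightarrow> 0 < a t x + h t x"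
proof -
  assume t: "t \<in> {-S..S}"
  obtain K1 where K1: "\<And>t. t \<in> {-S..S} \<Longrightarrow> norm (cU (X t)) \<le> K1"
    by (rule loclip_bound[OF loclip_bounded_linear[OF bl(2)]]) blast
  obtain K2 where K2: "\<And>t. t \<in> {-S..S} \<Longrightarrow> norm (cP (X t)) \<le> K2" by (rule loclip_bound[OF loclip_cP]) blast
  obtain K3 where K3: "\<And>t. t \<in> {-S..S} \<Longrightarrow> norm (cQ (X t)) \<le> K3" by (rule loclip_bound[OF loclip_cQ]) blast
  show ?thesis
    by (rule total_growth(1)[OF t, of x K1 "max K2 K3"])
      (use K1 K2 K3 in \<open>auto intro!: order_trans[OF ev_le_norm] simp: le_max_iff_disj\<close>)
qed

lemma a_nonneg: "t \<in> {-S..S} \<Longrightarrow> 0 \<le> a t x" and h_nonneg: "t \<in> {-S..S} \<Longrightarrow> 0 \<le> h t x"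
proof -
  assume t: "t \<in> {-S..S}"
  have "0 \<le> a t x * h t x" unfolding invariant[OF t] by simp
  then show "0 \<le> a t x" "0 \<le> h t x" using total_pos[OF t, of x] by (auto simp: zero_le_mult_iff)
qed

lemma U2a_le_h: "t \<in> {-S..S} \<Longrightarrow> (U t x)\<^sup>2 * a t x \<le> h t x"
proof -
  assume t: "t \<in> {-S..S}"
  show ?thesis
  proof (cases "a t x = 0")
    case False
    then have a: "0 < a t x" using a_nonneg[OF t, of x] by simp
    have "a t x * ((U t x)\<^sup>2 * a t x) \<le> a t x * h t x"
      unfolding invariant[OF t] by (simp add: power2_eq_square)
    then show ?thesis using a by simp
  qed (use h_nonneg[OF t] in simp)
qed

lemma b_le: "t \<in> {-S..S} \<Longrightarrow> \<bar>b t x\<bar> \<le> (a t x + h t x) / 2"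
  using density_bound(1)[OF invariant[of t x]] a_nonneg[of t x] h_nonneg[of t x] by simp

lemma w_nonneg: "t \<in> {-S..S} \<Longrightarrow> 0 \<le> ev (cw (X t)) x"
  using a_nonneg[of t x] h_nonneg[of t x] by (simp add: cw_def power2_eq_square[symmetric])

text \<open>Writes \<open>b_t\<close> through the two densities whose integrals over a period are
  computed in \<open>srcA_total\<close> and \<open>srcB_total\<close>; this closes the system for
  the two defects.\<close>

lemma db_total: "cb (lfield (X t)) = (1/4) *\<^sub>R ((cw (X t) - ca (X t) * srcA (ca (X t)) (cw (X t))) - (ca (X t) * srcB (ca (X t)) (cw (X t)) - cw (X t)))"
  by (rule pbm_eqI) (simp add: lfield_components cP_eq cw_def algebra_simps)

text \<open>The two defects \<open>\<integral>a - 1\<close> and \<open>\<integral>b\<close> of periodicity solve a closed linear differential inequality.\<close>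
lemma mean_a: "t \<in> {-S..S} \<Longrightarrow> antider (a t) 1 = 1" and mean_b: "t \<in> {-S..S} \<Longrightarrow> antider (b t) 1 = 0"
proof -
  assume t: "t \<in> {-S..S}"
  let ?D = "\<lambda>t. (antider (a t) 1 - 1, antider (b t) 1)"
  let ?D' = "\<lambda>t. (antider (b t) 1, antider (ev (cb (lfield (X t)))) 1)"
  obtain R where R: "\<And>t. t \<in> {-S..S} \<Longrightarrow> norm (ca (X t)) \<le> R"
    by (rule loclip_bound[OF loclip_bounded_linear[OF bl(3)]]) blast
  obtain M where M: "M \<ge> 0" "\<And>t. t \<in> {-S..S} \<Longrightarrow> norm (pexp (cumul (ca (X t))) * cw (X t)) \<le> M"
    by (rule loclip_bound[of "\<lambda>Z. pexp (cumul (ca Z)) * cw Z"])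
      (auto intro!: loclip_intros loclip_cw loclip_bounded_linear[OF bl(3)])
  obtain N where N: "N \<ge> 0" "\<And>t. t \<in> {-S..S} \<Longrightarrow> norm (pexp (- cumul (ca (X t))) * cw (X t)) \<le> N"
    by (rule loclip_bound[of "\<lambda>Z. pexp (- cumul (ca Z)) * cw Z"])
      (auto intro!: loclip_intros loclip_cw loclip_bounded_linear[OF bl(3)])
  define L where "L = (M / (exp 1 - 1) * exp (R + 1) + exp 1 * N / (exp 1 - 1) * exp (R + 1)) / 4"
  have e: "exp 1 - 1 > (0::real)" by simp
  have L: "\<bar>antider (ev (cb (lfield (X t)))) 1\<bar> \<le> L * \<bar>antider (a t) 1 - 1\<bar>" if t: "t \<in> {-S..S}" for t
  proof -
    let ?\<alpha> = "antider (a t) 1 - 1"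
    let ?G = "antider (ev (pexp (cumul (ca (X t))) * cw (X t))) 1" and ?V = "antider (ev (pexp (- cumul (ca (X t))) * cw (X t))) 1"
    have al: "\<bar>?\<alpha>\<bar> \<le> R + 1" using antider_ev_le[of "ca (X t)" 1] R[OF t] by simp
    have G: "\<bar>?G\<bar> \<le> M" "\<bar>?V\<bar> \<le> N"
      using antider_ev_le[of "pexp (cumul (ca (X t))) * cw (X t)" 1] antider_ev_le[of "pexp (- cumul (ca (X t))) * cw (X t)" 1] M(2)[OF t] N(2)[OF t] by linarith+
    have eq: "antider (ev (cb (lfield (X t)))) 1 =
      (?G / (exp 1 - 1) * (exp (- ?\<alpha>) - 1) - exp 1 * ?V / (exp 1 - 1) * (exp ?\<alpha> - 1)) / 4"
      unfolding db_total antider_scaleR antider_diff[of _ "_ - cw (X t)"] srcA_total srcB_total by simp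
    have "\<bar>antider (ev (cb (lfield (X t)))) 1\<bar> \<le> (\<bar>?G\<bar> / (exp 1 - 1) * \<bar>exp (- ?\<alpha>) - 1\<bar> + exp 1 * \<bar>?V\<bar> / (exp 1 - 1) * \<bar>exp ?\<alpha> - 1\<bar>) / 4"
      unfolding eq abs_divide using e by (auto simp: abs_mult intro!: divide_right_mono order_trans[OF abs_triangle_ineq4])
    also have "\<dots> \<le> (M / (exp 1 - 1) * (exp (R + 1) * \<bar>?\<alpha>\<bar>) + exp 1 * N / (exp 1 - 1) * (exp (R + 1) * \<bar>?\<alpha>\<bar>)) / 4"
    proof -
      have "\<bar>- ?\<alpha>\<bar> \<le> R + 1" using al by linarith
      then have "\<bar>exp (- ?\<alpha>) - 1\<bar> \<le> exp (R + 1) * \<bar>?\<alpha>\<bar>"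
        using exp_minus_one_le[of "- ?\<alpha>" "R + 1"] by (simp only: abs_minus_cancel)
      then show ?thesis using e G M(1) N(1) exp_minus_one_le[OF al]
        by (intro divide_right_mono add_mono mult_mono mult_left_mono) auto
    qed
    also have "\<dots> = L * \<bar>?\<alpha>\<bar>" by (simp add: L_def algebra_simps add_divide_distrib)
    finally show ?thesis .
  qed
  have L0: "0 \<le> L" using M N e by (auto simp: L_def)
  have "?D t = 0"
  proof (rule linear_growth_zero_symmetric[of S ?D ?D' "1 + L"])
    fix t assume t: "t \<in> {-S..S}"
    have "((\<lambda>t. antider (a t) 1 - 1) has_real_derivative antider (b t) 1) (at t within {-S..S})"
      using DERIV_diff[OF d_antider[OF bl(3) t, of 1] DERIV_const] by (simp add: lfield_components)
    then show "(?D has_vector_derivative ?D' t) (at t within {-S..S})"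
      using d_antider[OF bl(4) t, of 1]
      by (intro has_vector_derivative_Pair) (simp_all add: has_real_derivative_iff_has_vector_derivative)
    have "norm (?D' t) \<le> \<bar>antider (b t) 1\<bar> + \<bar>antider (ev (cb (lfield (X t)))) 1\<bar>"
      by (rule order_trans[OF norm_Pair_le]) simp
    also have "\<dots> \<le> norm (?D t) + L * norm (?D t)"
      using norm_snd_le[of "antider (b t) 1" "antider (a t) 1 - 1"] L[OF t]
        mult_left_mono[OF norm_fst_le[of "antider (a t) 1 - 1" "antider (b t) 1"] L0]
      by simp
    finally show "norm (?D' t) \<le> (1 + L) * norm (?D t)" by (simp add: algebra_simps)
  qed (use init_mean t in \<open>simp_all add: zero_prod_def\<close>)
  then show "antider (a t) 1 = 1" "antider (b t) 1 = 0" by (simp_all add: zero_prod_def)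
qed

lemma primitive_A: "t \<in> {-S..S} \<Longrightarrow> primitive (ev (srcA (ca (X t)) (cw (X t)))) (ev (cw (X t) - ca (X t) * srcA (ca (X t)) (cw (X t))))"
  and primitive_B: "t \<in> {-S..S} \<Longrightarrow> primitive (ev (srcB (ca (X t)) (cw (X t)))) (ev (ca (X t) * srcB (ca (X t)) (cw (X t)) - cw (X t)))"
  using src_primitive[OF mean_a] by blast+

lemma primitive_P: "t \<in> {-S..S} \<Longrightarrow> primitive (P t) (\<lambda>x. a t x * Q t x)"
proof -
  assume t: "t \<in> {-S..S}"
  have "P t = (\<lambda>x. 1/4 * (ev (srcA (ca (X t)) (cw (X t))) x + ev (srcB (ca (X t)) (cw (X t))) x))"
    by (rule ext) (simp add: cP_eq)
  then show ?thesis
    using primitive_cmult[OF primitive_add[OF primitive_A[OF t] primitive_B[OF t]], of "1/4"]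
    by (simp add: cQ_eq algebra_simps)
qed

text \<open>The label form of \<open>P_xx = P - (u^2 + u_x^2 / 2)\<close>.\<close>

lemma primitive_Q: "t \<in> {-S..S} \<Longrightarrow> primitive (Q t) (\<lambda>x. a t x * P t x - ev (cw (X t)) x / 2)"
proof -
  assume t: "t \<in> {-S..S}"
  have "Q t = (\<lambda>x. 1/4 * (ev (srcB (ca (X t)) (cw (X t))) x - ev (srcA (ca (X t)) (cw (X t))) x))"
    by (rule ext) (simp add: cQ_eq)
  then show ?thesis
    using primitive_cmult[OF primitive_diff[OF primitive_B[OF t] primitive_A[OF t]], of "1/4"]
    by (simp add: cP_eq algebra_simps)
qed

text \<open>The defect has zero time derivative: \<open>U_t = - Q\<close>, and by
  \<open>primitive_Q\<close> the time derivative of \<open>b\<close> is the label derivative of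
  \<open>- Q\<close>.\<close>

lemma U_consistent: "t \<in> {-S..S} \<Longrightarrow> U t x = U t 0 + antider (b t) (frac x)"
proof -
  assume t: "t \<in> {-S..S}"
  let ?G = "\<lambda>t. U t x - U t 0 - antider (b t) (frac x)"
  have "(?G has_real_derivative 0) (at t within {-S..S})" if t: "t \<in> {-S..S}" for t
  proof -
    have "(?G has_real_derivative - Q t x - - Q t 0 - antider (ev (cb (lfield (X t)))) (frac x)) (at t within {-S..S})"
      by (intro derivative_intros dU t d_antider bl)
    moreover have "antider (ev (cb (lfield (X t)))) (frac x) = - (Q t (frac x) - Q t 0)"
    proof -
      have eq: "ev (cb (lfield (X t))) = (\<lambda>x. - (a t x * P t x - ev (cw (X t)) x / 2))"
        by (rule ext) (simp add: lfield_components cw_def power2_eq_square algebra_simps)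
      have "primitive (\<lambda>x. - Q t x) (ev (cb (lfield (X t))))"
        unfolding eq using primitive_cmult[OF primitive_Q[OF t], of "-1"] by simp
      from primitive_unique_diff[OF ev_primitive this, of "frac x" 0] show ?thesis by simp
    qed
    moreover have "Q t (frac x) = Q t x" by (rule periodic_frac) (rule ev_periodic)
    ultimately show ?thesis by simp
  qed
  from constant_if_zero_derivative[OF this t] have "?G t = ?G 0" .
  moreover have "?G 0 = 0" using init_U[of x] by linarith
  ultimately show ?thesis by simp
qed

lemma z_consistent: "t \<in> {-S..S} \<Longrightarrow> zz t x = zz t 0 + antider (a t) (frac x) - frac x"
proof -
  assume t: "t \<in> {-S..S}"
  let ?G = "\<lambda>t. zz t x - zz t 0 - antider (a t) (frac x)"
  have "(?G has_real_derivative 0) (at t within {-S..S})" if t: "t \<in> {-S..S}" for t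
  proof -
    have "(?G has_real_derivative U t x - U t 0 - antider (ev (ca (lfield (X t)))) (frac x)) (at t within {-S..S})"
      by (intro derivative_intros dz t d_antider bl)
    then show ?thesis using U_consistent[OF t, of x] by (simp add: lfield_components)
  qed
  from constant_if_zero_derivative[OF this t] have "?G t = ?G 0" .
  moreover have "?G 0 = - frac x" using init_z[of x] by linarith
  ultimately show ?thesis by simp
qed

lemma primitive_U: "t \<in> {-S..S} \<Longrightarrow> primitive (U t) (b t)"
proof (rule periodic_primitive)
  assume t: "t \<in> {-S..S}"
  show "U t x = U t 0 + antider (b t) x" if "0 \<le> x" "x < 1" for x
    using U_consistent[OF t, of x] that by (simp add: frac_eq)
  show "antider (b t) 1 = 0" by (rule mean_b[OF t])
qed (rule ev_periodic)

lemma primitive_y: "t \<in> {-S..S} \<Longrightarrow> primitive (\<lambda>x. x + zz t x) (a t)"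
proof -
  assume t: "t \<in> {-S..S}"
  have c: "antider (ev (cst 1)) x = x" for x
    by (auto simp: antider_def cst.rep_eq)
  have "primitive (zz t) (ev (ca (X t) - cst 1))"
  proof (rule periodic_primitive)
    show "zz t x = zz t 0 + antider (ev (ca (X t) - cst 1)) x" if "0 \<le> x" "x < 1" for x
      using z_consistent[OF t, of x] that by (simp add: antider_diff c frac_eq)
    show "antider (ev (ca (X t) - cst 1)) 1 = 0" using mean_a[OF t] by (simp add: antider_diff c)
  qed (rule ev_periodic)
  from primitive_add[OF this ev_primitive[of "cst 1"]] show ?thesis by (simp add: c add.commute)
qed

text \<open>\<open>h_t\<close> is the label derivative of the periodic function
  \<open>U^3 - 2 P U\<close>.\<close>

lemma energy: "t \<in> {-S..S} \<Longrightarrow> antider (h t) 1 = E"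
proof -
  assume t: "t \<in> {-S..S}"
  have "((\<lambda>t. antider (h t) 1) has_real_derivative 0) (at t within {-S..S})" if t: "t \<in> {-S..S}" for t
  proof -
    let ?f = "\<lambda>x. U t x * U t x * U t x - 2 * (P t x * U t x)"
    have "primitive ?f (\<lambda>x. ((b t x * U t x + U t x * b t x) * U t x + U t x * U t x * b t x) - 2 * ((a t x * Q t x) * U t x + P t x * b t x))"
      by (intro primitive_mult primitive_diff primitive_cmult primitive_U[OF t] primitive_P[OF t])
    moreover have "(\<lambda>x. ((b t x * U t x + U t x * b t x) * U t x + U t x * U t x * b t x) - 2 * ((a t x * Q t x) * U t x + P t x * b t x)) = ev (ch (lfield (X t)))"
      by (rule ext) (simp add: lfield_components algebra_simps)
    ultimately have "primitive ?f (ev (ch (lfield (X t))))" by simp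
    from primitive_unique_diff[OF ev_primitive this, of 1 0]
    have "antider (ev (ch (lfield (X t)))) 1 = 0"
      using ev_periodic[of "cU (X t)" 0] ev_periodic[of "cP (X t)" 0] by simp
    then show ?thesis using d_antider[OF bl(5) t, of 1] by simp
  qed
  from constant_if_zero_derivative[OF this t] have "antider (h t) 1 = antider (h 0) 1" .
  then show ?thesis using init_mean(3) by simp
qed

lemma E_nonneg: "0 \<le> E"
  using antider_nonneg[of "ch (X 0)" 1] h_nonneg[OF zero_in] energy[OF zero_in] by simp

text \<open>Since \<open>\<bar>b\<bar> \<le> (a + h) / 2\<close>, the oscillation of
  \<open>U\<close> is at most \<open>(1 + E) / 2\<close>. Since
  \<open>2 \<bar>U\<bar> a \<le> a + U^2 a \<le> a + h\<close>, so is the average of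
  \<open>\<bar>U\<bar>\<close> against the probability density \<open>a\<close>. The two add up to
  \<open>1 + E\<close>.\<close>

lemma U_bound: "t \<in> {-S..S} \<Longrightarrow> \<bar>U t x\<bar> \<le> 1 + E"
proof -
  assume t: "t \<in> {-S..S}"
  define f where "f = (1/2) *\<^sub>R (ca (X t) + ch (X t))"
  have f: "\<bar>b t x\<bar> \<le> ev f x" for x using b_le[OF t, of x] by (simp add: f_def)
  have f0: "0 \<le> ev f x" for x using f[of x] by linarith
  have fb: "0 \<le> ev (f - cb (X t)) x" "0 \<le> ev (f + cb (X t)) x" for x
    using f[of x] by (simp_all add: abs_le_iff)
  have f1: "antider (ev f) 1 = (1 + E) / 2" by (simp add: f_def antider_scaleR antider_add mean_a[OF t] energy[OF t])
  have le: "\<bar>antider (b t) x - antider (b t) y\<bar> \<le> (1 + E) / 2" if xy: "0 \<le> x" "x \<le> 1" "0 \<le> y" "y \<le> 1" "y \<le> x" for x y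
  proof -
    have "primitive (\<lambda>x. antider (ev f) x - antider (b t) x) (ev (f - cb (X t)))"
      using primitive_diff[OF ev_primitive[of f] ev_primitive[of "cb (X t)"]] by (simp add: minus_pbm.rep_eq)
    from primitive_unique_diff[OF this ev_primitive, of x y]
    have 1: "antider (b t) x - antider (b t) y \<le> antider (ev f) x - antider (ev f) y"
      using antider_mono_arg[of "f - cb (X t)" y x, OF fb(1) xy(5)] by linarith
    have "primitive (\<lambda>x. antider (ev f) x + antider (b t) x) (ev (f + cb (X t)))"
      using primitive_add[OF ev_primitive[of f] ev_primitive[of "cb (X t)"]] by (simp add: plus_pbm.rep_eq)
    from primitive_unique_diff[OF this ev_primitive, of x y]
    have 2: "- (antider (b t) x - antider (b t) y) \<le> antider (ev f) x - antider (ev f) y"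
      using antider_mono_arg[of "f + cb (X t)" y x, OF fb(2) xy(5)] by linarith
    have "antider (ev f) x \<le> antider (ev f) 1" "0 \<le> antider (ev f) y"
      using antider_mono_arg[OF f0 xy(2)] antider_nonneg[OF f0 xy(3)] by auto
    with 1 2 f1 show ?thesis by linarith
  qed
  have dU: "\<bar>U t x\<bar> \<le> \<bar>U t y\<bar> + (1 + E) / 2" for y
  proof -
    have "\<bar>antider (b t) (frac x) - antider (b t) (frac y)\<bar> \<le> (1 + E) / 2"
      using le[of "frac x" "frac y"] le[of "frac y" "frac x"] frac_lt_1[of x] frac_lt_1[of y]
      by (cases "frac y \<le> frac x") (auto simp: abs_minus_commute less_imp_le)
    then show ?thesis using U_consistent[OF t, of x] U_consistent[OF t, of y] by linarith
  qed
  have "antider (ev (\<bar>U t x\<bar> *\<^sub>R ca (X t))) 1 \<le>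
      antider (ev ((1/2) *\<^sub>R (ca (X t) + ch (X t)) + ((1 + E) / 2) *\<^sub>R ca (X t))) 1"
  proof (rule antider_mono)
    fix y
    have "2 * \<bar>U t y\<bar> \<le> 1 + (U t y)\<^sup>2" using sum_squares_ge_zero[of "\<bar>U t y\<bar> - 1" 0] by (simp add: power2_eq_square algebra_simps)
    then have "2 * \<bar>U t y\<bar> * a t y \<le> (1 + (U t y)\<^sup>2) * a t y" by (rule mult_right_mono) (rule a_nonneg[OF t])
    also have "\<dots> \<le> a t y + h t y" using U2a_le_h[OF t, of y] by (simp add: algebra_simps)
    finally have "2 * \<bar>U t y\<bar> * a t y \<le> a t y + h t y" .
    moreover have "\<bar>U t x\<bar> * a t y \<le> (\<bar>U t y\<bar> + (1 + E) / 2) * a t y" by (rule mult_right_mono[OF dU a_nonneg[OF t]])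
    ultimately show "ev (\<bar>U t x\<bar> *\<^sub>R ca (X t)) y \<le> ev ((1/2) *\<^sub>R (ca (X t) + ch (X t)) + ((1 + E) / 2) *\<^sub>R ca (X t)) y"
      by (simp add: algebra_simps)
  qed simp
  then show ?thesis by (simp add: antider_scaleR antider_add mean_a[OF t] energy[OF t] field_simps)
qed

lemma w_mean: "t \<in> {-S..S} \<Longrightarrow> antider (ev (cw (X t))) 1 \<le> 2 * E"
proof -
  assume t: "t \<in> {-S..S}"
  have "antider (ev (cw (X t))) 1 \<le> antider (ev (2 *\<^sub>R ch (X t))) 1"
    by (rule antider_mono) (use U2a_le_h[OF t] in \<open>auto simp: cw_def power2_eq_square\<close>)
  then show ?thesis by (simp add: antider_scaleR energy[OF t])
qed

text \<open>With \<open>w_mean\<close>, \<open>srcA_bound\<close> and \<open>srcB_bound\<close> give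
  \<open>2 * CE\<close> for each operator; the factor 1/4 in \<open>P\<close> and \<open>Q\<close>
  leaves \<open>CE\<close>.\<close>

definition "CE = exp 1 * exp 1 / (exp 1 - 1) * E"

lemma PQ_bound: assumes t: "t \<in> {-S..S}" shows "\<bar>P t x\<bar> \<le> CE" "\<bar>Q t x\<bar> \<le> CE"
proof -
  let ?k = "exp 1 * exp 1 / (exp 1 - 1) :: real"
  have "?k * antider (ev (cw (X t))) 1 \<le> ?k * (2 * E)" using w_mean[OF t] by (intro mult_left_mono) auto
  also have "\<dots> = 2 * CE" by (simp add: CE_def)
  finally have k: "?k * antider (ev (cw (X t))) 1 \<le> 2 * CE" .
  note A = srcA_bound[of "ca (X t)" "cw (X t)" x, OF a_nonneg[OF t] mean_a[OF t] w_nonneg[OF t]]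
  note B = srcB_bound[of "ca (X t)" "cw (X t)" x, OF a_nonneg[OF t] mean_a[OF t] w_nonneg[OF t]]
  have "0 \<le> ev (srcA (ca (X t)) (cw (X t))) x" "ev (srcA (ca (X t)) (cw (X t))) x \<le> 2 * CE"
    "0 \<le> ev (srcB (ca (X t)) (cw (X t))) x" "ev (srcB (ca (X t)) (cw (X t))) x \<le> 2 * CE"
    using A(1) B(1) order_trans[OF A(2) k] order_trans[OF B(2) k] by simp_all
  then show "\<bar>P t x\<bar> \<le> CE" "\<bar>Q t x\<bar> \<le> CE" unfolding cP_eq cQ_eq by auto
qed

lemma ah_bound: "t \<in> {-S..S} \<Longrightarrow> a t x + h t x \<le> (a 0 x + h 0 x) * exp ((1 + 3 * (1 + E)\<^sup>2 + 2 * CE + 2 * CE * (1 + E)) * \<bar>t\<bar>)"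
  by (rule total_growth(2)) (auto intro: U_bound PQ_bound)

end

section \<open>Global Lagrangian solutions\<close>

lemma norm_lstate_le: "norm Z \<le> norm (cz Z) + norm (cU Z) + norm (ca Z) + norm (cb Z) + norm (ch Z)"
proof -
  obtain z U a b h where Z: "Z = (z, U, a, b, h)" by (metis surj_pair)
  have "norm (z, U, a, b, h) \<le> norm z + norm (U, a, b, h)" "norm (U, a, b, h) \<le> norm U + norm (a, b, h)"
    "norm (a, b, h) \<le> norm a + norm (b, h)" "norm (b, h) \<le> norm b + norm h"
    by (rule norm_Pair_le)+
  then show ?thesis by (simp add: Z cz_def cU_def ca_def cb_def ch_def)
qed

theorem lagrangian_global_existence:
  assumes init: "linit Z E"
  shows "\<exists>X. X 0 = Z \<and> (\<forall>t. (X has_vector_derivative lfield (X t)) (at t))"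
proof (rule global_solution_exists[OF loclip_lfield])
  fix T :: real assume "T > 0"
  \<comment> \<open>The exponent of \<open>ah_bound\<close>, with \<open>\<bar>t\<bar>\<close>
    replaced by \<open>T\<close> and the coefficient by its absolute value: the bound depends on
    \<open>Z\<close>, \<open>E\<close> and \<open>T\<close> but not on the solution.\<close>
  define K where "K = (norm (ca Z) + norm (ch Z)) * exp (\<bar>1 + 3 * (1 + E)\<^sup>2 + 2 * lagrangian_solution.CE E + 2 * lagrangian_solution.CE E * (1 + E)\<bar> * T)"
  have "norm (X t) \<le> (norm (cz Z) + (1 + E) * T) + (1 + E) + K + K + K"
    if S: "0 < S" "S \<le> T" and sol: "solves_on lfield S X" and X0: "X 0 = Z" and t: "t \<in> {-S..S}" for S X t
  proof -
    interpret lagrangian_solution X S E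
      by unfold_locales (use S sol X0 init in auto)
    have tT: "\<bar>t\<bar> \<le> T" using t that(2) by auto
    have zz: "\<bar>ev (cz (X t)) x\<bar> \<le> norm (cz Z) + (1 + E) * T" for x
    proof -
      have "norm (zz t x - zz 0 x) \<le> (1 + E) * norm (t - 0)"
        by (rule field_differentiable_bound[of "{-S..S}", OF _ dz]) (use U_bound t S in auto)
      also have "\<dots> \<le> (1 + E) * T" using tT E_nonneg by (intro mult_left_mono) auto
      finally show ?thesis using ev_le_norm[of "cz Z" x] X0 by (simp add: abs_le_iff)
    qed
    have ah: "a t x + h t x \<le> K" for x
    proof -
      let ?C = "1 + 3 * (1 + E)\<^sup>2 + 2 * CE + 2 * CE * (1 + E)"
      have "a t x + h t x \<le> (a 0 x + h 0 x) * exp (?C * \<bar>t\<bar>)" by (rule ah_bound[OF t])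
      also have "\<dots> \<le> (norm (ca Z) + norm (ch Z)) * exp (\<bar>?C\<bar> * T)"
      proof (rule mult_mono)
        show "a 0 x + h 0 x \<le> norm (ca Z) + norm (ch Z)"
          using ev_le_norm[of "ca Z" x] ev_le_norm[of "ch Z" x] X0 by simp
        have "?C * \<bar>t\<bar> \<le> \<bar>?C\<bar> * \<bar>t\<bar>" by (intro mult_right_mono) auto
        also have "\<dots> \<le> \<bar>?C\<bar> * T" using tT by (intro mult_left_mono) auto
        finally show "exp (?C * \<bar>t\<bar>) \<le> exp (\<bar>?C\<bar> * T)" by simp
      qed auto
      finally show ?thesis by (simp add: K_def)
    qed
    have "norm (cz (X t)) \<le> norm (cz Z) + (1 + E) * T" by (rule norm_pbm_le[OF zz])
    moreover have "norm (cU (X t)) \<le> 1 + E" by (rule norm_pbm_le[OF U_bound[OF t]])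
    moreover have "norm (ca (X t)) \<le> K" "norm (cb (X t)) \<le> K" "norm (ch (X t)) \<le> K"
    proof -
      have *: "\<bar>a t x\<bar> \<le> K" "\<bar>b t x\<bar> \<le> K" "\<bar>h t x\<bar> \<le> K" for x
        using ah[of x] a_nonneg[OF t, of x] h_nonneg[OF t, of x] b_le[OF t, of x] by auto
      show "norm (ca (X t)) \<le> K" "norm (cb (X t)) \<le> K" "norm (ch (X t)) \<le> K"
        by (intro norm_pbm_le *)+
    qed
    ultimately show ?thesis using norm_lstate_le[of "X t"] by linarith
  qed
  then show "\<exists>M. \<forall>S X. 0 < S \<longrightarrow> S \<le> T \<longrightarrow> solves_on lfield S X \<longrightarrow> X 0 = Z \<longrightarrow> (\<forall>t\<in>{-S..S}. norm (X t) \<le> M)"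
    by blast
qed

text \<open>The equation for \<open>A\<close> makes \<open>exp y * A\<close> a primitive of
  \<open>exp y * w\<close>. Going back \<open>n\<close> periods multiplies the boundary term by
  \<open>exp (- n)\<close>, so in the limit the periodic solution is the integral over the whole
  half-line.\<close>

lemma exp_primitive_left:
  assumes y: "primitive y a" and A: "primitive A (\<lambda>x. w x - a x * A x)" and w: "\<And>x. 0 \<le> w x"
    and per: "\<And>x. y (x + 1) = y x + 1" "\<And>x. A (x + 1) = A x" and A0: "\<And>x. 0 \<le> A x"
  shows "(\<integral>\<^sup>+\<eta>\<in>{..\<xi>}. ennreal (exp (y \<eta> - y \<xi>) * w \<eta>) \<partial>lborel) = ennreal (A \<xi>)"
proof -
  have yn: "y (x + real n) = y x + real n" for x n
  proof (induction n)
    case (Suc n)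
    have "x + real (Suc n) = x + real n + 1" by simp
    then show ?case using per(1)[of "x + real n"] Suc by (simp add: algebra_simps)
  qed simp
  have An: "A (x + real n) = A x" for x n
    using periodic_int[of A x "int n", OF per(2)] by simp
  let ?F = "\<lambda>x. exp (y x) * A x"
  have "primitive ?F (\<lambda>x. (exp (y x) * a x) * A x + exp (y x) * (w x - a x * A x))"
    by (intro primitive_mult A primitive_compose[OF y, where \<phi> = exp]) (auto intro!: derivative_eq_intros continuous_intros)
  then have F: "primitive ?F (\<lambda>x. exp (y x) * w x)" by (simp add: algebra_simps)
  have F': "primitive (\<lambda>x. exp (- y \<xi>) * ?F x) (\<lambda>x. exp (- y \<xi>) * (exp (y x) * w x))"
    by (rule primitive_cmult[OF F])
  have eqd: "(\<lambda>x. exp (- y \<xi>) * (exp (y x) * w x)) = (\<lambda>x. exp (y x - y \<xi>) * w x)"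
    by (simp add: exp_diff exp_minus field_simps)
  note F'' = F'[unfolded eqd]
  have [measurable]: "(\<lambda>x. exp (y x - y \<xi>) * w x) \<in> borel_measurable borel"
    by (rule primitive_measurable[OF F''])
  have seg: "(\<integral>\<^sup>+\<eta>\<in>{\<xi> - real n..\<xi>}. ennreal (exp (y \<eta> - y \<xi>) * w \<eta>) \<partial>lborel) = ennreal (A \<xi> * (1 - exp (- real n)))" for n
  proof -
    have A: "A (\<xi> - real n) = A \<xi>" and "y (\<xi> - real n) = y \<xi> - real n"
      using An[of "\<xi> - real n" n] yn[of "\<xi> - real n" n] by simp_all
    then have e: "exp (y (\<xi> - real n)) = exp (y \<xi>) * exp (- real n)"
      by (simp add: exp_add[symmetric])
    have "exp (- y \<xi>) * ?F \<xi> - exp (- y \<xi>) * ?F (\<xi> - real n) = (exp (- y \<xi>) * exp (y \<xi>)) * (A \<xi> * (1 - exp (- real n)))"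
      by (simp add: e A algebra_simps)
    then have "exp (- y \<xi>) * ?F \<xi> - exp (- y \<xi>) * ?F (\<xi> - real n) = A \<xi> * (1 - exp (- real n))"
      by (simp add: exp_minus_inverse mult.commute[of "exp (- y \<xi>)"])
    moreover have "(\<integral>\<^sup>+\<eta>\<in>{\<xi> - real n..\<xi>}. ennreal (exp (y \<eta> - y \<xi>) * w \<eta>) \<partial>lborel)
       = ennreal (exp (- y \<xi>) * ?F \<xi> - exp (- y \<xi>) * ?F (\<xi> - real n))"
      by (rule primitive_nn_integral[OF F'']) (use w in auto)
    ultimately show ?thesis by simp
  qed
  have "(\<lambda>n. \<integral>\<^sup>+\<eta>\<in>{\<xi> - real n..\<xi>}. ennreal (exp (y \<eta> - y \<xi>) * w \<eta>) \<partial>lborel)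
      \<longlonglongrightarrow> (\<integral>\<^sup>+\<eta>\<in>{..\<xi>}. ennreal (exp (y \<eta> - y \<xi>) * w \<eta>) \<partial>lborel)"
  proof (rule nn_integral_LIMSEQ)
    show "incseq (\<lambda>n \<eta>. ennreal (exp (y \<eta> - y \<xi>) * w \<eta>) * indicator {\<xi> - real n..\<xi>} \<eta>)"
      by (auto simp: incseq_def le_fun_def indicator_def)
    fix \<eta>
    obtain N where N: "\<xi> - \<eta> \<le> real N" using real_arch_simple by blast
    then have "ennreal (exp (y \<eta> - y \<xi>) * w \<eta>) * indicator {\<xi> - real n..\<xi>} \<eta>
       = ennreal (exp (y \<eta> - y \<xi>) * w \<eta>) * indicator {..\<xi>} \<eta>" if "n \<ge> N" for n
      using that by (auto simp: indicator_def)
    then show "(\<lambda>n. ennreal (exp (y \<eta> - y \<xi>) * w \<eta>) * indicator {\<xi> - real n..\<xi>} \<eta>)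
       \<longlonglongrightarrow> ennreal (exp (y \<eta> - y \<xi>) * w \<eta>) * indicator {..\<xi>} \<eta>"
      by (intro tendsto_eventually) (auto simp: eventually_sequentially)
  qed simp
  moreover have "(\<lambda>n. ennreal (A \<xi> * (1 - exp (- real n)))) \<longlonglongrightarrow> ennreal (A \<xi> * (1 - 0))"
  proof (intro tendsto_ennrealI tendsto_intros)
    show "(\<lambda>n. exp (- real n)) \<longlonglongrightarrow> 0"
      using LIMSEQ_realpow_zero[of "exp (-1::real)"] by (simp add: exp_of_nat_mult[symmetric])
  qed
  ultimately show ?thesis unfolding seg using LIMSEQ_unique by fastforce
qed

lemma nn_integral_reflect:
  fixes f :: "real \<Rightarrow> ennreal"
  assumes "f \<in> borel_measurable borel"
  shows "(\<integral>\<^sup>+x. f (- x) \<partial>lborel) = (\<integral>\<^sup>+x. f x \<partial>lborel)"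
  using nn_integral_real_affine[OF assms, of "-1" 0] by simp

lemma primitive_reflect:
  assumes "primitive f g" shows "primitive (\<lambda>x. - f (- x)) (\<lambda>x. g (- x))"
  unfolding primitive_def
proof (intro conjI allI impI)
  have [measurable]: "g \<in> borel_measurable borel" using assms by (rule primitive_measurable)
  show "(\<lambda>x. g (- x)) \<in> borel_measurable borel" by measurable
  fix a b :: real assume ab: "a \<le> b"
  have eq: "indicator {a..b} x *\<^sub>R g (- x) = indicator {-b..-a} (0 + (-1) * x) *\<^sub>R g (0 + (-1) * x)" for x
    by (auto simp: indicator_def)
  have "integrable lborel (\<lambda>x. indicator {-b..-a} x *\<^sub>R g x)"
    using primitive_set_integrable[OF assms, of "-b" "-a"] by (simp add: set_integrable_def)
  from lborel_integrable_real_affine[OF this, of "-1" 0] show "set_integrable lborel {a..b} (\<lambda>x. g (- x))"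
    unfolding set_integrable_def eq by simp
  have "(LINT x:{a..b}|lborel. g (- x)) = (LINT x:{-b..-a}|lborel. g x)"
    unfolding set_lebesgue_integral_def eq
    by (subst lborel_integral_real_affine[of "-1" _ 0]) auto
  then show "(LINT x:{a..b}|lborel. g (- x)) = - f (- b) - - f (- a)"
    using primitive_LINT[OF assms, of "-b" "-a"] ab by simp
qed

lemma exp_primitive_right:
  assumes y: "primitive y a" and B: "primitive B (\<lambda>x. a x * B x - w x)" and w: "\<And>x. 0 \<le> w x"
    and per: "\<And>x. y (x + 1) = y x + 1" "\<And>x. B (x + 1) = B x" and B0: "\<And>x. 0 \<le> B x"
    and [measurable]: "w \<in> borel_measurable borel"
  shows "(\<integral>\<^sup>+\<eta>\<in>{\<xi>..}. ennreal (exp (y \<xi> - y \<eta>) * w \<eta>) \<partial>lborel) = ennreal (B \<xi>)"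
proof -
  have [measurable]: "y \<in> borel_measurable borel"
    by (intro borel_measurable_continuous_onI primitive_continuous[OF y])
  have "(\<integral>\<^sup>+\<eta>\<in>{..- \<xi>}. ennreal (exp (- y (- \<eta>) - - y (- (- \<xi>))) * w (- \<eta>)) \<partial>lborel) = ennreal (B (- (- \<xi>)))"
  proof (rule exp_primitive_left)
    show "primitive (\<lambda>x. - y (- x)) (\<lambda>x. a (- x))" by (rule primitive_reflect[OF y])
    show "primitive (\<lambda>x. B (- x)) (\<lambda>x. w (- x) - a (- x) * B (- x))"
      using primitive_cmult[OF primitive_reflect[OF B], of "-1"] by simp
    show "- y (- (x + 1)) = - y (- x) + 1" for x using per(1)[of "- x - 1"] by simp
    show "B (- (x + 1)) = B (- x)" for x using per(2)[of "- x - 1"] by simp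
  qed (use w B0 in auto)
  also have "(\<integral>\<^sup>+\<eta>\<in>{..- \<xi>}. ennreal (exp (- y (- \<eta>) - - y (- (- \<xi>))) * w (- \<eta>)) \<partial>lborel)
    = (\<integral>\<^sup>+\<eta>. (\<lambda>\<eta>. ennreal (exp (y \<xi> - y \<eta>) * w \<eta>) * indicator {\<xi>..} \<eta>) (- \<eta>) \<partial>lborel)"
    by (intro nn_integral_cong) (auto simp: indicator_def)
  also have "\<dots> = (\<integral>\<^sup>+\<eta>\<in>{\<xi>..}. ennreal (exp (y \<xi> - y \<eta>) * w \<eta>) \<partial>lborel)"
    by (rule nn_integral_reflect) measurable
  finally show ?thesis by simp
qed

section \<open>Global Lagrangian solutions and the pressure as a whole-line integral\<close>

locale lagr =
  fixes X :: "real \<Rightarrow> lstate" and E :: real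
  assumes X: "\<And>t. (X has_vector_derivative lfield (X t)) (at t)" and init: "linit (X 0) E"
begin

definition "y t x = x + ev (cz (X t)) x"
abbreviation "U t \<equiv> ev (cU (X t))"
abbreviation "a t \<equiv> ev (ca (X t))"
abbreviation "b t \<equiv> ev (cb (X t))"
abbreviation "h t \<equiv> ev (ch (X t))"
abbreviation "P t \<equiv> ev (cP (X t))"
abbreviation "Q t \<equiv> ev (cQ (X t))"

text \<open>Each fact at time \<open>t\<close> is imported from the interval of half-length
  \<open>\<bar>t\<bar> + 1\<close>, in which \<open>t\<close> lies.\<close>

lemma sol: "lagrangian_solution X (\<bar>t\<bar> + 1) E"
proof
  show "solves_on lfield (\<bar>t\<bar> + 1) X"
    unfolding solves_on_def using X has_vector_derivative_at_within by blast
qed (use init in auto)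

lemma tin: "(t::real) \<in> {- (\<bar>t\<bar> + 1)..\<bar>t\<bar> + 1}" unfolding atLeastAtMost_iff by linarith

lemmas invariant = lagrangian_solution.invariant[OF sol tin]
lemmas total_pos = lagrangian_solution.total_pos[OF sol tin]
lemmas a_nonneg = lagrangian_solution.a_nonneg[OF sol tin]
lemmas h_nonneg = lagrangian_solution.h_nonneg[OF sol tin]
lemmas w_nonneg = lagrangian_solution.w_nonneg[OF sol tin]
lemmas primitive_P = lagrangian_solution.primitive_P[OF sol tin]
lemmas primitive_U = lagrangian_solution.primitive_U[OF sol tin]
lemmas energy = lagrangian_solution.energy[OF sol tin]
lemmas U_bound = lagrangian_solution.U_bound[OF sol tin]
lemmas PQ_bound = lagrangian_solution.PQ_bound[OF sol tin]
lemmas E_nonneg = lagrangian_solution.E_nonneg[OF sol]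
abbreviation "CE \<equiv> lagrangian_solution.CE E"

lemma primitive_y: "primitive (y t) (a t)"
  using lagrangian_solution.primitive_y[OF sol tin] unfolding y_def .

lemma y_periodic: "y t (x + 1) = y t x + 1"
  by (simp add: y_def ev_periodic)

lemma d_linear:
  assumes "bounded_linear \<phi>"
  shows "((\<lambda>t. \<phi> (X t)) has_real_derivative \<phi> (lfield (X t))) (at t)"
  using bounded_linear.has_vector_derivative[OF assms X]
  by (simp add: has_real_derivative_iff_has_vector_derivative)

lemma d_ev:
  assumes "bounded_linear c"
  shows "((\<lambda>t. ev (c (X t)) x) has_real_derivative ev (c (lfield (X t))) x) (at t)"
  by (rule d_linear[OF bounded_linear_compose[OF bounded_linear_ev assms]])

lemmas bl = bounded_linear_components

lemma dy: "((\<lambda>t. y t x) has_real_derivative U t x) (at t)"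
  and dU: "((\<lambda>t. U t x) has_real_derivative - Q t x) (at t)"
  and da: "((\<lambda>t. a t x) has_real_derivative b t x) (at t)"
  and db: "((\<lambda>t. b t x) has_real_derivative h t x / 2 + ((U t x)\<^sup>2 / 2 - P t x) * a t x) (at t)"
  using d_ev[OF bl(1)] d_ev[OF bl(2)] d_ev[OF bl(3)] d_ev[OF bl(4)]
  by (auto simp: lfield_components power2_eq_square mult.assoc y_def intro!: derivative_eq_intros)

lemma isCont_loclip:
  assumes "loclip F" shows "isCont (\<lambda>t. F (X t)) t"
proof -
  have iX: "isCont X t" using X has_vector_derivative_continuous by blast
  obtain L where L: "L \<ge> 0" "\<And>x y. norm x \<le> norm (X t) + 1 \<Longrightarrow> norm y \<le> norm (X t) + 1 \<Longrightarrow> norm (F x - F y) \<le> L * norm (x - y)"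
    by (rule loclipE[OF assms]) blast
  have "((\<lambda>s. norm (F (X s) - F (X t))) \<longlongrightarrow> 0) (at t)"
  proof (rule tendsto_sandwich[of "\<lambda>_. 0" _ _ "\<lambda>s. L * norm (X s - X t)"])
    have lim: "(X \<longlongrightarrow> X t) (at t)" using iX by (simp add: isCont_def)
    then have "\<forall>\<^sub>F s in at t. dist (X s) (X t) < 1" by (rule tendstoD) simp
    then show "\<forall>\<^sub>F s in at t. norm (F (X s) - F (X t)) \<le> L * norm (X s - X t)"
    proof eventually_elim
      case (elim s)
      have "norm (X s) \<le> norm (X t) + 1"
        using elim norm_triangle_ineq2[of "X s" "X t"] by (simp add: dist_norm)
      then show ?case by (intro L(2)) auto
    qed
    have "((\<lambda>s. L * norm (X s - X t)) \<longlongrightarrow> L * norm (X t - X t)) (at t)"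
      by (intro tendsto_intros lim)
    then show "((\<lambda>s. L * norm (X s - X t)) \<longlongrightarrow> 0) (at t)" by simp
  qed auto
  then have "((\<lambda>s. F (X s) - F (X t)) \<longlongrightarrow> 0) (at t)" by (rule tendsto_norm_zero_cancel)
  then show ?thesis unfolding isCont_def by (rule Lim_null[THEN iffD2])
qed

lemma isCont_ev:
  assumes "loclip F" shows "isCont (\<lambda>t. ev (F (X t)) x) t"
  using isCont_loclip[OF loclip_compose[OF loclip_bounded_linear[OF bounded_linear_ev] assms]] .

lemma isCont_U: "isCont (\<lambda>t. U t x) t" and isCont_a: "isCont (\<lambda>t. a t x) t"
  and isCont_b: "isCont (\<lambda>t. b t x) t" and isCont_h: "isCont (\<lambda>t. h t x) t"
  and isCont_Q: "isCont (\<lambda>t. Q t x) t" and isCont_P: "isCont (\<lambda>t. P t x) t"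
  by (intro isCont_ev loclip_bounded_linear bl loclip_cQ loclip_cP)+

text \<open>\<open>U a\<close> is the density of \<open>u dx\<close> in labels, so this is the
  momentum carried by a fixed range of labels; it feeds \<open>W_derivative\<close>.\<close>

lemma momentum:
  "((\<lambda>t. antider (ev (cU (X t) * ca (X t))) x) has_real_derivative
     antider (ev (cU (X t) * cb (X t) - cQ (X t) * ca (X t))) x) (at t)"
proof -
  have "((\<lambda>t. cU (X t) * ca (X t)) has_vector_derivative (cU (X t) * ca (lfield (X t)) + cU (lfield (X t)) * ca (X t))) (at t)"
    by (intro has_vector_derivative_mult bounded_linear.has_vector_derivative[OF bl(2) X] bounded_linear.has_vector_derivative[OF bl(3) X])
  from bounded_linear.has_vector_derivative[OF bounded_linear_antider_ev this, of x]
  show ?thesis by (simp add: has_real_derivative_iff_has_vector_derivative lfield_components)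
qed

text \<open>Monotonicity of \<open>y\<close> resolves the absolute value on either side of the label
  \<open>x\<close>, which leaves the two half-line integrals \<open>srcA\<close> and
  \<open>srcB\<close>.\<close>

lemma P_kernel: "(\<integral>\<^sup>+\<eta>. ennreal (exp (- \<bar>y t x - y t \<eta>\<bar>) * ev (cw (X t)) \<eta>) \<partial>lborel) = ennreal (4 * P t x)"
proof -
  let ?w = "ev (cw (X t))" and ?A = "ev (srcA (ca (X t)) (cw (X t)))" and ?B = "ev (srcB (ca (X t)) (cw (X t)))"
  have [measurable]: "y t \<in> borel_measurable borel"
    by (intro borel_measurable_continuous_onI primitive_continuous[OF primitive_y])
  have mono: "y t p \<le> y t q" if "p \<le> q" for p q
    using primitive_has_integral[OF primitive_y that] has_integral_nonneg[of "a t" "y t q - y t p" "{p..q}"] a_nonneg by auto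
  have pos: "0 \<le> ?A z" "0 \<le> ?B z" for z
    using srcA_bound(1)[of "ca (X t)" "cw (X t)"] srcB_bound(1)[of "ca (X t)" "cw (X t)"]
      a_nonneg w_nonneg lagrangian_solution.mean_a[OF sol tin] by auto
  have 1: "(\<integral>\<^sup>+\<eta>\<in>{..x}. ennreal (exp (y t \<eta> - y t x) * ?w \<eta>) \<partial>lborel) = ennreal (?A x)"
    by (rule exp_primitive_left[OF primitive_y])
      (use lagrangian_solution.primitive_A[OF sol tin] in \<open>auto simp: w_nonneg y_periodic ev_periodic pos minus_pbm.rep_eq\<close>)
  have 2: "(\<integral>\<^sup>+\<eta>\<in>{x..}. ennreal (exp (y t x - y t \<eta>) * ?w \<eta>) \<partial>lborel) = ennreal (?B x)"
    by (rule exp_primitive_right[OF primitive_y])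
      (use lagrangian_solution.primitive_B[OF sol tin] in \<open>auto simp: w_nonneg y_periodic ev_periodic pos minus_pbm.rep_eq\<close>)
  have "(\<integral>\<^sup>+\<eta>. ennreal (exp (- \<bar>y t x - y t \<eta>\<bar>) * ?w \<eta>) \<partial>lborel) =
     (\<integral>\<^sup>+\<eta>. ennreal (exp (y t \<eta> - y t x) * ?w \<eta>) * indicator {..x} \<eta> + ennreal (exp (y t x - y t \<eta>) * ?w \<eta>) * indicator {x..} \<eta> \<partial>lborel)"
  proof (rule nn_integral_cong_AE)
    have "AE \<eta> in lborel. \<eta> \<noteq> x" by (rule AE_lborel_singleton)
    then show "AE \<eta> in lborel. ennreal (exp (- \<bar>y t x - y t \<eta>\<bar>) * ?w \<eta>) =
      ennreal (exp (y t \<eta> - y t x) * ?w \<eta>) * indicator {..x} \<eta> + ennreal (exp (y t x - y t \<eta>) * ?w \<eta>) * indicator {x..} \<eta>"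
    proof eventually_elim
      case (elim \<eta>)
      then show ?case using mono[of \<eta> x] mono[of x \<eta>] by (cases "\<eta> < x") (auto simp: indicator_def)
    qed
  qed
  also have "\<dots> = ennreal (?A x) + ennreal (?B x)"
    unfolding 1[symmetric] 2[symmetric] by (rule nn_integral_add) measurable
  also have "\<dots> = ennreal (4 * P t x)" by (simp add: cP_eq ennreal_plus[symmetric] pos del: ennreal_plus)
  finally show ?thesis .
qed

end

section \<open>Lagrangian initial data\<close>

text \<open>\<open>G\<close> maps null sets to null sets: the measure of the preimage of
  \<open>N\<close> under the inverse \<open>I\<close> is the integral of the density
  \<open>g\<close> over \<open>N\<close>.\<close>

lemma AE_inverse_primitive:
  assumes G: "primitive G g" "\<And>x. 0 \<le> g x" "filterlim G at_top at_top" "filterlim G at_bot at_bot"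
    and inv: "\<And>x. I (G x) = x" and [measurable]: "I \<in> borel_measurable borel"
    and P: "AE x in lborel. P x"
  shows "AE s in lborel. P (I s)"
proof -
  have [measurable]: "g \<in> borel_measurable borel" by (rule primitive_measurable[OF G(1)])
  have [measurable]: "G \<in> borel_measurable borel"
    by (intro borel_measurable_continuous_onI primitive_continuous[OF G(1)])
  obtain N where N: "{x. \<not> P x} \<subseteq> N" "N \<in> null_sets lborel"
    using P by (auto simp: eventually_ae_filter)
  have [measurable]: "N \<in> sets borel" using N(2) by auto
  have "I -` N \<in> sets borel" using measurable_sets[of I borel borel N] by simp
  have "emeasure lborel (I -` N) = emeasure (distr (density lborel (\<lambda>x. ennreal (g x))) borel G) (I -` N)"
    by (simp add: primitive_distr_density[OF G])
  also have "\<dots> = emeasure (density lborel (\<lambda>x. ennreal (g x))) (G -` (I -` N))"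
    using \<open>I -` N \<in> sets borel\<close> by (subst emeasure_distr) auto
  also have "G -` (I -` N) = N" by (auto simp: inv)
  also have "emeasure (density lborel (\<lambda>x. ennreal (g x))) N = (\<integral>\<^sup>+x\<in>N. ennreal (g x) \<partial>lborel)"
    by (rule emeasure_density) auto
  also have "\<dots> = 0" by (rule nn_integral_null_set[OF N(2)])
  finally have "I -` N \<in> null_sets lborel" using \<open>I -` N \<in> sets borel\<close> by (auto simp: null_sets_def)
  then show ?thesis by (rule AE_I') (use N(1) in auto)
qed

lemma AE_periodic_frac:
  assumes f: "primitive f g" and per: "\<And>x. f (x + 1) = f x"
  shows "AE x in lborel. g (frac x) = g x"
proof -
  have "AE x in lborel. g x = g (x + of_int k)" for k
  proof -
    have "primitive f (\<lambda>x. g (x + of_int k))"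
      using primitive_shift[OF f, of "of_int k"] periodic_int[of f, OF per] by simp
    then show ?thesis by (rule primitive_AE_unique[OF f])
  qed
  then have "AE x in lborel. \<forall>k. g x = g (x + of_int k)" by (simp add: AE_all_countable)
  then show ?thesis
  proof eventually_elim
    case (elim x)
    then show ?case using elim[rule_format, of "- \<lfloor>x\<rfloor>"] by (simp add: frac_def)
  qed
qed

lemma periodic_set_integrable:
  fixes e :: "real \<Rightarrow> real"
  assumes [measurable]: "e \<in> borel_measurable borel" and per: "\<And>x. e (x + 1) = e x"
    and i: "set_integrable lborel {0..1} e"
  shows "set_integrable lborel {a..b} e"
proof -
  have unit: "set_integrable lborel {of_int k..of_int k + 1} e" for k :: int
  proof -
    have eq: "indicator {of_int k..of_int k + 1} x *\<^sub>R e x = indicator {0..1} (- of_int k + 1 * x) *\<^sub>R e (- of_int k + 1 * x)" for x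
      using periodic_int[of e x "- k", OF per] by (auto simp: indicator_def add.commute)
    show ?thesis
      unfolding set_integrable_def eq
      using lborel_integrable_real_affine[OF i[unfolded set_integrable_def], of 1 "- of_int k"] by simp
  qed
  obtain m n where m: "of_int m \<le> a" and n: "b \<le> of_int n" by (meson floor_correct le_of_int_ceiling of_int_floor_le)
  have "set_integrable lborel (\<Union>k\<in>{m..n}. {of_int k..of_int k + 1}) e"
    by (rule set_integrable_UN) (use unit in auto)
  then show ?thesis
  proof (rule set_integrable_subset)
    show "{a..b} \<subseteq> (\<Union>k\<in>{m..n}. {of_int k..of_int k + 1})"
    proof
      fix x assume x: "x \<in> {a..b}"
      have "m \<le> \<lfloor>x\<rfloor>" "\<lfloor>x\<rfloor> \<le> n" using x m n by (simp_all add: le_floor_iff floor_le_iff)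
      moreover have "x \<in> {of_int \<lfloor>x\<rfloor>..of_int \<lfloor>x\<rfloor> + 1}" unfolding atLeastAtMost_iff by linarith
      ultimately show "x \<in> (\<Union>k\<in>{m..n}. {of_int k..of_int k + 1})" by (intro UN_I[of "\<lfloor>x\<rfloor>"]) auto
    qed
  qed simp
qed

lemma quasi_periodic_limits:
  fixes y :: "real \<Rightarrow> real"
  assumes mono: "\<And>p q. p \<le> q \<Longrightarrow> y p \<le> y q" and per: "\<And>x. y (x + 1) = y x + 1"
  shows "filterlim y at_top at_top" "filterlim y at_bot at_bot"
proof -
  have "\<And>x. y (x + 1) - (x + 1) = y x - x" using per by simp
  then have per': "y (frac x) - frac x = y x - x" for x by (rule periodic_frac)
  have "\<bar>y x - x\<bar> \<le> \<bar>y 0\<bar> + \<bar>y 1\<bar> + 1" for x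
    using per'[of x] mono[of 0 "frac x"] mono[of "frac x" 1] frac_lt_1[of x] frac_ge_0[of x] by linarith
  then have b: "x - (\<bar>y 0\<bar> + \<bar>y 1\<bar> + 1) \<le> y x" "y x \<le> x + (\<bar>y 0\<bar> + \<bar>y 1\<bar> + 1)" for x by (smt (verit))+
  have "filterlim (\<lambda>x. - (\<bar>y 0\<bar> + \<bar>y 1\<bar> + 1) + x) at_top at_top"
    by (rule filterlim_tendsto_add_at_top[OF tendsto_const filterlim_ident])
  then show "filterlim y at_top at_top" by (rule filterlim_at_top_mono) (use b(1) in \<open>simp add: algebra_simps\<close>)
  show "filterlim y at_bot at_bot"
    unfolding filterlim_at_bot
  proof
    fix Z
    show "\<forall>\<^sub>F x in at_bot. y x \<le> Z"
      using eventually_le_at_bot[of "Z - (\<bar>y 0\<bar> + \<bar>y 1\<bar> + 1)"]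
    proof eventually_elim
      case (elim x)
      then show ?case using b(2)[of x] by linarith
    qed
  qed
qed

lemma H1_per_primitive:
  assumes "u \<in> H1_per"
  obtains g where "primitive u g" "\<And>x. g (x + 1) = g x" "AE x in lborel. deriv u x = g x"
    "set_integrable lborel {0..1} (\<lambda>x. (g x)\<^sup>2)"
proof -
  have per: "u (x + 1) = u x" for x using assms by (simp add: H1_per_def periodic1_def)
  have ac: "abs_continuous_on {a..b} u" for a b using assms by (simp add: H1_per_def)
  obtain g where g: "primitive u g" using abs_continuous_primitive[OF ac] by blast
  \<comment> \<open>The density inherits periodicity only almost everywhere; reading it from one
    period makes it exact.\<close>
  define gp where "gp x = g (frac x)" for x
  have [measurable]: "g \<in> borel_measurable borel" by (rule primitive_measurable[OF g])
  have gpm [measurable]: "gp \<in> borel_measurable borel" unfolding gp_def by measurable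
  have "AE x in lborel. g x = gp x"
    using AE_periodic_frac[OF g per] unfolding gp_def by eventually_elim simp
  then have gp: "primitive u gp" by (rule primitive_AE_cong[OF g _ gpm])
  have d: "AE x in lborel. deriv u x = gp x"
    using primitive_AE_derivative[OF gp] by eventually_elim (rule DERIV_imp_deriv)
  have "set_integrable lebesgue {0..1} (\<lambda>x. \<bar>deriv u x\<bar> powr 2)"
    using assms by (simp add: H1_per_def Lp_per_def)
  then have "integrable lebesgue (\<lambda>x. indicator {0..1} x *\<^sub>R \<bar>deriv u x\<bar> powr 2)" by (simp add: set_integrable_def)
  moreover have "AE x in lebesgue. indicator {0..1} x *\<^sub>R \<bar>deriv u x\<bar> powr 2 = indicator {0..1} x *\<^sub>R (gp x)\<^sup>2"
    unfolding AE_completion_iff using d by eventually_elim (simp add: powr_realpow[symmetric] powr_numeral)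
  moreover have "(\<lambda>x. indicator {0..1} x *\<^sub>R (gp x)\<^sup>2) \<in> borel_measurable lborel" by measurable
  ultimately have "integrable lebesgue (\<lambda>x. indicator {0..1} x *\<^sub>R (gp x)\<^sup>2)"
    by (subst integrable_cong_AE[symmetric]) (auto intro: measurable_completion)
  then have "integrable lborel (\<lambda>x. indicator {0..1} x *\<^sub>R (gp x)\<^sup>2)"
    by (subst (asm) integrable_completion) auto
  then have "set_integrable lborel {0..1} (\<lambda>x. (gp x)\<^sup>2)" by (simp add: set_integrable_def)
  moreover have "gp (x + 1) = gp x" for x by (simp add: gp_def frac_def)
  ultimately show ?thesis using that gp d by blast
qed

text \<open>The label of a position \<open>x\<close> is \<open>G x\<close>, position plus energy
  accumulated from 0, divided by \<open>1 + E\<close> so that periods correspond to periods. Then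
  \<open>a + h = 1 + E\<close> is constant: this keeps \<open>a\<close>, \<open>b\<close>,
  \<open>h\<close> bounded and makes \<open>y\<close> and \<open>U\<close> Lipschitz in the
  label.\<close>

theorem initial_data:
  assumes u: "u \<in> H1_per"
  shows "\<exists>Z E. linit Z E \<and> (\<forall>x. ev (cU Z) x = u (x + ev (cz Z) x)) \<and>
    E = (LINT x:{0..1}|lebesgue. (u x)\<^sup>2 + (deriv u x)\<^sup>2)"
proof -
  have per: "u (x + 1) = u x" for x using u by (simp add: H1_per_def periodic1_def)
  obtain g where g: "primitive u g" "\<And>x. g (x + 1) = g x" "AE x in lborel. deriv u x = g x"
    "set_integrable lborel {0..1} (\<lambda>x. (g x)\<^sup>2)" using H1_per_primitive[OF u] by blast
  note [measurable] = primitive_measurable[OF g(1)]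
  have cu: "continuous_on UNIV u" by (rule primitive_continuous[OF g(1)])
  then have [measurable]: "u \<in> borel_measurable borel" by (rule borel_measurable_continuous_onI)
  define e where "e x = (u x)\<^sup>2 + (g x)\<^sup>2" for x
  have em [measurable]: "e \<in> borel_measurable borel" unfolding e_def by measurable
  have e0: "0 \<le> e x" for x by (simp add: e_def)
  have eper: "e (x + 1) = e x" for x by (simp add: e_def per g(2))
  have "set_integrable lborel {0..1} (\<lambda>x. (u x)\<^sup>2)"
    unfolding set_integrable_def
    by (rule borel_integrable_compact) (auto intro!: continuous_intros continuous_on_subset[OF cu])
  then have "set_integrable lborel {0..1} e" unfolding e_def by (intro set_integral_add g(4))
  then have ei: "set_integrable lborel {a..b} e" for a b by (rule periodic_set_integrable[OF em eper])
  define E where "E = (LINT x:{0..1}|lborel. e x)"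
  have E0: "0 \<le> E" unfolding E_def set_lebesgue_integral_def using e0 by (intro Bochner_Integration.integral_nonneg) auto
  have pe: "primitive (antider e) e" by (rule antider_primitive_locally_integrable[OF em ei])
  have E1: "antider e 1 = E" using primitive_LINT[OF pe, of 0 1] by (simp add: E_def)
  define G where "G x = 1 / (1 + E) * (x + antider e x)" for x
  have pid: "primitive (\<lambda>x. x) (\<lambda>x. 1)"
    by (rule lipschitz_primitive[of _ 1]) auto
  have pG: "primitive G (\<lambda>x. 1 / (1 + E) * (1 + e x))"
    unfolding G_def by (intro primitive_cmult primitive_add pid pe)
  have g0: "0 \<le> 1 / (1 + E) * (1 + e x)" for x using E0 e0 by simp
  have emono: "antider e p \<le> antider e q" if "p \<le> q" for p q
    using primitive_has_integral[OF pe that] has_integral_nonneg[of e "antider e q - antider e p" "{p..q}"] e0 by auto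
  have Gexp: "(q - p) / (1 + E) \<le> G q - G p" if "p \<le> q" for p q
  proof -
    have "G q - G p = ((q - p) + (antider e q - antider e p)) / (1 + E)"
      by (simp add: G_def diff_divide_distrib add_divide_distrib)
    then show ?thesis using emono[OF that] E0 by (simp add: divide_right_mono)
  qed
  have Gmono: "G p \<le> G q" if "p \<le> q" for p q
    using Gexp[OF that] that E0 by (smt (verit) divide_nonneg_nonneg)
  have eE: "antider e (x + 1) = antider e x + E" for x
  proof -
    have "primitive (\<lambda>x. antider e (x + 1)) e" using primitive_shift[OF pe, of 1] by (simp add: eper)
    from primitive_unique_diff[OF this pe, of x 0] show ?thesis using E1 by simp
  qed
  have Gper: "G (x + 1) = G x + 1" for x
  proof -
    have "G (x + 1) = 1 / (1 + E) * ((x + antider e x) + (1 + E))" unfolding G_def eE by simp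
    also have "\<dots> = G x + 1" unfolding G_def distrib_left[of _ _ "1 + E"] using E0 by simp
    finally show ?thesis .
  qed
  note Glim = quasi_periodic_limits[of G, OF Gmono Gper]
  have cG: "continuous_on UNIV G" by (rule primitive_continuous[OF pG])
  have Ginj: "G p = G q \<longleftrightarrow> p = q" for p q
  proof
    assume "G p = G q"
    then have "(q - p) / (1 + E) \<le> 0 \<or> q < p" "(p - q) / (1 + E) \<le> 0 \<or> p < q" using Gexp[of p q] Gexp[of q p] by (auto simp: not_le)
    moreover have "\<not> p < q" "\<not> q < p"
      using Gexp[of p q] Gexp[of q p] \<open>G p = G q\<close> E0 by (auto simp: field_simps dest: less_imp_le)
    ultimately show "p = q" by linarith
  qed simp
  have Gsurj: "\<exists>x. G x = c" for c
  proof -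
    obtain s where s: "G s \<le> c" using Glim(2) unfolding filterlim_at_bot eventually_at_bot_linorder by blast
    obtain t where t: "c \<le> G t" using Glim(1) unfolding filterlim_at_top eventually_at_top_linorder by blast
    show ?thesis
    proof (cases "s \<le> t")
      case True
      then show ?thesis using IVT'[of G s c t] s t continuous_on_subset[OF cG] by auto
    next
      case False
      then have "G s = c" using s t Gmono[of t s] by auto
      then show ?thesis by blast
    qed
  qed
  define y where "y = the_inv G"
  have yG: "y (G x) = x" for x unfolding y_def by (rule the_inv_f_f) (simp add: inj_def Ginj)
  have Gy: "G (y s) = s" for s using Gsurj[of s] yG by metis
  have yper: "y (s + 1) = y s + 1" for s by (metis Gper Gy yG)
  have ylip: "\<bar>y s - y t\<bar> \<le> (1 + E) * \<bar>s - t\<bar>" for s t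
  proof -
    have *: "\<bar>p - q\<bar> \<le> (1 + E) * \<bar>G p - G q\<bar>" for p q
      using Gexp[of p q] Gexp[of q p] Gmono[of p q] Gmono[of q p] E0 by (cases "p \<le> q") (auto simp: field_simps)
    show ?thesis using *[of "y s" "y t"] by (simp add: Gy)
  qed
  have cy: "continuous_on UNIV y"
  proof -
    have "(1 + E)-lipschitz_on UNIV y" by (rule lipschitz_onI) (use ylip E0 in \<open>auto simp: dist_real_def\<close>)
    then show ?thesis by (rule lipschitz_on_continuous_on)
  qed
  then have [measurable]: "y \<in> borel_measurable borel" by (rule borel_measurable_continuous_onI)
  \<comment> \<open>The derivatives of \<open>u\<close> and \<open>G\<close> are known almost
    everywhere in position; here such facts become facts almost everywhere in the label.\<close>
  have AEy: "AE s in lborel. R (y s)" if "AE x in lborel. R x" for R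
    by (rule AE_inverse_primitive[OF pG g0 Glim yG _ that]) measurable
  define a where "a s = (1 + E) / (1 + e (y s))" for s
  define b where "b s = g (y s) * a s" for s
  define h where "h s = e (y s) * a s" for s
  have [measurable]: "a \<in> borel_measurable borel" unfolding a_def by measurable
  have [measurable]: "b \<in> borel_measurable borel" unfolding b_def by measurable
  have [measurable]: "h \<in> borel_measurable borel" unfolding h_def by measurable
  have e1: "1 + e x > 0" for x using e0[of x] by linarith
  have ah: "a s + h s = 1 + E" for s
  proof -
    have "1 + e (y s) \<noteq> 0" using e1[of "y s"] by simp
    have "a s + h s = (1 + e (y s)) * a s" by (simp add: h_def distrib_right)
    also have "\<dots> = 1 + E" unfolding a_def using \<open>1 + e (y s) \<noteq> 0\<close> by (rule nonzero_mult_div_cancel_left[of _ "1 + E", folded times_divide_eq_right])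
    finally show ?thesis .
  qed
  have a0: "0 < a s" for s using e1[of "y s"] E0 by (simp add: a_def)
  have h0: "0 \<le> h s" for s using a0[of s] e0 by (simp add: h_def)
  have inv: "a s * h s = (u (y s) * a s)\<^sup>2 + (b s)\<^sup>2" for s
    by (simp add: h_def b_def e_def power2_eq_square algebra_simps)
  have gle: "\<bar>g x\<bar> \<le> 1 + e x" for x
  proof -
    have "2 * \<bar>g x\<bar> \<le> 1 + (g x)\<^sup>2" using sum_squares_ge_zero[of "\<bar>g x\<bar> - 1" 0] by (simp add: power2_eq_square algebra_simps)
    then show ?thesis by (simp add: e_def) (smt (verit) zero_le_power2)
  qed
  have bb: "\<bar>b s\<bar> \<le> 1 + E" for s
  proof -
    have "\<bar>b s\<bar> \<le> (1 + e (y s)) * a s" unfolding b_def abs_mult using gle[of "y s"] a0[of s] e1[of "y s"] by (intro mult_mono) auto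
    also have "\<dots> = a s + h s" by (simp add: h_def algebra_simps)
    finally show ?thesis using ah[of s] by simp
  qed
  have py: "primitive y a"
  proof (rule lipschitz_primitive[OF ylip])
    have "AE x in lborel. (G has_real_derivative 1 / (1 + E) * (1 + e x)) (at x)" by (rule primitive_AE_derivative[OF pG])
    from AEy[OF this] show "AE s in lborel. (y has_real_derivative a s) (at s)"
    proof eventually_elim
      case (elim s)
      have "(y has_real_derivative inverse (1 / (1 + E) * (1 + e (y s)))) (at s)"
      proof (rule DERIV_inverse_function[of G _ y s "s - 1" "s + 1"])
        show "1 / (1 + E) * (1 + e (y s)) \<noteq> 0" using e1[of "y s"] E0 by simp
        show "isCont y s" using cy by (simp add: continuous_on_eq_continuous_at)
      qed (use elim Gy in auto)
      then show ?case by (simp add: a_def field_simps)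
    qed
  qed simp
  have pU: "primitive (\<lambda>s. u (y s)) b"
  proof (rule lipschitz_primitive)
    \<comment> \<open>\<open>\<bar>g\<bar> \<le> 1 + e\<close> bounds the increments of
      \<open>u\<close> by those of \<open>(1 + E) G\<close>.\<close>
    have *: "\<bar>u q - u p\<bar> \<le> (1 + E) * \<bar>G q - G p\<bar>" if "p \<le> q" for p q
    proof -
      have "\<bar>u q - u p\<bar> \<le> (LINT x:{p..q}|lborel. \<bar>g x\<bar>)" by (rule primitive_abs_diff_le[OF g(1) that])
      also have "\<dots> \<le> (LINT x:{p..q}|lborel. (1 + E) * (1 / (1 + E) * (1 + e x)))"
      proof (rule set_integral_mono)
        show "set_integrable lborel {p..q} (\<lambda>x. \<bar>g x\<bar>)"
          by (rule set_integrable_abs[OF primitive_set_integrable[OF g(1)]])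
        show "set_integrable lborel {p..q} (\<lambda>x. (1 + E) * (1 / (1 + E) * (1 + e x)))"
          by (rule primitive_set_integrable[OF primitive_cmult[OF pG]])
        show "\<bar>g x\<bar> \<le> (1 + E) * (1 / (1 + E) * (1 + e x))" for x using gle[of x] E0 by simp
      qed
      also have "\<dots> = (1 + E) * G q - (1 + E) * G p"
        by (rule primitive_LINT[OF primitive_cmult[OF pG] that])
      also have "\<dots> \<le> (1 + E) * \<bar>G q - G p\<bar>" using E0 by (simp add: right_diff_distrib[symmetric])
      finally show ?thesis .
    qed
    show "\<bar>u (y s) - u (y t)\<bar> \<le> (1 + E) * \<bar>s - t\<bar>" for s t
      using *[of "y s" "y t"] *[of "y t" "y s"] by (cases "y s \<le> y t") (auto simp: Gy abs_minus_commute)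
    have "AE s in lborel. (u has_real_derivative g (y s)) (at (y s))"
      by (rule AEy[OF primitive_AE_derivative[OF g(1)]])
    with primitive_AE_derivative[OF py] show "AE s in lborel. ((\<lambda>s. u (y s)) has_real_derivative b s) (at s)"
      by eventually_elim (auto simp: b_def intro: DERIV_chain2)
  qed simp
  have aper: "a (s + 1) = a s" and bper: "b (s + 1) = b s" and hper: "h (s + 1) = h s" for s
    by (simp_all add: a_def b_def h_def yper eper g(2))
  have eva: "ev (Pbm a) = a" by (rule Pbm_ev[of a "1 + E"]) (use aper a0 h0 ah in \<open>auto simp: abs_of_pos\<close>, smt (verit))
  have evb: "ev (Pbm b) = b" by (rule Pbm_ev[of b "1 + E"]) (use bper bb in auto)
  have evh: "ev (Pbm h) = h" by (rule Pbm_ev[of h "1 + E"]) (use hper a0 h0 ah in \<open>auto simp: abs_of_nonneg\<close>, smt (verit))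
  have bounded_periodic: "\<exists>B. \<forall>x. \<bar>f x\<bar> \<le> B" if "continuous_on UNIV f" "\<And>x. f (x + 1) = f x" for f :: "real \<Rightarrow> real"
  proof -
    have "bounded (f ` {0..1})" by (intro compact_imp_bounded compact_continuous_image continuous_on_subset[OF that(1)]) auto
    then obtain B where B: "\<And>x. x \<in> {0..1} \<Longrightarrow> \<bar>f x\<bar> \<le> B" unfolding bounded_iff by fastforce
    have "\<bar>f x\<bar> \<le> B" for x using B[of "frac x"] periodic_frac[of f x, OF that(2)] frac_lt_1[of x] by simp
    then show ?thesis by blast
  qed
  have cz: "continuous_on UNIV (\<lambda>s. y s - s)" by (intro continuous_intros cy)
  have cU: "continuous_on UNIV (\<lambda>s. u (y s))" by (rule continuous_on_compose2[OF cu cy]) simp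
  have evz: "ev (Pbm (\<lambda>s. y s - s)) = (\<lambda>s. y s - s)"
  proof -
    obtain B where "\<And>x. \<bar>y x - x\<bar> \<le> B" using bounded_periodic[OF cz] yper by (metis add_diff_cancel_right)
    then show ?thesis by (intro Pbm_ev[of _ B]) (auto simp: yper)
  qed
  have evU: "ev (Pbm (\<lambda>s. u (y s))) = (\<lambda>s. u (y s))"
  proof -
    obtain B where "\<And>x. \<bar>u (y x)\<bar> \<le> B" using bounded_periodic[OF cU] yper per by metis
    then show ?thesis by (intro Pbm_ev[of _ B]) (auto simp: yper per)
  qed
  define Z :: lstate where "Z = (Pbm (\<lambda>s. y s - s), Pbm (\<lambda>s. u (y s)), Pbm a, Pbm b, Pbm h)"
  have comps: "ev (cz Z) = (\<lambda>s. y s - s)" "ev (cU Z) = (\<lambda>s. u (y s))" "ev (ca Z) = a" "ev (cb Z) = b" "ev (ch Z) = h"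
    by (simp_all add: Z_def cz_def cU_def ca_def cb_def ch_def evz evU eva evb evh)
  have ad: "antider a x = y x - y 0" "antider b x = u (y x) - u (y 0)" for x
    using primitive_unique_diff[OF ev_primitive[of "Pbm a", unfolded eva] py, of x 0]
      primitive_unique_diff[OF ev_primitive[of "Pbm b", unfolded evb] pU, of x 0] by simp_all
  have y01: "y 1 = y 0 + 1" using yper[of 0] by simp
  have "antider h 1 = E"
  proof -
    have "antider (ev (ca Z + ch Z)) 1 = antider a 1 + antider h 1" by (simp add: antider_add comps)
    moreover have "ev (ca Z + ch Z) = (\<lambda>x. 1 + E)" by (auto simp: comps ah)
    moreover have "antider (\<lambda>x. 1 + E) 1 = 1 + E" by (simp add: antider_def)
    ultimately show ?thesis using ad(1)[of 1] y01 by simp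
  qed
  moreover have "u (y (frac x)) = u (y x)" "y (frac x) - frac x = y x - x" for x
    using periodic_frac[of "\<lambda>s. u (y s)" x] periodic_frac[of "\<lambda>s. y s - s" x] by (simp_all add: yper per)
  ultimately have "linit Z E"
    unfolding linit_def comps using a0 h0 inv y01 by (auto simp: ad per add_pos_nonneg)
  moreover have "E = (LINT x:{0..1}|lebesgue. (u x)\<^sup>2 + (deriv u x)\<^sup>2)"
  proof -
    have "AE x in lebesgue. indicator {0..1} x *\<^sub>R e x = indicator {0..1} x *\<^sub>R ((u x)\<^sup>2 + (deriv u x)\<^sup>2)"
      unfolding AE_completion_iff using g(3) by eventually_elim (simp add: e_def)
    moreover have "(\<lambda>x. indicator {0..1} x *\<^sub>R e x) \<in> borel_measurable lebesgue"
      by (rule measurable_completion) measurable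
    moreover have "(\<lambda>x. indicator {0..1} x *\<^sub>R ((u x)\<^sup>2 + (deriv u x)\<^sup>2)) \<in> borel_measurable lebesgue"
    proof -
      have [measurable]: "deriv u \<in> borel_measurable lebesgue" using u by (simp add: H1_per_def Lp_per_def)
      have [measurable]: "u \<in> borel_measurable lebesgue" by (rule measurable_completion) measurable
      have [measurable]: "{0..1::real} \<in> sets lebesgue" by simp
      show ?thesis by measurable
    qed
    ultimately have "(LINT x:{0..1}|lebesgue. e x) = (LINT x:{0..1}|lebesgue. (u x)\<^sup>2 + (deriv u x)\<^sup>2)"
      unfolding set_lebesgue_integral_def by (intro integral_cong_AE)
    moreover have "(LINT x:{0..1}|lebesgue. e x) = E"
      unfolding E_def set_lebesgue_integral_def by (rule integral_completion) measurable
    ultimately show ?thesis by simp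
  qed
  moreover have "\<forall>x. ev (cU Z) x = u (x + ev (cz Z) x)" by (simp add: comps)
  ultimately show ?thesis by blast
qed

section \<open>Eulerian variables\<close>

text \<open>The preimage of a null set under \<open>y\<close> can have positive measure, as
  \<open>y\<close> may be constant on intervals; but by \<open>primitive_distr_density\<close> it
  carries no \<open>a\<close>-mass.\<close>

lemma AE_pullback:
  assumes y: "primitive y a" "\<And>x. 0 \<le> a x" "filterlim y at_top at_top" "filterlim y at_bot at_bot"
    and R: "AE x in lborel. R x"
  shows "AE \<xi> in lborel. a \<xi> = 0 \<or> R (y \<xi>)"
proof -
  have [measurable]: "a \<in> borel_measurable borel" by (rule primitive_measurable[OF y(1)])
  have [measurable]: "y \<in> borel_measurable borel"
    by (intro borel_measurable_continuous_onI primitive_continuous[OF y(1)])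
  obtain N where N: "{x. \<not> R x} \<subseteq> N" "N \<in> null_sets lborel"
    using R by (auto simp: eventually_ae_filter)
  have [measurable]: "N \<in> sets borel" using N(2) by auto
  have yN: "y -` N \<in> sets borel" using measurable_sets[of y borel borel N] by simp
  have "(\<integral>\<^sup>+\<xi>\<in>y -` N. ennreal (a \<xi>) \<partial>lborel) = emeasure (density lborel (\<lambda>x. ennreal (a x))) (y -` N)"
    by (rule emeasure_density[symmetric]) (use yN in auto)
  also have "\<dots> = emeasure (distr (density lborel (\<lambda>x. ennreal (a x))) borel y) N"
    by (subst emeasure_distr) auto
  also have "\<dots> = 0" using N(2) by (simp add: primitive_distr_density[OF y] null_sets_def)
  finally have "AE \<xi> in lborel. ennreal (a \<xi>) * indicator (y -` N) \<xi> = 0"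
    using yN by (subst (asm) nn_integral_0_iff_AE) auto
  then show ?thesis
  proof eventually_elim
    case (elim \<xi>)
    then show ?case using N(1) y(2)[of \<xi>] by (auto simp: indicator_def split: if_splits)
  qed
qed

lemma nn_integral_pullback:
  assumes y: "primitive y a" "\<And>x. 0 \<le> a x" "filterlim y at_top at_top" "filterlim y at_bot at_bot"
    and [measurable]: "f \<in> borel_measurable borel"
  shows "(\<integral>\<^sup>+x. f x \<partial>lborel) = (\<integral>\<^sup>+\<xi>. ennreal (a \<xi>) * f (y \<xi>) \<partial>lborel)"
proof -
  have [measurable]: "a \<in> borel_measurable borel" by (rule primitive_measurable[OF y(1)])
  have [measurable]: "y \<in> borel_measurable borel"
    by (intro borel_measurable_continuous_onI primitive_continuous[OF y(1)])
  have "(\<integral>\<^sup>+x. f x \<partial>lborel) = (\<integral>\<^sup>+x. f x \<partial>distr (density lborel (\<lambda>x. ennreal (a x))) borel y)"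
    by (simp add: primitive_distr_density[OF y])
  also have "\<dots> = (\<integral>\<^sup>+\<xi>. f (y \<xi>) \<partial>density lborel (\<lambda>x. ennreal (a x)))" by (rule nn_integral_distr) auto
  also have "\<dots> = (\<integral>\<^sup>+\<xi>. ennreal (a \<xi>) * f (y \<xi>) \<partial>lborel)" by (rule nn_integral_density) auto
  finally show ?thesis .
qed

section \<open>The solution as a function of position: continuity, gradient and integrated
  equation\<close>

context lagr
begin

lemma y_mono: "p \<le> q \<Longrightarrow> y t p \<le> y t q"
  using primitive_has_integral[OF primitive_y, of p q t] has_integral_nonneg[of "a t" "y t q - y t p" "{p..q}"] a_nonneg by auto

lemma y_limits: "filterlim (y t) at_top at_top" "filterlim (y t) at_bot at_bot"
  using quasi_periodic_limits[of "y t"] y_mono y_periodic by blast+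

lemma continuous_y: "continuous_on UNIV (y t)"
  by (rule primitive_continuous[OF primitive_y])

lemma y_measurable [measurable]: "y t \<in> borel_measurable borel"
  by (rule borel_measurable_continuous_onI[OF continuous_y])

lemma y_surj: "\<exists>\<xi>. y t \<xi> = x"
proof -
  obtain p where p: "y t p \<le> x" using y_limits(2)[of t] unfolding filterlim_at_bot eventually_at_bot_linorder by blast
  obtain q where q: "x \<le> y t q" using y_limits(1)[of t] unfolding filterlim_at_top eventually_at_top_linorder by blast
  show ?thesis
  proof (cases "p \<le> q")
    case True
    then show ?thesis using IVT'[of "y t" p x q] p q continuous_on_subset[OF continuous_y] by auto
  next
    case False
    then have "y t p = x" using p q y_mono[of q p t] by auto
    then show ?thesis by blast
  qed
qed

text \<open>The labels at a position may form an interval; \<open>U\<close> and \<open>P\<close> are constant on it.\<close>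

definition "lab t x = (SOME \<xi>. y t \<xi> = x)"
definition "u t x = U t (lab t x)"
definition "pe t x = P t (lab t x)"

lemma y_lab: "y t (lab t x) = x"
  unfolding lab_def using y_surj by (rule someI_ex)

lemma lab_mono: "x < x' \<Longrightarrow> lab t x < lab t x'"
  using y_mono[of "lab t x'" "lab t x" t] by (force simp: y_lab not_le[symmetric])

text \<open>From \<open>b^2 \<le> a h\<close> by the arithmetic-geometric mean inequality with a
  free weight \<open>l\<close>: the share of \<open>a\<close> integrates to displacement, the share
  of \<open>h\<close> to energy.\<close>

lemma b_split: "0 < l \<Longrightarrow> \<bar>b t \<xi>\<bar> \<le> (l * a t \<xi> + h t \<xi> / l) / 2"
proof -
  assume l: "0 < l"
  have "(b t \<xi>)\<^sup>2 \<le> a t \<xi> * h t \<xi>" using invariant[of t \<xi>] by simp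
  also have "\<dots> = (l * a t \<xi>) * (h t \<xi> / l)" using l by simp
  also have "\<dots> \<le> ((l * a t \<xi> + h t \<xi> / l) / 2)\<^sup>2"
  proof -
    have "x * y \<le> ((x + y) / 2)\<^sup>2" for x y :: real
      using sum_squares_ge_zero[of "x - y" 0] by (simp add: power2_eq_square field_simps)
    then show ?thesis .
  qed
  finally have "\<bar>b t \<xi>\<bar>\<^sup>2 \<le> ((l * a t \<xi> + h t \<xi> / l) / 2)\<^sup>2" by simp
  then show ?thesis by (rule power2_le_imp_le) (use l a_nonneg h_nonneg in simp)
qed

abbreviation "H t \<equiv> antider (h t)"

lemma U_modulus:
  assumes l: "0 < l" and le: "\<xi> \<le> \<xi>'"
  shows "\<bar>U t \<xi>' - U t \<xi>\<bar> \<le> (l * (y t \<xi>' - y t \<xi>) + (H t \<xi>' - H t \<xi>) / l) / 2"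
proof -
  have pr: "primitive (\<lambda>\<xi>. 1/2 * (l * y t \<xi> + 1/l * H t \<xi>)) (\<lambda>\<xi>. 1/2 * (l * a t \<xi> + 1/l * h t \<xi>))"
    by (intro primitive_cmult primitive_add primitive_y ev_primitive)
  have "\<bar>U t \<xi>' - U t \<xi>\<bar> \<le> (LINT x:{\<xi>..\<xi>'}|lborel. \<bar>b t x\<bar>)" by (rule primitive_abs_diff_le[OF primitive_U le])
  also have "\<dots> \<le> (LINT x:{\<xi>..\<xi>'}|lborel. 1/2 * (l * a t x + 1/l * h t x))"
  proof (rule set_integral_mono)
    show "set_integrable lborel {\<xi>..\<xi>'} (\<lambda>x. \<bar>b t x\<bar>)" by (rule set_integrable_abs[OF primitive_set_integrable[OF primitive_U]])
    show "set_integrable lborel {\<xi>..\<xi>'} (\<lambda>x. 1/2 * (l * a t x + 1/l * h t x))" by (rule primitive_set_integrable[OF pr])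
    show "\<bar>b t x\<bar> \<le> 1/2 * (l * a t x + 1/l * h t x)" for x using b_split[OF l, of t x] by simp
  qed
  also have "\<dots> = 1/2 * (l * y t \<xi>' + 1/l * H t \<xi>') - 1/2 * (l * y t \<xi> + 1/l * H t \<xi>)"
    by (rule primitive_LINT[OF pr le])
  also have "\<dots> = (l * (y t \<xi>' - y t \<xi>) + (H t \<xi>' - H t \<xi>) / l) / 2"
    by (simp add: diff_divide_distrib right_diff_distrib add_divide_distrib)
  finally show ?thesis .
qed

text \<open>Positions less than 1 apart have labels at most one period apart, hence energy at most
  \<open>E\<close> between them. Optimising in \<open>l\<close> would give Hoelder continuity with
  exponent 1/2; leaving \<open>l\<close> free is more convenient.\<close>

lemma U_modulus_short:
  assumes l: "0 < l" and le: "\<xi> \<le> \<xi>'" and short: "y t \<xi>' - y t \<xi> < 1"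
  shows "\<bar>U t \<xi>' - U t \<xi>\<bar> \<le> (l * (y t \<xi>' - y t \<xi>) + E / l) / 2"
proof -
  have "\<xi>' \<le> \<xi> + 1" using y_mono[of "\<xi> + 1" \<xi>' t] short by (force simp: y_periodic not_le[symmetric])
  then have "H t \<xi>' \<le> H t (\<xi> + 1)" by (rule antider_mono_arg[OF h_nonneg])
  then have "(H t \<xi>' - H t \<xi>) / l \<le> E / l" using l energy[of t] by (intro divide_right_mono) (auto simp: antider_period)
  then have "(l * (y t \<xi>' - y t \<xi>) + (H t \<xi>' - H t \<xi>) / l) / 2 \<le> (l * (y t \<xi>' - y t \<xi>) + E / l) / 2"
    by (rule divide_right_mono[OF add_left_mono]) simp_all
  with U_modulus[OF l le, of t] show ?thesis by (rule order_trans)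
qed

text \<open>At equal positions only the term \<open>E / (2 l)\<close> of the modulus remains, and
  \<open>l\<close> may be taken arbitrarily large.\<close>

lemma U_eq: "y t \<xi> = y t \<xi>' \<Longrightarrow> U t \<xi> = U t \<xi>'"
proof (induction \<xi> \<xi>' rule: linorder_wlog)
  case (le \<xi> \<xi>')
  have "\<bar>U t \<xi>' - U t \<xi>\<bar> \<le> e" if "e > 0" for e
  proof -
    have l: "0 < (E + 1) / (2 * e)" using E_nonneg \<open>e > 0\<close> by simp
    have "\<bar>U t \<xi>' - U t \<xi>\<bar> \<le> (E / ((E + 1) / (2 * e))) / 2"
      using U_modulus_short[OF l le(1), of t] le(2) by simp
    also have "\<dots> = e * (E / (E + 1))"
    proof -
      have "E + 1 \<noteq> 0" "E * 2 + 2 \<noteq> 0" using E_nonneg by auto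
      then show ?thesis by (simp add: field_simps)
    qed
    also have "\<dots> \<le> e * 1" using E_nonneg \<open>e > 0\<close> by (intro mult_left_mono) auto
    finally show ?thesis by simp
  qed
  from field_le_epsilon[of "\<bar>U t \<xi>' - U t \<xi>\<bar>" 0] this have "\<bar>U t \<xi>' - U t \<xi>\<bar> \<le> 0" by simp
  then show ?case by simp
qed simp

lemma P_lipschitz: "\<xi> \<le> \<xi>' \<Longrightarrow> \<bar>P t \<xi>' - P t \<xi>\<bar> \<le> CE * (y t \<xi>' - y t \<xi>)"
proof -
  assume le: "\<xi> \<le> \<xi>'"
  have pr: "primitive (\<lambda>\<xi>. CE * y t \<xi>) (\<lambda>\<xi>. CE * a t \<xi>)" by (intro primitive_cmult primitive_y)
  have "\<bar>P t \<xi>' - P t \<xi>\<bar> \<le> (LINT x:{\<xi>..\<xi>'}|lborel. \<bar>a t x * Q t x\<bar>)" by (rule primitive_abs_diff_le[OF primitive_P le])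
  also have "\<dots> \<le> (LINT x:{\<xi>..\<xi>'}|lborel. CE * a t x)"
  proof (rule set_integral_mono)
    show "set_integrable lborel {\<xi>..\<xi>'} (\<lambda>x. \<bar>a t x * Q t x\<bar>)" by (rule set_integrable_abs[OF primitive_set_integrable[OF primitive_P]])
    show "set_integrable lborel {\<xi>..\<xi>'} (\<lambda>x. CE * a t x)" by (rule primitive_set_integrable[OF pr])
    show "\<bar>a t x * Q t x\<bar> \<le> CE * a t x" for x
      using mult_right_mono[OF PQ_bound(2)[of t x] a_nonneg[of t x]] a_nonneg[of t x] by (simp add: abs_mult mult.commute)
  qed
  also have "\<dots> = CE * y t \<xi>' - CE * y t \<xi>" by (rule primitive_LINT[OF pr le])
  finally show ?thesis by (simp add: right_diff_distrib)
qed

lemma P_eq: "y t \<xi> = y t \<xi>' \<Longrightarrow> P t \<xi> = P t \<xi>'"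
proof (induction \<xi> \<xi>' rule: linorder_wlog)
  case (le \<xi> \<xi>')
  have "y t \<xi>' - y t \<xi> = 0" using le(2) by simp
  then have "\<bar>P t \<xi>' - P t \<xi>\<bar> \<le> CE * 0" using P_lipschitz[OF le(1), of t] by (simp only:)
  then show ?case by simp
qed simp

lemma u_y: "u t (y t \<xi>) = U t \<xi>"
  unfolding u_def by (rule U_eq) (rule y_lab)

lemma pe_y: "pe t (y t \<xi>) = P t \<xi>"
  unfolding pe_def by (rule P_eq) (rule y_lab)

lemma u_periodic: "u t (x + 1) = u t x" and pe_periodic: "pe t (x + 1) = pe t x"
proof -
  have "x + 1 = y t (lab t x + 1)" by (simp add: y_periodic y_lab)
  then show "u t (x + 1) = u t x" "pe t (x + 1) = pe t x"
    using u_y[of t "lab t x + 1"] pe_y[of t "lab t x + 1"] by (simp_all add: ev_periodic u_def pe_def)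
qed

lemma u_bound: "\<bar>u t x\<bar> \<le> 1 + E" and pe_bound: "\<bar>pe t x\<bar> \<le> CE"
  unfolding u_def pe_def by (rule U_bound PQ_bound)+

lemma u_modulus:
  assumes "0 < l" "\<bar>x' - x\<bar> < 1" shows "\<bar>u t x' - u t x\<bar> \<le> (l * \<bar>x' - x\<bar> + E / l) / 2"
proof -
  have *: "\<bar>u t x' - u t x\<bar> \<le> (l * (x' - x) + E / l) / 2" if "x < x'" "x' - x < 1" for x x'
    using U_modulus_short[OF assms(1), of "lab t x" "lab t x'" t] lab_mono[OF that(1), of t] that by (simp add: u_def y_lab)
  consider "x < x'" | "x' < x" | "x = x'" by linarith
  then show ?thesis
  proof cases
    case 3 then show ?thesis using E_nonneg assms by simp
  qed (use *[of x x'] *[of x' x] assms in \<open>auto simp: abs_minus_commute\<close>)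
qed

lemma pe_lipschitz: "\<bar>pe t x' - pe t x\<bar> \<le> CE * \<bar>x' - x\<bar>"
proof -
  have *: "\<bar>pe t x' - pe t x\<bar> \<le> CE * (x' - x)" if "x < x'" for x x'
    using P_lipschitz[of "lab t x" "lab t x'" t] lab_mono[OF that, of t] by (simp add: pe_def y_lab)
  consider "x < x'" | "x' < x" | "x = x'" by linarith
  then show ?thesis by cases (use *[of x x'] *[of x' x] in \<open>auto simp: abs_minus_commute\<close>)
qed

lemma y_time: "\<bar>y s \<xi> - y t \<xi>\<bar> \<le> (1 + E) * \<bar>s - t\<bar>"
  using field_differentiable_bound[of UNIV "\<lambda>t. y t \<xi>" "\<lambda>t. U t \<xi>" "1 + E" s t] dy U_bound by auto

lemma U_time: "\<bar>U s \<xi> - U t \<xi>\<bar> \<le> CE * \<bar>s - t\<bar>"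
  using field_differentiable_bound[of UNIV "\<lambda>t. U t \<xi>" "\<lambda>t. - Q t \<xi>" CE s t] dU PQ_bound by auto

text \<open>Follow the label of the limit point. At the moving time, \<open>z n\<close> and the
  position of this label are close, and the modulus of \<open>u\<close> does not depend on time;
  along the label \<open>U\<close> is Lipschitz in time.\<close>

lemma u_tendsto:
  assumes s: "(s \<longlongrightarrow> t) F" and z: "(z \<longlongrightarrow> x) F"
  shows "((\<lambda>n. u (s n) (z n)) \<longlongrightarrow> u t x) F"
proof (rule tendstoI)
  fix e :: real assume e: "e > 0"
  define \<xi> where "\<xi> = lab t x"
  have utx: "u t x = U t \<xi>" by (simp add: u_def \<xi>_def)
  define l where "l = 2 * (E + 1) / e"
  have l: "l > 0" "E / l \<le> e / 2" using e E_nonneg by (auto simp: l_def field_simps)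
  define d where "d n = \<bar>z n - x\<bar> + (1 + E) * \<bar>s n - t\<bar>" for n
  have "(d \<longlongrightarrow> \<bar>x - x\<bar> + (1 + E) * \<bar>t - t\<bar>) F" unfolding d_def by (intro tendsto_intros s z)
  then have d0: "(d \<longlongrightarrow> 0) F" by simp
  have "((\<lambda>n. (l * d n + e / 2) / 2 + CE * \<bar>s n - t\<bar>) \<longlongrightarrow> (l * 0 + e / 2) / 2 + CE * \<bar>t - t\<bar>) F"
    by (intro tendsto_intros d0 s) simp_all
  then have ev: "\<forall>\<^sub>F n in F. (l * d n + e / 2) / 2 + CE * \<bar>s n - t\<bar> < e"
    by (rule order_tendstoD) (use e in simp)
  \<comment> \<open>\<open>u_modulus\<close> speaks only of positions less than 1 apart.\<close>
  have ev1: "\<forall>\<^sub>F n in F. d n < 1" using d0 by (rule order_tendstoD) simp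
  from ev ev1 show "\<forall>\<^sub>F n in F. dist (u (s n) (z n)) (u t x) < e"
  proof eventually_elim
    case (elim n)
    have zx: "\<bar>z n - y (s n) \<xi>\<bar> \<le> d n"
      using y_time[of "s n" \<xi> t] y_lab[of t x] by (simp add: d_def \<xi>_def)
    have "\<bar>u (s n) (z n) - u (s n) (y (s n) \<xi>)\<bar> \<le> (l * \<bar>z n - y (s n) \<xi>\<bar> + E / l) / 2"
      using zx elim by (intro u_modulus l) linarith
    also have "\<dots> \<le> (l * d n + e / 2) / 2"
      using zx l by (intro divide_right_mono add_mono mult_left_mono) auto
    finally have "\<bar>u (s n) (z n) - u (s n) (y (s n) \<xi>)\<bar> \<le> (l * d n + e / 2) / 2" .
    moreover have "\<bar>u (s n) (y (s n) \<xi>) - u t x\<bar> \<le> CE * \<bar>s n - t\<bar>"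
      using U_time[of "s n" \<xi> t] by (simp add: u_y utx)
    ultimately show ?case unfolding dist_real_def using elim(1) by linarith
  qed
qed

lemma pe_tendsto:
  assumes s: "(s \<longlongrightarrow> t) F" and z: "(z \<longlongrightarrow> x) F"
  shows "((\<lambda>n. pe (s n) (z n)) \<longlongrightarrow> pe t x) F"
proof -
  define \<xi> where "\<xi> = lab t x"
  have ptx: "pe t x = P t \<xi>" by (simp add: pe_def \<xi>_def)
  have CE0: "0 \<le> CE" using PQ_bound(1)[of 0 0] by linarith
  have "((\<lambda>n. norm (cP (X (s n)) - cP (X t))) \<longlongrightarrow> norm (cP (X t) - cP (X t))) F"
    using isCont_tendsto_compose[OF isCont_loclip[OF loclip_cP] s] by (intro tendsto_intros)
  then have c: "((\<lambda>n. norm (cP (X (s n)) - cP (X t))) \<longlongrightarrow> 0) F" by simp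
  have "((\<lambda>n. CE * (\<bar>z n - x\<bar> + (1 + E) * \<bar>s n - t\<bar>) + norm (cP (X (s n)) - cP (X t))) \<longlongrightarrow> CE * (\<bar>x - x\<bar> + (1 + E) * \<bar>t - t\<bar>) + 0) F"
    by (intro tendsto_intros s z c)
  then have lim: "((\<lambda>n. CE * (\<bar>z n - x\<bar> + (1 + E) * \<bar>s n - t\<bar>) + norm (cP (X (s n)) - cP (X t))) \<longlongrightarrow> 0) F" by simp
  have "((\<lambda>n. pe (s n) (z n) - pe t x) \<longlongrightarrow> 0) F"
  proof (rule Lim_null_comparison[OF _ lim], intro always_eventually allI)
    fix n
    have "\<bar>pe (s n) (z n) - pe (s n) (y (s n) \<xi>)\<bar> \<le> CE * \<bar>z n - y (s n) \<xi>\<bar>" by (rule pe_lipschitz)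
    also have "\<dots> \<le> CE * (\<bar>z n - x\<bar> + (1 + E) * \<bar>s n - t\<bar>)"
      using y_time[of "s n" \<xi> t] y_lab[of t x] CE0 by (intro mult_left_mono) (auto simp: \<xi>_def)
    finally have 1: "\<bar>pe (s n) (z n) - pe (s n) (y (s n) \<xi>)\<bar> \<le> CE * (\<bar>z n - x\<bar> + (1 + E) * \<bar>s n - t\<bar>)" .
    have "\<bar>pe (s n) (y (s n) \<xi>) - pe t x\<bar> \<le> norm (cP (X (s n)) - cP (X t))"
      using ev_le_norm[of "cP (X (s n)) - cP (X t)" \<xi>] by (simp add: pe_y ptx)
    with 1 show "norm (pe (s n) (z n) - pe t x) \<le> CE * (\<bar>z n - x\<bar> + (1 + E) * \<bar>s n - t\<bar>) + norm (cP (X (s n)) - cP (X t))"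
      by simp
  qed
  then show ?thesis by (rule LIM_zero_cancel)
qed

lemma continuous_u: "continuous_on UNIV (u t)" and continuous_pe: "continuous_on UNIV (pe t)"
  unfolding continuous_on_def by (auto intro!: u_tendsto pe_tendsto tendsto_ident_at)

lemma u_measurable [measurable]: "u t \<in> borel_measurable borel" and pe_measurable [measurable]: "pe t \<in> borel_measurable borel"
  by (intro borel_measurable_continuous_onI continuous_u continuous_pe)+

text \<open>\<open>lab t\<close> may jump, but it carries disjoint position intervals to disjoint
  label intervals. Summing \<open>U_modulus\<close> gives at most
  \<open>(l * len D + K / l) / 2\<close>, where \<open>K\<close> is the energy of the label range;
  choose \<open>l\<close> large first, then the length small.\<close>

lemma abs_continuous_u: "abs_continuous_on {c..d} (u t)"
  unfolding abs_continuous_on_adm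
proof (intro allI impI)
  fix e :: real assume e: "e > 0"
  define K where "K = (LINT \<xi>:{lab t c..lab t d}|lborel. h t \<xi>)"
  have K0: "0 \<le> K" unfolding K_def set_lebesgue_integral_def
    using h_nonneg by (intro Bochner_Integration.integral_nonneg) auto
  define l where "l = (K + 1) / e"
  have l: "l > 0" "K / l < e" using e K0 by (auto simp: l_def field_simps)
  have "varsum (u t) D < e" if D: "adm D c d" "len D < e / l" for D
  proof -
    define D' where "D' = (\<lambda>(p, q). (lab t p, lab t q)) ` D"
    have inj: "inj_on (\<lambda>(p, q). (lab t p, lab t q)) D"
      by (rule inj_onI) (metis (no_types, lifting) case_prod_conv old.prod.exhaust prod.inject y_lab)
    have labm: "lab t p \<le> lab t q" if "p \<le> q" for p q using lab_mono[of p q t] that by (cases "p = q") auto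
    have "adm D' (lab t c) (lab t d)"
      unfolding adm_def
    proof (intro conjI)
      show "finite D'" using D by (simp add: D'_def adm_def)
      show "\<forall>(p, q)\<in>D'. lab t c \<le> p \<and> p < q \<and> q \<le> lab t d"
        using D(1) lab_mono labm by (force simp: D'_def adm_def)
      show "pairwise (\<lambda>(p, q) (r, s). {p<..<q} \<inter> {r<..<s} = {}) D'"
      proof (rule pairwiseI)
        fix x x' assume "x \<in> D'" "x' \<in> D'" "x \<noteq> x'"
        then obtain p q r s where x: "(p, q) \<in> D" "x = (lab t p, lab t q)" "(r, s) \<in> D" "x' = (lab t r, lab t s)" "(p, q) \<noteq> (r, s)"
          by (auto simp: D'_def)
        have "pairwise (\<lambda>(p, q) (r, s). {p<..<q} \<inter> {r<..<s} = {}) D" using D(1) by (simp add: adm_def)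
        from pairwiseD[OF this x(1,3,5)] have dis: "{p<..<q} \<inter> {r<..<s} = {}" by simp
        have pq: "p < q" "r < s" using D(1) x(1,3) by (auto simp: adm_def)
        have "q \<le> r \<or> s \<le> p"
        proof (rule ccontr)
          assume "\<not> (q \<le> r \<or> s \<le> p)"
          then have "(max p r + min q s) / 2 \<in> {p<..<q} \<inter> {r<..<s}" using pq by (auto simp: max_def min_def field_simps)
          then show False using dis by blast
        qed
        then have "lab t q \<le> lab t r \<or> lab t s \<le> lab t p" using labm by blast
        then show "(case x of (p, q) \<Rightarrow> \<lambda>(r, s). {p<..<q} \<inter> {r<..<s} = {}) x'" by (auto simp: x)
      qed
    qed
    then have "(\<Sum>(p, q)\<in>D'. LINT \<xi>:{p..q}|lborel. h t \<xi>) \<le> K"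
      unfolding K_def by (rule adm_sum_integral_le[OF _ primitive_set_integrable[OF ev_primitive] h_nonneg])
    also have "(\<Sum>(p, q)\<in>D'. LINT \<xi>:{p..q}|lborel. h t \<xi>) = (\<Sum>(p, q)\<in>D. LINT \<xi>:{lab t p..lab t q}|lborel. h t \<xi>)"
      unfolding D'_def by (subst sum.reindex[OF inj]) (simp add: case_prod_unfold)
    also have "\<dots> = (\<Sum>(p, q)\<in>D. H t (lab t q) - H t (lab t p))"
      using D(1) labm by (intro sum.cong) (auto simp: adm_def less_imp_le intro!: primitive_LINT[OF ev_primitive])
    finally have HK: "(\<Sum>(p, q)\<in>D. H t (lab t q) - H t (lab t p)) \<le> K" .
    have "varsum (u t) D \<le> (\<Sum>(p, q)\<in>D. (l * (q - p) + (H t (lab t q) - H t (lab t p)) / l) / 2)"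
      unfolding varsum_def
    proof (rule sum_mono, clarify)
      fix p q assume "(p, q) \<in> D"
      then have "lab t p \<le> lab t q" using D(1) labm by (auto simp: adm_def)
      from U_modulus[OF l(1) this, of t]
      show "\<bar>u t q - u t p\<bar> \<le> (l * (q - p) + (H t (lab t q) - H t (lab t p)) / l) / 2" by (simp add: u_def y_lab)
    qed
    also have "\<dots> = (l * len D + (\<Sum>(p, q)\<in>D. H t (lab t q) - H t (lab t p)) / l) / 2"
      by (simp add: case_prod_unfold sum_distrib_left sum_divide_distrib sum.distrib add_divide_distrib)
    also have "\<dots> < (e + e) / 2"
    proof (intro divide_strict_right_mono add_strict_mono)
      show "l * len D < e" using D(2) l(1) by (simp add: field_simps)
      have "(\<Sum>(p, q)\<in>D. H t (lab t q) - H t (lab t p)) / l \<le> K / l" using HK l(1) by (intro divide_right_mono) auto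
      then show "(\<Sum>(p, q)\<in>D. H t (lab t q) - H t (lab t p)) / l < e" using l(2) by linarith
    qed simp
    finally show ?thesis by simp
  qed
  moreover have "e / l > 0" using e l by simp
  ultimately show "\<exists>\<delta>>0. \<forall>D. adm D c d \<longrightarrow> len D < \<delta> \<longrightarrow> varsum (u t) D < e" by blast
qed

text \<open>Minus the flux: the equation reads \<open>u_t = \<Psi>_x\<close>, and \<open>v\<close>
  will be the right-hand side.\<close>

definition "\<Psi> t x = - ((u t x)\<^sup>2 / 2 + pe t x)"

lemma \<Psi>_y: "\<Psi> t (y t \<xi>) = - ((U t \<xi>)\<^sup>2 / 2 + P t \<xi>)" by (simp add: \<Psi>_def u_y pe_y)

lemma \<Psi>_tendsto: "(s \<longlongrightarrow> t) F \<Longrightarrow> (z \<longlongrightarrow> x) F \<Longrightarrow> ((\<lambda>n. \<Psi> (s n) (z n)) \<longlongrightarrow> \<Psi> t x) F"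
  unfolding \<Psi>_def by (intro tendsto_intros u_tendsto pe_tendsto) simp_all

lemma \<Psi>_periodic: "\<Psi> t (x + 1) = \<Psi> t x" by (simp add: \<Psi>_def u_periodic pe_periodic)

lemma continuous_\<Psi>: "continuous_on UNIV (\<lambda>z. \<Psi> (fst z) (snd z))"
  unfolding continuous_on_def by (intro ballI \<Psi>_tendsto tendsto_fst tendsto_snd tendsto_ident_at)

lemma abs_continuous_\<Psi>: "abs_continuous_on {c..d} (\<Psi> t)"
proof (rule abs_continuous_on_dominated[OF abs_continuous_u abs_continuous_on_lipschitz])
  show "\<bar>pe t q - pe t r\<bar> \<le> CE * (q - r)" if "r \<le> q" for q r using pe_lipschitz[of t q r] that by simp
  show "\<bar>\<Psi> t q - \<Psi> t r\<bar> \<le> (2 + E) * (\<bar>u t q - u t r\<bar> + \<bar>pe t q - pe t r\<bar>)" for q r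
  proof -
    have "\<Psi> t q - \<Psi> t r = - ((u t q + u t r) / 2 * (u t q - u t r)) - (pe t q - pe t r)"
      by (simp add: \<Psi>_def power2_eq_square algebra_simps add_divide_distrib diff_divide_distrib)
    also have "\<bar>\<dots>\<bar> \<le> \<bar>(u t q + u t r) / 2\<bar> * \<bar>u t q - u t r\<bar> + \<bar>pe t q - pe t r\<bar>"
      by (rule order_trans[OF abs_triangle_ineq4]) (simp add: abs_mult)
    also have "\<dots> \<le> (2 + E) * \<bar>u t q - u t r\<bar> + (2 + E) * \<bar>pe t q - pe t r\<bar>"
    proof (intro add_mono mult_right_mono)
      show "\<bar>(u t q + u t r) / 2\<bar> \<le> 2 + E" using u_bound[of t q] u_bound[of t r] E_nonneg by (simp add: abs_le_iff)
      have "1 * \<bar>pe t q - pe t r\<bar> \<le> (2 + E) * \<bar>pe t q - pe t r\<bar>" using E_nonneg by (intro mult_right_mono) auto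
      then show "\<bar>pe t q - pe t r\<bar> \<le> (2 + E) * \<bar>pe t q - pe t r\<bar>" by simp
    qed simp
    finally show ?thesis by (simp add: distrib_left)
  qed
qed (use E_nonneg in auto)

text \<open>A pointwise limit of jointly continuous difference quotients, so that Fubini applies to it.\<close>
definition "v t x = lim (\<lambda>n. real (Suc n) * (\<Psi> t (x + 1 / real (Suc n)) - \<Psi> t x))"

lemma v_measurable2 [measurable]: "(\<lambda>z. v (fst z) (snd z)) \<in> borel_measurable borel"
  unfolding v_def
proof (rule borel_measurable_lim_metric, rule borel_measurable_continuous_onI)
  fix n
  have "continuous_on UNIV (\<lambda>z. \<Psi> (fst (fst z, snd z + 1 / real (Suc n))) (snd (fst z, snd z + 1 / real (Suc n))))"
    by (rule continuous_on_compose2[OF continuous_\<Psi>]) (auto intro!: continuous_intros)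
  then show "continuous_on UNIV (\<lambda>z. real (Suc n) * (\<Psi> (fst z) (snd z + 1 / real (Suc n)) - \<Psi> (fst z) (snd z)))"
    by (intro continuous_intros continuous_\<Psi>) simp
qed

lemma v_measurable [measurable]: "v t \<in> borel_measurable borel"
proof -
  have "(\<lambda>x. (\<lambda>z. v (fst z) (snd z)) (t, x)) \<in> borel_measurable borel"
    by (rule measurable_compose[OF _ v_measurable2]) (simp add: borel_prod[symmetric])
  then show ?thesis by simp
qed

lemma v_periodic: "v t (x + 1) = v t x"
proof -
  have "\<Psi> t (x + 1 + c) = \<Psi> t (x + c)" for c using \<Psi>_periodic[of t "x + c"] by (simp add: add.commute add.left_commute)
  from this[of 0] this show ?thesis by (simp add: v_def)
qed

lemma v_eq: assumes "(\<Psi> t has_real_derivative D) (at x)" shows "v t x = D"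
proof -
  have q: "((\<lambda>h. (\<Psi> t (x + h) - \<Psi> t x) / h) \<longlongrightarrow> D) (at 0)" using assms by (simp add: DERIV_def)
  have "filterlim (\<lambda>n. 1 / real (Suc n)) (at 0) sequentially"
    unfolding filterlim_at using LIMSEQ_inverse_real_of_nat by (auto simp: inverse_eq_divide)
  from filterlim_compose[OF q this]
  have "(\<lambda>n. real (Suc n) * (\<Psi> t (x + 1 / real (Suc n)) - \<Psi> t x)) \<longlonglongrightarrow> D"
    by (simp add: mult.commute)
  then show ?thesis unfolding v_def by (rule limI)
qed

lemma primitive_v: "primitive (\<Psi> t) (v t)"
proof -
  obtain g where g: "primitive (\<Psi> t) g" using abs_continuous_primitive[OF abs_continuous_\<Psi>] by blast
  have "AE x in lborel. g x = v t x"
    using primitive_AE_derivative[OF g] by eventually_elim (simp add: v_eq)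
  then show ?thesis by (rule primitive_AE_cong[OF g]) simp
qed

text \<open>The label derivative of \<open>\<Psi> t (y t \<xi>)\<close>, that is, \<open>v\<close>
  times \<open>a\<close> at labels with \<open>a \<noteq> 0\<close>.\<close>

definition "r t \<xi> = - (U t \<xi> * b t \<xi> + a t \<xi> * Q t \<xi>)"

lemma v_pullback: "AE \<xi> in lborel. a t \<xi> = 0 \<or> v t (y t \<xi>) = r t \<xi> / a t \<xi>"
proof -
  have "primitive (\<lambda>\<xi>. (-1) * (1/2 * (U t \<xi> * U t \<xi>) + P t \<xi>)) (\<lambda>\<xi>. (-1) * (1/2 * (b t \<xi> * U t \<xi> + U t \<xi> * b t \<xi>) + a t \<xi> * Q t \<xi>))"
    by (intro primitive_cmult primitive_add primitive_mult primitive_U primitive_P)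
  then have pr: "primitive (\<lambda>\<xi>. \<Psi> t (y t \<xi>)) (r t)"
    by (simp add: \<Psi>_y r_def[abs_def] power2_eq_square algebra_simps)
  from AE_pullback[OF primitive_y[of t] a_nonneg y_limits primitive_AE_derivative[OF primitive_v[of t]]]
    primitive_AE_derivative[OF primitive_y[of t]] primitive_AE_derivative[OF pr]
  show ?thesis
  proof eventually_elim
    case (elim \<xi>)
    show ?case
    proof (cases "a t \<xi> = 0")
      case False
      then have "((\<lambda>\<xi>. \<Psi> t (y t \<xi>)) has_real_derivative v t (y t \<xi>) * a t \<xi>) (at \<xi>)"
        using elim by (intro DERIV_chain2[of "\<Psi> t"]) auto
      from DERIV_unique[OF this elim(3)] show ?thesis using False by (simp add: field_simps)
    qed simp
  qed
qed

lemma u_deriv_pullback: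
  assumes "primitive (u t) g"
  shows "AE \<xi> in lborel. a t \<xi> = 0 \<or> g (y t \<xi>) = b t \<xi> / a t \<xi>"
  using AE_pullback[OF primitive_y[of t] a_nonneg y_limits primitive_AE_derivative[OF assms]]
    primitive_AE_derivative[OF primitive_y[of t]] primitive_AE_derivative[OF primitive_U[of t]]
proof eventually_elim
  case (elim \<xi>)
  show ?case
  proof (cases "a t \<xi> = 0")
    case False
    then have "((\<lambda>\<xi>. u t (y t \<xi>)) has_real_derivative g (y t \<xi>) * a t \<xi>) (at \<xi>)"
      using elim by (intro DERIV_chain2[of "u t"]) auto
    then have "(U t has_real_derivative g (y t \<xi>) * a t \<xi>) (at \<xi>)" by (simp add: u_y)
    from DERIV_unique[OF this elim(3)] show ?thesis using False by (simp add: field_simps)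
  qed simp
qed

lemma primitive_W: "primitive (antider (u t)) (u t)"
  by (rule antider_primitive[OF u_measurable u_bound])

lemma W_y: "antider (u t) (y t \<xi>') - antider (u t) (y t \<xi>) =
    antider (ev (cU (X t) * ca (X t))) \<xi>' - antider (ev (cU (X t) * ca (X t))) \<xi>"
proof -
  have "primitive (\<lambda>\<xi>. antider (u t) (y t \<xi>)) (\<lambda>\<xi>. u t (y t \<xi>) * a t \<xi>)"
    by (rule primitive_compose[OF primitive_y])
      (use antider_has_vector_derivative[OF continuous_u] in \<open>auto simp: has_real_derivative_iff_has_vector_derivative continuous_u\<close>)
  then have "primitive (\<lambda>\<xi>. antider (u t) (y t \<xi>)) (ev (cU (X t) * ca (X t)))"
    by (simp add: u_y times_pbm.rep_eq)
  from primitive_unique_diff[OF this ev_primitive] show ?thesis .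
qed

text \<open>By the mean value theorem the integral of \<open>u s\<close> between the moving label
  and \<open>x\<close> is \<open>u s\<close> at an intermediate point times the distance. That point
  tends to \<open>x\<close>, so joint continuity of \<open>u\<close> suffices and no time derivative
  of \<open>u\<close> is needed.\<close>

lemma W_shift:
  assumes x: "y t \<xi> = x"
  shows "((\<lambda>s. antider (u s) x - antider (u s) (y s \<xi>)) has_real_derivative - (u t x)\<^sup>2) (at t)"
proof -
  have mvt: "\<exists>z. \<bar>z - x\<bar> \<le> \<bar>y s \<xi> - x\<bar> \<and> antider (u s) x - antider (u s) (y s \<xi>) = u s z * (x - y s \<xi>)" for s
  proof -
    have d: "(antider (u s) has_real_derivative u s z) (at z)" for z
      using antider_has_vector_derivative[OF continuous_u] by (simp add: has_real_derivative_iff_has_vector_derivative)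
    consider "y s \<xi> < x" | "x < y s \<xi>" | "y s \<xi> = x" by linarith
    then show ?thesis
    proof cases
      case 1
      obtain z where "y s \<xi> < z" "z < x" "antider (u s) x - antider (u s) (y s \<xi>) = (x - y s \<xi>) * u s z"
        using MVT2[OF 1, of "antider (u s)" "u s"] d by blast
      then show ?thesis by (intro exI[of _ z]) (auto simp: mult.commute)
    next
      case 2
      obtain z where "x < z" "z < y s \<xi>" "antider (u s) (y s \<xi>) - antider (u s) x = (y s \<xi> - x) * u s z"
        using MVT2[OF 2, of "antider (u s)" "u s"] d by blast
      then show ?thesis by (intro exI[of _ z]) (auto simp: algebra_simps)
    next
      case 3 then show ?thesis by (intro exI[of _ x]) auto
    qed
  qed
  then obtain z where z: "\<And>s. \<bar>z s - x\<bar> \<le> \<bar>y s \<xi> - x\<bar>" "\<And>s. antider (u s) x - antider (u s) (y s \<xi>) = u s (z s) * (x - y s \<xi>)"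
    by metis
  have yl: "((\<lambda>s. y s \<xi>) \<longlongrightarrow> x) (at t)" using DERIV_isCont[OF dy[of \<xi> t]] x by (simp add: isCont_def)
  have "((\<lambda>s. \<bar>y s \<xi> - x\<bar>) \<longlongrightarrow> \<bar>x - x\<bar>) (at t)" by (intro tendsto_intros yl)
  then have "((\<lambda>s. z s - x) \<longlongrightarrow> 0) (at t)"
    by (intro Lim_null_comparison[of "\<lambda>s. z s - x" "\<lambda>s. \<bar>y s \<xi> - x\<bar>"]) (use z(1) in auto)
  then have "(z \<longlongrightarrow> x) (at t)" by (rule LIM_zero_cancel)
  then have uz: "((\<lambda>s. u s (z s)) \<longlongrightarrow> u t x) (at t)" by (intro u_tendsto tendsto_ident_at)
  have q: "((\<lambda>s. (y s \<xi> - y t \<xi>) / (s - t)) \<longlongrightarrow> U t \<xi>) (at t)"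
    using dy[of \<xi> t] by (simp add: has_field_derivative_iff)
  have "((\<lambda>s. u s (z s) * - ((y s \<xi> - y t \<xi>) / (s - t))) \<longlongrightarrow> u t x * - U t \<xi>) (at t)"
    by (intro tendsto_intros uz q)
  moreover have "U t \<xi> = u t x" using u_y[of t \<xi>] x by simp
  moreover have "u s (z s) * - ((y s \<xi> - y t \<xi>) / (s - t)) =
     ((antider (u s) x - antider (u s) (y s \<xi>)) - (antider (u t) x - antider (u t) (y t \<xi>))) / (s - t)" for s
    using z(2)[of s] by (simp add: x minus_divide_left[symmetric] divide_simps) (simp add: algebra_simps)
  ultimately show ?thesis by (simp add: has_field_derivative_iff power2_eq_square)
qed

text \<open>The conservation law integrated over a position interval, valid at every time. The
  labels in the interval contribute the increment of \<open>u^2 / 2 - P\<close>, the motion of its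
  ends that of \<open>- u^2\<close>.\<close>

lemma W_derivative:
  "((\<lambda>s. antider (u s) x' - antider (u s) x) has_real_derivative \<Psi> t x' - \<Psi> t x) (at t)"
proof -
  define \<xi> \<xi>' where "\<xi> = lab t x" and "\<xi>' = lab t x'"
  have yx: "y t \<xi> = x" "y t \<xi>' = x'" by (simp_all add: \<xi>_def \<xi>'_def y_lab)
  let ?M = "\<lambda>s. antider (ev (cU (X s) * ca (X s)))"
  have eq: "(\<lambda>s. antider (u s) x' - antider (u s) x) = (\<lambda>s. (antider (u s) x' - antider (u s) (y s \<xi>'))
      + (?M s \<xi>' - ?M s \<xi>) - (antider (u s) x - antider (u s) (y s \<xi>)))"
    by (rule ext) (simp add: W_y[symmetric])
  have pr: "primitive (\<lambda>\<xi>. 1/2 * (U t \<xi> * U t \<xi>) - P t \<xi>) (\<lambda>\<xi>. 1/2 * (b t \<xi> * U t \<xi> + U t \<xi> * b t \<xi>) - a t \<xi> * Q t \<xi>)"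
    by (intro primitive_cmult primitive_diff primitive_mult primitive_U primitive_P)
  have "(\<lambda>\<xi>. 1/2 * (b t \<xi> * U t \<xi> + U t \<xi> * b t \<xi>) - a t \<xi> * Q t \<xi>) = ev (cU (X t) * cb (X t) - cQ (X t) * ca (X t))"
    by (rule ext) (simp add: algebra_simps)
  with pr have "primitive (\<lambda>\<xi>. 1/2 * (U t \<xi> * U t \<xi>) - P t \<xi>) (ev (cU (X t) * cb (X t) - cQ (X t) * ca (X t)))" by simp
  from primitive_unique_diff[OF ev_primitive this, of \<xi>' \<xi>]
  have Md: "antider (ev (cU (X t) * cb (X t) - cQ (X t) * ca (X t))) \<xi>' - antider (ev (cU (X t) * cb (X t) - cQ (X t) * ca (X t))) \<xi>
    = ((u t x')\<^sup>2 / 2 - pe t x') - ((u t x)\<^sup>2 / 2 - pe t x)"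
    by (simp add: u_def pe_def \<xi>_def \<xi>'_def power2_eq_square)
  have "((\<lambda>s. (antider (u s) x' - antider (u s) (y s \<xi>')) + (?M s \<xi>' - ?M s \<xi>) - (antider (u s) x - antider (u s) (y s \<xi>)))
     has_real_derivative (- (u t x')\<^sup>2 + (antider (ev (cU (X t) * cb (X t) - cQ (X t) * ca (X t))) \<xi>' - antider (ev (cU (X t) * cb (X t) - cQ (X t) * ca (X t))) \<xi>) - - (u t x)\<^sup>2)) (at t)"
    by (intro DERIV_diff DERIV_add W_shift momentum yx)
  then show ?thesis unfolding eq Md by (simp add: \<Psi>_def algebra_simps)
qed

end

section \<open>The time derivative in $L^p$\<close>

text \<open>The p-th power of the norm with values in \<open>ennreal\<close>: divergence stays
  visible, whereas \<open>Lp_norm\<close> would be 0, and the triangle inequality up to the factor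
  \<open>2 powr p\<close> is enough.\<close>

definition np :: "real \<Rightarrow> (real \<Rightarrow> real) \<Rightarrow> ennreal" where
  "np p f = (\<integral>\<^sup>+x\<in>{0..1}. ennreal (\<bar>f x\<bar> powr p) \<partial>lborel)"

lemma powr_add_le:
  fixes x y z p :: real
  assumes "0 \<le> p" "\<bar>z\<bar> \<le> \<bar>x\<bar> + \<bar>y\<bar>"
  shows "\<bar>z\<bar> powr p \<le> 2 powr p * (\<bar>x\<bar> powr p + \<bar>y\<bar> powr p)"
proof -
  have "\<bar>z\<bar> powr p \<le> (2 * max \<bar>x\<bar> \<bar>y\<bar>) powr p" using assms by (intro powr_mono2) auto
  also have "\<dots> = 2 powr p * (max \<bar>x\<bar> \<bar>y\<bar>) powr p" by (rule powr_mult)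
  also have "\<dots> \<le> 2 powr p * (\<bar>x\<bar> powr p + \<bar>y\<bar> powr p)"
    by (intro mult_left_mono) (auto simp: max_def)
  finally show ?thesis .
qed

lemma np_triangle:
  assumes [measurable]: "f \<in> borel_measurable borel" "g \<in> borel_measurable borel"
    and "0 \<le> p" "\<And>x. \<bar>k x\<bar> \<le> \<bar>f x\<bar> + \<bar>g x\<bar>"
  shows "np p k \<le> ennreal (2 powr p) * (np p f + np p g)"
proof -
  have "np p k \<le> (\<integral>\<^sup>+x. ennreal (2 powr p) * (ennreal (\<bar>f x\<bar> powr p) * indicator {0..1} x + ennreal (\<bar>g x\<bar> powr p) * indicator {0..1} x) \<partial>lborel)"
    unfolding np_def
  proof (rule nn_integral_mono)
    fix x
    show "ennreal (\<bar>k x\<bar> powr p) * indicator {0..1} x \<le> ennreal (2 powr p) * (ennreal (\<bar>f x\<bar> powr p) * indicator {0..1} x + ennreal (\<bar>g x\<bar> powr p) * indicator {0..1} x)"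
      using powr_add_le[OF assms(3) assms(4)[of x]]
      by (auto simp: indicator_def ennreal_mult[symmetric] ennreal_plus[symmetric] simp del: ennreal_plus)
  qed
  also have "\<dots> = ennreal (2 powr p) * (np p f + np p g)"
    unfolding np_def by (subst nn_integral_cmult) (auto simp: nn_integral_add)
  finally show ?thesis .
qed

lemma np_tendsto_zero:
  assumes [measurable]: "\<And>n. k n \<in> borel_measurable borel" "w \<in> borel_measurable borel"
    and p: "0 < p" and b: "\<And>n x. \<bar>k n x\<bar> \<le> \<bar>w x\<bar>" and w: "np p w < \<infinity>"
    and lim: "AE x in lborel. (\<lambda>n. k n x) \<longlonglongrightarrow> 0"
  shows "(\<lambda>n. np p (k n)) \<longlonglongrightarrow> 0"
proof -
  have "(\<lambda>n. np p (k n)) \<longlonglongrightarrow> (\<integral>\<^sup>+x. 0 \<partial>(lborel :: real measure))"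
    unfolding np_def
  proof (rule nn_integral_dominated_convergence[where w = "\<lambda>x. ennreal (\<bar>w x\<bar> powr p) * indicator {0..1} x"])
    show "AE x in lborel. ennreal (\<bar>k n x\<bar> powr p) * indicator {0..1} x \<le> ennreal (\<bar>w x\<bar> powr p) * indicator {0..1} x" for n
      using p b by (intro AE_I2 mult_right_mono ennreal_leI powr_mono2) auto
    show "(\<integral>\<^sup>+x. ennreal (\<bar>w x\<bar> powr p) * indicator {0..1} x \<partial>lborel) < \<infinity>" using w by (simp add: np_def)
    show "AE x in lborel. (\<lambda>n. ennreal (\<bar>k n x\<bar> powr p) * indicator {0..1} x) \<longlonglongrightarrow> 0"
      using lim
    proof eventually_elim
      case (elim x)
      have "(\<lambda>n. \<bar>k n x\<bar> powr p) \<longlonglongrightarrow> 0"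
        by (rule tendsto_zero_powrI[OF tendsto_rabs_zero[OF elim] tendsto_const _ p]) auto
      from tendsto_ennrealI[OF this] show ?case by (auto simp: indicator_def)
    qed
  qed measurable
  then show ?thesis by simp
qed

text \<open>Truncate \<open>f\<close> first, then approximate it almost everywhere by continuous
  functions truncated at the same height, so that constants dominate the second limit.\<close>

lemma np_dense_continuous:
  assumes [measurable]: "f \<in> borel_measurable borel" and p: "0 < p" and fin: "np p f < \<infinity>" and e: "0 < e"
  obtains g G where "continuous_on UNIV g" "\<And>x. \<bar>g x\<bar> \<le> G" "np p (\<lambda>x. f x - g x) < e"
proof -
  define cl where "cl m z = max (- real m) (min (real m) z)" for m and z :: real
  have clm [measurable]: "cl m \<in> borel_measurable borel" for m unfolding cl_def by measurable
  have "f \<in> borel_measurable (lebesgue_on UNIV)"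
    by (intro measurable_restrict_space1 measurable_completion) simp
  then have "f measurable_on UNIV" by (subst measurable_on_iff_borel_measurable) auto
  then obtain N k where N: "negligible N" and k: "\<And>n. continuous_on UNIV (k n)" "\<And>x. x \<notin> N \<Longrightarrow> (\<lambda>n. k n x) \<longlonglongrightarrow> f x"
    unfolding measurable_on_def by auto
  have [measurable]: "k n \<in> borel_measurable borel" for n by (rule borel_measurable_continuous_onI[OF k(1)])
  define c where "c = ennreal (2 powr p)"
  have c: "0 < c" "c < top" by (auto simp: c_def)
  obtain e' where e': "0 < e'" "c * (e' + e') < e"
  proof -
    obtain e0 where e0: "0 < ennreal e0" "ennreal e0 < e" "e0 > 0"
      using e by (metis ennreal_0 ennreal_less_zero_iff dense less_ennreal.rep_eq ennreal_cases not_less_zero order.strict_trans top.not_eq_extremum)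
    show ?thesis
    proof (rule that)
      show "0 < ennreal (e0 / (2 * 2 powr p))" using e0 by simp
      have "c * (ennreal (e0 / (2 * 2 powr p)) + ennreal (e0 / (2 * 2 powr p))) = ennreal e0"
        using e0 by (simp add: c_def ennreal_plus[symmetric] ennreal_mult[symmetric] del: ennreal_plus)
      then show "c * (ennreal (e0 / (2 * 2 powr p)) + ennreal (e0 / (2 * 2 powr p))) < e" using e0 by simp
    qed
  qed
  have "(\<lambda>m. np p (\<lambda>x. f x - cl m (f x))) \<longlonglongrightarrow> 0"
  proof (rule np_tendsto_zero[OF _ _ p _ fin])
    show "\<bar>f x - cl m (f x)\<bar> \<le> \<bar>f x\<bar>" for m x by (auto simp: cl_def max_def min_def)
    show "AE x in lborel. (\<lambda>m. f x - cl m (f x)) \<longlonglongrightarrow> 0"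
    proof (rule AE_I2)
      fix x
      obtain M where M: "\<bar>f x\<bar> \<le> real M" using real_arch_simple by blast
      have "f x - cl m (f x) = 0" if "m \<ge> M" for m
      proof -
        have "\<bar>f x\<bar> \<le> real m" using M that by linarith
        then show ?thesis by (auto simp: cl_def)
      qed
      then show "(\<lambda>m. f x - cl m (f x)) \<longlonglongrightarrow> 0" by (intro tendsto_eventually) (auto simp: eventually_sequentially)
    qed
  qed measurable
  from order_tendstoD(2)[OF this e'(1)] obtain m where m: "np p (\<lambda>x. f x - cl m (f x)) < e'"
    by (auto simp: eventually_sequentially)
  have "(\<lambda>n. np p (\<lambda>x. cl m (f x) - cl m (k n x))) \<longlonglongrightarrow> 0"
  proof (rule np_tendsto_zero[where w = "\<lambda>_. 2 * real m", OF _ _ p])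
    show "\<bar>cl m (f x) - cl m (k n x)\<bar> \<le> \<bar>2 * real m\<bar>" for n x by (auto simp: cl_def max_def min_def)
    show "np p (\<lambda>_. 2 * real m) < \<infinity>" by (simp add: np_def nn_integral_cmult ennreal_mult_less_top)
    show "AE x in lborel. (\<lambda>n. cl m (f x) - cl m (k n x)) \<longlonglongrightarrow> 0"
      using negligible_AE_lborel[OF N]
    proof eventually_elim
      case (elim x)
      have "(\<lambda>n. cl m (f x) - cl m (k n x)) \<longlonglongrightarrow> cl m (f x) - cl m (f x)"
        unfolding cl_def by (intro tendsto_intros k(2)[OF elim])
      then show ?case by simp
    qed
  qed measurable
  from order_tendstoD(2)[OF this e'(1)] obtain n where n: "np p (\<lambda>x. cl m (f x) - cl m (k n x)) < e'"
    by (auto simp: eventually_sequentially)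
  have "np p (\<lambda>x. f x - cl m (k n x)) \<le> c * (np p (\<lambda>x. f x - cl m (f x)) + np p (\<lambda>x. cl m (f x) - cl m (k n x)))"
    unfolding c_def using p by (intro np_triangle) auto
  also have "\<dots> \<le> c * (e' + e')" using m n by (intro mult_left_mono add_mono) auto
  also have "\<dots> < e" by (rule e'(2))
  finally have "np p (\<lambda>x. f x - cl m (k n x)) < e" .
  moreover have "continuous_on UNIV (\<lambda>x. cl m (k n x))" unfolding cl_def by (intro continuous_intros k(1))
  moreover have "\<bar>cl m (k n x)\<bar> \<le> real m" for x by (auto simp: cl_def max_def min_def)
  ultimately show ?thesis using that by blast
qed

lemma powr_le_square: "\<lbrakk>1 \<le> p; p \<le> 2; 0 \<le> z\<rbrakk> \<Longrightarrow> z powr p \<le> z\<^sup>2 + 1" for z p :: real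
proof (cases "z \<le> 1")
  case True
  assume p: "1 \<le> p" "p \<le> 2" "0 \<le> z"
  have "z powr p \<le> 1 powr p" using p True by (intro powr_mono2) auto
  then have "z powr p \<le> 1" by simp
  moreover have "0 \<le> z\<^sup>2" by simp
  ultimately show ?thesis by linarith
next
  case False
  assume p: "1 \<le> p" "p \<le> 2" "0 \<le> z"
  have "z powr p \<le> z powr 2" using p False by (intro powr_mono) auto
  then show ?thesis using False by (simp add: powr_numeral)
qed

section \<open>Continuity of \<open>v\<close> in time\<close>

context lagr
begin

lemma local_bounds:
  obtains K B where "K \<ge> 0" "B \<ge> 0" "\<And>s \<xi>. \<bar>s\<bar> \<le> R \<Longrightarrow> a s \<xi> \<le> K" "\<And>s \<xi>. \<bar>s\<bar> \<le> R \<Longrightarrow> h s \<xi> \<le> K"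
    "\<And>s \<xi>. \<bar>s\<bar> \<le> R \<Longrightarrow> \<bar>y s \<xi> - \<xi>\<bar> \<le> B"
proof -
  interpret ls: lagrangian_solution X "\<bar>R\<bar> + 1" E using sol[of R] by simp
  have in': "s \<in> {-(\<bar>R\<bar> + 1)..\<bar>R\<bar> + 1}" if "\<bar>s\<bar> \<le> R" for s using that by auto
  obtain K1 where K1: "K1 \<ge> 0" "\<And>t. t \<in> {-(\<bar>R\<bar> + 1)..\<bar>R\<bar> + 1} \<Longrightarrow> norm (ca (X t)) \<le> K1"
    by (rule ls.loclip_bound[OF loclip_bounded_linear[OF bl(3)]]) blast
  obtain K2 where K2: "K2 \<ge> 0" "\<And>t. t \<in> {-(\<bar>R\<bar> + 1)..\<bar>R\<bar> + 1} \<Longrightarrow> norm (ch (X t)) \<le> K2"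
    by (rule ls.loclip_bound[OF loclip_bounded_linear[OF bl(5)]]) blast
  obtain B where B: "B \<ge> 0" "\<And>t. t \<in> {-(\<bar>R\<bar> + 1)..\<bar>R\<bar> + 1} \<Longrightarrow> norm (cz (X t)) \<le> B"
    by (rule ls.loclip_bound[OF loclip_bounded_linear[OF bl(1)]]) blast
  show ?thesis
  proof (rule that[of "K1 + K2" B])
    fix s \<xi> assume s: "\<bar>s\<bar> \<le> R"
    show "a s \<xi> \<le> K1 + K2" using ev_le_norm[of "ca (X s)" \<xi>] K1(2)[OF in'[OF s]] K2(1) by linarith
    show "h s \<xi> \<le> K1 + K2" using ev_le_norm[of "ch (X s)" \<xi>] K2(2)[OF in'[OF s]] K1(1) by linarith
    show "\<bar>y s \<xi> - \<xi>\<bar> \<le> B" using ev_le_norm[of "cz (X s)" \<xi>] B(2)[OF in'[OF s]] by (simp add: y_def)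
  qed (use K1 K2 B in auto)
qed

text \<open>The factor \<open>a\<close>, which comes from \<open>b^2 \<le> a h\<close>, is what
  keeps \<open>r^2 / a\<close>, the density of \<open>v^2\<close> in labels, bounded as
  \<open>a\<close> tends to 0.\<close>

lemma r_square: "(r t \<xi>)\<^sup>2 \<le> a t \<xi> * (2 * (1 + E)\<^sup>2 * h t \<xi> + 2 * CE\<^sup>2 * a t \<xi>)"
proof -
  have U2: "(U t \<xi>)\<^sup>2 \<le> (1 + E)\<^sup>2" using U_bound[of t \<xi>] by (metis abs_ge_zero power2_abs power_mono)
  have Q2: "(Q t \<xi>)\<^sup>2 \<le> CE\<^sup>2" using PQ_bound(2)[of t \<xi>] by (metis abs_ge_zero power2_abs power_mono)
  have b2: "(b t \<xi>)\<^sup>2 \<le> a t \<xi> * h t \<xi>" using invariant[of t \<xi>] by simp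
  have "(r t \<xi>)\<^sup>2 \<le> 2 * ((U t \<xi>)\<^sup>2 * (b t \<xi>)\<^sup>2) + 2 * ((a t \<xi>)\<^sup>2 * (Q t \<xi>)\<^sup>2)"
    using sum_squares_ge_zero[of "U t \<xi> * b t \<xi> - a t \<xi> * Q t \<xi>" 0]
    by (simp add: r_def power2_eq_square algebra_simps)
  also have "\<dots> \<le> 2 * ((1 + E)\<^sup>2 * (a t \<xi> * h t \<xi>)) + 2 * ((a t \<xi>)\<^sup>2 * CE\<^sup>2)"
    using U2 Q2 b2 by (intro add_mono mult_left_mono mult_mono) auto
  also have "\<dots> = a t \<xi> * (2 * (1 + E)\<^sup>2 * h t \<xi> + 2 * CE\<^sup>2 * a t \<xi>)" by (simp add: power2_eq_square algebra_simps)
  finally show ?thesis .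
qed

lemma r_measurable [measurable]: "r t \<in> borel_measurable borel"
  unfolding r_def by measurable

text \<open>The integrand of \<open>np p (v s - g)\<close> in the label variable.\<close>

definition "\<phi> p g s \<xi> = (if a s \<xi> = 0 then 0 else indicator {0..1} (y s \<xi>) * (a s \<xi> * \<bar>r s \<xi> / a s \<xi> - g (y s \<xi>)\<bar> powr p))"

lemma \<phi>_nonneg: "0 \<le> \<phi> p g s \<xi>"
  using a_nonneg by (simp add: \<phi>_def)

lemma np_v:
  assumes [measurable]: "g \<in> borel_measurable borel"
  shows "np p (\<lambda>x. v s x - g x) = (\<integral>\<^sup>+\<xi>. ennreal (\<phi> p g s \<xi>) \<partial>lborel)"
proof -
  have "np p (\<lambda>x. v s x - g x) = (\<integral>\<^sup>+\<xi>. ennreal (a s \<xi>) * (ennreal (\<bar>v s (y s \<xi>) - g (y s \<xi>)\<bar> powr p) * indicator {0..1} (y s \<xi>)) \<partial>lborel)"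
    unfolding np_def by (rule nn_integral_pullback[OF primitive_y a_nonneg y_limits]) measurable
  also have "\<dots> = (\<integral>\<^sup>+\<xi>. ennreal (\<phi> p g s \<xi>) \<partial>lborel)"
  proof (rule nn_integral_cong_AE)
    show "AE \<xi> in lborel. ennreal (a s \<xi>) * (ennreal (\<bar>v s (y s \<xi>) - g (y s \<xi>)\<bar> powr p) * indicator {0..1} (y s \<xi>)) = ennreal (\<phi> p g s \<xi>)"
      using v_pullback[of s]
    proof eventually_elim
      case (elim \<xi>)
      show ?case
      proof (cases "a s \<xi> = 0")
        case False
        with elim have "v s (y s \<xi>) = r s \<xi> / a s \<xi>" by simp
        then show ?thesis using False by (simp add: \<phi>_def indicator_def ennreal_mult[symmetric] a_nonneg)
      qed (simp add: \<phi>_def)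
    qed
  qed
  finally show ?thesis .
qed

lemma \<phi>_measurable:
  assumes [measurable]: "g \<in> borel_measurable borel"
  shows "\<phi> p g s \<in> borel_measurable borel"
proof -
  have [measurable]: "(\<lambda>\<xi>. indicator {0..1} (y s \<xi>) :: real) \<in> borel_measurable borel"
    by (rule measurable_compose[OF y_measurable]) simp
  have [measurable]: "(\<lambda>\<xi>. g (y s \<xi>)) \<in> borel_measurable borel"
    by (rule measurable_compose[OF y_measurable assms])
  have "(\<lambda>\<xi>. if a s \<xi> = 0 then 0 else indicator {0..1} (y s \<xi>) * (a s \<xi> * \<bar>r s \<xi> / a s \<xi> - g (y s \<xi>)\<bar> powr p)) \<in> borel_measurable borel"
    by measurable
  then show ?thesis unfolding \<phi>_def[abs_def] .
qed

lemma \<phi>_bound: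
  assumes p: "1 \<le> p" "p \<le> 2" and g: "\<And>x. \<bar>g x\<bar> \<le> G"
  shows "\<phi> p g s \<xi> \<le> indicator {0..1} (y s \<xi>) * (4 * (1 + E)\<^sup>2 * h s \<xi> + (4 * CE\<^sup>2 + 2 * G\<^sup>2 + 1) * a s \<xi>)"
proof (cases "a s \<xi> = 0")
  case True
  then show ?thesis using h_nonneg[of s \<xi>] by (simp add: \<phi>_def)
next
  case False
  then have a: "0 < a s \<xi>" using a_nonneg[of s \<xi>] by simp
  let ?q = "r s \<xi> / a s \<xi>"
  have g2: "(g (y s \<xi>))\<^sup>2 \<le> G\<^sup>2" using g by (metis abs_ge_zero power2_abs power_mono)
  have "\<bar>?q - g (y s \<xi>)\<bar> powr p \<le> \<bar>?q - g (y s \<xi>)\<bar>\<^sup>2 + 1" by (rule powr_le_square) (use p in auto)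
  also have "\<dots> \<le> 2 * ?q\<^sup>2 + 2 * (g (y s \<xi>))\<^sup>2 + 1"
    using sum_squares_ge_zero[of "?q + g (y s \<xi>)" 0] by (simp add: power2_eq_square algebra_simps)
  finally have "a s \<xi> * \<bar>?q - g (y s \<xi>)\<bar> powr p \<le> a s \<xi> * (2 * ?q\<^sup>2 + 2 * G\<^sup>2 + 1)"
    using g2 a by (intro mult_left_mono) auto
  also have "\<dots> = 2 * ((r s \<xi>)\<^sup>2 / a s \<xi>) + (2 * G\<^sup>2 + 1) * a s \<xi>"
    using a by (simp add: power2_eq_square field_simps)
  also have "(r s \<xi>)\<^sup>2 / a s \<xi> \<le> 2 * (1 + E)\<^sup>2 * h s \<xi> + 2 * CE\<^sup>2 * a s \<xi>"
    using r_square[of s \<xi>] a by (simp add: pos_divide_le_eq mult.commute)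
  finally have "a s \<xi> * \<bar>?q - g (y s \<xi>)\<bar> powr p \<le> 4 * (1 + E)\<^sup>2 * h s \<xi> + (4 * CE\<^sup>2 + 2 * G\<^sup>2 + 1) * a s \<xi>"
    by (simp add: algebra_simps)
  then show ?thesis using False by (simp add: \<phi>_def indicator_def)
qed

text \<open>A whole period of labels is added on either side because the fibres over 0 and 1 may be
  intervals.\<close>

lemma y_in_unit: "y s \<xi> \<in> {0..1} \<Longrightarrow> \<xi> \<in> {lab s 0 - 1..lab s 0 + 2}"
proof -
  assume y: "y s \<xi> \<in> {0..1}"
  have "y s (lab s 0 - 1) = -1" "y s (lab s 0 + 2) = 2"
    using y_periodic[of s "lab s 0 - 1"] y_periodic[of s "lab s 0"] y_periodic[of s "lab s 0 + 1"]
    by (simp_all add: y_lab add.assoc)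
  then show ?thesis using y_mono[of \<xi> "lab s 0 - 1" s] y_mono[of "lab s 0 + 2" \<xi> s] y by force
qed

text \<open>The integral over three periods of \<open>4 (1 + E)^2 h + (4 CE^2 + 1) a\<close>, the
  bound of \<open>\<phi>_bound\<close> with \<open>G = 0\<close>; three periods come from
  \<open>y_in_unit\<close>.\<close>

definition "L2 = 12 * (1 + E)\<^sup>2 * E + 3 * (4 * CE\<^sup>2 + 1)"

lemma L2_nonneg: "0 \<le> L2" using E_nonneg by (simp add: L2_def)

lemma np_v_bound: assumes "1 \<le> p" "p \<le> 2" shows "np p (v s) \<le> ennreal L2"
proof -
  let ?f = "\<lambda>\<xi>. 4 * (1 + E)\<^sup>2 * h s \<xi> + (4 * CE\<^sup>2 + 1) * a s \<xi>"
  have f0: "0 \<le> ?f \<xi>" for \<xi> using h_nonneg[of s \<xi>] a_nonneg[of s \<xi>] by simp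
  have pr: "primitive (\<lambda>\<xi>. 4 * (1 + E)\<^sup>2 * H s \<xi> + (4 * CE\<^sup>2 + 1) * y s \<xi>) ?f"
    by (intro primitive_add primitive_cmult primitive_y ev_primitive)
  have "np p (v s) = (\<integral>\<^sup>+\<xi>. ennreal (\<phi> p (\<lambda>_. 0) s \<xi>) \<partial>lborel)"
    using np_v[of "\<lambda>_. 0" p s] by simp
  also have "\<dots> \<le> (\<integral>\<^sup>+\<xi>\<in>{lab s 0 - 1..lab s 0 + 2}. ennreal (?f \<xi>) \<partial>lborel)"
  proof (rule nn_integral_mono)
    fix \<xi>
    have "\<phi> p (\<lambda>_. 0) s \<xi> \<le> indicator {0..1} (y s \<xi>) * ?f \<xi>" using \<phi>_bound[OF assms, of "\<lambda>_. 0" 0 s \<xi>] by simp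
    also have "\<dots> \<le> indicator {lab s 0 - 1..lab s 0 + 2} \<xi> * ?f \<xi>"
      using y_in_unit[of s \<xi>] f0[of \<xi>] by (auto simp: indicator_def)
    finally show "ennreal (\<phi> p (\<lambda>_. 0) s \<xi>) \<le> ennreal (?f \<xi>) * indicator {lab s 0 - 1..lab s 0 + 2} \<xi>"
      by (auto simp: indicator_def ennreal_neg intro: ennreal_leI split: if_splits)
  qed
  also have "\<dots> = ennreal ((4 * (1 + E)\<^sup>2 * H s (lab s 0 + 2) + (4 * CE\<^sup>2 + 1) * y s (lab s 0 + 2)) - (4 * (1 + E)\<^sup>2 * H s (lab s 0 - 1) + (4 * CE\<^sup>2 + 1) * y s (lab s 0 - 1)))"
    by (rule primitive_nn_integral[OF pr f0]) simp
  also have "\<dots> = ennreal L2"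
  proof -
    have H3: "H s (lab s 0 + 2) = H s (lab s 0 - 1) + 3 * E" "y s (lab s 0 + 2) = y s (lab s 0 - 1) + 3"
      using antider_period[of "ch (X s)" "lab s 0 - 1"] antider_period[of "ch (X s)" "lab s 0"] antider_period[of "ch (X s)" "lab s 0 + 1"]
        y_periodic[of s "lab s 0 - 1"] y_periodic[of s "lab s 0"] y_periodic[of s "lab s 0 + 1"] energy[of s]
      by (simp_all add: add.assoc)
    show ?thesis unfolding H3 by (simp add: L2_def algebra_simps)
  qed
  finally show ?thesis .
qed

text \<open>Where \<open>a t \<xi> \<noteq> 0\<close> all ingredients are continuous in time, apart
  from the indicator. Where \<open>a t \<xi> = 0\<close> write
  \<open>a q^p = (a q^2) powr (p/2) * a powr (1 - p/2)\<close>: the first factor is bounded by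
  \<open>r_square\<close>, the second tends to 0 exactly because \<open>p < 2\<close>. For
  \<open>p = 2\<close> such labels are excluded by \<open>good\<close>.\<close>

lemma \<phi>_tendsto:
  assumes p: "1 \<le> p" "p \<le> 2" and g: "continuous_on UNIV g" "\<And>x. \<bar>g x\<bar> \<le> G"
    and S: "S \<longlonglongrightarrow> t" and good: "p < 2 \<or> (AE \<xi> in lborel. a t \<xi> \<noteq> 0)"
  shows "AE \<xi> in lborel. (\<lambda>n. \<phi> p g (S n) \<xi>) \<longlonglongrightarrow> \<phi> p g t \<xi>"
proof -
  have lim: "(\<lambda>n. a (S n) \<xi>) \<longlonglongrightarrow> a t \<xi>" "(\<lambda>n. h (S n) \<xi>) \<longlonglongrightarrow> h t \<xi>" "(\<lambda>n. y (S n) \<xi>) \<longlonglongrightarrow> y t \<xi>" "(\<lambda>n. r (S n) \<xi>) \<longlonglongrightarrow> r t \<xi>" for \<xi>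
    unfolding r_def
    by (intro tendsto_intros isCont_tendsto_compose[OF isCont_a S] isCont_tendsto_compose[OF isCont_b S] isCont_tendsto_compose[OF isCont_h S]
        isCont_tendsto_compose[OF isCont_Q S] isCont_tendsto_compose[OF isCont_U S] isCont_tendsto_compose[OF DERIV_isCont[OF dy] S])+
  have pos: "(\<lambda>n. \<phi> p g (S n) \<xi>) \<longlonglongrightarrow> \<phi> p g t \<xi>" if a: "a t \<xi> \<noteq> 0" and y: "y t \<xi> \<noteq> 0" "y t \<xi> \<noteq> 1" for \<xi>
  proof -
    have ev: "\<forall>\<^sub>F n in sequentially. a (S n) \<xi> \<noteq> 0" by (rule tendsto_imp_eventually_ne[OF lim(1) a])
    have "\<forall>\<^sub>F n in sequentially. indicator {0..1} (y (S n) \<xi>) = (indicator {0..1} (y t \<xi>) :: real)"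
    proof (cases "y t \<xi> \<in> {0..1}")
      case True
      then have "0 < y t \<xi>" "y t \<xi> < 1" using y by auto
      from order_tendstoD(1)[OF lim(3) this(1)] order_tendstoD(2)[OF lim(3) this(2)]
      show ?thesis by eventually_elim (use True in \<open>auto simp: indicator_def\<close>)
    next
      case False
      then consider "y t \<xi> < 0" | "y t \<xi> > 1" by force
      then show ?thesis
      proof cases
        case 1
        from order_tendstoD(2)[OF lim(3) 1] show ?thesis by eventually_elim (use 1 in \<open>auto simp: indicator_def\<close>)
      next
        case 2
        from order_tendstoD(1)[OF lim(3) 2] show ?thesis by eventually_elim (use 2 in \<open>auto simp: indicator_def\<close>)
      qed
    qed
    then have i: "(\<lambda>n. indicator {0..1} (y (S n) \<xi>) :: real) \<longlonglongrightarrow> indicator {0..1} (y t \<xi>)" by (rule tendsto_eventually)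
    have gc: "(\<lambda>n. g (y (S n) \<xi>)) \<longlonglongrightarrow> g (y t \<xi>)"
      using continuous_on_tendsto_compose[OF g(1) lim(3)] by simp
    have "(\<lambda>n. \<bar>r (S n) \<xi> / a (S n) \<xi> - g (y (S n) \<xi>)\<bar> powr p) \<longlonglongrightarrow> \<bar>r t \<xi> / a t \<xi> - g (y t \<xi>)\<bar> powr p"
      by (rule tendsto_powr') (use p a in \<open>auto intro!: tendsto_intros lim gc\<close>)
    then have "(\<lambda>n. indicator {0..1} (y (S n) \<xi>) * (a (S n) \<xi> * \<bar>r (S n) \<xi> / a (S n) \<xi> - g (y (S n) \<xi>)\<bar> powr p)) \<longlonglongrightarrow> \<phi> p g t \<xi>"
      using a unfolding \<phi>_def by (auto intro!: tendsto_intros i lim)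
    then show ?thesis
      by (rule Lim_transform_eventually) (use ev in \<open>eventually_elim, simp add: \<phi>_def\<close>)
  qed
  have zero: "(\<lambda>n. \<phi> p g (S n) \<xi>) \<longlonglongrightarrow> \<phi> p g t \<xi>" if a: "a t \<xi> = 0" and p2: "p < 2" for \<xi>
  proof -
    define K where "K n = 4 * (1 + E)\<^sup>2 * h (S n) \<xi> + (4 * CE\<^sup>2 + 2 * G\<^sup>2) * a (S n) \<xi>" for n
    have K0: "0 \<le> K n" for n using h_nonneg[of "S n" \<xi>] a_nonneg[of "S n" \<xi>] by (simp add: K_def)
    have le: "\<phi> p g (S n) \<xi> \<le> (K n) powr (p / 2) * a (S n) \<xi> powr (1 - p / 2)" for n
    proof (cases "a (S n) \<xi> = 0")
      case False
      then have an: "0 < a (S n) \<xi>" using a_nonneg[of "S n" \<xi>] by simp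
      let ?q = "r (S n) \<xi> / a (S n) \<xi>"
      have g2: "(g (y (S n) \<xi>))\<^sup>2 \<le> G\<^sup>2" using g(2) by (metis abs_ge_zero power2_abs power_mono)
      have "\<bar>?q - g (y (S n) \<xi>)\<bar>\<^sup>2 \<le> 2 * ?q\<^sup>2 + 2 * (g (y (S n) \<xi>))\<^sup>2"
        using sum_squares_ge_zero[of "?q + g (y (S n) \<xi>)" 0] by (simp add: power2_eq_square algebra_simps)
      then have "a (S n) \<xi> * \<bar>?q - g (y (S n) \<xi>)\<bar>\<^sup>2 \<le> a (S n) \<xi> * (2 * ?q\<^sup>2 + 2 * G\<^sup>2)"
        using g2 an by (intro mult_left_mono) auto
      also have "\<dots> = 2 * ((r (S n) \<xi>)\<^sup>2 / a (S n) \<xi>) + 2 * G\<^sup>2 * a (S n) \<xi>"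
        using an by (simp add: power2_eq_square field_simps)
      also have "(r (S n) \<xi>)\<^sup>2 / a (S n) \<xi> \<le> 2 * (1 + E)\<^sup>2 * h (S n) \<xi> + 2 * CE\<^sup>2 * a (S n) \<xi>"
        using r_square[of "S n" \<xi>] an by (simp add: pos_divide_le_eq mult.commute)
      finally have "a (S n) \<xi> * \<bar>?q - g (y (S n) \<xi>)\<bar>\<^sup>2 \<le> K n" by (simp add: K_def algebra_simps)
      then have "(a (S n) \<xi> * \<bar>?q - g (y (S n) \<xi>)\<bar>\<^sup>2) powr (p / 2) \<le> K n powr (p / 2)"
        using an p by (intro powr_mono2) auto
      also have "(a (S n) \<xi> * \<bar>?q - g (y (S n) \<xi>)\<bar>\<^sup>2) powr (p / 2) = a (S n) \<xi> powr (p / 2) * \<bar>?q - g (y (S n) \<xi>)\<bar> powr p"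
      proof -
        have "(\<bar>?q - g (y (S n) \<xi>)\<bar>\<^sup>2) powr (p / 2) = \<bar>?q - g (y (S n) \<xi>)\<bar> powr p"
          using powr_powr[of "\<bar>?q - g (y (S n) \<xi>)\<bar>" 2 "p / 2"] by (simp add: powr_numeral)
        then show ?thesis using an by (simp add: powr_mult)
      qed
      finally have "a (S n) \<xi> powr (1 - p / 2) * (a (S n) \<xi> powr (p / 2) * \<bar>?q - g (y (S n) \<xi>)\<bar> powr p) \<le> a (S n) \<xi> powr (1 - p / 2) * K n powr (p / 2)"
        by (intro mult_left_mono) auto
      also have "a (S n) \<xi> powr (1 - p / 2) * (a (S n) \<xi> powr (p / 2) * \<bar>?q - g (y (S n) \<xi>)\<bar> powr p) = a (S n) \<xi> * \<bar>?q - g (y (S n) \<xi>)\<bar> powr p"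
        using an by (simp add: mult.assoc[symmetric] powr_add[symmetric])
      finally have "a (S n) \<xi> * \<bar>?q - g (y (S n) \<xi>)\<bar> powr p \<le> K n powr (p / 2) * a (S n) \<xi> powr (1 - p / 2)" by (simp add: mult.commute)
      then show ?thesis using False by (auto simp: \<phi>_def indicator_def)
    qed (simp add: \<phi>_def)
    have "K \<longlonglongrightarrow> 4 * (1 + E)\<^sup>2 * h t \<xi> + (4 * CE\<^sup>2 + 2 * G\<^sup>2) * a t \<xi>"
      unfolding K_def by (intro tendsto_intros lim)
    then have "(\<lambda>n. (K n) powr (p / 2)) \<longlonglongrightarrow> (4 * (1 + E)\<^sup>2 * h t \<xi> + (4 * CE\<^sup>2 + 2 * G\<^sup>2) * a t \<xi>) powr (p / 2)"
      by (rule tendsto_powr'[OF _ tendsto_const]) (use p K0 in auto)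
    moreover have "(\<lambda>n. a (S n) \<xi> powr (1 - p / 2)) \<longlonglongrightarrow> 0"
      by (rule tendsto_zero_powrI[OF _ tendsto_const]) (use lim(1)[of \<xi>] a p2 a_nonneg in auto)
    ultimately have "(\<lambda>n. (K n) powr (p / 2) * a (S n) \<xi> powr (1 - p / 2)) \<longlonglongrightarrow> (4 * (1 + E)\<^sup>2 * h t \<xi> + (4 * CE\<^sup>2 + 2 * G\<^sup>2) * a t \<xi>) powr (p / 2) * 0"
      by (rule tendsto_mult)
    then have up: "(\<lambda>n. (K n) powr (p / 2) * a (S n) \<xi> powr (1 - p / 2)) \<longlonglongrightarrow> 0" by simp
    have "(\<lambda>n. \<phi> p g (S n) \<xi>) \<longlonglongrightarrow> 0"
    proof (rule Lim_null_comparison[OF _ up], intro always_eventually allI)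
      show "norm (\<phi> p g (S n) \<xi>) \<le> (K n) powr (p / 2) * a (S n) \<xi> powr (1 - p / 2)" for n
        using le[of n] \<phi>_nonneg[of p g "S n" \<xi>] by simp
    qed
    then show ?thesis using a by (simp add: \<phi>_def)
  qed
  \<comment> \<open>The indicator of the period is discontinuous only at positions 0 and 1, and
    almost all labels sent there have \<open>a = 0\<close>.\<close>
  have "AE x::real in lborel. x \<noteq> 0 \<and> x \<noteq> 1" by (intro AE_conjI AE_lborel_singleton)
  from AE_pullback[OF primitive_y[of t] a_nonneg y_limits this]
  have yp: "AE \<xi> in lborel. a t \<xi> = 0 \<or> (y t \<xi> \<noteq> 0 \<and> y t \<xi> \<noteq> 1)" .
  show ?thesis
  proof (cases "p < 2")
    case True
    from yp show ?thesis by eventually_elim (use pos zero True in blast)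
  next
    case False
    with good have "AE \<xi> in lborel. a t \<xi> \<noteq> 0" by blast
    with yp show ?thesis by eventually_elim (use pos in blast)
  qed
qed

lemma np_v_tendsto:
  assumes p: "1 \<le> p" "p \<le> 2" and g: "continuous_on UNIV g" "\<And>x. \<bar>g x\<bar> \<le> G"
    and S: "S \<longlonglongrightarrow> t" and good: "p < 2 \<or> (AE \<xi> in lborel. a t \<xi> \<noteq> 0)"
  shows "(\<lambda>n. np p (\<lambda>x. v (S n) x - g x)) \<longlonglongrightarrow> np p (\<lambda>x. v t x - g x)"
proof -
  have gm [measurable]: "g \<in> borel_measurable borel" by (rule borel_measurable_continuous_onI[OF g(1)])
  have "Bseq S" using S by (simp add: convergent_imp_Bseq convergentI)
  then obtain R where R: "\<And>n. \<bar>S n\<bar> \<le> R" by (auto simp: Bseq_def)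
  obtain K B where KB: "K \<ge> 0" "B \<ge> 0" "\<And>s \<xi>. \<bar>s\<bar> \<le> R \<Longrightarrow> a s \<xi> \<le> K" "\<And>s \<xi>. \<bar>s\<bar> \<le> R \<Longrightarrow> h s \<xi> \<le> K"
    "\<And>s \<xi>. \<bar>s\<bar> \<le> R \<Longrightarrow> \<bar>y s \<xi> - \<xi>\<bar> \<le> B" by (rule local_bounds[of R]) blast
  define M where "M = 4 * (1 + E)\<^sup>2 * K + (4 * CE\<^sup>2 + 2 * G\<^sup>2 + 1) * K"
  show ?thesis
    \<comment> \<open>For all times of the sequence \<open>\<bar>y - \<xi>\<bar>\<close> is at most
      \<open>B\<close>, so the labels sent into the unit interval lie in one fixed bounded set, on
      which a constant dominates.\<close>
    unfolding np_v[OF gm]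
  proof (rule nn_integral_dominated_convergence[where w = "\<lambda>\<xi>. ennreal M * indicator {-B-1..B+1} \<xi>"])
    show "AE \<xi> in lborel. ennreal (\<phi> p g (S n) \<xi>) \<le> ennreal M * indicator {- B - 1..B + 1} \<xi>" for n
    proof (rule AE_I2)
      fix \<xi>
      have "4 * (1 + E)\<^sup>2 * h (S n) \<xi> + (4 * CE\<^sup>2 + 2 * G\<^sup>2 + 1) * a (S n) \<xi> \<le> M"
        unfolding M_def using KB(3,4)[OF R] by (intro add_mono mult_left_mono) auto
      then have "\<phi> p g (S n) \<xi> \<le> indicator {0..1} (y (S n) \<xi>) * M"
        using \<phi>_bound[where g = g and G = G and s = "S n" and \<xi> = \<xi>, OF p g(2)] by (auto simp: indicator_def split: if_splits)
      moreover have "y (S n) \<xi> \<in> {0..1} \<Longrightarrow> \<xi> \<in> {-B-1..B+1}" using KB(5)[OF R, of n \<xi>] by auto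
      ultimately show "ennreal (\<phi> p g (S n) \<xi>) \<le> ennreal M * indicator {- B - 1..B + 1} \<xi>"
        by (cases "y (S n) \<xi> \<in> {0..1}") (auto simp: ennreal_neg intro: ennreal_leI)
    qed
    show "(\<integral>\<^sup>+\<xi>. ennreal M * indicator {- B - 1..B + 1} \<xi> \<partial>lborel) < \<infinity>"
      using KB(2) by (simp add: nn_integral_cmult ennreal_mult_less_top)
    show "AE \<xi> in lborel. (\<lambda>n. ennreal (\<phi> p g (S n) \<xi>)) \<longlonglongrightarrow> ennreal (\<phi> p g t \<xi>)"
      using \<phi>_tendsto[OF p g S good] by eventually_elim (rule tendsto_ennrealI)
    show "(\<lambda>\<xi>. ennreal (\<phi> p g (S n) \<xi>)) \<in> borel_measurable lborel" for n
      using \<phi>_measurable[OF gm] by simp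
    show "(\<lambda>\<xi>. ennreal (\<phi> p g t \<xi>)) \<in> borel_measurable lborel"
      using \<phi>_measurable[OF gm] by simp
  qed measurable
qed

text \<open>In labels, \<open>v t\<close> would have to be evaluated along the moving
  \<open>y (S n)\<close>, which a merely measurable function does not tolerate. A continuous
  \<open>g\<close> close to \<open>v t\<close> does, and both functions are compared with
  it.\<close>

theorem v_continuous:
  assumes p: "1 \<le> p" "p \<le> 2" and S: "S \<longlonglongrightarrow> t" and good: "p < 2 \<or> (AE \<xi> in lborel. a t \<xi> \<noteq> 0)"
  shows "(\<lambda>n. np p (\<lambda>x. v (S n) x - v t x)) \<longlonglongrightarrow> 0"
proof (rule order_tendstoI)
  fix e :: ennreal assume "0 < e"
  define c where "c = ennreal (2 powr p)"
  obtain e' where e': "0 < e'" "c * (e' + e') < e"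
  proof -
    obtain e0 where e0: "0 < e0" "ennreal e0 < e"
      using \<open>0 < e\<close> by (metis dense ennreal_cases ennreal_less_zero_iff ennreal_neq_top less_top not_less_iff_gr_or_eq top.extremum_strict)
    show ?thesis
    proof (rule that)
      show "0 < ennreal (e0 / (2 * 2 powr p))" using e0 by simp
      have "c * (ennreal (e0 / (2 * 2 powr p)) + ennreal (e0 / (2 * 2 powr p))) = ennreal e0"
        using e0 by (simp add: c_def ennreal_plus[symmetric] ennreal_mult[symmetric] del: ennreal_plus)
      then show "c * (ennreal (e0 / (2 * 2 powr p)) + ennreal (e0 / (2 * 2 powr p))) < e" using e0 by simp
    qed
  qed
  have fin: "np p (v t) < \<infinity>" using np_v_bound[OF p, of t] by (simp add: le_less_trans)
  obtain g G where g: "continuous_on UNIV g" "\<And>x. \<bar>g x\<bar> \<le> G" "np p (\<lambda>x. v t x - g x) < e'"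
    by (rule np_dense_continuous[OF v_measurable _ fin e'(1)]) (use p in auto)
  have [measurable]: "g \<in> borel_measurable borel" by (rule borel_measurable_continuous_onI[OF g(1)])
  from order_tendstoD(2)[OF np_v_tendsto[OF p g(1,2) S good] g(3)]
  show "\<forall>\<^sub>F n in sequentially. np p (\<lambda>x. v (S n) x - v t x) < e"
  proof eventually_elim
    case (elim n)
    have "np p (\<lambda>x. v (S n) x - v t x) \<le> c * (np p (\<lambda>x. v (S n) x - g x) + np p (\<lambda>x. v t x - g x))"
      unfolding c_def by (rule np_triangle) (use p in auto)
    also have "\<dots> \<le> c * (e' + e')" using elim g(3) by (intro mult_left_mono add_mono) auto
    also have "\<dots> < e" by (rule e'(2))
    finally show ?case .
  qed
qed (simp add: not_less)

end

text \<open>With \<open>m\<close> the modulus of the average, Young gives \<open>m^(p-1)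
  \<bar>f\<bar> \<le> \<bar>f\<bar>^p / p + (1 - 1/p) m^p\<close>; integrating and absorbing the
  last term proves the claim.\<close>

lemma jensen_powr:
  fixes f :: "real \<Rightarrow> real"
  assumes [measurable]: "f \<in> borel_measurable borel" and t: "t1 < t2" and p: "1 \<le> p"
  shows "ennreal (\<bar>(LINT s:{t1..t2}|lborel. f s) / (t2 - t1)\<bar> powr p)
    \<le> ennreal (1 / (t2 - t1)) * (\<integral>\<^sup>+s\<in>{t1..t2}. ennreal (\<bar>f s\<bar> powr p) \<partial>lborel)"
proof -
  define T where "T = t2 - t1"
  have T: "0 < T" using t by (simp add: T_def)
  define m where "m = \<bar>(LINT s:{t1..t2}|lborel. f s) / T\<bar>"
  let ?N = "\<integral>\<^sup>+s\<in>{t1..t2}. ennreal (\<bar>f s\<bar> powr p) \<partial>lborel"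
  have "ennreal (m powr p) \<le> ennreal (1 / T) * ?N"
  proof (cases "m = 0 \<or> ?N = \<infinity>")
    case True
    then show ?thesis using T by (auto simp: ennreal_mult_top)
  next
    case False
    then have m: "0 < m" and N: "?N < \<infinity>" by (auto simp: m_def less_top)
    \<comment> \<open>The integral of a non-integrable function is 0 by convention, which would
      force \<open>m = 0\<close>.\<close>
    have fi: "set_integrable lborel {t1..t2} f"
    proof (rule ccontr)
      assume "\<not> set_integrable lborel {t1..t2} f"
      then have "(LINT s:{t1..t2}|lborel. f s) = 0"
        unfolding set_integrable_def set_lebesgue_integral_def by (rule not_integrable_integral_eq)
      then show False using m by (simp add: m_def)
    qed
    have pint: "integrable lborel (\<lambda>s. indicator {t1..t2} s *\<^sub>R (\<bar>f s\<bar> powr p))"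
    proof (rule integrableI_nonneg)
      show "(\<integral>\<^sup>+s. ennreal (indicator {t1..t2} s *\<^sub>R \<bar>f s\<bar> powr p) \<partial>lborel) < \<infinity>"
        using N by (simp add: mult.commute ennreal_mult' ennreal_indicator)
    qed auto
    then have pi: "set_integrable lborel {t1..t2} (\<lambda>s. \<bar>f s\<bar> powr p)" by (simp add: set_integrable_def)
    define I where "I = (LINT s:{t1..t2}|lborel. \<bar>f s\<bar> powr p)"
    have NI: "?N = ennreal I"
    proof -
      have "?N = (\<integral>\<^sup>+s. ennreal (indicator {t1..t2} s *\<^sub>R \<bar>f s\<bar> powr p) \<partial>lborel)"
        by (intro nn_integral_cong) (auto simp: indicator_def)
      also have "\<dots> = ennreal I" unfolding I_def set_lebesgue_integral_def
        by (rule nn_integral_eq_integral[OF pint]) auto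
      finally show ?thesis .
    qed
    have young: "m powr (p - 1) * z \<le> (1/p) * z powr p + (1 - 1/p) * m powr p" if z: "0 \<le> z" for z
    proof (cases "p = 1")
      case True
      then show ?thesis using m z by simp
    next
      case False
      then have p1: "1 < p" using p by simp
      have "z * m powr (p - 1) \<le> z powr p / p + (m powr (p - 1)) powr (p / (p - 1)) / (p / (p - 1))"
        by (rule Youngs_inequality) (use p1 z in \<open>auto simp: field_simps\<close>)
      also have "(m powr (p - 1)) powr (p / (p - 1)) = m powr p" using p1 by (simp add: powr_powr)
      also have "m powr p / (p / (p - 1)) = (1 - 1/p) * m powr p" using p1 by (simp add: field_simps)
      finally show ?thesis by (simp add: mult.commute)
    qed
    have ci: "set_integrable lborel {t1..t2} (\<lambda>_. c)" for c :: real
      by (rule bounded_measurable_set_integrable[where C = "\<bar>c\<bar>"]) auto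
    have cint: "(LINT s:{t1..t2}|lborel. c) = c * T" for c :: real
      using t by (simp add: set_lebesgue_integral_def T_def)
    have ai: "set_integrable lborel {t1..t2} (\<lambda>s. \<bar>f s\<bar>)" by (rule set_integrable_abs[OF fi])
    have "\<bar>LINT s:{t1..t2}|lborel. f s\<bar> \<le> (LINT s:{t1..t2}|lborel. \<bar>f s\<bar>)"
      using set_integral_norm_bound[OF fi] by simp
    then have mT: "m * T \<le> (LINT s:{t1..t2}|lborel. \<bar>f s\<bar>)" using T by (simp add: m_def abs_divide)
    have "m powr (p - 1) * (m * T) \<le> m powr (p - 1) * (LINT s:{t1..t2}|lborel. \<bar>f s\<bar>)"
      using mT by (intro mult_left_mono) auto
    also have "\<dots> = (LINT s:{t1..t2}|lborel. m powr (p - 1) * \<bar>f s\<bar>)" by simp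
    also have "\<dots> \<le> (LINT s:{t1..t2}|lborel. (1/p) * \<bar>f s\<bar> powr p + (1 - 1/p) * m powr p)"
      by (rule set_integral_mono) (use ai pi ci young in \<open>auto intro!: set_integral_add(1)\<close>)
    also have "\<dots> = (LINT s:{t1..t2}|lborel. (1/p) * \<bar>f s\<bar> powr p) + (LINT s:{t1..t2}|lborel. (1 - 1/p) * m powr p)"
      by (rule set_integral_add(2)) (use pi ci in auto)
    also have "\<dots> = (1/p) * I + (1 - 1/p) * m powr p * T" unfolding cint I_def by simp
    finally have "m powr (p - 1) * (m * T) \<le> (1/p) * I + (1 - 1/p) * m powr p * T" .
    moreover have "m powr (p - 1) * (m * T) = m powr p * T"
      using powr_mult_base[of m "p - 1"] m by (simp add: mult_ac)
    ultimately have "m powr p * T \<le> (1/p) * I + (1 - 1/p) * m powr p * T" by simp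
    then have "(1/p) * (m powr p * T) \<le> (1/p) * I" by (simp only: left_diff_distrib mult_1_left mult.assoc)
    then have "m powr p * T \<le> I" using p by (simp add: divide_le_cancel)
    then have "m powr p \<le> 1 / T * I" using T by (simp add: field_simps)
    then have "ennreal (m powr p) \<le> ennreal (1 / T * I)" by (rule ennreal_leI)
    also have "\<dots> = ennreal (1 / T) * ?N" unfolding NI using T by (intro ennreal_mult') simp
    finally show ?thesis .
  qed
  then show ?thesis by (simp add: m_def T_def)
qed

lemma periodic_nn_bound:
  fixes f :: "real \<Rightarrow> ennreal"
  assumes [measurable]: "f \<in> borel_measurable borel" and per: "\<And>x. f (x + 1) = f x"
  shows "(\<integral>\<^sup>+x\<in>{-real N..real N}. f x \<partial>lborel) \<le> of_nat (2 * N) * (\<integral>\<^sup>+x\<in>{0..1}. f x \<partial>lborel)"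
proof -
  let ?c = "\<lambda>k::nat. - real N + real k"
  have unit: "(\<integral>\<^sup>+x\<in>{?c k..?c k + 1}. f x \<partial>lborel) = (\<integral>\<^sup>+x\<in>{0..1}. f x \<partial>lborel)" for k
  proof -
    have "f (?c k + x) = f x" for x
      using periodic_int[of f x "int k - int N", OF per] by (simp add: algebra_simps)
    then have "(\<integral>\<^sup>+x\<in>{0..1}. f x \<partial>lborel) = (\<integral>\<^sup>+x. (\<lambda>z. f z * indicator {?c k..?c k + 1} z) (?c k + 1 * x) \<partial>lborel)"
      by (intro nn_integral_cong) (auto simp: indicator_def)
    also have "\<dots> = (\<integral>\<^sup>+x\<in>{?c k..?c k + 1}. f x \<partial>lborel)"
      using nn_integral_real_affine[of "\<lambda>z. f z * indicator {?c k..?c k + 1} z" 1 "?c k"] by simp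
    finally show ?thesis by simp
  qed
  show ?thesis
  proof (cases "N = 0")
    case True
    have "AE x::real in lborel. x \<noteq> 0" by (rule AE_lborel_singleton)
    then have "(\<integral>\<^sup>+x\<in>{-real N..real N}. f x \<partial>lborel) = (\<integral>\<^sup>+x. 0 \<partial>(lborel::real measure))"
      using True by (intro nn_integral_cong_AE) (auto simp: indicator_def)
    then show ?thesis by simp
  next
    case False
    have "(\<integral>\<^sup>+x\<in>{-real N..real N}. f x \<partial>lborel) \<le> (\<integral>\<^sup>+x. (\<Sum>k<2*N. f x * indicator {?c k..?c k + 1} x) \<partial>lborel)"
    proof (rule nn_integral_mono)
      fix x
      show "f x * indicator {-real N..real N} x \<le> (\<Sum>k<2*N. f x * indicator {?c k..?c k + 1} x)"
      proof (cases "x \<in> {-real N..real N}")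
        case True
        \<comment> \<open>The minimum assigns the right end point \<open>x = N\<close> to the last
          unit interval.\<close>
        define k where "k = min (nat \<lfloor>x + real N\<rfloor>) (2 * N - 1)"
        have k: "k < 2 * N" using False by (auto simp: k_def)
        have "x \<in> {?c k..?c k + 1}"
        proof (cases "nat \<lfloor>x + real N\<rfloor> \<le> 2 * N - 1")
          case True
          then have "k = nat \<lfloor>x + real N\<rfloor>" by (simp add: k_def)
          moreover have "0 \<le> \<lfloor>x + real N\<rfloor>" using \<open>x \<in> {-real N..real N}\<close> by (simp only: zero_le_floor) simp
          ultimately have "real k = of_int \<lfloor>x + real N\<rfloor>" by (simp only: of_nat_nat)
          then show ?thesis unfolding atLeastAtMost_iff by linarith
        next
          case False
          then have k2: "k = 2 * N - 1" by (simp add: k_def)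
          have "real (2 * N) \<le> x + real N" using False \<open>N \<noteq> 0\<close> by linarith
          then have "x = real N" using \<open>x \<in> {-real N..real N}\<close> by simp
          then show ?thesis using k2 \<open>N \<noteq> 0\<close> by (simp add: of_nat_diff)
        qed
        then have "f x * indicator {-real N..real N} x \<le> f x * indicator {?c k..?c k + 1} x" by (simp add: indicator_def)
        also have "\<dots> \<le> (\<Sum>k<2*N. f x * indicator {?c k..?c k + 1} x)"
          using k by (intro member_le_sum) auto
        finally show ?thesis .
      qed simp
    qed
    also have "\<dots> = (\<Sum>k<2*N. \<integral>\<^sup>+x\<in>{?c k..?c k + 1}. f x \<partial>lborel)"
      by (rule nn_integral_sum) measurable
    also have "\<dots> = of_nat (2 * N) * (\<integral>\<^sup>+x\<in>{0..1}. f x \<partial>lborel)" unfolding unit by simp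
    finally show ?thesis .
  qed
qed

section \<open>Difference quotients of \<open>u\<close> as time averages of \<open>v\<close>\<close>

context lagr
begin

lemma v_pair_measurable [measurable]: "(\<lambda>(s, x). v s x) \<in> borel_measurable (lborel \<Otimes>\<^sub>M lborel)"
proof -
  have "(\<lambda>z. v (fst z) (snd z)) \<in> borel_measurable (borel \<Otimes>\<^sub>M borel)" using v_measurable2 by (simp add: borel_prod)
  then show ?thesis by (simp add: case_prod_unfold cong: measurable_cong_sets)
qed

lemma v_integrable_box:
  assumes "t1 \<le> t2"
  shows "integrable (lborel \<Otimes>\<^sub>M lborel) (\<lambda>(s, x). indicator {t1..t2} s * (indicator {c..d} x * v s x))"
proof -
  obtain N where N: "\<bar>c\<bar> + \<bar>d\<bar> \<le> real N" using real_arch_simple by blast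
  have inner: "(\<integral>\<^sup>+x. ennreal (norm (indicator {t1..t2} s * (indicator {c..d} x * v s x))) \<partial>lborel)
      \<le> (of_nat (2 * N) * ennreal L2) * indicator {t1..t2} s" for s
  proof -
    have "(\<integral>\<^sup>+x. ennreal (norm (indicator {t1..t2} s * (indicator {c..d} x * v s x))) \<partial>lborel)
      \<le> (\<integral>\<^sup>+x. (ennreal (\<bar>v s x\<bar> powr 1) * indicator {-real N..real N} x) * indicator {t1..t2} s \<partial>lborel)"
      using N by (intro nn_integral_mono) (auto simp: indicator_def)
    also have "\<dots> = (\<integral>\<^sup>+x\<in>{-real N..real N}. ennreal (\<bar>v s x\<bar> powr 1) \<partial>lborel) * indicator {t1..t2} s"
      by (rule nn_integral_multc) measurable
    also have "(\<integral>\<^sup>+x\<in>{-real N..real N}. ennreal (\<bar>v s x\<bar> powr 1) \<partial>lborel) \<le> of_nat (2 * N) * np 1 (v s)"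
      unfolding np_def by (rule periodic_nn_bound) (simp_all add: v_periodic)
    also have "\<dots> \<le> of_nat (2 * N) * ennreal L2" by (intro mult_left_mono np_v_bound) auto
    finally show ?thesis by (simp add: mult_right_mono)
  qed
  show ?thesis
  proof (rule integrableI_bounded)
    show "(\<lambda>(s, x). indicator {t1..t2} s * (indicator {c..d} x * v s x)) \<in> borel_measurable (lborel \<Otimes>\<^sub>M lborel)"
      by measurable
    have "(\<integral>\<^sup>+z. ennreal (norm (case z of (s, x) \<Rightarrow> indicator {t1..t2} s * (indicator {c..d} x * v s x))) \<partial>(lborel \<Otimes>\<^sub>M lborel))
      = (\<integral>\<^sup>+s. \<integral>\<^sup>+x. ennreal (norm (indicator {t1..t2} s * (indicator {c..d} x * v s x))) \<partial>lborel \<partial>lborel)"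
      by (subst lborel.nn_integral_fst[symmetric]) auto
    also have "\<dots> \<le> (\<integral>\<^sup>+s. (of_nat (2 * N) * ennreal L2) * indicator {t1..t2} s \<partial>lborel)"
      by (rule nn_integral_mono) (rule inner)
    also have "\<dots> < \<infinity>" using assms by (simp add: nn_integral_cmult ennreal_mult_less_top of_nat_less_top)
    finally show "(\<integral>\<^sup>+z. ennreal (norm (case z of (s, x) \<Rightarrow> indicator {t1..t2} s * (indicator {c..d} x * v s x))) \<partial>(lborel \<Otimes>\<^sub>M lborel)) < \<infinity>" .
  qed
qed

lemma \<Psi>_time_integral:
  assumes t: "t1 \<le> t2"
  shows "(LINT s:{t1..t2}|lborel. \<Psi> s d - \<Psi> s c) = (antider (u t2) d - antider (u t2) c) - (antider (u t1) d - antider (u t1) c)"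
proof -
  have cont: "continuous_on {t1..t2} (\<lambda>s. \<Psi> s d - \<Psi> s c)"
    unfolding continuous_on_def by (intro ballI tendsto_diff \<Psi>_tendsto tendsto_ident_at tendsto_const)
  have "((\<lambda>s. \<Psi> s d - \<Psi> s c) has_integral (antider (u t2) d - antider (u t2) c) - (antider (u t1) d - antider (u t1) c)) {t1..t2}"
    by (rule fundamental_theorem_of_calculus[OF t])
      (use W_derivative in \<open>auto simp: has_real_derivative_iff_has_vector_derivative intro: has_vector_derivative_at_within\<close>)
  moreover have "set_integrable lborel {t1..t2} (\<lambda>s. \<Psi> s d - \<Psi> s c)"
    unfolding set_integrable_def by (rule borel_integrable_compact[OF compact_Icc cont])
  ultimately show ?thesis by (simp add: set_borel_integral_eq_integral(2) integral_unique)
qed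

text \<open>Both sides are densities of the same function of \<open>x\<close>: integrate
  \<open>W_derivative\<close> in time and exchange the integrals, then use uniqueness of
  densities.\<close>

lemma u_difference:
  assumes t: "t1 \<le> t2"
  shows "AE x in lborel. u t2 x - u t1 x = (LINT s:{t1..t2}|lborel. v s x)"
    "AE x in lborel. set_integrable lborel {t1..t2} (\<lambda>s. v s x)"
proof -
  define k where "k x = (LINT s:{t1..t2}|lborel. v s x)" for x
  have k: "k \<in> borel_measurable borel"
  proof -
    have "(\<lambda>x. \<integral>s. indicator {t1..t2} s *\<^sub>R v s x \<partial>lborel) \<in> borel_measurable lborel"
      by (rule lborel.borel_measurable_lebesgue_integral) measurable
    then show ?thesis unfolding k_def set_lebesgue_integral_def by simp
  qed
  have "primitive (\<lambda>x. antider (u t2) x - antider (u t1) x) k"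
    unfolding primitive_def
  proof (intro conjI allI impI k)
    fix c d :: real assume cd: "c \<le> d"
    note I = v_integrable_box[OF t, of c d]
    have eq: "(\<integral>s. indicator {t1..t2} s * (indicator {c..d} x * v s x) \<partial>lborel) = indicator {c..d} x *\<^sub>R k x" for x
      unfolding k_def set_lebesgue_integral_def by (simp add: mult.left_commute)
    from lborel_pair.integrable_snd[OF I] show "set_integrable lborel {c..d} k"
      by (simp add: eq set_integrable_def)
    have "(LINT x:{c..d}|lborel. k x) = (\<integral>x. (\<integral>s. indicator {t1..t2} s * (indicator {c..d} x * v s x) \<partial>lborel) \<partial>lborel)"
      by (simp add: eq set_lebesgue_integral_def)
    also have "\<dots> = (\<integral>s. (\<integral>x. indicator {t1..t2} s * (indicator {c..d} x * v s x) \<partial>lborel) \<partial>lborel)"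
      by (rule lborel_pair.Fubini_integral[OF I])
    also have "\<dots> = (LINT s:{t1..t2}|lborel. \<Psi> s d - \<Psi> s c)"
      using primitive_LINT[OF primitive_v cd] by (simp add: set_lebesgue_integral_def)
    also have "\<dots> = (antider (u t2) d - antider (u t2) c) - (antider (u t1) d - antider (u t1) c)" by (rule \<Psi>_time_integral[OF t])
    finally show "(LINT x:{c..d}|lborel. k x) = (antider (u t2) d - antider (u t1) d) - (antider (u t2) c - antider (u t1) c)" by simp
  qed
  from primitive_AE_unique[OF primitive_diff[OF primitive_W primitive_W] this]
  show "AE x in lborel. u t2 x - u t1 x = (LINT s:{t1..t2}|lborel. v s x)" by (simp add: k_def)
  have "AE x in lborel. integrable lborel (\<lambda>s. indicator {t1..t2} s * (indicator {-real n..real n} x * v s x))" for n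
    using lborel_pair.AE_integrable_snd[OF v_integrable_box[OF t, of "-real n" "real n"]] .
  then have "AE x in lborel. \<forall>n. integrable lborel (\<lambda>s. indicator {t1..t2} s * (indicator {-real n..real n} x * v s x))"
    by (subst AE_all_countable) blast
  then show "AE x in lborel. set_integrable lborel {t1..t2} (\<lambda>s. v s x)"
  proof eventually_elim
    case (elim x)
    obtain n where "\<bar>x\<bar> \<le> real n" using real_arch_simple by blast
    then have "x \<in> {-real n..real n}" by auto
    with elim[rule_format, of n] show ?case by (simp add: set_integrable_def)
  qed
qed

text \<open>The quotient is the average of \<open>v\<close> over the time interval, so Jensen and
  Fubini transfer any uniform bound on \<open>v s - c\<close>. Taking \<open>c = 0\<close> gives the
  Lipschitz estimate, \<open>c = v t\<close> the derivative.\<close>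

lemma np_difference_quotient:
  assumes t: "t1 < t2" and p: "1 \<le> p" and [measurable]: "c \<in> borel_measurable borel"
    and M: "\<And>s. s \<in> {t1..t2} \<Longrightarrow> np p (\<lambda>x. v s x - c x) \<le> M"
  shows "np p (\<lambda>x. (u t2 x - u t1 x) / (t2 - t1) - c x) \<le> M"
proof -
  let ?T = "t2 - t1"
  have T: "0 < ?T" using t by simp
  have "np p (\<lambda>x. (u t2 x - u t1 x) / ?T - c x)
    \<le> (\<integral>\<^sup>+x. ennreal (1 / ?T) * (\<integral>\<^sup>+s. indicator {t1..t2} s * (indicator {0..1} x * ennreal (\<bar>v s x - c x\<bar> powr p)) \<partial>lborel) \<partial>lborel)"
    unfolding np_def
  proof (rule nn_integral_mono_AE)
    from u_difference[OF less_imp_le[OF t]]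
    show "AE x in lborel. ennreal (\<bar>(u t2 x - u t1 x) / ?T - c x\<bar> powr p) * indicator {0..1} x
      \<le> ennreal (1 / ?T) * (\<integral>\<^sup>+s. indicator {t1..t2} s * (indicator {0..1} x * ennreal (\<bar>v s x - c x\<bar> powr p)) \<partial>lborel)"
    proof eventually_elim
      case (elim x)
      have ci: "set_integrable lborel {t1..t2} (\<lambda>_. c x)"
        by (rule bounded_measurable_set_integrable[where C = "\<bar>c x\<bar>"]) auto
      have "(LINT s:{t1..t2}|lborel. v s x - c x) = (u t2 x - u t1 x) - (LINT s:{t1..t2}|lborel. c x)"
        unfolding elim(1) by (rule set_integral_diff(2)[OF elim(2) ci])
      also have "(LINT s:{t1..t2}|lborel. c x) = c x * ?T" using t by (simp add: set_lebesgue_integral_def)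
      finally have eq: "(LINT s:{t1..t2}|lborel. v s x - c x) / ?T = (u t2 x - u t1 x) / ?T - c x"
        using T by (simp add: diff_divide_distrib)
      have "ennreal (\<bar>(u t2 x - u t1 x) / ?T - c x\<bar> powr p)
         \<le> ennreal (1 / ?T) * (\<integral>\<^sup>+s\<in>{t1..t2}. ennreal (\<bar>v s x - c x\<bar> powr p) \<partial>lborel)"
        unfolding eq[symmetric] by (rule jensen_powr[OF _ t p]) measurable
      then show ?case by (cases "x \<in> {0..1}") (simp_all add: mult.commute)
    qed
  qed
  also have "\<dots> = ennreal (1 / ?T) * (\<integral>\<^sup>+x. (\<integral>\<^sup>+s. indicator {t1..t2} s * (indicator {0..1} x * ennreal (\<bar>v s x - c x\<bar> powr p)) \<partial>lborel) \<partial>lborel)"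
    by (rule nn_integral_cmult) measurable
  also have "(\<integral>\<^sup>+x. (\<integral>\<^sup>+s. indicator {t1..t2} s * (indicator {0..1} x * ennreal (\<bar>v s x - c x\<bar> powr p)) \<partial>lborel) \<partial>lborel)
     = (\<integral>\<^sup>+s. (\<integral>\<^sup>+x. indicator {t1..t2} s * (indicator {0..1} x * ennreal (\<bar>v s x - c x\<bar> powr p)) \<partial>lborel) \<partial>lborel)"
    by (rule lborel_pair.Fubini') measurable
  also have "\<dots> = (\<integral>\<^sup>+s. indicator {t1..t2} s * np p (\<lambda>x. v s x - c x) \<partial>lborel)"
    unfolding np_def by (intro nn_integral_cong, subst nn_integral_cmult[symmetric]) (auto simp: mult.commute)
  also have "\<dots> \<le> (\<integral>\<^sup>+s. M * indicator {t1..t2} s \<partial>lborel)"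
    using M by (intro nn_integral_mono) (auto simp: indicator_def)
  also have "\<dots> = M * ennreal ?T" using t by (subst nn_integral_cmult_indicator) auto
  also have "ennreal (1 / ?T) * (M * ennreal ?T) = M"
  proof -
    have "ennreal (1 / ?T) * ennreal ?T = 1" using T by (simp add: ennreal_mult[symmetric])
    then show ?thesis by (metis mult.left_commute mult.right_neutral)
  qed
  finally show ?thesis by (simp add: mult_left_mono)
qed

lemma np_lipschitz:
  assumes "s \<noteq> t" shows "np 2 (\<lambda>x. (u s x - u t x) / (s - t)) \<le> ennreal L2"
proof -
  have *: "np 2 (\<lambda>x. (u t2 x - u t1 x) / (t2 - t1)) \<le> ennreal L2" if "t1 < t2" for t1 t2
    using np_difference_quotient[OF that, of 2 "\<lambda>_. 0"] np_v_bound[of 2] by simp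
  have "(u s x - u t x) / (s - t) = (u t x - u s x) / (t - s)" for x
    by (metis minus_diff_eq minus_divide_divide)
  then show ?thesis using *[of s t] *[of t s] assms by (cases "s < t") auto
qed

theorem np_derivative:
  assumes p: "1 \<le> p" "p \<le> 2" and good: "p < 2 \<or> (AE \<xi> in lborel. a t \<xi> \<noteq> 0)"
  shows "((\<lambda>k. np p (\<lambda>x. (u (t + k) x - u t x) / k - v t x)) \<longlongrightarrow> 0) (at 0)"
proof (rule order_tendstoI)
  fix e :: ennreal assume "0 < e"
  then obtain e' where e': "0 < e'" "e' < e" using dense by blast
  have "((\<lambda>s. np p (\<lambda>x. v s x - v t x)) \<longlongrightarrow> 0) (at t)"
    unfolding tendsto_at_iff_sequentially
    using v_continuous[OF p _ good] by (auto simp: o_def)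
  from order_tendstoD(2)[OF this e'(1)]
  obtain d where d: "d > 0" "\<And>s. s \<noteq> t \<Longrightarrow> dist s t < d \<Longrightarrow> np p (\<lambda>x. v s x - v t x) < e'"
    unfolding eventually_at by auto
  \<comment> \<open>The limit at \<open>t\<close> leaves out \<open>s = t\<close>, where the
    difference is identically 0.\<close>
  have d': "np p (\<lambda>x. v s x - v t x) \<le> e'" if "dist s t < d" for s
    using d(2)[OF _ that] by (cases "s = t") (auto simp: np_def less_imp_le)
  have "np p (\<lambda>x. (u (t + k) x - u t x) / k - v t x) < e" if k: "k \<noteq> 0" "\<bar>k\<bar> < d" for k
  proof (cases "k > 0")
    case True
    have "np p (\<lambda>x. (u (t + k) x - u t x) / (t + k - t) - v t x) \<le> e'"
      by (rule np_difference_quotient[OF _ p(1) v_measurable]) (use True k in \<open>auto intro!: d' simp: dist_real_def\<close>)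
    then show ?thesis using e'(2) by simp
  next
    case False
    have "np p (\<lambda>x. (u t x - u (t + k) x) / (t - (t + k)) - v t x) \<le> e'"
      by (rule np_difference_quotient[OF _ p(1) v_measurable]) (use False k in \<open>auto intro!: d' simp: dist_real_def\<close>)
    moreover have "(u t x - u (t + k) x) / (t - (t + k)) = (u (t + k) x - u t x) / k" for x
      using k(1) by (simp add: field_simps)
    ultimately show ?thesis using e'(2) by simp
  qed
  then show "\<forall>\<^sub>F k in at 0. np p (\<lambda>x. (u (t + k) x - u t x) / k - v t x) < e"
    unfolding eventually_at using d(1) by (intro exI[of _ d]) (auto simp: dist_real_def)
qed (simp add: not_less)

section \<open>Breaking times\<close>

lemma a_zero_isolated: "\<exists>e>0. \<forall>s. 0 < \<bar>s - t\<bar> \<and> \<bar>s - t\<bar> < e \<longrightarrow> a s \<xi> \<noteq> 0"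
proof (cases "a t \<xi> = 0")
  case False
  have "\<forall>\<^sub>F s in at t. a s \<xi> \<noteq> 0"
    by (rule tendsto_imp_eventually_ne[OF _ False]) (use isCont_a in \<open>simp add: isCont_def\<close>)
  then show ?thesis unfolding eventually_at by (auto simp: dist_real_def)
next
  case True
  have b0: "b t \<xi> = 0" using invariant[of t \<xi>] True by simp
  have "0 < h t \<xi>" using total_pos[of t \<xi>] True by simp
  then have pos: "0 < h t \<xi> / 2 + ((U t \<xi>)\<^sup>2 / 2 - P t \<xi>) * a t \<xi>" using True by simp
  obtain d1 where d1: "d1 > 0" "\<And>k. 0 < k \<Longrightarrow> k < d1 \<Longrightarrow> b t \<xi> < b (t + k) \<xi>"
    using DERIV_pos_inc_right[OF db[of \<xi> t] pos] by blast
  obtain d2 where d2: "d2 > 0" "\<And>k. 0 < k \<Longrightarrow> k < d2 \<Longrightarrow> b (t - k) \<xi> < b t \<xi>"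
    using DERIV_pos_inc_left[OF db[of \<xi> t] pos] by blast
  have "a s \<xi> \<noteq> 0" if s: "0 < \<bar>s - t\<bar>" "\<bar>s - t\<bar> < min d1 d2" for s
  proof (cases "t < s")
    case True
    obtain z where z: "t < z" "z < s" "a s \<xi> - a t \<xi> = (s - t) * b z \<xi>"
      using MVT2[OF True, of "\<lambda>t. a t \<xi>" "\<lambda>t. b t \<xi>"] da by blast
    have "0 < b z \<xi>" using d1(2)[of "z - t"] z s b0 True by simp
    then have "0 < a s \<xi> - a t \<xi>" unfolding z(3) using True by simp
    then show ?thesis using \<open>a t \<xi> = 0\<close> by simp
  next
    case False
    then have st: "s < t" using s by simp
    obtain z where z: "s < z" "z < t" "a t \<xi> - a s \<xi> = (t - s) * b z \<xi>"
      using MVT2[OF st, of "\<lambda>t. a t \<xi>" "\<lambda>t. b t \<xi>"] da by blast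
    have "b z \<xi> < 0" using d2(2)[of "t - z"] z s b0 st by simp
    then have "a t \<xi> - a s \<xi> < 0" unfolding z(3) using st by (simp add: mult_pos_neg)
    then show ?thesis using \<open>a t \<xi> = 0\<close> by simp
  qed
  then show ?thesis using d1(1) d2(1) by (intro exI[of _ "min d1 d2"]) auto
qed

lemma a_zero_countable: "countable {t. a t \<xi> = 0}"
proof -
  let ?Z = "{t. a t \<xi> = 0}"
  have "?Z sparse_in UNIV"
    unfolding sparse_in_def
  proof
    fix t :: real
    obtain e where e: "e > 0" "\<And>s. 0 < \<bar>s - t\<bar> \<Longrightarrow> \<bar>s - t\<bar> < e \<Longrightarrow> a s \<xi> \<noteq> 0"
      using a_zero_isolated[of t \<xi>] by blast
    have "\<not> y islimpt ?Z" if y: "y \<in> ball t e" for y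
    proof
      assume lim: "y islimpt ?Z"
      \<comment> \<open>Away from \<open>t\<close> the neighbourhood must also leave out
        \<open>t\<close>, which may itself be a zero.\<close>
      have "open (if y = t then ball t e else ball t e - {t})" by auto
      moreover have "y \<in> (if y = t then ball t e else ball t e - {t})" using y by auto
      ultimately obtain z where "z \<in> ?Z" "z \<in> (if y = t then ball t e else ball t e - {t})" "z \<noteq> y"
        using lim unfolding islimpt_def by blast
      then show False using e(2)[of z] by (auto simp: dist_real_def abs_minus_commute split: if_splits)
    qed
    then show "\<exists>B. t \<in> B \<and> open B \<and> (\<forall>y\<in>B. \<not> y islimpt ?Z)" using e(1) by (intro exI[of _ "ball t e"]) auto
  qed
  then show ?thesis using sparse_imp_countable[OF open_UNIV] by auto
qed

theorem good_times: "AE t in lborel. AE \<xi> in lborel. a t \<xi> \<noteq> 0"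
proof -
  \<comment> \<open>Joint measurability of a function continuous in time and Borel in the label: it
    is the limit of its versions with time rounded down to multiples of
    \<open>1 / Suc n\<close>.\<close>
  have am: "(\<lambda>z. a (fst z) (snd z)) \<in> borel_measurable (lborel \<Otimes>\<^sub>M lborel)"
  proof (rule borel_measurable_LIMSEQ_real)
    fix z :: "real \<times> real"
    have "(\<lambda>n. of_int \<lfloor>real (Suc n) * fst z\<rfloor> / real (Suc n)) \<longlonglongrightarrow> fst z"
    proof (rule tendsto_sandwich[of "\<lambda>n. fst z - 1 / real (Suc n)" _ _ "\<lambda>_. fst z"])
      have "of_int \<lfloor>real (Suc n) * fst z\<rfloor> / real (Suc n) \<le> fst z" "fst z - 1 / real (Suc n) \<le> of_int \<lfloor>real (Suc n) * fst z\<rfloor> / real (Suc n)" for n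
      proof -
        have n: "0 < real (Suc n)" by simp
        have f: "of_int \<lfloor>real (Suc n) * fst z\<rfloor> \<le> real (Suc n) * fst z" "real (Suc n) * fst z - 1 \<le> of_int \<lfloor>real (Suc n) * fst z\<rfloor>" by linarith+
        show "of_int \<lfloor>real (Suc n) * fst z\<rfloor> / real (Suc n) \<le> fst z" using f(1) n by (simp add: pos_divide_le_eq mult.commute del: of_nat_Suc)
        have "fst z - 1 / real (Suc n) = (real (Suc n) * fst z - 1) / real (Suc n)" using n by (simp add: diff_divide_distrib del: of_nat_Suc)
        then show "fst z - 1 / real (Suc n) \<le> of_int \<lfloor>real (Suc n) * fst z\<rfloor> / real (Suc n)" using f(2) n by (simp only: divide_right_mono less_imp_le)
      qed
      then show "\<forall>\<^sub>F n in sequentially. fst z - 1 / real (Suc n) \<le> of_int \<lfloor>real (Suc n) * fst z\<rfloor> / real (Suc n)"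
        "\<forall>\<^sub>F n in sequentially. of_int \<lfloor>real (Suc n) * fst z\<rfloor> / real (Suc n) \<le> fst z" by auto
      have "(\<lambda>n. fst z - inverse (real (Suc n))) \<longlonglongrightarrow> fst z - 0" by (intro tendsto_intros LIMSEQ_inverse_real_of_nat)
      then show "(\<lambda>n. fst z - 1 / real (Suc n)) \<longlonglongrightarrow> fst z" by (simp add: inverse_eq_divide)
    qed simp
    from isCont_tendsto_compose[OF isCont_a this]
    show "(\<lambda>n. a (of_int \<lfloor>real (Suc n) * fst z\<rfloor> / real (Suc n)) (snd z)) \<longlonglongrightarrow> a (fst z) (snd z)" .
  next
    fix n
    show "(\<lambda>z. a (of_int \<lfloor>real (Suc n) * fst z\<rfloor> / real (Suc n)) (snd z)) \<in> borel_measurable (lborel \<Otimes>\<^sub>M lborel)"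
      by (rule measurable_compose_countable[of "\<lambda>i z. a (of_int i / real (Suc n)) (snd z)" _ _ "\<lambda>z. \<lfloor>real (Suc n) * fst z\<rfloor>"]) measurable
  qed
  have "AE \<xi> in lborel. AE t in lborel. a t \<xi> \<noteq> 0"
  proof (rule AE_I2)
    fix \<xi>
    have "{t. a t \<xi> = 0} \<in> null_sets lborel" by (rule countable_imp_null_set_lborel[OF a_zero_countable])
    then show "AE t in lborel. a t \<xi> \<noteq> 0" by (rule AE_I') auto
  qed
  moreover have "{z \<in> space (lborel \<Otimes>\<^sub>M lborel). a (fst z) (snd z) \<noteq> 0} \<in> sets (lborel \<Otimes>\<^sub>M lborel)"
    using am by measurable
  ultimately show ?thesis
    using lborel_pair.AE_commute[of "\<lambda>t \<xi>. a t \<xi> \<noteq> 0"] by simp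
qed

end

section \<open>The Camassa--Holm equation\<close>

lemma lebesgue_measurable_AE:
  fixes f F :: "real \<Rightarrow> real"
  assumes "AE x in lborel. F x = f x" "f \<in> borel_measurable borel"
  shows "F \<in> borel_measurable lebesgue"
proof (rule borel_measurable_AE)
  show "f \<in> borel_measurable lebesgue" using assms(2) by (intro measurable_completion) simp
  show "AE x in lebesgue. f x = F x" using assms(1) unfolding AE_completion_iff by eventually_elim simp
qed

text \<open>The theorem integrates \<open>deriv\<close> against \<open>lebesgue\<close>, while the
  estimates concern Borel densities against \<open>lborel\<close>. In the infinite case both sides
  of the first equation are 0 by convention.\<close>

lemma lebesgue_integral_AE:
  fixes f F :: "real \<Rightarrow> real"
  assumes ae: "AE x in lborel. F x = f x" and [measurable]: "f \<in> borel_measurable borel" and nn: "\<And>x. 0 \<le> f x"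
  shows "integral\<^sup>L lebesgue F = enn2real (\<integral>\<^sup>+x. ennreal (f x) \<partial>lborel)"
    "(\<integral>\<^sup>+x. ennreal (f x) \<partial>lborel) < \<infinity> \<Longrightarrow> integrable lebesgue F"
proof -
  have fm: "f \<in> borel_measurable lebesgue" by (intro measurable_completion) simp
  note Fm = lebesgue_measurable_AE[OF assms(1,2)]
  have ae': "AE x in lebesgue. F x = f x" using ae by (simp add: AE_completion_iff)
  have "integral\<^sup>L lebesgue F = integral\<^sup>L lebesgue f" by (rule integral_cong_AE[OF Fm fm ae'])
  also have "\<dots> = integral\<^sup>L lborel f" by (rule integral_completion) simp
  also have "\<dots> = enn2real (\<integral>\<^sup>+x. ennreal (f x) \<partial>lborel)"
    by (rule integral_eq_nn_integral) (auto simp: nn)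
  finally show "integral\<^sup>L lebesgue F = enn2real (\<integral>\<^sup>+x. ennreal (f x) \<partial>lborel)" .
  assume "(\<integral>\<^sup>+x. ennreal (f x) \<partial>lborel) < \<infinity>"
  then have "integrable lborel f" by (intro integrableI_nonneg) (auto simp: nn)
  then have "integrable lebesgue f" by (subst integrable_completion) auto
  then show "integrable lebesgue F" using integrable_cong_AE[OF Fm fm ae'] by simp
qed

lemma lebesgue_set_integral_AE:
  fixes f F :: "real \<Rightarrow> real"
  assumes ae: "AE x in lborel. F x = f x" and [measurable]: "f \<in> borel_measurable borel" and nn: "\<And>x. 0 \<le> f x"
  shows "(LINT x:{c..d}|lebesgue. F x) = enn2real (\<integral>\<^sup>+x\<in>{c..d}. ennreal (f x) \<partial>lborel)"
    "(\<integral>\<^sup>+x\<in>{c..d}. ennreal (f x) \<partial>lborel) < \<infinity> \<Longrightarrow> set_integrable lebesgue {c..d} F"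
proof -
  have eq: "(\<integral>\<^sup>+x\<in>{c..d}. ennreal (f x) \<partial>lborel) = (\<integral>\<^sup>+x. ennreal (indicator {c..d} x *\<^sub>R f x) \<partial>lborel)"
    by (intro nn_integral_cong) (auto simp: indicator_def)
  have ae': "AE x in lborel. indicator {c..d} x *\<^sub>R F x = indicator {c..d} x *\<^sub>R f x"
    using ae by eventually_elim simp
  note * = lebesgue_integral_AE[OF ae']
  show "(LINT x:{c..d}|lebesgue. F x) = enn2real (\<integral>\<^sup>+x\<in>{c..d}. ennreal (f x) \<partial>lborel)"
    unfolding set_lebesgue_integral_def eq by (rule *(1)) (auto simp: nn)
  show "set_integrable lebesgue {c..d} F" if "(\<integral>\<^sup>+x\<in>{c..d}. ennreal (f x) \<partial>lborel) < \<infinity>"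
    unfolding set_integrable_def using that unfolding eq by (intro *(2)) (auto simp: nn)
qed

lemma Lp_norm_np:
  assumes ae: "AE x in lborel. F x = f x" and [measurable]: "f \<in> borel_measurable borel"
  shows "Lp_norm p F = enn2real (np p f) powr (1 / p)"
proof -
  have "AE x in lborel. \<bar>F x\<bar> powr p = \<bar>f x\<bar> powr p" using ae by eventually_elim simp
  from lebesgue_set_integral_AE(1)[OF this] show ?thesis by (simp add: Lp_norm_def np_def)
qed

lemma Lp_per_np:
  assumes ae: "AE x in lborel. F x = f x" and [measurable]: "f \<in> borel_measurable borel"
    and "periodic1 F" "np p f < \<infinity>"
  shows "F \<in> Lp_per p"
proof -
  have "AE x in lborel. \<bar>F x\<bar> powr p = \<bar>f x\<bar> powr p" using ae by eventually_elim simp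
  from lebesgue_set_integral_AE(2)[OF this, of 0 1] show ?thesis
    using assms lebesgue_measurable_AE[OF ae] by (simp add: Lp_per_def np_def)
qed

lemma Lp_norm_scale:
  assumes "0 < p" shows "Lp_norm p (\<lambda>x. c * f x) = \<bar>c\<bar> * Lp_norm p f"
proof -
  have "(LINT x:{0..1}|lebesgue. \<bar>c * f x\<bar> powr p) = \<bar>c\<bar> powr p * (LINT x:{0..1}|lebesgue. \<bar>f x\<bar> powr p)"
    by (simp add: abs_mult powr_mult)
  then show ?thesis using assms by (simp add: Lp_norm_def powr_mult powr_powr)
qed

lemma Lp_norm_tendsto_zero:
  assumes lim: "((\<lambda>k. np p (f k)) \<longlongrightarrow> 0) F" and p: "0 < p"
    and ae: "\<And>k. AE x in lborel. D k x = f k x" and m: "\<And>k. f k \<in> borel_measurable borel"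
  shows "((\<lambda>k. Lp_norm p (D k)) \<longlongrightarrow> 0) F"
proof -
  have "((\<lambda>k. enn2real (np p (f k))) \<longlongrightarrow> 0) F" by (rule tendsto_enn2real) (use lim in auto)
  then have "((\<lambda>k. enn2real (np p (f k)) powr (1 / p)) \<longlongrightarrow> 0 powr (1 / p)) F"
    by (rule tendsto_powr2) (use p in auto)
  then show ?thesis by (simp add: Lp_norm_np[OF ae m])
qed

lemma periodic1_deriv: "periodic1 f \<Longrightarrow> periodic1 (deriv f)"
  unfolding periodic1_def deriv_def by (simp add: DERIV_shift)

section \<open>From labels back to the equation\<close>

context lagr
begin

lemma P_nonneg: "0 \<le> P t \<xi>"
proof -
  have "0 \<le> ev (srcA (ca (X t)) (cw (X t))) \<xi>" "0 \<le> ev (srcB (ca (X t)) (cw (X t))) \<xi>"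
    by (rule srcA_bound(1) srcB_bound(1); use a_nonneg w_nonneg lagrangian_solution.mean_a[OF sol tin] in blast)+
  then show ?thesis by (simp add: cP_eq scaleR_pbm.rep_eq plus_pbm.rep_eq)
qed

lemma u_gradient:
  obtains g where "g \<in> borel_measurable borel" "primitive (u t) g" "AE x in lborel. deriv (u t) x = g x"
    "AE x in lborel. (u t has_real_derivative g x) (at x)"
proof -
  obtain g where g: "primitive (u t) g" using abs_continuous_primitive[OF abs_continuous_u] by blast
  moreover from primitive_AE_derivative[OF g] have "AE x in lborel. deriv (u t) x = g x"
    by eventually_elim (rule DERIV_imp_deriv)
  ultimately show ?thesis using that[of g] primitive_measurable[OF g] primitive_AE_derivative[OF g] by blast
qed

lemma H_period: "H t (x + 1) = H t x + E" using antider_period[of "ch (X t)" x] energy by simp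

text \<open>Valid at every time, breaking times included: labels with \<open>a = 0\<close> drop out
  of the left side, which only helps. The factor 3 counts the periods in
  \<open>y_in_unit\<close>.\<close>

lemma gradient_energy_bound:
  assumes g: "primitive (u t) g" shows "np 2 g \<le> ennreal (3 * E)"
proof -
  have [measurable]: "g \<in> borel_measurable borel" by (rule primitive_measurable[OF g])
  have "np 2 g = (\<integral>\<^sup>+\<xi>. ennreal (a t \<xi>) * (ennreal (\<bar>g (y t \<xi>)\<bar> powr 2) * indicator {0..1} (y t \<xi>)) \<partial>lborel)"
    unfolding np_def by (rule nn_integral_pullback[OF primitive_y a_nonneg y_limits]) measurable
  also have "\<dots> \<le> (\<integral>\<^sup>+\<xi>\<in>{lab t 0 - 1..lab t 0 + 2}. ennreal (h t \<xi>) \<partial>lborel)"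
  proof (rule nn_integral_mono_AE)
    from u_deriv_pullback[OF g]
    show "AE \<xi> in lborel. ennreal (a t \<xi>) * (ennreal (\<bar>g (y t \<xi>)\<bar> powr 2) * indicator {0..1} (y t \<xi>))
      \<le> ennreal (h t \<xi>) * indicator {lab t 0 - 1..lab t 0 + 2} \<xi>"
    proof eventually_elim
      case (elim \<xi>)
      show ?case
      proof (cases "a t \<xi> = 0 \<or> y t \<xi> \<notin> {0..1}")
        case False
        then have a: "0 < a t \<xi>" and ge: "g (y t \<xi>) = b t \<xi> / a t \<xi>" and y: "y t \<xi> \<in> {0..1}"
          using elim a_nonneg[of t \<xi>] by auto
        have "(b t \<xi>)\<^sup>2 \<le> a t \<xi> * h t \<xi>" using invariant[of t \<xi>] by simp
        then have "a t \<xi> * (b t \<xi> / a t \<xi>)\<^sup>2 \<le> h t \<xi>" using a by (simp add: power2_eq_square field_simps)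
        moreover have "\<bar>g (y t \<xi>)\<bar> powr 2 = (b t \<xi> / a t \<xi>)\<^sup>2" by (simp add: ge power_divide)
        ultimately have "ennreal (a t \<xi>) * ennreal (\<bar>g (y t \<xi>)\<bar> powr 2) \<le> ennreal (h t \<xi>)"
          using a by (simp only: ennreal_mult[symmetric] less_imp_le zero_le_power2 ennreal_leI)
        then show ?thesis using y_in_unit[OF y] y by simp
      qed auto
    qed
  qed
  also have "\<dots> = ennreal (H t (lab t 0 + 2) - H t (lab t 0 - 1))"
    by (rule primitive_nn_integral[OF ev_primitive h_nonneg]) simp
  also have "H t (lab t 0 + 2) - H t (lab t 0 - 1) = 3 * E"
    using H_period[of t "lab t 0 - 1"] H_period[of t "lab t 0"] H_period[of t "lab t 0 + 1"] by (simp add: add.assoc)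
  finally show ?thesis .
qed

lemma u_in_H1_per: "u t \<in> H1_per"
proof -
  obtain g where g: "g \<in> borel_measurable borel" "primitive (u t) g" "AE x in lborel. deriv (u t) x = g x"
    by (rule u_gradient)
  have "periodic1 (u t)" by (simp add: periodic1_def u_periodic)
  moreover have "np 2 g < \<infinity>" using gradient_energy_bound[OF g(2)] by (auto intro: le_less_trans)
  ultimately show ?thesis
    using abs_continuous_u Lp_per_np[OF g(3,1) periodic1_deriv] by (auto simp: H1_per_def)
qed

text \<open>At a good time no label drops out, and \<open>a (u^2 + u_x^2) = h\<close> holds at
  almost every label. Up to null sets the labels of one unit of positions form exactly one period,
  so the result is \<open>E\<close> itself.\<close>

lemma energy_pullback:
  assumes good: "AE \<xi> in lborel. a t \<xi> \<noteq> 0"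
  shows "(LINT x:{0..1}|lebesgue. (u t x)\<^sup>2 + (deriv (u t) x)\<^sup>2) = E"
proof -
  obtain g where g: "g \<in> borel_measurable borel" "primitive (u t) g" "AE x in lborel. deriv (u t) x = g x"
    by (rule u_gradient)
  note [measurable] = g(1)
  have "AE x in lborel. (u t x)\<^sup>2 + (deriv (u t) x)\<^sup>2 = (u t x)\<^sup>2 + (g x)\<^sup>2" using g(3) by eventually_elim simp
  then have "(LINT x:{0..1}|lebesgue. (u t x)\<^sup>2 + (deriv (u t) x)\<^sup>2) = enn2real (\<integral>\<^sup>+x\<in>{0..1}. ennreal ((u t x)\<^sup>2 + (g x)\<^sup>2) \<partial>lborel)"
    by (rule lebesgue_set_integral_AE(1)) auto
  also have "(\<integral>\<^sup>+x\<in>{0..1}. ennreal ((u t x)\<^sup>2 + (g x)\<^sup>2) \<partial>lborel)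
      = (\<integral>\<^sup>+\<xi>. ennreal (a t \<xi>) * (ennreal ((u t (y t \<xi>))\<^sup>2 + (g (y t \<xi>))\<^sup>2) * indicator {0..1} (y t \<xi>)) \<partial>lborel)"
    by (rule nn_integral_pullback[OF primitive_y a_nonneg y_limits]) measurable
  also have "\<dots> = (\<integral>\<^sup>+\<xi>\<in>{lab t 0..lab t 0 + 1}. ennreal (h t \<xi>) \<partial>lborel)"
  proof (rule nn_integral_cong_AE)
    have "AE x::real in lborel. x \<noteq> 0 \<and> x \<noteq> 1" using AE_lborel_singleton[of 0] AE_lborel_singleton[of 1] by eventually_elim simp
    from AE_pullback[OF primitive_y[of t] a_nonneg y_limits this] good u_deriv_pullback[OF g(2)]
    show "AE \<xi> in lborel. ennreal (a t \<xi>) * (ennreal ((u t (y t \<xi>))\<^sup>2 + (g (y t \<xi>))\<^sup>2) * indicator {0..1} (y t \<xi>))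
      = ennreal (h t \<xi>) * indicator {lab t 0..lab t 0 + 1} \<xi>"
    proof eventually_elim
      case (elim \<xi>)
      have a: "0 < a t \<xi>" and ge: "g (y t \<xi>) = b t \<xi> / a t \<xi>" using elim a_nonneg[of t \<xi>] by auto
      have "a t \<xi> * ((U t \<xi>)\<^sup>2 + (b t \<xi> / a t \<xi>)\<^sup>2) = ((U t \<xi> * a t \<xi>)\<^sup>2 + (b t \<xi>)\<^sup>2) / a t \<xi>"
        using a by (simp add: power2_eq_square field_simps)
      also have "\<dots> = h t \<xi>" using a invariant[of t \<xi>] by (simp add: field_simps)
      finally have eq: "ennreal (a t \<xi>) * ennreal ((u t (y t \<xi>))\<^sup>2 + (g (y t \<xi>))\<^sup>2) = ennreal (h t \<xi>)"
        using a by (simp only: u_y ge ennreal_mult[symmetric] less_imp_le add_nonneg_nonneg zero_le_power2)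
      have y01: "y t (lab t 0) = 0" "y t (lab t 0 + 1) = 1" by (simp_all add: y_lab y_periodic)
      have "y t \<xi> \<in> {0..1} \<longleftrightarrow> \<xi> \<in> {lab t 0..lab t 0 + 1}"
      proof
        assume "y t \<xi> \<in> {0..1}"
        then have "0 < y t \<xi>" "y t \<xi> < 1" using elim by auto
        then show "\<xi> \<in> {lab t 0..lab t 0 + 1}"
          using y_mono[of \<xi> "lab t 0" t] y_mono[of "lab t 0 + 1" \<xi> t] y01 by force
      next
        assume "\<xi> \<in> {lab t 0..lab t 0 + 1}"
        then show "y t \<xi> \<in> {0..1}" using y_mono[of "lab t 0" \<xi> t] y_mono[of \<xi> "lab t 0 + 1" t] y01 by auto
      qed
      then show ?case using eq by (simp add: mult.assoc[symmetric] indicator_def)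
    qed
  qed
  also have "\<dots> = ennreal (H t (lab t 0 + 1) - H t (lab t 0))"
    by (rule primitive_nn_integral[OF ev_primitive h_nonneg]) simp
  also have "\<dots> = ennreal E" by (simp add: H_period)
  finally show ?thesis using E_nonneg by simp
qed

text \<open>The convolution sees only the energy that has a density in position, whereas
  \<open>pe\<close> contains all of \<open>h\<close>; they agree when almost every label has
  \<open>a \<noteq> 0\<close>.\<close>

lemma CH_P_pullback:
  assumes good: "AE \<xi> in lborel. a t \<xi> \<noteq> 0"
  shows "CH_P (u t) = pe t"
proof
  fix x
  obtain g where g: "g \<in> borel_measurable borel" "primitive (u t) g" "AE x in lborel. deriv (u t) x = g x"
    by (rule u_gradient)
  note [measurable] = g(1)
  let ?\<xi> = "lab t x"
  have "AE z in lborel. exp (- \<bar>x - z\<bar>) * ((u t z)\<^sup>2 + (deriv (u t) z)\<^sup>2 / 2) = exp (- \<bar>x - z\<bar>) * ((u t z)\<^sup>2 + (g z)\<^sup>2 / 2)"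
    using g(3) by eventually_elim simp
  then have "(LINT z|lebesgue. exp (- \<bar>x - z\<bar>) * ((u t z)\<^sup>2 + (deriv (u t) z)\<^sup>2 / 2))
     = enn2real (\<integral>\<^sup>+z. ennreal (exp (- \<bar>x - z\<bar>) * ((u t z)\<^sup>2 + (g z)\<^sup>2 / 2)) \<partial>lborel)"
    by (rule lebesgue_integral_AE(1)) auto
  also have "(\<integral>\<^sup>+z. ennreal (exp (- \<bar>x - z\<bar>) * ((u t z)\<^sup>2 + (g z)\<^sup>2 / 2)) \<partial>lborel)
      = (\<integral>\<^sup>+\<eta>. ennreal (a t \<eta>) * ennreal (exp (- \<bar>x - y t \<eta>\<bar>) * ((u t (y t \<eta>))\<^sup>2 + (g (y t \<eta>))\<^sup>2 / 2)) \<partial>lborel)"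
    by (rule nn_integral_pullback[OF primitive_y a_nonneg y_limits]) measurable
  also have "\<dots> = (\<integral>\<^sup>+\<eta>. ennreal (1/2) * ennreal (exp (- \<bar>y t ?\<xi> - y t \<eta>\<bar>) * ev (cw (X t)) \<eta>) \<partial>lborel)"
  proof (rule nn_integral_cong_AE)
    from good u_deriv_pullback[OF g(2)]
    show "AE \<eta> in lborel. ennreal (a t \<eta>) * ennreal (exp (- \<bar>x - y t \<eta>\<bar>) * ((u t (y t \<eta>))\<^sup>2 + (g (y t \<eta>))\<^sup>2 / 2))
      = ennreal (1/2) * ennreal (exp (- \<bar>y t ?\<xi> - y t \<eta>\<bar>) * ev (cw (X t)) \<eta>)"
    proof eventually_elim
      case (elim \<eta>)
      have a: "0 < a t \<eta>" and ge: "g (y t \<eta>) = b t \<eta> / a t \<eta>" using elim a_nonneg[of t \<eta>] by auto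
      have "(b t \<eta>)\<^sup>2 = a t \<eta> * h t \<eta> - (U t \<eta> * a t \<eta>)\<^sup>2" using invariant[of t \<eta>] by simp
      then have K: "a t \<eta> * ((U t \<eta>)\<^sup>2 + (b t \<eta> / a t \<eta>)\<^sup>2 / 2) = 1/2 * ev (cw (X t)) \<eta>"
        using a by (simp add: cw_def times_pbm.rep_eq plus_pbm.rep_eq power_divide) (simp add: power2_eq_square field_simps)
      have "a t \<eta> * (exp (- \<bar>x - y t \<eta>\<bar>) * ((u t (y t \<eta>))\<^sup>2 + (g (y t \<eta>))\<^sup>2 / 2))
          = 1/2 * (exp (- \<bar>y t ?\<xi> - y t \<eta>\<bar>) * ev (cw (X t)) \<eta>)"
        unfolding u_y ge y_lab mult.left_commute[of "a t \<eta>"] K by (simp only: mult.left_commute)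
      then show ?case using a w_nonneg by (simp only: ennreal_mult[symmetric] mult_nonneg_nonneg exp_ge_zero less_imp_le
          add_nonneg_nonneg zero_le_power2 divide_nonneg_nonneg zero_le_numeral zero_le_one)
    qed
  qed
  also have "\<dots> = ennreal (1/2) * (\<integral>\<^sup>+\<eta>. ennreal (exp (- \<bar>y t ?\<xi> - y t \<eta>\<bar>) * ev (cw (X t)) \<eta>) \<partial>lborel)"
    by (rule nn_integral_cmult) measurable
  also have "\<dots> = ennreal (2 * P t ?\<xi>)" unfolding P_kernel by (subst ennreal_mult'[symmetric]) simp_all
  finally show "CH_P (u t) x = pe t x" using P_nonneg[of t ?\<xi>] by (simp add: CH_P_def pe_def)
qed

text \<open>\<open>v\<close> was defined from the Lagrangian pressure at all times; the good time
  enters by replacing \<open>CH_P (u t)\<close> with \<open>pe t\<close>.\<close>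

lemma CH_rhs_eq_v:
  assumes good: "AE \<xi> in lborel. a t \<xi> \<noteq> 0"
  shows "AE x in lborel. CH_rhs (u t) x = v t x" "periodic1 (CH_rhs (u t))"
proof -
  obtain g where g: "AE x in lborel. (u t has_real_derivative g x) (at x)" by (rule u_gradient)
  have "abs_continuous_on {c..d} (pe t)" for c d
    by (rule abs_continuous_on_lipschitz[where C = CE]) (metis abs_of_nonneg diff_ge_0_iff_ge pe_lipschitz)
  then obtain q where q: "primitive (pe t) q" using abs_continuous_primitive by blast
  from g primitive_AE_derivative[OF q] show "AE x in lborel. CH_rhs (u t) x = v t x"
  proof eventually_elim
    case (elim x)
    have "(\<Psi> t has_real_derivative - (u t x * g x + q x)) (at x)"
      unfolding \<Psi>_def[abs_def] by (auto intro!: derivative_eq_intros elim)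
    from v_eq[OF this] show ?case
      using elim by (simp add: CH_rhs_def CH_P_pullback[OF good] DERIV_imp_deriv)
  qed
  have "periodic1 (u t)" "periodic1 (pe t)" by (simp_all add: periodic1_def u_periodic pe_periodic)
  from this[THEN periodic1_deriv] show "periodic1 (CH_rhs (u t))"
    by (simp add: periodic1_def CH_rhs_def CH_P_pullback[OF good] u_periodic)
qed

lemma u_in_Lp: assumes "0 \<le> p" shows "u t \<in> Lp_per p"
proof (rule Lp_per_np)
  have "np p (u t) \<le> (\<integral>\<^sup>+x\<in>{0..1::real}. ennreal ((1 + E) powr p) \<partial>lborel)"
    unfolding np_def
  proof (rule nn_integral_mono)
    fix x
    have "\<bar>u t x\<bar> powr p \<le> (1 + E) powr p" by (rule powr_mono2[OF assms _ u_bound]) simp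
    then show "ennreal (\<bar>u t x\<bar> powr p) * indicator {0..1} x \<le> ennreal ((1 + E) powr p) * indicator {0..1} x"
      by (simp add: ennreal_leI indicator_def)
  qed
  also have "\<dots> < \<infinity>" by (subst nn_integral_cmult_indicator) (auto simp: ennreal_mult_less_top)
  finally show "np p (u t) < \<infinity>" .
qed (auto simp: periodic1_def u_periodic)

lemma Lp_lipschitz_u: "Lp_lipschitz 2 u"
  unfolding Lp_lipschitz_def
proof (intro conjI allI exI)
  fix s t
  show "u t \<in> Lp_per 2" by (rule u_in_Lp) simp
  show "Lp_norm 2 (\<lambda>x. u s x - u t x) \<le> L2 powr (1/2) * \<bar>s - t\<bar>"
  proof (cases "s = t")
    case False
    have "Lp_norm 2 (\<lambda>x. u s x - u t x) = Lp_norm 2 (\<lambda>x. (s - t) * ((u s x - u t x) / (s - t)))"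
      using False by simp
    also have "\<dots> = \<bar>s - t\<bar> * Lp_norm 2 (\<lambda>x. (u s x - u t x) / (s - t))" by (rule Lp_norm_scale) simp
    finally have eq: "Lp_norm 2 (\<lambda>x. u s x - u t x) = \<bar>s - t\<bar> * Lp_norm 2 (\<lambda>x. (u s x - u t x) / (s - t))" .
    have "Lp_norm 2 (\<lambda>x. (u s x - u t x) / (s - t)) = enn2real (np 2 (\<lambda>x. (u s x - u t x) / (s - t))) powr (1/2)"
      by (rule Lp_norm_np) auto
    also have "\<dots> \<le> L2 powr (1/2)"
      using np_lipschitz[OF False] L2_nonneg by (intro powr_mono2 enn2real_leI) auto
    finally show ?thesis unfolding eq by (subst mult.commute) (rule mult_right_mono, simp_all)
  qed (simp add: Lp_norm_def)
qed

lemma has_Lp_derivative_u: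
  assumes p: "1 \<le> p" "p \<le> 2" and good: "p < 2 \<or> (AE \<xi> in lborel. a t \<xi> \<noteq> 0)"
    and w: "AE x in lborel. w x = v t x" "periodic1 w"
  shows "has_Lp_derivative p u w t"
  unfolding has_Lp_derivative_def
proof (intro conjI allI)
  show "u s \<in> Lp_per p" for s using p by (intro u_in_Lp) simp
  show "w \<in> Lp_per p" using np_v_bound[OF p, of t] by (intro Lp_per_np[OF w(1) v_measurable w(2)]) (auto intro: le_less_trans)
  show "((\<lambda>k. Lp_norm p (\<lambda>x. (u (t + k) x - u t x) / k - w x)) \<longlongrightarrow> 0) (at 0)"
  proof (rule Lp_norm_tendsto_zero[OF np_derivative[OF p good]])
    show "AE x in lborel. (u (t + k) x - u t x) / k - w x = (u (t + k) x - u t x) / k - v t x" for k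
      using w(1) by eventually_elim simp
  qed (use p in auto)
qed

text \<open>The continuous derivative is \<open>v\<close>, defined at every time; the right-hand
  side \<open>CH_rhs (u t)\<close> is identified with it only at good times.\<close>

lemma Lp_C1_u: assumes p: "1 \<le> p" "p < 2" shows "Lp_C1 p u"
  unfolding Lp_C1_def
proof (intro exI[of _ v] conjI allI)
  have per: "periodic1 (v t)" for t by (simp add: periodic1_def v_periodic)
  show "has_Lp_derivative p u (v t) t" for t
    by (rule has_Lp_derivative_u) (use p per in auto)
  show "Lp_continuous p v"
    unfolding Lp_continuous_def
  proof (intro conjI allI)
    fix t
    show "v t \<in> Lp_per p" by (rule Lp_per_np[OF _ v_measurable per])
      (use np_v_bound[of p t] p in \<open>auto intro: le_less_trans\<close>)
    have "((\<lambda>s. np p (\<lambda>x. v s x - v t x)) \<longlongrightarrow> 0) (at t)"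
      unfolding tendsto_at_iff_sequentially using v_continuous[of p _ t] p by (auto simp: o_def)
    then show "((\<lambda>s. Lp_norm p (\<lambda>x. v s x - v t x)) \<longlongrightarrow> 0) (at t)"
      by (rule Lp_norm_tendsto_zero) (use p in auto)
  qed
qed

end

theorem theorem1p1:
  fixes ubar :: "real \<Rightarrow> real"
  assumes "ubar \<in> H1_per"
  shows "\<exists>u :: real \<Rightarrow> real \<Rightarrow> real.
    (\<forall>t. u t \<in> H1_per) \<and>
    u 0 = ubar \<and>
    Lp_lipschitz 2 u \<and>
    (AE t in lebesgue. has_Lp_derivative 2 u (CH_rhs (u t)) t) \<and>
    (\<forall>p. 1 \<le> p \<and> p < 2 \<longrightarrow>
      Lp_C1 p u \<and> (AE t in lebesgue. has_Lp_derivative p u (CH_rhs (u t)) t)) \<and>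
    (AE t in lebesgue.
      (LINT x:{0..1}|lebesgue. (u t x)\<^sup>2 + (deriv (u t) x)\<^sup>2) =
      (LINT x:{0..1}|lebesgue. (ubar x)\<^sup>2 + (deriv ubar x)\<^sup>2))"
proof -
  obtain Z E where Z: "linit Z E" "\<And>x. ev (cU Z) x = ubar (x + ev (cz Z) x)"
      "E = (LINT x:{0..1}|lebesgue. (ubar x)\<^sup>2 + (deriv ubar x)\<^sup>2)"
    using initial_data[OF assms] by blast
  obtain X where X0: "X 0 = Z" and X': "\<And>t. (X has_vector_derivative lfield (X t)) (at t)"
    using lagrangian_global_existence[OF Z(1)] by blast
  interpret lagr X E by unfold_locales (use X0 X' Z(1) in auto)
  have good: "AE t in lebesgue. AE \<xi> in lborel. a t \<xi> \<noteq> 0" using good_times by (simp add: AE_completion_iff)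
  have der: "AE t in lebesgue. has_Lp_derivative p u (CH_rhs (u t)) t" if "1 \<le> p" "p \<le> 2" for p
    using good
  proof eventually_elim
    case (elim t)
    show ?case by (rule has_Lp_derivative_u[OF that]) (use elim CH_rhs_eq_v[OF elim] in auto)
  qed
  have "u 0 x = ubar x" for x
  proof -
    have "u 0 x = ubar (y 0 (lab 0 x))" using Z(2)[of "lab 0 x"] by (simp add: u_def y_def X0)
    then show ?thesis by (simp add: y_lab)
  qed
  then have u0: "u 0 = ubar" by (rule ext)
  have energy': "AE t in lebesgue. (LINT x:{0..1}|lebesgue. (u t x)\<^sup>2 + (deriv (u t) x)\<^sup>2) =
      (LINT x:{0..1}|lebesgue. (ubar x)\<^sup>2 + (deriv ubar x)\<^sup>2)"
    using good by eventually_elim (simp only: energy_pullback Z(3)[symmetric])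
  show ?thesis
    by (intro exI[of _ u] conjI allI impI u_in_H1_per u0 Lp_lipschitz_u der energy' Lp_C1_u) auto
qed

end
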